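(* Let $\epsilon>0$ be a constant. Given a $d$-degenerate graph $G$ with $n$ vertices stored on disk (as lists of vertices and edges), one can compute a $(2+\epsilon)d$-degeneracy ordering of $G$ in the external-memory model using $O(sort(dn))$ I/O's, without knowing the value of $d$ in advance.
   Context: Graphs are finite, undirected and simple. A graph is $d$-degenerate if its $k$-core number is $d$, i.e. $d$ is the largest $k$ such that the graph has a nonempty subgraph of minimum degree at least $k$ (equivalently, every nonempty subgraph has a vertex of degree at most $d$). A $\delta$-degeneracy ordering is a linear ordering of all vertices such that every vertex has at most $\delta$ neighbors appearing after it. External-memory model: internal memory of $M$ items, $D$ disks, one I/O transfers a block of $B$ consecutive items on each disk in parallel; $scan(N)=\Theta\!\left(\frac{N}{DB}\right)$, $sort(N)=\Theta\!\left(\frac{N}{DB}\log_{M/B}\frac{N}{B}\right)$. *)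

theory Defs
  imports Complex_Main
begin

definition simple_graph :: "'a set \<Rightarrow> 'a set set \<Rightarrow> bool" where
  "simple_graph V E \<longleftrightarrow> finite V \<and> (\<forall>e\<in>E. e \<subseteq> V \<and> card e = 2)"

definition vertex_degree :: "'a set set \<Rightarrow> 'a \<Rightarrow> nat" where
  "vertex_degree E v = card {e \<in> E. v \<in> e}"

definition has_core :: "'a set \<Rightarrow> 'a set set \<Rightarrow> nat \<Rightarrow> bool" where
  "has_core V E k \<longleftrightarrow>
     (\<exists>V' E'. V' \<noteq> {} \<and> V' \<subseteq> V \<and> E' \<subseteq> E \<and> simple_graph V' E' \<and> (\<forall>v\<in>V'. k \<le> vertex_degree E' v))"

definition degenerate :: "'a set \<Rightarrow> 'a set set \<Rightarrow> nat \<Rightarrow> bool" where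
  "degenerate V E d \<longleftrightarrow> has_core V E d \<and> (\<forall>k. has_core V E k \<longrightarrow> k \<le> d)"

text \<open>The bound is real-valued, because it will be \<open>(2 + \<epsilon>) d\<close>.\<close>

definition degeneracy_ordering :: "'a set \<Rightarrow> 'a set set \<Rightarrow> real \<Rightarrow> 'a list \<Rightarrow> bool" where
  "degeneracy_ordering V E \<delta> xs \<longleftrightarrow>
     distinct xs \<and> set xs = V \<and>
     (\<forall>i < length xs. real (card {j. i < j \<and> j < length xs \<and> {xs ! i, xs ! j} \<in> E}) \<le> \<delta>)"


text \<open>
  The external-memory model with independent parallel disks. Only I/Os are charged; internal
  computation is free, so an algorithm is a function from the contents of internal memory to the
  next action. This is meaningful only if internal memory is the sole state of the algorithm and
  has bounded information content. Hence an item is a record of at most \<open>k\<close> machine words,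
  where a word is a number below \<open>word_range\<close> and \<open>k\<close> is a constant of the algorithm, and
  track numbers are bounded in the same way.
\<close>

record machine =
  mem_size :: nat    \<comment> \<open>M\<close>
  block_size :: nat  \<comment> \<open>B\<close>
  num_disks :: nat   \<comment> \<open>D\<close>
  word_range :: nat

text \<open>
  \<open>2DB \<le> M\<close> is the customary restriction: internal memory can hold two blocks per disk.
  In particular the base \<open>M/B\<close> of the logarithm in the sorting bound is at least 2.
\<close>

definition valid_machine :: "machine \<Rightarrow> bool" where
  "valid_machine P \<longleftrightarrow> 1 \<le> block_size P \<and> 1 \<le> num_disks P \<and>
     2 * num_disks P * block_size P \<le> mem_size P"

type_synonym item = "nat list"

definition valid_item :: "machine \<Rightarrow> nat \<Rightarrow> item \<Rightarrow> bool" where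
  "valid_item P k x \<longleftrightarrow> length x \<le> k \<and> (\<forall>w\<in>set x. w < word_range P)"

definition valid_track :: "machine \<Rightarrow> nat \<Rightarrow> nat \<Rightarrow> bool" where
  "valid_track P k tr \<longleftrightarrow> tr < word_range P ^ k"

text \<open>\<open>dsk i tr\<close> is the block of \<open>B\<close> consecutive items at track \<open>tr\<close> of disk \<open>i\<close>.\<close>

type_synonym disks = "nat \<Rightarrow> nat \<Rightarrow> item list"

text \<open>
  In a single I/O each disk may access a track of its own. The first argument of \<open>Read\<close> and
  \<open>Write\<close> is what remains in internal memory besides the transferred blocks. \<open>Halt a\<close>
  announces that the output is the striped list starting at track \<open>a\<close>.
\<close>

datatype action =
    Read "item list" "nat \<Rightarrow> nat option"
  | Write "item list" "nat \<Rightarrow> (nat \<times> item list) option"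
  | Halt nat

type_synonym em_algorithm = "machine \<Rightarrow> item list \<Rightarrow> action"

definition read_blocks :: "machine \<Rightarrow> disks \<Rightarrow> (nat \<Rightarrow> nat option) \<Rightarrow> item list" where
  "read_blocks P dsk sel =
     concat (map (\<lambda>i. case sel i of None \<Rightarrow> [] | Some tr \<Rightarrow> dsk i tr) [0..<num_disks P])"

definition written_items :: "machine \<Rightarrow> (nat \<Rightarrow> (nat \<times> item list) option) \<Rightarrow> item list" where
  "written_items P wr =
     concat (map (\<lambda>i. case wr i of None \<Rightarrow> [] | Some (tr, blk) \<Rightarrow> blk) [0..<num_disks P])"

definition write_blocks ::
    "machine \<Rightarrow> (nat \<Rightarrow> (nat \<times> item list) option) \<Rightarrow> disks \<Rightarrow> disks" where
  "write_blocks P wr dsk = (\<lambda>i tr.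
     if i < num_disks P
     then (case wr i of None \<Rightarrow> dsk i tr | Some (tr', blk) \<Rightarrow> if tr = tr' then blk else dsk i tr)
     else dsk i tr)"

text \<open>
  \<open>em_run P k f mem dsk t a dsk'\<close>: started with internal memory \<open>mem\<close> and disks \<open>dsk\<close>,
  the algorithm performs exactly \<open>t\<close> legal I/Os and then halts with output at track \<open>a\<close> of
  the disks \<open>dsk'\<close>. There is no rule for an illegal action.
\<close>

inductive em_run ::
    "machine \<Rightarrow> nat \<Rightarrow> (item list \<Rightarrow> action) \<Rightarrow> item list \<Rightarrow> disks \<Rightarrow> nat \<Rightarrow> nat \<Rightarrow> disks \<Rightarrow> bool"
  for P k f where
  halt: "f mem = Halt a \<Longrightarrow> valid_track P k a \<Longrightarrow> em_run P k f mem dsk 0 a dsk"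
| read: "f mem = Read keep sel \<Longrightarrow>
    \<forall>x\<in>set keep. valid_item P k x \<Longrightarrow>
    \<forall>i<num_disks P. \<forall>tr. sel i = Some tr \<longrightarrow> valid_track P k tr \<Longrightarrow>
    length keep + length (read_blocks P dsk sel) \<le> mem_size P \<Longrightarrow>
    em_run P k f (keep @ read_blocks P dsk sel) dsk t a dsk' \<Longrightarrow>
    em_run P k f mem dsk (Suc t) a dsk'"
| "write": "f mem = Write keep wr \<Longrightarrow>
    \<forall>x\<in>set keep. valid_item P k x \<Longrightarrow>
    \<forall>i<num_disks P. \<forall>tr blk. wr i = Some (tr, blk) \<longrightarrow>
      valid_track P k tr \<and> length blk = block_size P \<and> (\<forall>x\<in>set blk. valid_item P k x) \<Longrightarrow>
    length keep + length (written_items P wr) \<le> mem_size P \<Longrightarrow>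
    em_run P k f keep (write_blocks P wr dsk) t a dsk' \<Longrightarrow>
    em_run P k f mem dsk (Suc t) a dsk'"

text \<open>
  Lists on disk are striped: item number \<open>j\<close> lies in block number \<open>j div B\<close>, and block
  number \<open>b\<close> lies on disk \<open>b mod D\<close>, \<open>b div D\<close> tracks after the first track of the list.
  The last blocks are padded with empty items.
\<close>

definition striped :: "machine \<Rightarrow> item list \<Rightarrow> disks" where
  "striped P xs = (\<lambda>i tr. map (\<lambda>j. if j < length xs then xs ! j else [])
     [(tr * num_disks P + i) * block_size P ..< (tr * num_disks P + i + 1) * block_size P])"

definition num_stripes :: "machine \<Rightarrow> nat \<Rightarrow> nat" where
  "num_stripes P N = nat \<lceil>real N / real (num_disks P * block_size P)\<rceil>"

definition input_disks :: "machine \<Rightarrow> nat list \<Rightarrow> (nat \<times> nat) list \<Rightarrow> disks" where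
  "input_disks P vs es = (\<lambda>i tr.
     let s = num_stripes P (length vs) in
     if tr < s then striped P (map (\<lambda>v. [v]) vs) i tr
     else striped P (map (\<lambda>(u, v). [u, v]) es) i (tr - s))"

definition output_list :: "machine \<Rightarrow> disks \<Rightarrow> nat \<Rightarrow> nat \<Rightarrow> item list" where
  "output_list P dsk a N = map (\<lambda>j. let b = j div block_size P in
     dsk (b mod num_disks P) (a + b div num_disks P) ! (j mod block_size P)) [0..<N]"

text \<open>Every edge is listed exactly once, with its endpoints in either order.\<close>

definition lists_graph ::
    "nat list \<Rightarrow> (nat \<times> nat) list \<Rightarrow> nat set \<Rightarrow> nat set set \<Rightarrow> bool" where
  "lists_graph vs es V E \<longleftrightarrow>
     distinct vs \<and> set vs = V \<and>
     distinct (map (\<lambda>(u, v). {u, v}) es) \<and> set (map (\<lambda>(u, v). {u, v}) es) = E"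

text \<open>Vertex names and the numbers of vertices and of edges fit into a machine word.\<close>

definition fits_words :: "machine \<Rightarrow> nat list \<Rightarrow> (nat \<times> nat) list \<Rightarrow> bool" where
  "fits_words P vs es \<longleftrightarrow>
     (\<forall>v\<in>set vs. v < word_range P) \<and> length vs < word_range P \<and> length es < word_range P"

text \<open>
  \<open>sort(N)\<close>, with the usual conventions that make it meaningful for small \<open>N\<close>: a whole
  number of I/Os for a scan, and a logarithmic factor of at least 1. For \<open>N \<ge> M\<close> both only
  change \<open>N/(DB) log_{M/B} (N/B)\<close> by a constant factor.
\<close>

definition sort_ios :: "machine \<Rightarrow> nat \<Rightarrow> real" where
  "sort_ios P N =
     real_of_int \<lceil>real N / real (num_disks P * block_size P)\<rceil> *
     max 1 (log (real (mem_size P) / real (block_size P)) (real N / real (block_size P)))"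

text \<open>
  Internal memory initially holds just the lengths of the two input lists, so this is all that
  the algorithm knows before its first I/O.
\<close>

definition computes_ordering ::
    "machine \<Rightarrow> nat \<Rightarrow> em_algorithm \<Rightarrow> nat list \<Rightarrow> (nat \<times> nat) list \<Rightarrow> nat \<Rightarrow> nat list \<Rightarrow> bool" where
  "computes_ordering P k A vs es t xs \<longleftrightarrow>
     (\<exists>a dsk. em_run P k (A P) [[length vs, length es]] (input_disks P vs es) t a dsk \<and>
        output_list P dsk a (length vs) = map (\<lambda>v. [v]) xs)"

end

theory Submission
  imports Defs "HOL-Library.List_Lexorder" "HOL-Library.Multiset" "HOL-Library.Discrete_Functions"
begin

text \<open>
  Vertices are removed in rounds: with \<open>n\<close> vertices and \<open>m \<le> d n\<close> edges left, those of degree at most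
  \<open>(2 + \<epsilon>) m / n \<le> (2 + \<epsilon>) d\<close> are appended to the ordering. The degrees sum up to \<open>2 m\<close>, so at most
  \<open>2 n / (2 + \<epsilon>)\<close> vertices survive a round. A round takes a constant number of sorting and streaming passes
  over \<open>O(d n)\<close> items, and these costs decrease geometrically. Once the graph fits into internal
  memory, an optimal ordering of it is appended.

  Sorting optimally on independent disks is done without randomization. The disks are grouped into about
  \<open>sqrt D\<close> virtual disks. Merging only the first items of all blocks, at one I/O per virtual block, yields
  the order in which a merge needs the blocks. The blocks are then rearranged into this order, where a greedy edge colouring of the
  moves between virtual disks lets them use a constant fraction of the bandwidth, and merged in a single pass.

  Algorithms are written as trees of I/Os with arbitrary internal computation. If the number of subtrees
  that can be reached is at most \<open>W ^ (c M)\<close>, where \<open>W\<close> is the word range, then the current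
  subtree can be encoded by half of the internal memory, which leaves the other half for the blocks of the next I/O.
\<close>

section \<open>Programs and their simulation by bounded memory\<close>

text \<open>The base of the sorting bound is \<open>M/B\<close>, while \<open>M\<close> may be as
  small as \<open>2DB\<close>. Using all disks as one disk with blocks of \<open>DB\<close> items
  gives fan-in \<open>M/(DB)\<close>, possibly only 2, although \<open>M/B\<close> is at least
  \<open>2D\<close>; a factor of order \<open>log D\<close> can be lost. Blocks of \<open>B\<close>
  items give the right fan-in, but the blocks needed next may lie on the same disk, and bandwidth
  collapses. Rearranging the blocks beforehand cures this; to know the order, a list with one key
  per block must be merged, at one I/O per block of that list. Each stripe contributes as many keys
  as there are disks, so this is cheap only if a block has at least as many items as there are
  disks. About \<open>sqrt D\<close> virtual disks achieve that, and \<open>M/B\<close> stays below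
  a fixed power of the fan-in, which changes the logarithm by a constant factor only. Since internal
  computation is free, space is a matter of counting: the continuations of a program over all
  conceivable disk contents must be bounded with one exponent for all machines and inputs.\<close>

datatype 'r prog =
    Ret 'r
  | Rd "nat \<Rightarrow> nat option" "item list \<Rightarrow> 'r prog"
  | Wr "nat \<Rightarrow> (nat \<times> item list) option" "'r prog"

primrec bind :: "'a prog \<Rightarrow> ('a \<Rightarrow> 'b prog) \<Rightarrow> 'b prog" (infixl "\<bind>" 54) where
  "(Ret r \<bind> q) = q r"
| "(Rd sel c \<bind> q) = Rd sel (\<lambda>x. c x \<bind> q)"
| "(Wr wr p \<bind> q) = Wr wr (p \<bind> q)"

primrec exec :: "machine \<Rightarrow> 'r prog \<Rightarrow> disks \<Rightarrow> 'r \<times> disks \<times> nat" where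
  "exec P (Ret r) d = (r, d, 0)"
| "exec P (Rd sel c) d = (case exec P (c (read_blocks P d sel)) d of (r, d', t) \<Rightarrow> (r, d', Suc t))"
| "exec P (Wr wr p) d = (case exec P p (write_blocks P wr d) of (r, d', t) \<Rightarrow> (r, d', Suc t))"

section \<open>Weakest preconditions that count I/Os\<close>

definition wp :: "machine \<Rightarrow> 'r prog \<Rightarrow> disks \<Rightarrow> ('r \<Rightarrow> disks \<Rightarrow> nat \<Rightarrow> bool) \<Rightarrow> bool" where
  "wp P p d Q = (case exec P p d of (r, d', t) \<Rightarrow> Q r d' t)"

lemma wp_Ret [simp]: "wp P (Ret r) d Q = Q r d 0"
  by (simp add: wp_def)

lemma exec_bind:
  "exec P (p \<bind> q) d = (case exec P p d of (r, d', t) \<Rightarrow> case exec P (q r) d' of (r', d'', t') \<Rightarrow> (r', d'', t + t'))"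
  by (induction p arbitrary: d) (auto split: prod.splits)

lemma wp_bind: "wp P (p \<bind> q) d Q = wp P p d (\<lambda>r d' t. wp P (q r) d' (\<lambda>r' d'' t'. Q r' d'' (t + t')))"
  by (auto simp: wp_def exec_bind split: prod.splits)

lemma wp_mono: "wp P p d Q \<Longrightarrow> (\<And>r d' t. Q r d' t \<Longrightarrow> Q' r d' t) \<Longrightarrow> wp P p d Q'"
  by (auto simp: wp_def split: prod.splits)

lemma wp_bindI:
  assumes "wp P p d Q'" and "\<And>r d' t. Q' r d' t \<Longrightarrow> wp P (q r) d' (\<lambda>r' d'' t'. Q r' d'' (t + t'))"
  shows "wp P (p \<bind> q) d Q"
  unfolding wp_bind using assms by (rule wp_mono)

text \<open>A word range of at least 2 lets its powers absorb constant factors. It follows from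
  \<open>fits_words\<close>, since a degenerate graph has a vertex and its number of vertices is a
  word.\<close>

definition okm :: "machine \<Rightarrow> bool" where
  "okm P \<longleftrightarrow> valid_machine P \<and> 2 \<le> word_range P"

lemma okmD:
  assumes "okm P"
  shows "1 \<le> block_size P" "1 \<le> num_disks P" "2 * num_disks P * block_size P \<le> mem_size P"
    "2 \<le> word_range P" "2 \<le> mem_size P"
proof -
  show *: "1 \<le> block_size P" "1 \<le> num_disks P" "2 * num_disks P * block_size P \<le> mem_size P" "2 \<le> word_range P"
    using assms by (auto simp: okm_def valid_machine_def)
  have "2 * 1 * 1 \<le> 2 * num_disks P * block_size P" using * by (intro mult_le_mono) auto
  then show "2 \<le> mem_size P" using *(3) by linarith
qed

text \<open>Eight words suffice for every stored item: graph items have at most four, triggers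
  seven.\<close>

definition vitems :: "machine \<Rightarrow> item set" where
  "vitems P = {x. valid_item P 8 x}"

definition disk_ok :: "machine \<Rightarrow> disks \<Rightarrow> bool" where
  "disk_ok P d \<longleftrightarrow> (\<forall>i tr. length (d i tr) = block_size P \<and> set (d i tr) \<subseteq> vitems P)"

text \<open>Every answer that a single read could conceivably give. Ranging over all of them, and
  not over the answers of a particular disk state, makes the count of continuations independent of
  correctness invariants.\<close>

definition responses :: "machine \<Rightarrow> item list set" where
  "responses P = {xs. length xs \<le> num_disks P * block_size P \<and> set xs \<subseteq> vitems P}"

primrec nodes :: "machine \<Rightarrow> 'r prog \<Rightarrow> 'r prog set" where
  "nodes P (Ret r) = {Ret r}"
| "nodes P (Rd sel c) = insert (Rd sel c) (\<Union>x\<in>responses P. nodes P (c x))"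
| "nodes P (Wr wr p) = insert (Wr wr p) (nodes P p)"

definition legal_wr :: "machine \<Rightarrow> (nat \<Rightarrow> (nat \<times> item list) option) \<Rightarrow> bool" where
  "legal_wr P wr \<longleftrightarrow> (\<forall>i<num_disks P. \<forall>tr blk. wr i = Some (tr, blk) \<longrightarrow>
     tr < word_range P ^ 8 \<and> length blk = block_size P \<and> set blk \<subseteq> vitems P)"

primrec legal :: "machine \<Rightarrow> 'r prog \<Rightarrow> bool" where
  "legal P (Ret r) = True"
| "legal P (Rd sel c) = ((\<forall>i<num_disks P. \<forall>tr. sel i = Some tr \<longrightarrow> tr < word_range P ^ 8) \<and>
     (\<forall>x\<in>responses P. legal P (c x)))"
| "legal P (Wr wr p) = (legal_wr P wr \<and> legal P p)"

section \<open>Counting states by powers of the word range\<close>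

definition small :: "machine \<Rightarrow> nat \<Rightarrow> 'a set \<Rightarrow> bool" where
  "small P c X \<longleftrightarrow> finite X \<and> card X \<le> word_range P ^ (c * mem_size P)"

lemma small_mono: "okm P \<Longrightarrow> small P c X \<Longrightarrow> c \<le> c' \<Longrightarrow> small P c' X"
  unfolding small_def by (meson le_trans mult_le_mono1 okmD(4) power_increasing one_le_numeral)

lemma small_subset: "small P c X \<Longrightarrow> Y \<subseteq> X \<Longrightarrow> small P c Y"
  unfolding small_def by (meson card_mono finite_subset le_trans)

lemma small_image: "small P c X \<Longrightarrow> small P c (f ` X)"
  unfolding small_def by (meson card_image_le finite_imageI le_trans)

lemma two_le_power_mem: "okm P \<Longrightarrow> 2 \<le> word_range P ^ mem_size P"
  using okmD(4,5)[of P] self_le_power[of "word_range P" "mem_size P"] by linarith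

text \<open>The factor 2 lost by a union is paid by one more power of \<open>W^M\<close>, which is
  at least 2.\<close>

lemma small_Un:
  assumes "okm P" "small P a X" "small P b Y"
  shows "small P (a + b + 1) (X \<union> Y)"
proof -
  let ?W = "word_range P" and ?M = "mem_size P"
  have "card (X \<union> Y) \<le> ?W ^ (a * ?M) + ?W ^ (b * ?M)"
    using card_Un_le[of X Y] assms(2,3) by (auto simp: small_def)
  also have "\<dots> \<le> ?W ^ ((a+b) * ?M) + ?W ^ ((a+b) * ?M)"
    using okmD[OF assms(1)] by (intro add_mono power_increasing) auto
  also have "\<dots> = 2 * ?W ^ ((a+b) * ?M)" by simp
  also have "\<dots> \<le> ?W ^ ?M * ?W ^ ((a+b) * ?M)"
    using two_le_power_mem[OF assms(1)] by (intro mult_le_mono) auto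
  also have "\<dots> = ?W ^ ((a+b+1) * ?M)" by (simp add: power_add algebra_simps)
  finally show ?thesis using assms by (auto simp: small_def)
qed

lemma small_UN:
  assumes "small P a I" "\<And>i. i \<in> I \<Longrightarrow> small P b (X i)"
  shows "small P (a + b) (\<Union>i\<in>I. X i)"
proof -
  let ?W = "word_range P" and ?M = "mem_size P"
  have "card (\<Union>i\<in>I. X i) \<le> (\<Sum>i\<in>I. card (X i))"
    using assms by (auto simp: small_def intro: card_UN_le)
  also have "\<dots> \<le> (\<Sum>i\<in>I. ?W ^ (b * ?M))"
    using assms by (intro sum_mono) (auto simp: small_def)
  also have "\<dots> \<le> ?W ^ (a * ?M) * ?W ^ (b * ?M)"
    using assms(1) by (simp add: small_def)
  also have "\<dots> = ?W ^ ((a+b) * ?M)" by (simp add: power_add algebra_simps)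
  finally show ?thesis using assms by (auto simp: small_def)
qed

lemma small_Times:
  assumes "small P a X" "small P b Y"
  shows "small P (a + b) (X \<times> Y)"
proof -
  have "X \<times> Y = (\<Union>x\<in>X. Pair x ` Y)" by auto
  moreover have "small P (a + b) (\<Union>x\<in>X. Pair x ` Y)"
    by (intro small_UN assms small_image)
  ultimately show ?thesis by simp
qed

lemma small_singleton: "okm P \<Longrightarrow> small P 0 {x}"
  by (simp add: small_def)

text \<open>Replaces the geometric sum that counts lists of bounded length by a single power, with
  no exception for the bases 0 and 1.\<close>

lemma sum_power_le: "(\<Sum>i\<le>n. a ^ i) \<le> (a + 1 :: nat) ^ n"
proof (induction n)
  case (Suc n)
  have "a ^ Suc n \<le> a * (a + 1) ^ n" by (metis le_add1 mult_le_mono2 power_Suc power_mono zero_le)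
  then have "(\<Sum>i\<le>Suc n. a ^ i) \<le> (a + 1) ^ n + a * (a + 1) ^ n"
    unfolding sum.atMost_Suc by (rule add_mono[OF Suc])
  then show ?case by (simp add: algebra_simps)
qed simp

text \<open>One extra symbol as filler turns lists of length at most \<open>e M\<close> into words
  of exactly this length, so there are at most \<open>(W^c + 1)^(e M)\<close> of them, and
  \<open>W^c + 1\<close> is at most \<open>W^(c + 1)\<close>.\<close>

lemma small_lists:
  assumes ok: "okm P" and A: "finite A" "card A \<le> word_range P ^ c"
  shows "small P ((c + 1) * e) {xs. length xs \<le> e * mem_size P \<and> set xs \<subseteq> A}"
proof -
  let ?W = "word_range P" and ?M = "mem_size P"
  have eq: "{xs. length xs \<le> e * ?M \<and> set xs \<subseteq> A} = {xs. set xs \<subseteq> A \<and> length xs \<le> e * ?M}" by auto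
  have "card A + 1 \<le> ?W ^ c + ?W ^ c" using A okmD[OF ok] by (intro add_mono) auto
  also have "\<dots> = 2 * ?W ^ c" by simp
  also have "\<dots> \<le> ?W * ?W ^ c" by (intro mult_le_mono okmD[OF ok]) simp
  finally have 1: "card A + 1 \<le> ?W ^ (c + 1)" by simp
  have "card {xs. set xs \<subseteq> A \<and> length xs \<le> e * ?M} = (\<Sum>i\<le>e * ?M. card A ^ i)"
    by (rule card_lists_length_le[OF A(1)])
  also have "\<dots> \<le> (card A + 1) ^ (e * ?M)" by (rule sum_power_le)
  also have "\<dots> \<le> (?W ^ (c + 1)) ^ (e * ?M)" by (intro power_mono 1) simp
  also have "\<dots> = ?W ^ ((c + 1) * e * ?M)" by (simp only: power_mult)
  finally show ?thesis using finite_lists_length_le[OF A(1)] by (simp add: small_def eq)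
qed

lemma vitems_finite_card:
  assumes "okm P"
  shows "finite (vitems P)" "card (vitems P) \<le> word_range P ^ 16"
proof -
  let ?W = "word_range P"
  have eq: "vitems P = {xs. set xs \<subseteq> {..<?W} \<and> length xs \<le> 8}"
    by (auto simp: vitems_def valid_item_def)
  show "finite (vitems P)" unfolding eq by (rule finite_lists_length_le) simp
  have "card (vitems P) = (\<Sum>i\<le>8. ?W ^ i)" unfolding eq by (subst card_lists_length_le) auto
  also have "\<dots> \<le> (?W + 1) ^ 8" by (rule sum_power_le)
  also have "\<dots> \<le> (?W ^ 2) ^ 8"
  proof (intro power_mono)
    have "2 * ?W \<le> ?W * ?W" by (intro mult_le_mono okmD[OF assms]) simp
    moreover have "?W + 1 \<le> 2 * ?W" using okmD(4)[OF assms] by linarith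
    ultimately show "?W + 1 \<le> ?W ^ 2" by (simp only: power2_eq_square)
  qed simp
  finally show "card (vitems P) \<le> ?W ^ 16" by (simp flip: power_mult)
qed

text \<open>Lists longer than \<open>M\<close> are harmless: a state is stored through an encoding
  with \<open>k\<close> words per item, so only the number of states matters. The factor 20 covers a
  burst of \<open>18 M\<close> items together with an incomplete stripe.\<close>

definition item_lists :: "machine \<Rightarrow> item list set" where
  "item_lists P = {xs. length xs \<le> 20 * mem_size P \<and> set xs \<subseteq> vitems P}"

definition nat_lists :: "machine \<Rightarrow> nat list set" where
  "nat_lists P = {xs. length xs \<le> 20 * mem_size P \<and> set xs \<subseteq> {..<word_range P ^ 8}}"

definition nums :: "machine \<Rightarrow> nat set" where
  "nums P = {..<word_range P ^ (20 * mem_size P)}"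

definition smallset :: "(machine \<Rightarrow> 'a set) \<Rightarrow> bool" where
  "smallset S \<longleftrightarrow> (\<exists>c. \<forall>P. okm P \<longrightarrow> small P c (S P))"

lemma smallset_item_lists: "smallset item_lists"
  unfolding smallset_def item_lists_def using small_lists vitems_finite_card by blast

lemma smallset_nat_lists: "smallset nat_lists"
proof -
  have "small P ((8 + 1) * 20) (nat_lists P)" if "okm P" for P
    unfolding nat_lists_def by (rule small_lists[OF that]) auto
  then show ?thesis unfolding smallset_def by blast
qed

lemma smallset_nums: "smallset nums"
  unfolding smallset_def nums_def small_def by (intro exI[of _ 20]) auto

lemma smallset_finite_const:
  assumes "finite A" shows "smallset (\<lambda>P. A)"
proof -
  have "small P (card A) A" if "okm P" for P
  proof -
    have "card A < 2 ^ card A" by (rule less_exp)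
    also have "\<dots> \<le> word_range P ^ card A" using okmD[OF that] by (intro power_mono) auto
    also have "\<dots> \<le> word_range P ^ (card A * mem_size P)"
      using okmD[OF that] by (intro power_increasing) auto
    finally show ?thesis using assms by (simp add: small_def)
  qed
  then show ?thesis unfolding smallset_def by blast
qed

lemma smallset_Times: "smallset S \<Longrightarrow> smallset T \<Longrightarrow> smallset (\<lambda>P. S P \<times> T P)"
  unfolding smallset_def by (elim exE, rule exI) (blast intro: small_Times)

lemmas smallset_intros = smallset_Times smallset_nums smallset_item_lists smallset_nat_lists

text \<open>The exponent \<open>c\<close> is the same for all machines and inputs, because it
  determines \<open>k\<close>, which must be a constant of the algorithm.\<close>

definition lean :: "(machine \<Rightarrow> 'x \<Rightarrow> 'r prog) \<Rightarrow> bool" where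
  "lean p \<longleftrightarrow> (\<exists>c. \<forall>P x. okm P \<longrightarrow> small P c (nodes P (p P x)) \<and> legal P (p P x))"

lemma self_in_nodes: "p \<in> nodes P p"
  by (cases p) auto

text \<open>Results of the first program are leaves of its tree, so their number is bounded by the
  number of its nodes. This is why exponents of space bounds add under sequencing.\<close>

lemma nodes_bind:
  "nodes P (p \<bind> q) \<subseteq> (\<lambda>x. x \<bind> q) ` nodes P p \<union> (\<Union>r\<in>{r. Ret r \<in> nodes P p}. nodes P (q r))"
proof (induction p)
  case (Ret r)
  then show ?case by auto
next
  case (Rd sel c)
  show ?case
  proof
    fix y assume "y \<in> nodes P (Rd sel c \<bind> q)"
    then consider "y = Rd sel (\<lambda>x. c x \<bind> q)" | x where "x \<in> responses P" "y \<in> nodes P (c x \<bind> q)" by auto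
    then show "y \<in> (\<lambda>x. x \<bind> q) ` nodes P (Rd sel c) \<union> (\<Union>r\<in>{r. Ret r \<in> nodes P (Rd sel c)}. nodes P (q r))"
    proof cases
      case 1
      then have "y = Rd sel c \<bind> q" by simp
      then show ?thesis by (metis UnI1 image_eqI self_in_nodes)
    next
      case 2
      have "y \<in> (\<lambda>x. x \<bind> q) ` nodes P (c x) \<union> (\<Union>r\<in>{r. Ret r \<in> nodes P (c x)}. nodes P (q r))"
        using Rd.IH[of "c x"] 2(2) by blast
      then show ?thesis using 2(1) by auto
    qed
  qed
next
  case (Wr wr p)
  show ?case
  proof
    fix y assume "y \<in> nodes P (Wr wr p \<bind> q)"
    then consider "y = Wr wr p \<bind> q" | "y \<in> nodes P (p \<bind> q)" by auto
    then show "y \<in> (\<lambda>x. x \<bind> q) ` nodes P (Wr wr p) \<union> (\<Union>r\<in>{r. Ret r \<in> nodes P (Wr wr p)}. nodes P (q r))"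
    proof cases
      case 1
      then show ?thesis by (metis UnI1 image_eqI self_in_nodes)
    next
      case 2
      then show ?thesis using Wr.IH by auto
    qed
  qed
qed

lemma small_rets: "small P c (nodes P p) \<Longrightarrow> small P c {r. Ret r \<in> nodes P p}"
proof -
  assume a: "small P c (nodes P p)"
  have "Ret ` {r. Ret r \<in> nodes P p} \<subseteq> nodes P p" by auto
  then have "small P c (Ret ` {r. Ret r \<in> nodes P p})" using a small_subset by blast
  then have "small P c ((\<lambda>x. case x of Ret r \<Rightarrow> r) ` Ret ` {r. Ret r \<in> nodes P p})" by (rule small_image)
  then show ?thesis by (simp add: image_image)
qed

lemma legal_bind: "legal P p \<Longrightarrow> (\<And>r. legal P (q r)) \<Longrightarrow> legal P (p \<bind> q)"
  by (induction p) auto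

lemma lean_Ret: "lean (\<lambda>P x. Ret (f P x))"
  unfolding lean_def by (intro exI[of _ 0]) (simp add: small_singleton)

lemma lean_comp: "lean p \<Longrightarrow> lean (\<lambda>P x. p P (g P x))"
  unfolding lean_def by blast

text \<open>The second program is bounded for arbitrary pairs of input and intermediate result, so
  nothing has to be known about the results that the first program can produce.\<close>

lemma lean_bind:
  assumes "lean p" "lean (\<lambda>P y. q P (fst y) (snd y))"
  shows "lean (\<lambda>P x. p P x \<bind> q P x)"
proof -
  obtain a where a: "\<And>P x. okm P \<Longrightarrow> small P a (nodes P (p P x)) \<and> legal P (p P x)"
    using assms(1) unfolding lean_def by blast
  obtain b where b: "\<And>P x r. okm P \<Longrightarrow> small P b (nodes P (q P x r)) \<and> legal P (q P x r)"
    using assms(2) unfolding lean_def by force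
  have "small P (a + (a + b) + 1) (nodes P (p P x \<bind> q P x)) \<and> legal P (p P x \<bind> q P x)" if ok: "okm P" for P x
  proof -
    have "small P (a + (a + b) + 1) ((\<lambda>y. y \<bind> q P x) ` nodes P (p P x) \<union> (\<Union>r\<in>{r. Ret r \<in> nodes P (p P x)}. nodes P (q P x r)))"
      using a[OF ok] b[OF ok] by (intro small_Un[OF ok] small_image small_UN small_rets) auto
    then show ?thesis using nodes_bind small_subset legal_bind a[OF ok] b[OF ok] by metis
  qed
  then show ?thesis unfolding lean_def by blast
qed

lemma lean_if:
  assumes "lean p" "lean q"
  shows "lean (\<lambda>P x. if b P x then p P x else q P x)"
proof -
  obtain a where a: "\<And>P x. okm P \<Longrightarrow> small P a (nodes P (p P x)) \<and> legal P (p P x)"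
    using assms(1) unfolding lean_def by blast
  obtain c where c: "\<And>P x. okm P \<Longrightarrow> small P c (nodes P (q P x)) \<and> legal P (q P x)"
    using assms(2) unfolding lean_def by blast
  have "small P (a + c) (nodes P (if b P x then p P x else q P x)) \<and> legal P (if b P x then p P x else q P x)" if "okm P" for P x
    using small_mono[OF that conjunct1[OF a[OF that]], of "a + c" x]
      small_mono[OF that conjunct1[OF c[OF that]], of "a + c" x] a[OF that, of x] c[OF that, of x] by simp
  then show ?thesis unfolding lean_def by blast
qed

primrec whilen :: "nat \<Rightarrow> 's set \<Rightarrow> ('s \<Rightarrow> bool) \<Rightarrow> ('s \<Rightarrow> 's prog) \<Rightarrow> 's \<Rightarrow> 's prog" where
  "whilen 0 S b body s = Ret s"
| "whilen (Suc j) S b body s = (if s \<in> S \<and> b s then body s \<bind> whilen j S b body else Ret s)"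

text \<open>The test \<open>s \<in> S\<close> in \<open>whilen\<close> bounds the number of states for arbitrary disk contents, so that
  the space bound of a program needs none of the invariants behind its correctness.\<close>

definition while :: "machine \<Rightarrow> 's set \<Rightarrow> ('s \<Rightarrow> bool) \<Rightarrow> ('s \<Rightarrow> 's prog) \<Rightarrow> 's \<Rightarrow> 's prog" where
  "while P S b body s = whilen (word_range P ^ (20 * mem_size P)) S b body s"

text \<open>A point inside the loop is described by the remaining fuel, the state at the start of
  the current iteration, and a node of the body. Each of the three ranges over a small set, and
  their exponents add.\<close>

lemma nodes_whilen:
  "nodes P (whilen j S b body s) \<subseteq>
     insert (Ret s) (\<Union>i\<in>{..<j}. \<Union>s'\<in>S. (\<lambda>x. x \<bind> whilen i S b body) ` nodes P (body s'))"
proof (induction j arbitrary: s)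
  case (Suc j)
  show ?case
  proof (cases "s \<in> S \<and> b s")
    case True
    let ?q = "whilen j S b body"
    let ?T = "(\<Union>i\<in>{..<Suc j}. \<Union>s'\<in>S. (\<lambda>x. x \<bind> whilen i S b body) ` nodes P (body s'))"
    have "nodes P (body s \<bind> ?q) \<subseteq> (\<lambda>x. x \<bind> ?q) ` nodes P (body s) \<union> (\<Union>r\<in>{r. Ret r \<in> nodes P (body s)}. nodes P (?q r))"
      by (rule nodes_bind)
    moreover have "(\<lambda>x. x \<bind> ?q) ` nodes P (body s) \<subseteq> ?T" using True by auto
    moreover have "nodes P (?q r) \<subseteq> ?T" if r: "Ret r \<in> nodes P (body s)" for r
    proof -
      \<comment> \<open>Without fuel the loop returns its state at once, so the leaf
        \<open>Ret r\<close> of the body equals this leaf followed by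
        \<open>whilen 0\<close>.\<close>
      have "Ret r \<in> ?T"
      proof (cases j)
        case 0
        then have "Ret r = Ret r \<bind> whilen 0 S b body" by simp
        then have "Ret r \<in> (\<lambda>x. x \<bind> whilen 0 S b body) ` nodes P (body s)" using r by blast
        then show ?thesis using True by auto
      next
        case j: (Suc i)
        then have "Ret r = Ret r \<bind> whilen 0 S b body" by simp
        then have "Ret r \<in> (\<lambda>x. x \<bind> whilen 0 S b body) ` nodes P (body s)" using r by blast
        then show ?thesis using True by auto
      qed
      moreover have "nodes P (?q r) \<subseteq> insert (Ret r) (\<Union>i\<in>{..<j}. \<Union>s'\<in>S. (\<lambda>x. x \<bind> whilen i S b body) ` nodes P (body s'))"
        by (rule Suc.IH)
      ultimately show ?thesis by fastforce
    qed
    ultimately show ?thesis using True by auto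
  qed auto
qed simp

lemma legal_whilen: "(\<And>s. legal P (body s)) \<Longrightarrow> legal P (whilen j S b body s)"
  by (induction j arbitrary: s) (auto intro: legal_bind)

lemma lean_while:
  assumes "smallset S" "lean (\<lambda>P y. body P (fst y) (snd y))"
  shows "lean (\<lambda>P x. while P (S P) (b P x) (body P x) (s0 P x))"
proof -
  obtain a where a: "\<And>P. okm P \<Longrightarrow> small P a (S P)" using assms(1) unfolding smallset_def by blast
  obtain c where c: "\<And>P x s. okm P \<Longrightarrow> small P c (nodes P (body P x s)) \<and> legal P (body P x s)"
    using assms(2) unfolding lean_def by force
  have "small P (0 + (20 + (a + c)) + 1) (nodes P (while P (S P) (b P x) (body P x) (s0 P x)))" if ok: "okm P" for P x
  proof -
    have "small P 20 {..<word_range P ^ (20 * mem_size P)}" by (simp add: small_def)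
    then have "small P (0 + (20 + (a + c)) + 1) ({Ret (s0 P x)} \<union> (\<Union>i\<in>{..<word_range P ^ (20 * mem_size P)}. \<Union>s'\<in>S P. (\<lambda>y. y \<bind> whilen i (S P) (b P x) (body P x)) ` nodes P (body P x s')))"
      using a[OF ok] c[OF ok] by (intro small_Un[OF ok] small_singleton[OF ok] small_UN small_image) auto
    then show ?thesis unfolding while_def
      by (rule small_subset) (use nodes_whilen in \<open>simp only: insert_is_Un[symmetric]\<close>)
  qed
  moreover have "legal P (while P (S P) (b P x) (body P x) (s0 P x))" if "okm P" for P x
    unfolding while_def by (rule legal_whilen) (use c[OF that] in blast)
  ultimately show ?thesis unfolding lean_def by blast
qed

lemma wp_while_measure:
  fixes \<Phi> \<mu> :: "'s \<Rightarrow> nat"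
  assumes "I s d" "\<mu> s \<le> word_range P ^ (20 * mem_size P)"
    and step: "\<And>s d. I s d \<Longrightarrow> b s \<Longrightarrow> s \<in> S \<and> wp P (body s) d (\<lambda>s' d' t. I s' d' \<and> t + \<Phi> s' \<le> \<Phi> s \<and> \<mu> s' < \<mu> s)"
  shows "wp P (while P S b body s) d (\<lambda>s' d' t. I s' d' \<and> \<not> b s' \<and> t + \<Phi> s' \<le> \<Phi> s)"
proof -
  have "wp P (whilen j S b body s) d (\<lambda>s' d' t. I s' d' \<and> \<not> b s' \<and> t + \<Phi> s' \<le> \<Phi> s)" if "I s d" "\<mu> s \<le> j" for j
    using that
  proof (induction j arbitrary: s d)
    case 0
    then have "\<not> b s" using step[of s d] by (auto simp: wp_def split: prod.splits)
    then show ?case using 0 by simp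
  next
    case (Suc j)
    show ?case
    proof (cases "b s")
      case True
      have "wp P (body s \<bind> whilen j S b body) d (\<lambda>s' d' t. I s' d' \<and> \<not> b s' \<and> t + \<Phi> s' \<le> \<Phi> s)"
      proof (rule wp_bindI)
        show "wp P (body s) d (\<lambda>s' d' t. I s' d' \<and> t + \<Phi> s' \<le> \<Phi> s \<and> \<mu> s' < \<mu> s)"
          using step Suc True by blast
      next
        fix r d' t assume *: "I r d' \<and> t + \<Phi> r \<le> \<Phi> s \<and> \<mu> r < \<mu> s"
        then have "wp P (whilen j S b body r) d' (\<lambda>s' d' t. I s' d' \<and> \<not> b s' \<and> t + \<Phi> s' \<le> \<Phi> r)"
          using Suc by auto
        then show "wp P (whilen j S b body r) d' (\<lambda>s' d'' t'. I s' d'' \<and> \<not> b s' \<and> t + t' + \<Phi> s' \<le> \<Phi> s)"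
          by (rule wp_mono) (use * in auto)
      qed
      then show ?thesis using step Suc True by auto
    qed (use Suc in auto)
  qed
  then show ?thesis unfolding while_def using assms by blast
qed

lemma wp_while:
  fixes \<Phi> :: "'s \<Rightarrow> nat"
  assumes "I s d" "\<Phi> s \<le> word_range P ^ (20 * mem_size P)"
    and "\<And>s d. I s d \<Longrightarrow> b s \<Longrightarrow> s \<in> S \<and> wp P (body s) d (\<lambda>s' d' t. I s' d' \<and> t + \<Phi> s' \<le> \<Phi> s \<and> \<Phi> s' < \<Phi> s)"
  shows "wp P (while P S b body s) d (\<lambda>s' d' t. I s' d' \<and> \<not> b s' \<and> t + \<Phi> s' \<le> \<Phi> s)"
  using assms by (rule wp_while_measure[where I = I and \<mu> = \<Phi>])

subsection \<open>Encoding the reachable programs in internal memory\<close>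

lemma length_written_items:
  "legal_wr P wr \<Longrightarrow> length (written_items P wr) \<le> num_disks P * block_size P"
proof -
  assume a: "legal_wr P wr"
  have "length (concat (map (\<lambda>i. case wr i of None \<Rightarrow> [] | Some (tr, blk) \<Rightarrow> blk) [0..<n])) \<le> n * block_size P"
    if "n \<le> num_disks P" for n using that
  proof (induction n)
    case (Suc n)
    then have "n < num_disks P" by simp
    then have "length (case wr n of None \<Rightarrow> [] | Some (tr, blk) \<Rightarrow> blk) \<le> block_size P"
      using a unfolding legal_wr_def by (cases "wr n") (auto split: prod.split)
    then show ?case using Suc by simp
  qed simp
  then show ?thesis by (auto simp: written_items_def)
qed

lemma read_blocks_response: "disk_ok P d \<Longrightarrow> read_blocks P d sel \<in> responses P"
proof -
  assume a: "disk_ok P d"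
  have "length (concat (map (\<lambda>i. case sel i of None \<Rightarrow> [] | Some tr \<Rightarrow> d i tr) [0..<n])) \<le> n * block_size P" for n
    using a by (induction n) (auto simp: disk_ok_def split: option.splits)
  then show ?thesis using a
    by (auto simp: read_blocks_def responses_def disk_ok_def split: option.splits)
qed

lemma disk_ok_write: "disk_ok P d \<Longrightarrow> legal_wr P wr \<Longrightarrow> disk_ok P (write_blocks P wr d)"
  by (auto simp: disk_ok_def legal_wr_def write_blocks_def split: option.splits)

text \<open>The memory holds the code of the node that issued the last I/O, not of its successor:
  the successor of a read depends on the blocks that have just arrived behind the code.\<close>

definition resume :: "machine \<Rightarrow> (item list \<Rightarrow> 'r prog) \<Rightarrow> item list \<Rightarrow> 'r prog" where
  "resume P dec mem = (case dec (take (mem_size P div 2) mem) of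
      Ret a \<Rightarrow> Ret a | Rd sel c \<Rightarrow> c (drop (mem_size P div 2) mem) | Wr wr p \<Rightarrow> p)"


definition prog_action :: "(nat prog \<Rightarrow> item list) \<Rightarrow> nat prog \<Rightarrow> action" where
  "prog_action e p = (case p of Ret a \<Rightarrow> Halt a | Rd sel c \<Rightarrow> Read (e p) sel | Wr wr p' \<Rightarrow> Write (e p) wr)"

text \<open>The induction over the tree assumes only that the algorithm, applied to the present
  memory, issues the action at the root. The initial memory and the memory after an I/O look
  different, but both satisfy this.\<close>

lemma run_of_exec:
  fixes f :: "item list \<Rightarrow> action"
  assumes ok: "okm P" and k: "8 \<le> k"
    and e: "\<And>p. p \<in> X \<Longrightarrow> length (e p) = mem_size P div 2 \<and> (\<forall>x\<in>set (e p). valid_item P k x) \<and> dec (e p) = p"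
    and f: "\<And>p rest. p \<in> X \<Longrightarrow> f (e p @ rest) = prog_action e (resume P dec (e p @ rest))"
    and "nodes P p \<subseteq> X" "legal P p" "disk_ok P d" "f mem = prog_action e p"
    and "exec P p d = (a, d', t)" "a < word_range P ^ 8"
  shows "em_run P k f mem d t a d'"
  using assms(5-)
proof (induction p arbitrary: mem d t)
  case (Ret r)
  have "word_range P ^ 8 \<le> word_range P ^ k" using okmD[OF ok] k by (intro power_increasing) auto
  then show ?case using Ret by (auto intro!: em_run.halt simp: prog_action_def valid_track_def)
next
  case (Rd sel c)
  let ?r = "read_blocks P d sel" and ?p = "Rd sel c"
  obtain t' where t': "exec P (c ?r) d = (a, d', t')" "t = Suc t'"
    using Rd.prems(5) by (auto split: prod.splits)
  have X: "?p \<in> X" using Rd.prems(1) by auto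
  have resp: "?r \<in> responses P" using Rd.prems read_blocks_response by blast
  have pw: "word_range P ^ 8 \<le> word_range P ^ k" using okmD[OF ok] k by (intro power_increasing) auto
  have "em_run P k f (e ?p @ ?r) d t' a d'"
  proof (rule Rd.IH)
    show "f (e ?p @ ?r) = prog_action e (c ?r)"
      using f[OF X, of ?r] e[OF X] by (simp add: resume_def)
    show "nodes P (c ?r) \<subseteq> X" using Rd.prems(1) resp by auto
    show "legal P (c ?r)" using Rd.prems resp by auto
  qed (use Rd.prems t' in auto)
  then show ?case unfolding t'(2)
  proof (rule em_run.read[rotated -1])
    show "f mem = Read (e ?p) sel" using Rd.prems by (simp add: prog_action_def)
    show "\<forall>i<num_disks P. \<forall>tr. sel i = Some tr \<longrightarrow> valid_track P k tr"
      using Rd.prems pw by (auto simp: valid_track_def)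
    show "\<forall>x\<in>set (e ?p). valid_item P k x" using e[OF X] by auto
    show "length (e ?p) + length ?r \<le> mem_size P"
      using e[OF X] resp okmD(3)[OF ok] by (auto simp: responses_def)
  qed
next
  case (Wr wr p)
  let ?p = "Wr wr p"
  obtain t' where t': "exec P p (write_blocks P wr d) = (a, d', t')" "t = Suc t'"
    using Wr.prems(5) by (auto split: prod.splits)
  have X: "?p \<in> X" using Wr.prems(1) by auto
  have lw: "legal_wr P wr" using Wr.prems by auto
  have pw: "word_range P ^ 8 \<le> word_range P ^ k" using okmD[OF ok] k by (intro power_increasing) auto
  have "em_run P k f (e ?p) (write_blocks P wr d) t' a d'"
  proof (rule Wr.IH)
    show "f (e ?p) = prog_action e p"
      using f[OF X, of "[]"] e[OF X] by (simp add: resume_def)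
    show "disk_ok P (write_blocks P wr d)" using Wr.prems lw disk_ok_write by blast
  qed (use Wr.prems t' in auto)
  then show ?case unfolding t'(2)
  proof (rule em_run.write[rotated -1])
    show "f mem = Write (e ?p) wr" using Wr.prems by (simp add: prog_action_def)
    show "\<forall>x\<in>set (e ?p). valid_item P k x" using e[OF X] by auto
    show "\<forall>i<num_disks P. \<forall>tr blk. wr i = Some (tr, blk) \<longrightarrow>
        valid_track P k tr \<and> length blk = block_size P \<and> (\<forall>x\<in>set blk. valid_item P k x)"
    proof (intro allI impI)
      fix i tr blk assume "i < num_disks P" "wr i = Some (tr, blk)"
      then have *: "tr < word_range P ^ 8" "length blk = block_size P" "set blk \<subseteq> vitems P"
        using lw by (auto simp: legal_wr_def)
      then show "valid_track P k tr \<and> length blk = block_size P \<and> (\<forall>x\<in>set blk. valid_item P k x)"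
        using pw k by (auto simp: valid_track_def vitems_def valid_item_def subset_iff)
    qed
    show "length (e ?p) + length (written_items P wr) \<le> mem_size P"
      using e[OF X] length_written_items[OF lw] okmD(3)[OF ok] by auto
  qed
qed

text \<open>The encoding comes from a comparison of cardinalities. It need not be computable, since
  the algorithm may be any function of the memory contents.\<close>

theorem lean_simulation:
  fixes main :: "machine \<Rightarrow> nat \<times> nat \<Rightarrow> nat prog"
  assumes "lean main"
  obtains A :: em_algorithm and k where
    "\<And>P n m d a d' t. okm P \<Longrightarrow> n < word_range P \<Longrightarrow> m < word_range P \<Longrightarrow> disk_ok P d \<Longrightarrow>
       exec P (main P (n, m)) d = (a, d', t) \<Longrightarrow> a < word_range P ^ 8 \<Longrightarrow> em_run P k (A P) [[n, m]] d t a d'"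
proof -
  obtain c where c: "\<And>P x. okm P \<Longrightarrow> small P c (nodes P (main P x)) \<and> legal P (main P x)"
    using assms unfolding lean_def by blast
  \<comment> \<open>The factor 3 compensates for using only \<open>M div 2\<close> items, since
    \<open>M\<close> is at most \<open>3 * (M div 2)\<close>; the exponent \<open>c + 2\<close>
    accounts for the two input lengths. The summand 8 makes the items of programs legal and code
    items longer than the initial item.\<close>
  define k where "k = 3 * (c + 2) + 8"
  define X where "X P = (\<Union>n\<in>{..<word_range P}. \<Union>m\<in>{..<word_range P}. nodes P (main P (n, m)))" for P
  define Cod where "Cod P = {xs. set xs \<subseteq> {x. set x \<subseteq> {..<word_range P} \<and> length x = k} \<and> length xs = mem_size P div 2}" for P :: machine
  have "\<exists>e. inj_on e (X P) \<and> e ` X P \<subseteq> Cod P" if ok: "okm P" for P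
  proof -
    let ?W = "word_range P" and ?M = "mem_size P"
    have W: "small P 1 {..<?W}" using okmD[OF ok] by (auto simp: small_def intro: self_le_power)
    have "small P (1 + (1 + c)) (X P)" unfolding X_def by (intro small_UN W) (use c[OF ok] in auto)
    then have X: "finite (X P)" "card (X P) \<le> ?W ^ ((c + 2) * ?M)" by (auto simp: small_def)
    have fin: "finite {x. set x \<subseteq> {..<?W} \<and> length x = k}" by (rule finite_lists_length_eq) simp
    have "card (Cod P) = (?W ^ k) ^ (?M div 2)"
      unfolding Cod_def using fin by (simp add: card_lists_length_eq)
    moreover have "(c + 2) * ?M \<le> k * (?M div 2)"
    proof -
      have "?M \<le> 3 * (?M div 2)" using okmD(5)[OF ok] by presburger
      then have "(c + 2) * ?M \<le> (c + 2) * (3 * (?M div 2))" by (rule mult_le_mono2)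
      also have "\<dots> \<le> k * (?M div 2)" by (simp add: k_def algebra_simps)
      finally show ?thesis .
    qed
    moreover have "?W ^ ((c + 2) * ?M) \<le> ?W ^ (k * (?M div 2))" if "(c + 2) * ?M \<le> k * (?M div 2)"
      using that okmD(4)[OF ok] by (intro power_increasing) auto
    ultimately have "card (X P) \<le> card (Cod P)"
      using X(2) by (simp flip: power_mult)
    moreover have "finite (Cod P)" unfolding Cod_def using fin by (rule finite_lists_length_eq)
    ultimately show ?thesis using X(1) card_le_inj[of "X P" "Cod P"] by blast
  qed
  then obtain e where e: "\<And>P. okm P \<Longrightarrow> inj_on (e P) (X P)" "\<And>P. okm P \<Longrightarrow> e P ` X P \<subseteq> Cod P"
    using choice[of "\<lambda>P e. okm P \<longrightarrow> inj_on e (X P) \<and> e ` X P \<subseteq> Cod P"] by blast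
  define dec where "dec P = inv_into (X P) (e P)" for P
  \<comment> \<open>Code items have length \<open>k > 2\<close>, so a first item of length 2
    identifies the initial memory.\<close>
  define A where "A P mem = prog_action (e P) (if mem \<noteq> [] \<and> length (hd mem) = 2
      then main P (hd mem ! 0, hd mem ! 1) else resume P (dec P) mem)" for P mem
  have "em_run P k (A P) [[n, m]] d t a d'"
    if "okm P" "n < word_range P" "m < word_range P" "disk_ok P d"
      "exec P (main P (n, m)) d = (a, d', t)" "a < word_range P ^ 8" for P n m d a d' t
  proof (rule run_of_exec[where X = "X P" and e = "e P" and dec = "dec P"])
    show "8 \<le> k" by (simp add: k_def)
    show E: "length (e P p) = mem_size P div 2 \<and> (\<forall>x\<in>set (e P p). valid_item P k x) \<and> dec P (e P p) = p"
      if "p \<in> X P" for p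
    proof -
      have "e P p \<in> Cod P" using e(2)[OF \<open>okm P\<close>] that by auto
      then show ?thesis using e(1)[OF \<open>okm P\<close>] that
        by (auto simp: Cod_def dec_def valid_item_def subset_iff)
    qed
    show "A P (e P p @ rest) = prog_action (e P) (resume P (dec P) (e P p @ rest))" if "p \<in> X P" for p rest
    proof -
      have "e P p \<in> Cod P" using e(2)[OF \<open>okm P\<close>] that by auto
      moreover have "e P p \<noteq> []" using E[OF that] okmD(5)[OF \<open>okm P\<close>] by auto
      ultimately have "length (hd (e P p @ rest)) \<noteq> 2" by (cases "e P p") (auto simp: Cod_def k_def)
      then show ?thesis by (simp add: A_def)
    qed
    show "nodes P (main P (n, m)) \<subseteq> X P" using that by (auto simp: X_def)
    show "legal P (main P (n, m))" using c that by blast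
    show "A P [[n, m]] = prog_action (e P) (main P (n, m))" by (simp add: A_def)
  qed (use that in auto)
  then show ?thesis using that by blast
qed

section \<open>Striped lists and streaming passes\<close>

lemma concat_slice:
  assumes "\<forall>x\<in>set xss. length x = B" "i < length xss"
  shows "take B (drop (i * B) (concat xss)) = xss ! i"
  using assms
proof (induction xss arbitrary: i)
  case (Cons x xss)
  then show ?case by (cases i) auto
qed simp

lemma concat_slices: "concat (map (\<lambda>i. take B (drop (i * B) xs)) [0..<n]) = take (n * B) xs"
proof (induction n)
  case (Suc n)
  then show ?case by (simp add: take_add[symmetric] add.commute)
qed simp

lemma length_concat_const: "\<forall>x\<in>set xss. length x = B \<Longrightarrow> length (concat xss) = length xss * B"
  by (induction xss) auto

text \<open>The range test makes every instance legal, whatever its arguments, so that space bounds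
  and correctness can be proved separately.\<close>

definition rdop :: "machine \<Rightarrow> (nat \<Rightarrow> nat) \<Rightarrow> item list prog" where
  "rdop P f = (if \<forall>i<num_disks P. f i < word_range P ^ 8 then Rd (\<lambda>i. Some (f i)) Ret else Ret [])"

definition wrop :: "machine \<Rightarrow> (nat \<Rightarrow> (nat \<times> item list) option) \<Rightarrow> unit prog" where
  "wrop P wr = (if legal_wr P wr then Wr wr (Ret ()) else Ret ())"

lemma smallset_responses: "smallset responses"
proof -
  obtain c where c: "\<And>P. okm P \<Longrightarrow> small P c (item_lists P)"
    using smallset_item_lists unfolding smallset_def by blast
  have "responses P \<subseteq> item_lists P" if "okm P" for P
    using okmD(3)[OF that] by (auto simp: responses_def item_lists_def)
  then have "small P c (responses P)" if "okm P" for P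
    using c small_subset that by blast
  then show ?thesis unfolding smallset_def by blast
qed

lemma lean_rdop: "lean (\<lambda>P x. rdop P (f P x))"
proof -
  obtain c where c: "\<And>P. okm P \<Longrightarrow> small P c (responses P)"
    using smallset_responses unfolding smallset_def by blast
  have "small P (0 + (c + 0) + 1) (nodes P (rdop P f)) \<and> legal P (rdop P f)" if ok: "okm P" for P f
  proof (cases "\<forall>i<num_disks P. f i < word_range P ^ 8")
    case True
    have "nodes P (rdop P f) = {Rd (\<lambda>i. Some (f i)) Ret} \<union> (\<Union>x\<in>responses P. {Ret x})"
      using True by (auto simp: rdop_def)
    moreover have "small P (0 + (c + 0) + 1) ({Rd (\<lambda>i. Some (f i)) Ret} \<union> (\<Union>x\<in>responses P. {Ret x}))"
      by (intro small_Un[OF ok] small_singleton[OF ok] small_UN c[OF ok])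
    ultimately show ?thesis using True by (auto simp: rdop_def)
  next
    case False
    have "small P 0 {Ret [] :: item list prog}" by (rule small_singleton[OF ok])
    then have "small P (0 + (c + 0) + 1) {Ret [] :: item list prog}" by (rule small_mono[OF ok]) simp
    then show ?thesis using False by (auto simp: rdop_def)
  qed
  then show ?thesis unfolding lean_def by blast
qed

lemma lean_wrop: "lean (\<lambda>P x. wrop P (f P x))"
proof -
  have "small P (0 + 0 + 1) (nodes P (wrop P f)) \<and> legal P (wrop P f)" if ok: "okm P" for P f
  proof -
    have "nodes P (wrop P f) \<subseteq> {Wr f (Ret ())} \<union> {Ret ()}" by (auto simp: wrop_def)
    moreover have "small P (0 + 0 + 1) ({Wr f (Ret ())} \<union> {Ret ()})"
      by (intro small_Un[OF ok] small_singleton[OF ok])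
    ultimately show ?thesis using small_subset by (fastforce simp: wrop_def)
  qed
  then show ?thesis unfolding lean_def by blast
qed

lemma wp_rdop:
  "(\<And>i. i < num_disks P \<Longrightarrow> f i < word_range P ^ 8) \<Longrightarrow>
    wp P (rdop P f) d Q = Q (concat (map (\<lambda>i. d i (f i)) [0..<num_disks P])) d 1"
  by (auto simp: rdop_def wp_def read_blocks_def)

lemma wp_wrop: "legal_wr P wr \<Longrightarrow> wp P (wrop P wr) d Q = Q () (write_blocks P wr d) 1"
  by (auto simp: wrop_def wp_def)

section \<open>Frame conditions and the contents of striped arrays\<close>

definition same_off :: "nat set \<Rightarrow> disks \<Rightarrow> disks \<Rightarrow> bool" where
  "same_off X d d' \<longleftrightarrow> (\<forall>i t. t \<notin> X \<longrightarrow> d' i t = d i t)"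

lemma same_off_refl [simp]: "same_off X d d"
  by (simp add: same_off_def)

lemma same_off_trans: "same_off X d d' \<Longrightarrow> same_off Y d' d'' \<Longrightarrow> X \<union> Y \<subseteq> Z \<Longrightarrow> same_off Z d d''"
  unfolding same_off_def by (metis Un_iff subsetD)

lemma same_off_mono: "same_off X d d' \<Longrightarrow> X \<subseteq> Y \<Longrightarrow> same_off Y d d'"
  by (auto simp: same_off_def)

text \<open>The parameter \<open>u\<close> is the number of disks in use: all of them for input and
  output, only \<open>vu P\<close> for the work arrays, which consist of whole virtual
  blocks.\<close>

definition stripe :: "nat \<Rightarrow> disks \<Rightarrow> nat \<Rightarrow> item list" where
  "stripe u d t = concat (map (\<lambda>i. d i t) [0..<u])"

definition cont :: "nat \<Rightarrow> disks \<Rightarrow> nat \<Rightarrow> nat \<Rightarrow> item list" where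
  "cont u d a K = concat (map (stripe u d) [a..<a+K])"

lemma cont_0 [simp]: "cont u d a 0 = []"
  by (simp add: cont_def)

lemma cont_add: "cont u d a (K + K') = cont u d a K @ cont u d (a + K) K'"
  using upt_add_eq_append[of a "a + K" K'] by (simp add: cont_def add.assoc)

lemma cont_Suc: "cont u d a (Suc K) = cont u d a K @ stripe u d (a + K)"
  by (simp add: cont_def)

lemma cont_same_off:
  assumes "same_off X d d'" "X \<inter> {a..<a+K} = {}"
  shows "cont u d' a K = cont u d a K"
proof -
  have "stripe u d' t = stripe u d t" if "t \<in> {a..<a+K}" for t
  proof -
    have "t \<notin> X" using assms(2) that by blast
    then show ?thesis using assms(1) by (simp add: same_off_def stripe_def)
  qed
  then show ?thesis unfolding cont_def by (metis atLeastLessThan_upt map_cong)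
qed

lemma length_stripe: "disk_ok P d \<Longrightarrow> length (stripe u d t) = u * block_size P"
  unfolding stripe_def by (subst length_concat_const[where B = "block_size P"]) (auto simp: disk_ok_def)

lemma length_cont: "disk_ok P d \<Longrightarrow> length (cont u d a K) = K * (u * block_size P)"
  by (induction K) (auto simp: cont_Suc length_stripe)

lemma set_cont_vitems: "disk_ok P d \<Longrightarrow> set (cont u d a K) \<subseteq> vitems P"
  by (auto simp: cont_def stripe_def disk_ok_def)

lemma stripe_in_cont: "disk_ok P d \<Longrightarrow> z < K \<Longrightarrow>
   stripe u d (a + z) = take (u * block_size P) (drop (z * (u * block_size P)) (cont u d a K))"
  unfolding cont_def by (subst concat_slice) (auto simp: length_stripe)

definition rds :: "machine \<Rightarrow> nat \<Rightarrow> nat \<Rightarrow> item list prog" where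
  "rds P u t = rdop P (\<lambda>_. t) \<bind> (\<lambda>x. Ret (take (u * block_size P) x))"

definition wrs :: "machine \<Rightarrow> nat \<Rightarrow> nat \<Rightarrow> item list \<Rightarrow> unit prog" where
  "wrs P u t xs = wrop P (\<lambda>i. if i < u then Some (t, take (block_size P) (drop (i * block_size P) xs)) else None)"

lemma lean_rds: "lean (\<lambda>P x. rds P (u P x) (t P x))"
  unfolding rds_def by (intro lean_bind lean_rdop lean_Ret)

lemma lean_wrs: "lean (\<lambda>P x. wrs P (u P x) (t P x) (xs P x))"
  unfolding wrs_def by (intro lean_wrop)

lemma wp_rds:
  assumes "disk_ok P d" "u \<le> num_disks P" "t < word_range P ^ 8" "Q (stripe u d t) d 1"
  shows "wp P (rds P u t) d Q"
proof -
  have "[0..<num_disks P] = [0..<u] @ [u..<num_disks P]"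
    using assms(2) upt_add_eq_append[of 0 u "num_disks P - u"] by simp
  then have "take (u * block_size P) (concat (map (\<lambda>i. d i t) [0..<num_disks P])) = stripe u d t"
    using length_stripe[OF assms(1), of u t] by (simp add: stripe_def)
  then show ?thesis using assms by (simp add: rds_def wp_bind wp_rdop)
qed

lemma wp_wrs:
  assumes ok: "disk_ok P d" and "u \<le> num_disks P" "t < word_range P ^ 8"
    and xs: "length xs = u * block_size P" "set xs \<subseteq> vitems P"
    and Q: "\<And>d'. disk_ok P d' \<Longrightarrow> stripe u d' t = xs \<Longrightarrow> same_off {t} d d' \<Longrightarrow> Q () d' 1"
  shows "wp P (wrs P u t xs) d Q"
proof -
  let ?wr = "\<lambda>i. if i < u then Some (t, take (block_size P) (drop (i * block_size P) xs)) else None"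
  have len: "length (take (block_size P) (drop (i * block_size P) xs)) = block_size P" if "i < u" for i
  proof -
    have "(i + 1) * block_size P \<le> u * block_size P" using that by (intro mult_le_mono1) simp
    then show ?thesis using xs(1) by simp
  qed
  have legal: "legal_wr P ?wr"
    using assms(3) xs len by (auto simp: legal_wr_def dest!: in_set_takeD in_set_dropD split: if_splits)
  let ?d = "write_blocks P ?wr d"
  have 1: "?d i t' = (if i < u \<and> t' = t then take (block_size P) (drop (i * block_size P) xs) else d i t')" for i t'
    using assms(2) by (auto simp: write_blocks_def)
  have "stripe u ?d t = xs"
  proof -
    have "stripe u ?d t = concat (map (\<lambda>i. take (block_size P) (drop (i * block_size P) xs)) [0..<u])"
      unfolding stripe_def by (intro arg_cong[where f = concat] map_cong) (auto simp: 1)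
    then show ?thesis using concat_slices[of "block_size P" xs u] xs(1) by simp
  qed
  moreover have "same_off {t} d ?d" by (auto simp: same_off_def 1)
  moreover have "disk_ok P ?d" using ok legal disk_ok_write by blast
  ultimately show ?thesis unfolding wrs_def wp_wrop[OF legal] using Q by blast
qed

text \<open>Flushes the full stripes of a buffer; the result is the next free track and the
  incomplete rest.\<close>

definition wout :: "machine \<Rightarrow> nat \<Rightarrow> nat \<times> item list \<Rightarrow> (nat \<times> item list) prog" where
  "wout P u s = while P (nums P \<times> item_lists P) (\<lambda>s. u * block_size P \<le> length (snd s))
     (\<lambda>s. wrs P u (fst s) (take (u * block_size P) (snd s)) \<bind> (\<lambda>_. Ret (fst s + 1, drop (u * block_size P) (snd s)))) s"

lemma lean_wout: "lean (\<lambda>P x. wout P (u P x) (s P x))"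
  unfolding wout_def by (intro lean_while smallset_intros lean_bind lean_wrs lean_Ret)

lemma word_power_le:
  assumes "okm P" "c \<le> 20 * mem_size P" shows "word_range P ^ c \<le> word_range P ^ (20 * mem_size P)"
  using assms okmD[OF assms(1)] by (intro power_increasing) auto

lemma nums_le: "okm P \<Longrightarrow> x \<le> word_range P ^ 8 \<Longrightarrow> x \<in> nums P"
proof -
  assume a: "okm P" "x \<le> word_range P ^ 8"
  have "word_range P ^ 8 < word_range P ^ (20 * mem_size P)"
    using okmD[OF a(1)] by (intro power_strict_increasing) auto
  then show ?thesis using a by (simp add: nums_def)
qed

lemma nums_small: "okm P \<Longrightarrow> x < 20 * mem_size P \<Longrightarrow> x \<in> nums P"
proof -
  assume a: "okm P" "x < 20 * mem_size P"
  have "20 * mem_size P < 2 ^ (20 * mem_size P)" by (rule less_exp)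
  also have "\<dots> \<le> word_range P ^ (20 * mem_size P)" using okmD[OF a(1)] by (intro power_mono) auto
  finally show ?thesis using a by (simp add: nums_def)
qed

lemma wp_wout:
  assumes ok: "okm P" "disk_ok P d" and u: "1 \<le> u" "u \<le> num_disks P"
    and xs: "set xs \<subseteq> vitems P" "length xs \<le> 20 * mem_size P"
    and b: "b + length xs div (u * block_size P) \<le> word_range P ^ 8"
  shows "wp P (wout P u (b, xs)) d (\<lambda>r d' t. \<exists>c. c = length xs div (u * block_size P) \<and> fst r = b + c \<and>
     cont u d' b c = take (c * (u * block_size P)) xs \<and> snd r = drop (c * (u * block_size P)) xs \<and>
     disk_ok P d' \<and> same_off {b..<b+c} d d' \<and> t \<le> c)"
proof -
  let ?Z = "u * block_size P"
  have Z: "1 \<le> ?Z" using u okmD[OF ok(1)] by (simp add: Suc_le_eq)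
  define I where "I r d' \<longleftrightarrow> disk_ok P d' \<and> (\<exists>c. fst r = b + c \<and> c * ?Z \<le> length xs \<and> snd r = drop (c * ?Z) xs \<and>
     cont u d' b c = take (c * ?Z) xs \<and> same_off {b..<b+c} d d')" for r :: "nat \<times> item list" and d'
  define \<Phi> where "\<Phi> r = length (snd r) div ?Z" for r :: "nat \<times> item list"
  have "wp P (wout P u (b, xs)) d (\<lambda>r d' t. I r d' \<and> \<not> ?Z \<le> length (snd r) \<and> t + \<Phi> r \<le> \<Phi> (b, xs))"
    unfolding wout_def
  proof (rule wp_while)
    show "I (b, xs) d" using ok by (auto simp: I_def)
    have "\<Phi> (b, xs) \<le> length xs" by (simp add: \<Phi>_def)
    also have "\<dots> \<le> word_range P ^ (20 * mem_size P)"
      using xs(2) nums_small[OF ok(1), of "20 * mem_size P - 1"] okmD[OF ok(1)] by (auto simp: nums_def)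
    finally show "\<Phi> (b, xs) \<le> word_range P ^ (20 * mem_size P)" .
  next
    fix s d1 assume I: "I s d1" and le: "?Z \<le> length (snd s)"
    obtain c where c: "fst s = b + c" "c * ?Z \<le> length xs" "snd s = drop (c * ?Z) xs"
     "cont u d1 b c = take (c * ?Z) xs" "same_off {b..<b+c} d d1" "disk_ok P d1" using I by (auto simp: I_def)
    have c1: "(c + 1) * ?Z \<le> length xs" using le c by simp
    then have "(c + 1) * ?Z div ?Z \<le> length xs div ?Z" by (rule div_le_mono)
    then have c2: "c + 1 \<le> length xs div ?Z" using Z by auto
    have "s \<in> nums P \<times> item_lists P"
      using c xs b c2 nums_le[OF ok(1), of "b + c"]
      by (cases s) (auto simp: item_lists_def dest: in_set_dropD)
    moreover have "wp P (wrs P u (fst s) (take ?Z (snd s)) \<bind> (\<lambda>_. Ret (fst s + 1, drop ?Z (snd s)))) d1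
       (\<lambda>s' d' t. I s' d' \<and> t + \<Phi> s' \<le> \<Phi> s \<and> \<Phi> s' < \<Phi> s)"
      unfolding wp_bind
    proof (rule wp_wrs[OF c(6) u(2)])
      show "fst s < word_range P ^ 8" using b c c2 by simp
      show "length (take ?Z (snd s)) = ?Z" using le by simp
      show "set (take ?Z (snd s)) \<subseteq> vitems P" using xs c by (auto dest!: in_set_takeD in_set_dropD)
    next
      fix d2 assume d2: "disk_ok P d2" "stripe u d2 (fst s) = take ?Z (snd s)" "same_off {fst s} d1 d2"
      have "cont u d2 b c = cont u d1 b c" by (rule cont_same_off[OF d2(3)]) (use c in auto)
      then have "cont u d2 b (Suc c) = take (Suc c * ?Z) xs"
        using c d2 by (simp add: cont_Suc take_add[symmetric] add.commute)
      moreover have "same_off {b..<b + Suc c} d d2"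
        by (rule same_off_trans[OF c(5) d2(3)]) (use c in auto)
      ultimately have I': "I (fst s + 1, drop ?Z (snd s)) d2"
        unfolding I_def using c c1 d2 by (auto intro!: exI[of _ "Suc c"] simp: add.commute)
      have "Suc ((length (snd s) - ?Z) div ?Z) = length (snd s) div ?Z"
        using le Z by (simp add: le_div_geq)
      then show "wp P (Ret (fst s + 1, drop ?Z (snd s))) d2 (\<lambda>s' d' t'. I s' d' \<and> 1 + t' + \<Phi> s' \<le> \<Phi> s \<and> \<Phi> s' < \<Phi> s)"
        using I' by (simp add: \<Phi>_def)
    qed
    ultimately show "s \<in> nums P \<times> item_lists P \<and> wp P (wrs P u (fst s) (take ?Z (snd s)) \<bind> (\<lambda>_. Ret (fst s + 1, drop ?Z (snd s)))) d1
       (\<lambda>s' d' t. I s' d' \<and> t + \<Phi> s' \<le> \<Phi> s \<and> \<Phi> s' < \<Phi> s)" ..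
  qed
  then show ?thesis
  proof (rule wp_mono)
    fix r d' t assume *: "I r d' \<and> \<not> ?Z \<le> length (snd r) \<and> t + \<Phi> r \<le> \<Phi> (b, xs)"
    then obtain c where c: "fst r = b + c" "c * ?Z \<le> length xs" "snd r = drop (c * ?Z) xs"
     "cont u d' b c = take (c * ?Z) xs" "same_off {b..<b+c} d d'" "disk_ok P d'" by (auto simp: I_def)
    have "length xs - c * ?Z < ?Z" using * c by simp
    then have "length xs div ?Z = c" using c(2) by (intro div_nat_eqI) (auto simp: algebra_simps)
    then show "\<exists>c. c = length xs div ?Z \<and> fst r = b + c \<and>
     cont u d' b c = take (c * ?Z) xs \<and> snd r = drop (c * ?Z) xs \<and>
     disk_ok P d' \<and> same_off {b..<b+c} d d' \<and> t \<le> c"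
      using c * by (auto simp: \<Phi>_def)
  qed
qed

text \<open>The run of a transducer (Mealy machine), with its final state and its concatenated
  output.\<close>

fun trun :: "('s \<Rightarrow> item \<Rightarrow> 's \<times> item list) \<Rightarrow> 's \<Rightarrow> item list \<Rightarrow> 's \<times> item list" where
  "trun f s [] = (s, [])"
| "trun f s (x # xs) = (fst (trun f (fst (f s x)) xs), snd (f s x) @ snd (trun f (fst (f s x)) xs))"

lemma trun_append:
  "trun f s (xs @ ys) = (fst (trun f (fst (trun f s xs)) ys), snd (trun f s xs) @ snd (trun f (fst (trun f s xs)) ys))"
  by (induction xs arbitrary: s) auto

text \<open>Graph items start with 0, so padding is larger than all of them and stays at the end
  under sorting. It has length four, like all items that are sorted.\<close>

definition pad_item :: item where "pad_item = [1, 0, 0, 0]"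

definition cdiv :: "nat \<Rightarrow> nat \<Rightarrow> nat" where "cdiv n Z = (n + Z - 1) div Z"

definition pad :: "nat \<Rightarrow> item list \<Rightarrow> item list" where
  "pad Z xs = xs @ replicate (cdiv (length xs) Z * Z - length xs) pad_item"

lemma cdiv_ge: "1 \<le> Z \<Longrightarrow> n \<le> cdiv n Z * Z"
proof -
  assume Z: "1 \<le> Z"
  have "n + Z - 1 < Suc ((n + Z - 1) div Z) * Z"
    using Z by (metis One_nat_def Suc_le_lessD dividend_less_div_times mult_Suc add.commute)
  then show ?thesis using Z by (simp add: cdiv_def)
qed

lemma cdiv_mono: "m \<le> n \<Longrightarrow> cdiv m Z \<le> cdiv n Z"
  unfolding cdiv_def by (intro div_le_mono) simp

lemma div_le_cdiv: "n div Z \<le> cdiv n Z"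
proof (cases "Z = 0")
  case False
  then show ?thesis unfolding cdiv_def by (intro div_le_mono) simp
qed (simp add: cdiv_def)

lemma cdiv_less: "1 \<le> Z \<Longrightarrow> 1 \<le> n \<Longrightarrow> (cdiv n Z - 1) * Z < n"
proof -
  assume Z: "1 \<le> Z" "1 \<le> n"
  have "cdiv n Z * Z \<le> n + Z - 1" unfolding cdiv_def by simp
  then show ?thesis using Z by (simp add: diff_mult_distrib)
qed

lemma cdiv_le: "n \<le> k * Z \<Longrightarrow> 1 \<le> Z \<Longrightarrow> cdiv n Z \<le> k"
proof -
  assume a: "n \<le> k * Z" "1 \<le> Z"
  then have "(n + Z - 1) div Z \<le> (k * Z + (Z - 1)) div Z" by (intro div_le_mono) simp
  also have "\<dots> = k" using a by (intro div_nat_eqI) (auto simp: mult.commute)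
  finally show ?thesis by (simp add: cdiv_def)
qed

lemma cdiv_mult [simp]: "1 \<le> Z \<Longrightarrow> cdiv (k * Z) Z = k"
  using cdiv_le[of "k * Z" k Z] cdiv_ge[of Z "k * Z"] by auto

lemma length_pad: "1 \<le> Z \<Longrightarrow> length (pad Z xs) = cdiv (length xs) Z * Z"
  using cdiv_ge by (simp add: pad_def)

lemma pad_full: "1 \<le> Z \<Longrightarrow> length xs = k * Z \<Longrightarrow> pad Z xs = xs"
  by (simp add: pad_def)

text \<open>\<open>y\<close> is a fixed parameter of the transducer \<open>f\<close>, and
  \<open>e\<close> draws a last output from its final state. Separate disk counts \<open>u\<close>
  and \<open>v\<close> let a pass convert between the striping of input or output and that of the
  work arrays.\<close>

definition scan :: "(machine \<Rightarrow> 's set) \<Rightarrow> (machine \<Rightarrow> 'y \<Rightarrow> 's \<Rightarrow> item \<Rightarrow> 's \<times> item list) \<Rightarrow> (machine \<Rightarrow> 'y \<Rightarrow> 's \<Rightarrow> item list) \<Rightarrow>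
    (machine \<Rightarrow> nat) \<Rightarrow> (machine \<Rightarrow> nat) \<Rightarrow> machine \<Rightarrow> 'y \<times> nat \<times> nat \<times> nat \<times> 's \<Rightarrow> ('s \<times> nat) prog" where
  "scan S f e u v P x = (case x of (y, a, K, b, s0) \<Rightarrow>
     while P (nums P \<times> nums P \<times> S P \<times> item_lists P) (\<lambda>(z, b, s, buf). z < a + K)
       (\<lambda>(z, b, s, buf). rds P (u P) z \<bind> (\<lambda>xs. wout P (v P) (b, buf @ snd (trun (f P y) s xs)) \<bind>
          (\<lambda>(b', buf'). Ret (z + 1, b', fst (trun (f P y) s xs), buf')))) (a, b, s0, [])
     \<bind> (\<lambda>(z, b, s, buf). wout P (v P) (b, pad (v P * block_size P) (buf @ e P y s)) \<bind> (\<lambda>(b', _). Ret (s, b'))))"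

lemma lean_scan: "smallset S \<Longrightarrow> lean (scan S f e u v)"
  unfolding scan_def case_prod_beta
  by (intro lean_bind lean_while lean_wout lean_rds lean_Ret smallset_intros)

lemma lean_scan_comp: "smallset S \<Longrightarrow> lean (\<lambda>P x. scan S f e u v P (g P x))"
  by (rule lean_comp[OF lean_scan])

text \<open>\<open>burst\<close> bounds the output caused by a single stripe of input, which must be
  held at once; \<open>st\<close> keeps the transducer inside the set \<open>S P\<close> from which
  the space bound is computed. The source must not meet the target, because writing starts before
  reading ends.\<close>

lemma wp_scan:
  fixes f :: "machine \<Rightarrow> 'y \<Rightarrow> 's \<Rightarrow> item \<Rightarrow> 's \<times> item list"
  assumes ok: "okm P" "disk_ok P d" and u: "1 \<le> u P" "u P \<le> num_disks P" and v: "1 \<le> v P" "v P \<le> num_disks P"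
    and xs: "xs = cont (u P) d a K" and f': "f' = f P y"
    and out: "out = snd (trun f' s0 xs) @ e P y (fst (trun f' s0 xs))"
    and K': "K' = cdiv (length out) (v P * block_size P)"
    and st: "\<And>ys zs. xs = ys @ zs \<Longrightarrow> fst (trun f' s0 ys) \<in> S P"
    and burst: "\<And>ys zs ws. xs = ys @ zs @ ws \<Longrightarrow> length zs = u P * block_size P \<Longrightarrow>
      length (snd (trun f' (fst (trun f' s0 ys)) zs)) \<le> 18 * mem_size P"
    and burst_end: "length (e P y (fst (trun f' s0 xs))) \<le> 18 * mem_size P"
    and valid: "set out \<subseteq> vitems P"
    and tracks: "a + K \<le> word_range P ^ 8" "b + K' \<le> word_range P ^ 8" "{a..<a+K} \<inter> {b..<b+K'} = {}"
  shows "wp P (scan S f e u v P (y, a, K, b, s0)) d (\<lambda>r d' t. fst r = fst (trun f' s0 xs) \<and> snd r = b + K' \<and>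
     cont (v P) d' b K' = pad (v P * block_size P) out \<and> disk_ok P d' \<and> same_off {b..<b+K'} d d' \<and> t \<le> K + K')"
proof -
  let ?B = "block_size P"
  let ?Z = "v P * ?B" and ?Y = "u P * ?B" and ?M = "mem_size P"
  have Z: "1 \<le> ?Z" using v okmD[OF ok(1)] by (simp add: Suc_le_eq)
  have ZM: "2 * ?Z \<le> ?M"
  proof -
    have "?Z \<le> num_disks P * ?B" using v by simp
    then show ?thesis using okmD(3)[OF ok(1)] by linarith
  qed
  have lxs: "length xs = K * ?Y" using length_cont[OF ok(2)] xs by blast
  define tk where "tk j = take (j * ?Y) xs" for j
  have tk_Suc: "tk (Suc j) = tk j @ stripe (u P) d (a + j)" if "j < K" for j
    using stripe_in_cont[OF ok(2) that, of "u P" a] xs by (simp add: tk_def take_add[symmetric] add.commute)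
  have tk_app: "\<exists>zs. xs = tk j @ zs" for j by (metis append_take_drop_id tk_def)
  define o1 where "o1 j = snd (trun f' s0 (tk j))" for j
  have o1_pre: "\<exists>zs. out = o1 j @ zs" for j
  proof -
    obtain zs where "xs = tk j @ zs" using tk_app by blast
    then show ?thesis using out by (simp add: o1_def trun_append)
  qed
  have o1_len: "length (o1 j) div ?Z \<le> K'" for j
  proof -
    have "length (o1 j) \<le> length out" using o1_pre[of j] by auto
    then show ?thesis using K' div_le_cdiv cdiv_mono le_trans by blast
  qed
  have o1_valid: "set (o1 j) \<subseteq> vitems P" for j using o1_pre[of j] valid by auto
  \<comment> \<open>Only whole stripes have been written: \<open>c\<close> is the number of full
    stripes of the output so far, and the buffer holds the remainder.\<close>
  define I where "I r d' \<longleftrightarrow> (case r of (z, b', s, buf) \<Rightarrow> disk_ok P d' \<and> (\<exists>j c. j \<le> K \<and> z = a + j \<and> b' = b + c \<and>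
      s = fst (trun f' s0 (tk j)) \<and> c = length (o1 j) div ?Z \<and> cont (v P) d' b c = take (c * ?Z) (o1 j) \<and>
      buf = drop (c * ?Z) (o1 j) \<and> same_off {b..<b+c} d d'))" for r and d'
  define \<Phi> where "\<Phi> r = (case r of (z, b', s, buf) \<Rightarrow> (a + K - z) + (b + K' - b'))" for r :: "nat \<times> nat \<times> 's \<times> item list"
  let ?b = "\<lambda>(z, b, s, buf). z < a + K"
  let ?body = "\<lambda>(z, b, s, buf). rds P (u P) z \<bind> (\<lambda>xs. wout P (v P) (b, buf @ snd (trun f' s xs)) \<bind>
          (\<lambda>(b', buf'). Ret (z + 1, b', fst (trun f' s xs), buf')))"
  have buf_len: "length (drop (length (o1 j) div ?Z * ?Z) (o1 j)) < ?Z" for j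
    using Z by (simp add: minus_div_mult_eq_mod)
  have loop: "wp P (while P (nums P \<times> nums P \<times> S P \<times> item_lists P) ?b ?body (a, b, s0, [])) d
     (\<lambda>r d' t. I r d' \<and> \<not> ?b r \<and> t + \<Phi> r \<le> \<Phi> (a, b, s0, []))"
  proof (rule wp_while)
    have "tk 0 = []" by (simp add: tk_def)
    then show "I (a, b, s0, []) d" using ok by (auto simp: I_def o1_def intro!: exI[of _ 0])
    have "\<Phi> (a, b, s0, []) \<le> word_range P ^ 8 + word_range P ^ 8" using tracks by (simp add: \<Phi>_def)
    also have "\<dots> \<le> word_range P * word_range P ^ 8"
      using mult_le_mono1[OF okmD(4)[OF ok(1)], of "word_range P ^ 8"] by (simp only: mult_2)
    also have "\<dots> \<le> word_range P ^ (20 * mem_size P)"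
      using word_power_le[OF ok(1), of 9] okmD(5)[OF ok(1)] by (simp add: power_Suc[symmetric] del: power_Suc)
    finally show "\<Phi> (a, b, s0, []) \<le> word_range P ^ (20 * mem_size P)" .
  next
    fix r d1 assume I: "I r d1" and br: "?b r"
    obtain z b' s buf where r: "r = (z, b', s, buf)" by (cases r)
    obtain j c where c: "disk_ok P d1" "j \<le> K" "z = a + j" "b' = b + c"
      "s = fst (trun f' s0 (tk j))" "c = length (o1 j) div ?Z" "cont (v P) d1 b c = take (c * ?Z) (o1 j)"
      "buf = drop (c * ?Z) (o1 j)" "same_off {b..<b+c} d d1" using I unfolding I_def r by auto
    have j: "j < K" using br r c by simp
    have cK: "c \<le> K'" using o1_len c by simp
    let ?x = "stripe (u P) d (a + j)"
    have st1: "stripe (u P) d1 z = ?x"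
    proof -
      have "cont (u P) d1 a K = cont (u P) d a K"
      proof (rule cont_same_off[OF c(9)])
        have "{b..<b+c} \<subseteq> {b..<b+K'}" using cK by auto
        then show "{b..<b+c} \<inter> {a..<a+K} = {}" using tracks(3) by blast
      qed
      then show ?thesis using stripe_in_cont[OF c(1) j, of "u P" a] stripe_in_cont[OF ok(2) j, of "u P" a] c by simp
    qed
    have o1S: "o1 (Suc j) = o1 j @ snd (trun f' s ?x)"
      using tk_Suc[OF j] c by (simp add: o1_def trun_append)
    have sS: "fst (trun f' s0 (tk (Suc j))) = fst (trun f' s ?x)"
      using tk_Suc[OF j] c by (simp add: trun_append)
    let ?ys = "buf @ snd (trun f' s ?x)"
    have ys: "?ys = drop (c * ?Z) (o1 (Suc j))" using o1S c by simp
    have bl: "length buf < ?Z" using buf_len[of j] c by simp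
    have "length (snd (trun f' s ?x)) \<le> 18 * ?M"
    proof -
      obtain zs where "xs = tk (Suc j) @ zs" using tk_app by blast
      then have "xs = tk j @ ?x @ zs" using tk_Suc[OF j] by simp
      then show ?thesis using burst length_stripe[OF ok(2)] c(5) by blast
    qed
    then have yl: "length ?ys \<le> 20 * ?M" using bl ZM by simp
    have ydiv: "length ?ys div ?Z = length (o1 (Suc j)) div ?Z - c"
    proof -
      have "c * ?Z \<le> length (o1 j)" using c(6) by simp
      then have "length (o1 (Suc j)) = length ?ys + c * ?Z" using o1S c(8) by simp
      then show ?thesis using Z by (simp only: ) (subst div_mult_self1, auto)
    qed
    have cle: "c \<le> length (o1 (Suc j)) div ?Z" using o1S c(6) by (simp add: div_le_mono)
    let ?c' = "length (o1 (Suc j)) div ?Z"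
    have c'K: "?c' \<le> K'" by (rule o1_len)
    have "r \<in> nums P \<times> nums P \<times> S P \<times> item_lists P"
    proof -
      obtain zs where "xs = tk j @ zs" using tk_app by blast
      then have "s \<in> S P" using st c(5) by blast
      moreover have "set buf \<subseteq> vitems P" using o1_valid c(8) by (auto dest: in_set_dropD)
      ultimately show ?thesis unfolding r
        using nums_le[OF ok(1), of z] nums_le[OF ok(1), of b'] tracks c cK bl ZM by (auto simp: item_lists_def)
    qed
    moreover have "wp P (?body r) d1 (\<lambda>s' d' t. I s' d' \<and> t + \<Phi> s' \<le> \<Phi> r \<and> \<Phi> s' < \<Phi> r)"
      unfolding r prod.case
    proof (subst wp_bind, rule wp_rds[OF c(1) u(2)])
      show "z < word_range P ^ 8" using c j tracks by simp
      show "wp P (wout P (v P) (b', buf @ snd (trun f' s (stripe (u P) d1 z))) \<bind>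
          (\<lambda>(b', buf'). Ret (z + 1, b', fst (trun f' s (stripe (u P) d1 z)), buf'))) d1
          (\<lambda>r' d'' t'. I r' d'' \<and> 1 + t' + \<Phi> r' \<le> \<Phi> (z, b', s, buf) \<and> \<Phi> r' < \<Phi> (z, b', s, buf))"
        unfolding st1
      proof (rule wp_bindI, rule wp_wout[OF ok(1) c(1) v _ yl])
        show "set ?ys \<subseteq> vitems P" unfolding ys using o1_valid by (meson set_drop_subset subset_trans)
        show "b' + length ?ys div ?Z \<le> word_range P ^ 8" unfolding ydiv using c cle c'K tracks by simp
      next
        fix q d3 t' assume "\<exists>c. c = length ?ys div ?Z \<and> fst q = b' + c \<and> cont (v P) d3 b' c = take (c * ?Z) ?ys \<and>
          snd q = drop (c * ?Z) ?ys \<and> disk_ok P d3 \<and> same_off {b'..<b'+c} d1 d3 \<and> t' \<le> c"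
        then obtain e where e: "e = ?c' - c" "fst q = b' + e" "cont (v P) d3 b' e = take (e * ?Z) ?ys"
          "snd q = drop (e * ?Z) ?ys" "disk_ok P d3" "same_off {b'..<b'+e} d1 d3" "t' \<le> e" using ydiv by auto
        have ce: "c + e = ?c'" using e cle by simp
        have "cont (v P) d3 b c = cont (v P) d1 b c" by (rule cont_same_off[OF e(6)]) (use c in auto)
        moreover have "take (c * ?Z) (o1 (Suc j)) = take (c * ?Z) (o1 j)" using o1S c(6) by simp
        moreover have "cont (v P) d3 b' e = take (e * ?Z) (drop (c * ?Z) (o1 (Suc j)))" using e(3) by (simp only: ys)
        moreover have "take (?c' * ?Z) (o1 (Suc j)) = take (c * ?Z) (o1 (Suc j)) @ take (e * ?Z) (drop (c * ?Z) (o1 (Suc j)))"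
          by (simp only: ce[symmetric] add_mult_distrib take_add)
        ultimately have "cont (v P) d3 b ?c' = take (?c' * ?Z) (o1 (Suc j))"
          by (simp only: ce[symmetric] cont_add c(4)[symmetric] c(7))
        moreover have "drop (e * ?Z) ?ys = drop (?c' * ?Z) (o1 (Suc j))"
          by (simp only: ys drop_drop ce[symmetric] add_mult_distrib add.commute)
        moreover have "same_off {b..<b+?c'} d d3"
          by (rule same_off_trans[OF c(9) e(6)]) (use ce c in auto)
        ultimately have "I (z + 1, b + ?c', fst (trun f' s ?x), drop (e * ?Z) ?ys) d3"
          unfolding I_def prod.case
          by (intro conjI exI[of _ "Suc j"] exI[of _ ?c']) (use e(5) j c(3) sS in simp_all)
        moreover have "1 + t' + \<Phi> (z + 1, b + ?c', fst (trun f' s ?x), drop (e * ?Z) ?ys) \<le> \<Phi> (z, b', s, buf)"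
          "\<Phi> (z + 1, b + ?c', fst (trun f' s ?x), drop (e * ?Z) ?ys) < \<Phi> (z, b', s, buf)"
          unfolding \<Phi>_def prod.case using e(7) ce c(3,4) j c'K by linarith+
        moreover have "q = (b + ?c', drop (e * ?Z) ?ys)"
          using e(2,4) ce c(4) by (metis add.assoc prod.collapse)
        ultimately show "wp P (case q of (b', buf') \<Rightarrow> Ret (z + 1, b', fst (trun f' s ?x), buf')) d3
          (\<lambda>r' d'' t''. I r' d'' \<and> 1 + (t' + t'') + \<Phi> r' \<le> \<Phi> (z, b', s, buf) \<and> \<Phi> r' < \<Phi> (z, b', s, buf))"
          by simp
      qed
    qed
    ultimately show "r \<in> nums P \<times> nums P \<times> S P \<times> item_lists P \<and>
      wp P (?body r) d1 (\<lambda>s' d' t. I s' d' \<and> t + \<Phi> s' \<le> \<Phi> r \<and> \<Phi> s' < \<Phi> r)" ..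
  qed
  show ?thesis unfolding scan_def prod.case f'[symmetric]
  proof (rule wp_bindI, rule loop)
    fix r d1 t assume *: "I r d1 \<and> \<not> ?b r \<and> t + \<Phi> r \<le> \<Phi> (a, b, s0, [])"
    obtain z b' s buf where r: "r = (z, b', s, buf)" by (cases r)
    obtain j c where c0: "disk_ok P d1" "j \<le> K" "z = a + j" "b' = b + c"
      "s = fst (trun f' s0 (tk j))" "c = length (o1 j) div ?Z" "cont (v P) d1 b c = take (c * ?Z) (o1 j)"
      "buf = drop (c * ?Z) (o1 j)" "same_off {b..<b+c} d d1" using * unfolding I_def r by auto
    have jK: "j = K" using * c0 r by simp
    have tkK: "tk j = xs" using lxs jK by (simp add: tk_def)
    have outp: "out = o1 j @ e P y s" using out c0(5) by (simp add: o1_def tkK)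
    have cK: "c \<le> K'" using o1_len c0 by simp
    let ?ys = "pad ?Z (buf @ e P y s)"
    have bl: "length buf < ?Z" using buf_len[of j] c0 by simp
    have cl: "c * ?Z \<le> length (o1 j)" using c0(6) by simp
    have "length out = c * ?Z + length (buf @ e P y s)" using outp c0(8) cl by simp
    then have "K' = (c * ?Z + length (buf @ e P y s) + ?Z - 1) div ?Z" using K' by (simp add: cdiv_def)
    also have "\<dots> = (length (buf @ e P y s) + ?Z - 1 + c * ?Z) div ?Z"
      by (rule arg_cong2[where f = "(div)"]) (use Z in linarith, rule refl)
    also have "\<dots> = cdiv (length (buf @ e P y s)) ?Z + c" unfolding cdiv_def using Z by (subst div_mult_self1) auto
    finally have K'c: "cdiv (length (buf @ e P y s)) ?Z = K' - c" by simp
    have pl: "length ?ys = (K' - c) * ?Z" using length_pad[OF Z] K'c by simp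
    \<comment> \<open>The flushed prefix is a multiple of the stripe size, so padding the whole
      output only pads the buffered rest.\<close>
    have pout: "pad ?Z out = take (c * ?Z) (o1 j) @ ?ys"
    proof -
      have "cdiv (length out) ?Z * ?Z - length out = (K' - c) * ?Z - length (buf @ e P y s)"
        using \<open>length out = _\<close> K' cK by (simp add: diff_mult_distrib)
      moreover have "out = take (c * ?Z) (o1 j) @ (buf @ e P y s)" using outp c0(8) by simp
      ultimately show ?thesis unfolding pad_def K'c by (metis append.assoc)
    qed
    have yl: "length ?ys \<le> 20 * ?M"
    proof -
      have "(cdiv (length (buf @ e P y s)) ?Z) * ?Z \<le> length (buf @ e P y s) + ?Z - 1" unfolding cdiv_def by simp
      moreover have "length (e P y s) \<le> 18 * ?M" using burst_end c0(5) tkK by simp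
      ultimately show ?thesis using pl K'c bl ZM by simp
    qed
    show "wp P (case r of (z, b, s, buf) \<Rightarrow> wout P (v P) (b, pad ?Z (buf @ e P y s)) \<bind> (\<lambda>(b', _). Ret (s, b'))) d1
       (\<lambda>r' d'' t'. fst r' = fst (trun f' s0 xs) \<and> snd r' = b + K' \<and>
     cont (v P) d'' b K' = pad ?Z out \<and> disk_ok P d'' \<and> same_off {b..<b+K'} d d'' \<and> t + t' \<le> K + K')"
      unfolding r prod.case
    proof (rule wp_bindI, rule wp_wout[OF ok(1) c0(1) v _ yl])
      have "pad_item \<in> vitems P" using okmD(4)[OF ok(1)] by (auto simp: vitems_def valid_item_def pad_item_def)
      moreover have "set (buf @ e P y s) \<subseteq> vitems P" using outp valid c0(8) by (auto dest: in_set_dropD)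
      ultimately show "set ?ys \<subseteq> vitems P" by (auto simp: pad_def)
      show "b' + length ?ys div ?Z \<le> word_range P ^ 8" using pl Z cK c0(4) tracks by simp
    next
      fix q d3 t' assume "\<exists>c. c = length ?ys div ?Z \<and> fst q = b' + c \<and> cont (v P) d3 b' c = take (c * ?Z) ?ys \<and>
          snd q = drop (c * ?Z) ?ys \<and> disk_ok P d3 \<and> same_off {b'..<b'+c} d1 d3 \<and> t' \<le> c"
      then have e: "fst q = b' + (K' - c)" "cont (v P) d3 b' (K' - c) = ?ys"
          "disk_ok P d3" "same_off {b'..<b'+(K' - c)} d1 d3" "t' \<le> K' - c" using pl Z by auto
      have "cont (v P) d3 b c = cont (v P) d1 b c" by (rule cont_same_off[OF e(4)]) (use c0 in auto)
      then have "cont (v P) d3 b (c + (K' - c)) = pad ?Z out"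
        unfolding cont_add using e(2) c0(4,7) pout by simp
      then have "cont (v P) d3 b K' = pad ?Z out" using cK by simp
      moreover have "same_off {b..<b+K'} d d3"
        by (rule same_off_trans[OF c0(9) e(4)]) (use cK c0 in auto)
      moreover have "t + \<Phi> r \<le> \<Phi> (a, b, s0, [])" using * by blast
      then have "t + t' \<le> K + K'" using e(5) cK c0(3,4) jK by (simp add: \<Phi>_def r)
      ultimately show "wp P (case q of (b', _) \<Rightarrow> Ret (s, b')) d3 (\<lambda>r' d'' t''. fst r' = fst (trun f' s0 xs) \<and> snd r' = b + K' \<and>
          cont (v P) d'' b K' = pad ?Z out \<and> disk_ok P d'' \<and> same_off {b..<b+K'} d d'' \<and> t + (t' + t'') \<le> K + K')"
        using e(1,3) c0(4,5) cK tkK by (simp add: case_prod_beta)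
    qed
  qed
qed

section \<open>Virtual disks and block permutations\<close>

text \<open>The disks are grouped into \<open>vd\<close> virtual disks of \<open>vg \<ge> vd\<close> disks each, so that a virtual block has
  at least as many items as there are virtual disks, while \<open>M/B\<close> is still polynomial in the fan-in.\<close>

definition vd :: "machine \<Rightarrow> nat" where "vd P = floor_sqrt (num_disks P)"
definition vg :: "machine \<Rightarrow> nat" where "vg P = num_disks P div vd P"
definition vb :: "machine \<Rightarrow> nat" where "vb P = vg P * block_size P"
definition vu :: "machine \<Rightarrow> nat" where "vu P = vd P * vg P"
definition zs :: "machine \<Rightarrow> nat" where "zs P = vd P * vb P"
definition fan :: "machine \<Rightarrow> nat" where "fan P = mem_size P div vb P"
definition cap :: "machine \<Rightarrow> nat" where "cap P = mem_size P div zs P"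

text \<open>Rounding wastes at most half of the disks. For the fan-in,
  \<open>D < (vd P + 1)^2\<close> gives \<open>vg P <= 4 * vd P <= 2 * fan P\<close>; then
  \<open>M < 2 * fan P * vb P <= 4 * fan P ^ 2 * B <= fan P ^ 4 * B\<close>, which makes logarithms
  to the bases \<open>fan P\<close> and \<open>M/B\<close> comparable.\<close>

lemma virt:
  assumes ok: "okm P"
  shows "1 \<le> vd P" "1 \<le> vg P" "vd P \<le> vb P" "1 \<le> vb P" "1 \<le> vu P" "vu P \<le> num_disks P"
    "vu P * block_size P = zs P" "1 \<le> zs P" "2 * zs P \<le> mem_size P" "num_disks P * block_size P \<le> 2 * zs P"
    "2 * vd P \<le> fan P" "2 \<le> cap P" "cap P * zs P \<le> mem_size P" "mem_size P \<le> 2 * (cap P * zs P)"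
    "fan P * vb P \<le> mem_size P" "mem_size P \<le> fan P ^ 4 * block_size P" "vd P \<le> vg P" "fan P * vd P \<le> mem_size P"
proof -
  let ?D = "num_disks P" and ?B = "block_size P" and ?M = "mem_size P"
  note m = okmD[OF ok]
  show vd1: "1 \<le> vd P" using m by (simp add: vd_def Suc_le_eq)
  have sq: "vd P * vd P \<le> ?D" using floor_sqrt_power2_le[of ?D] by (simp add: vd_def power2_eq_square)
  have sq2: "?D < (vd P + 1) * (vd P + 1)"
    using Suc_floor_sqrt_power2_gt[of ?D] by (simp add: vd_def power2_eq_square)
  have "vd P * vd P div vd P \<le> vg P" unfolding vg_def by (rule div_le_mono[OF sq])
  then show vdg: "vd P \<le> vg P" using vd1 by simp
  then show vg1: "1 \<le> vg P" using vd1 by simp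
  show "vd P \<le> vb P" using vdg m(1) by (simp add: vb_def trans_le_add1 le_trans[OF vdg])
  show vb1: "1 \<le> vb P" using vg1 m(1) by (simp add: vb_def Suc_le_eq)
  show "1 \<le> vu P" using vg1 vd1 by (simp add: vu_def Suc_le_eq)
  show vuD: "vu P \<le> ?D" by (simp add: vu_def vg_def)
  show zsu: "vu P * ?B = zs P" by (simp add: vu_def zs_def vb_def mult.assoc)
  show zs1: "1 \<le> zs P" using vd1 vb1 by (simp add: zs_def Suc_le_eq)
  have "zs P \<le> ?D * ?B" using vuD zsu by (metis mult_le_mono1)
  then show zM: "2 * zs P \<le> ?M" using m(3) by linarith
  have "?D < vu P + vd P"
    using vd1 dividend_less_times_div[of "vd P" ?D] by (simp add: vu_def vg_def add.commute)
  also have "\<dots> \<le> vu P + vu P" using vg1 by (simp add: vu_def)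
  finally show "?D * ?B \<le> 2 * zs P" using zsu by (metis less_imp_le mult_2 mult_le_mono1 add_mult_distrib)
  have "2 * vd P * vb P div vb P \<le> fan P" unfolding fan_def using zM by (intro div_le_mono) (simp add: zs_def mult.assoc)
  then show fd: "2 * vd P \<le> fan P" using vb1 by simp
  have "2 * zs P div zs P \<le> cap P" unfolding cap_def by (rule div_le_mono[OF zM])
  then show cap2: "2 \<le> cap P" using zs1 by simp
  show "cap P * zs P \<le> ?M" by (simp add: cap_def)
  have "?M < cap P * zs P + zs P" unfolding cap_def
    using zs1 dividend_less_times_div[of "zs P" ?M] by (simp add: mult.commute add.commute)
  also have "\<dots> \<le> 2 * (cap P * zs P)" using cap2 by (cases "cap P") auto
  finally show "?M \<le> 2 * (cap P * zs P)" by simp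
  show fv: "fan P * vb P \<le> ?M" by (simp add: fan_def)
  then show "fan P * vd P \<le> ?M" using \<open>vd P \<le> vb P\<close> by (meson le_trans mult_le_mono2)
  have "?D \<le> 4 * vd P * vd P"
  proof -
    have "?D \<le> vd P * vd P + 2 * vd P" using sq2 by (simp add: algebra_simps)
    also have "2 * vd P \<le> 2 * (vd P * vd P)" using vd1 by simp
    finally show ?thesis by simp
  qed
  then have "vg P \<le> 4 * vd P * vd P div vd P" unfolding vg_def by (rule div_le_mono)
  then have g2: "vg P \<le> 2 * fan P" using fd vd1 by simp
  have f2: "2 \<le> fan P" using fd vd1 by simp
  have "?M < fan P * vb P + vb P" unfolding fan_def
    using vb1 dividend_less_times_div[of "vb P" ?M] by (simp add: mult.commute add.commute)
  also have "\<dots> \<le> 2 * (fan P * vb P)" using f2 by (cases "fan P") auto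
  also have "\<dots> \<le> 2 * (fan P * (2 * fan P * ?B))" unfolding vb_def using g2 by (intro mult_le_mono) auto
  also have "\<dots> = (2 * 2) * (fan P * fan P) * ?B" by simp
  also have "\<dots> \<le> (fan P * fan P) * (fan P * fan P) * ?B" using f2 by (intro mult_le_mono) auto
  also have "\<dots> = fan P ^ 4 * ?B" by (simp add: power4_eq_xxxx)
  finally show "?M \<le> fan P ^ 4 * ?B" by simp
qed

lemma concat_map_blocks:
  "concat (map f [0..<n * g]) = concat (map (\<lambda>v. concat (map (\<lambda>i. f (g * v + i)) [0..<g])) [0..<n])"
proof (induction n)
  case (Suc n)
  have "[0..<Suc n * g] = [0..<n * g] @ map (\<lambda>i. n * g + i) [0..<g]"
    using upt_add_eq_append[of 0 "n * g" g] map_add_upt[of "n * g" g] by (simp add: add.commute)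
  then show ?case using Suc by (simp add: comp_def mult.commute)
qed simp

definition vblk :: "machine \<Rightarrow> disks \<Rightarrow> nat \<Rightarrow> nat \<Rightarrow> item list" where
  "vblk P d v t = concat (map (\<lambda>i. d (vg P * v + i) t) [0..<vg P])"

definition blk :: "machine \<Rightarrow> disks \<Rightarrow> nat \<Rightarrow> nat \<Rightarrow> item list" where
  "blk P d a \<beta> = vblk P d (\<beta> mod vd P) (a + \<beta> div vd P)"

lemma length_vblk: "disk_ok P d \<Longrightarrow> length (vblk P d v t) = vb P"
  unfolding vblk_def by (subst length_concat_const[where B = "block_size P"]) (auto simp: disk_ok_def vb_def)

lemma length_blk: "disk_ok P d \<Longrightarrow> length (blk P d a \<beta>) = vb P"
  by (simp add: blk_def length_vblk)

lemma set_vblk: "disk_ok P d \<Longrightarrow> set (vblk P d v t) \<subseteq> vitems P"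
  by (auto simp: vblk_def disk_ok_def)

lemma stripe_vblk: "stripe (vu P) d t = concat (map (\<lambda>v. vblk P d v t) [0..<vd P])"
  unfolding stripe_def vu_def vblk_def by (rule concat_map_blocks)

lemma cont_blk:
  assumes "1 \<le> vd P" shows "cont (vu P) d a K = concat (map (blk P d a) [0..<K * vd P])"
proof -
  have "concat (map (\<lambda>v. blk P d a (vd P * t + v)) [0..<vd P]) = stripe (vu P) d (a + t)" for t
    unfolding stripe_vblk using assms by (intro arg_cong[where f = concat] map_cong) (auto simp: blk_def)
  moreover have "[a..<a + K] = map (\<lambda>t. a + t) [0..<K]"
    using map_add_upt[of a K] by (simp add: add.commute)
  ultimately show ?thesis unfolding cont_def by (subst concat_map_blocks) (simp add: comp_def)
qed

lemma blk_in_cont: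
  assumes "okm P" "disk_ok P d" "\<beta> < K * vd P"
  shows "blk P d a \<beta> = take (vb P) (drop (\<beta> * vb P) (cont (vu P) d a K))"
  unfolding cont_blk[OF virt(1)[OF assms(1)]] using assms length_blk
  by (subst concat_slice) auto

definition vslice :: "machine \<Rightarrow> item list \<Rightarrow> nat \<Rightarrow> item list" where
  "vslice P xs v = take (vb P) (drop (v * vb P) xs)"

definition vrd :: "machine \<Rightarrow> (nat \<Rightarrow> nat) \<Rightarrow> item list prog" where
  "vrd P \<tau> = rdop P (\<lambda>i. \<tau> (i div vg P))"

definition vwr :: "machine \<Rightarrow> (nat \<Rightarrow> (nat \<times> item list) option) \<Rightarrow> unit prog" where
  "vwr P \<phi> = wrop P (\<lambda>i. if i < vu P then map_option (\<lambda>(t, x). (t, take (block_size P) (drop ((i mod vg P) * block_size P) x)))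
      (\<phi> (i div vg P)) else None)"

lemma lean_vrd: "lean (\<lambda>P x. vrd P (f P x))" unfolding vrd_def by (rule lean_rdop)
lemma lean_vwr: "lean (\<lambda>P x. vwr P (f P x))" unfolding vwr_def by (rule lean_wrop)

text \<open>The disks outside all virtual disks are read as well, at the tracks that
  \<open>\<tau>\<close> assigns to indices from \<open>vd P\<close> on. Hence \<open>\<tau>\<close>
  is bounded everywhere; the surplus data come last, beyond the slices in use.\<close>

lemma wp_vrd:
  assumes ok: "okm P" "disk_ok P d" and "\<And>v. \<tau> v < word_range P ^ 8"
    and Q: "\<And>resp. (\<forall>v<vd P. vslice P resp v = vblk P d v (\<tau> v)) \<Longrightarrow> set resp \<subseteq> vitems P \<Longrightarrow> Q resp d 1"
  shows "wp P (vrd P \<tau>) d Q"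
proof -
  let ?f = "\<lambda>i. d i (\<tau> (i div vg P))"
  let ?resp = "concat (map ?f [0..<num_disks P])"
  have g: "1 \<le> vg P" using virt[OF ok(1)] by simp
  have "[0..<num_disks P] = [0..<vu P] @ [vu P..<num_disks P]"
    using virt(6)[OF ok(1)] upt_add_eq_append[of 0 "vu P" "num_disks P - vu P"] by simp
  then obtain rest where 1: "?resp = concat (map ?f [0..<vu P]) @ rest" by auto
  have "concat (map ?f [0..<vu P]) = concat (map (\<lambda>v. vblk P d v (\<tau> v)) [0..<vd P])"
    unfolding vu_def vblk_def using g by (subst concat_map_blocks) (auto intro!: arg_cong[where f = concat])
  with 1 have 2: "?resp = concat (map (\<lambda>v. vblk P d v (\<tau> v)) [0..<vd P]) @ rest" by simp
  have len: "length (concat (map (\<lambda>v. vblk P d v (\<tau> v)) [0..<vd P])) = vd P * vb P"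
    using length_vblk[OF ok(2)] by (subst length_concat_const[where B = "vb P"]) auto
  have "vslice P ?resp v = vblk P d v (\<tau> v)" if "v < vd P" for v
  proof -
    have le: "Suc v * vb P \<le> vd P * vb P" using that by (intro mult_le_mono1) simp
    have "vslice P ?resp v = take (vb P) (drop (v * vb P) (concat (map (\<lambda>v. vblk P d v (\<tau> v)) [0..<vd P])))"
      unfolding vslice_def 2 using le len by simp
    also have "\<dots> = vblk P d v (\<tau> v)"
      using that length_vblk[OF ok(2)] by (subst concat_slice) auto
    finally show ?thesis .
  qed
  moreover have "set ?resp \<subseteq> vitems P" using ok(2) by (auto simp: disk_ok_def)
  ultimately show ?thesis unfolding vrd_def using Q assms(3) by (subst wp_rdop) auto
qed

lemma slice_slice_length:
  assumes "i < n" "length x = n * B" shows "length (take B (drop (i * B) x)) = (B::nat)"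
proof -
  have "Suc i * B \<le> n * B" using assms(1) by (intro mult_le_mono1) simp
  then show ?thesis using assms(2) by simp
qed

lemma wp_vwr:
  assumes ok: "okm P" "disk_ok P d"
    and \<phi>: "\<And>v t x. v < vd P \<Longrightarrow> \<phi> v = Some (t, x) \<Longrightarrow> t < word_range P ^ 8 \<and> length x = vb P \<and> set x \<subseteq> vitems P"
    and Q: "\<And>d'. disk_ok P d' \<Longrightarrow> (\<forall>v<vd P. \<forall>t. vblk P d' v t = (case \<phi> v of Some (t', x) \<Rightarrow> if t = t' then x else vblk P d v t
        | None \<Rightarrow> vblk P d v t)) \<Longrightarrow> same_off {t. \<exists>v<vd P. \<exists>x. \<phi> v = Some (t, x)} d d' \<Longrightarrow> Q () d' 1"
  shows "wp P (vwr P \<phi>) d Q"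
proof -
  let ?B = "block_size P"
  let ?wr = "\<lambda>i. if i < vu P then map_option (\<lambda>(t, x). (t, take ?B (drop ((i mod vg P) * ?B) x))) (\<phi> (i div vg P)) else None"
  have g: "1 \<le> vg P" and D: "vu P \<le> num_disks P" using virt[OF ok(1)] by simp_all
  have iv: "i div vg P < vd P" if "i < vu P" for i using that by (simp add: vu_def less_mult_imp_div_less)
  have legal: "legal_wr P ?wr"
    unfolding legal_wr_def
  proof (intro allI impI)
    fix i tr bl assume i: "i < num_disks P" and w: "?wr i = Some (tr, bl)"
    then obtain x where x: "i < vu P" "\<phi> (i div vg P) = Some (tr, x)" "bl = take ?B (drop ((i mod vg P) * ?B) x)"
      by (auto split: if_splits)
    have p: "tr < word_range P ^ 8" "length x = vb P" "set x \<subseteq> vitems P" using \<phi>[OF iv[OF x(1)] x(2)] by auto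
    have "length bl = ?B" unfolding x(3) by (rule slice_slice_length[of _ "vg P"]) (use p g in \<open>auto simp: vb_def\<close>)
    then show "tr < word_range P ^ 8 \<and> length bl = ?B \<and> set bl \<subseteq> vitems P"
      using p x(3) by (auto dest!: in_set_takeD in_set_dropD)
  qed
  let ?d = "write_blocks P ?wr d"
  have 1: "?d (vg P * v + i) t = (case \<phi> v of Some (t', x) \<Rightarrow> if t = t' then take ?B (drop (i * ?B) x) else d (vg P * v + i) t | None \<Rightarrow> d (vg P * v + i) t)"
    if "v < vd P" "i < vg P" for v i t
  proof -
    have "vg P * v + i < vg P * Suc v" using that by simp
    also have "\<dots> \<le> vg P * vd P" using that by (intro mult_le_mono2) simp
    finally have "vg P * v + i < vu P" by (simp add: vu_def mult.commute)
    then show ?thesis using D that by (auto simp: write_blocks_def split: option.splits)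
  qed
  have "vblk P ?d v t = (case \<phi> v of Some (t', x) \<Rightarrow> if t = t' then x else vblk P d v t | None \<Rightarrow> vblk P d v t)" if v: "v < vd P" for v t
  proof -
    have "vblk P ?d v t = concat (map (\<lambda>i. case \<phi> v of Some (t', x) \<Rightarrow> if t = t' then take ?B (drop (i * ?B) x) else d (vg P * v + i) t | None \<Rightarrow> d (vg P * v + i) t) [0..<vg P])"
      unfolding vblk_def by (intro arg_cong[where f = concat] map_cong) (auto simp: 1[OF v])
    also have "\<dots> = (case \<phi> v of Some (t', x) \<Rightarrow> if t = t' then x else vblk P d v t | None \<Rightarrow> vblk P d v t)"
    proof (cases "\<phi> v")
      case (Some a)
      then obtain t' x where a: "\<phi> v = Some (t', x)" by (cases a) auto
      have "length x = vg P * ?B" using \<phi>[OF v a] by (simp add: vb_def)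
      then show ?thesis using concat_slices[of ?B x "vg P"] by (auto simp: a vblk_def)
    qed (simp add: vblk_def)
    finally show ?thesis .
  qed
  moreover have "same_off {t. \<exists>v<vd P. \<exists>x. \<phi> v = Some (t, x)} d ?d"
    unfolding same_off_def using iv by (fastforce simp: write_blocks_def split: option.splits if_splits)
  moreover have "disk_ok P ?d" using ok legal disk_ok_write by blast
  ultimately show ?thesis unfolding vwr_def wp_wrop[OF legal] using Q by blast
qed

definition load :: "machine \<Rightarrow> nat \<times> nat \<Rightarrow> item list prog" where
  "load P x = while P (nums P \<times> item_lists P) (\<lambda>s. fst s < fst x + snd x)
     (\<lambda>s. rds P (vu P) (fst s) \<bind> (\<lambda>xs. Ret (fst s + 1, snd s @ xs))) (fst x, []) \<bind> (\<lambda>s. Ret (snd s))"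

lemma lean_load: "lean (\<lambda>P x. load P (g P x))"
  unfolding load_def by (intro lean_bind lean_while lean_rds lean_Ret smallset_intros)

lemma wp_load:
  assumes ok: "okm P" "disk_ok P d" and K: "K \<le> cap P" "a + K \<le> word_range P ^ 8"
    and Q: "\<And>t. t \<le> K \<Longrightarrow> Q (cont (vu P) d a K) d t"
  shows "wp P (load P (a, K)) d Q"
proof -
  define I where "I s d' \<longleftrightarrow> d' = d \<and> (\<exists>j\<le>K. fst s = a + j \<and> snd s = cont (vu P) d a j)" for s and d' :: disks
  define \<Phi> where "\<Phi> s = a + K - fst s" for s :: "nat \<times> item list"
  have "wp P (while P (nums P \<times> item_lists P) (\<lambda>s. fst s < a + K)
     (\<lambda>s. rds P (vu P) (fst s) \<bind> (\<lambda>xs. Ret (fst s + 1, snd s @ xs))) (a, [])) d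
     (\<lambda>s' d' t. I s' d' \<and> \<not> fst s' < a + K \<and> t + \<Phi> s' \<le> \<Phi> (a, []))"
  proof (rule wp_while)
    show "I (a, []) d" by (auto simp: I_def)
    have "K \<in> nums P" using nums_le[OF ok(1), of K] K by simp
    then show "\<Phi> (a, []) \<le> word_range P ^ (20 * mem_size P)" by (simp add: \<Phi>_def nums_def)
  next
    fix s d1 assume "I s d1" and b: "fst s < a + K"
    then obtain j where j: "d1 = d" "j \<le> K" "fst s = a + j" "snd s = cont (vu P) d a j" by (auto simp: I_def)
    have "length (snd s) \<le> mem_size P"
    proof -
      have "length (snd s) = j * zs P" using length_cont[OF ok(2)] j virt(7)[OF ok(1)] by simp
      also have "\<dots> \<le> cap P * zs P" using j K by (intro mult_le_mono1) simp
      finally show ?thesis using virt(13)[OF ok(1)] by simp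
    qed
    then have "s \<in> nums P \<times> item_lists P"
      using nums_le[OF ok(1), of "fst s"] j K set_cont_vitems[OF ok(2)] b
      by (cases s) (auto simp: item_lists_def)
    moreover have "wp P (rds P (vu P) (fst s) \<bind> (\<lambda>xs. Ret (fst s + 1, snd s @ xs))) d1
      (\<lambda>s' d' t. I s' d' \<and> t + \<Phi> s' \<le> \<Phi> s \<and> \<Phi> s' < \<Phi> s)"
      unfolding wp_bind by (rule wp_rds)
        (use j ok virt[OF ok(1)] K b in \<open>auto simp: I_def \<Phi>_def cont_Suc intro!: exI[of _ "Suc j"]\<close>)
    ultimately show "s \<in> nums P \<times> item_lists P \<and> wp P (rds P (vu P) (fst s) \<bind> (\<lambda>xs. Ret (fst s + 1, snd s @ xs))) d1
      (\<lambda>s' d' t. I s' d' \<and> t + \<Phi> s' \<le> \<Phi> s \<and> \<Phi> s' < \<Phi> s)" ..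
  qed
  then show ?thesis unfolding load_def fst_conv snd_conv
    by (rule wp_bindI) (use Q in \<open>auto simp: I_def \<Phi>_def\<close>)
qed

subsection \<open>Scheduling block moves by edge colouring\<close>

text \<open>Position \<open>e\<close> stands for a move from virtual disk \<open>p e\<close> to
  virtual disk \<open>q e\<close>, an edge of a bipartite multigraph. In greedy colouring the
  earlier edges at its two ends exclude at most \<open>(A - 1) + (B - 1)\<close> colours. Compared
  with the maximum degree, which would be optimal, \<open>A + B\<close> colours cost only a constant
  factor.\<close>

lemma edge_colouring:
  fixes p q :: "nat \<Rightarrow> nat"
  assumes A: "\<And>e. e < n \<Longrightarrow> card {e'. e' < n \<and> p e' = p e} \<le> A"
    and B: "\<And>e. e < n \<Longrightarrow> card {e'. e' < n \<and> q e' = q e} \<le> B"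
  shows "\<exists>col. (\<forall>e<n. col e < A + B) \<and> (\<forall>e<n. \<forall>e'<n. e \<noteq> e' \<and> col e = col e' \<longrightarrow> p e \<noteq> p e' \<and> q e \<noteq> q e')"
proof -
  have "k \<le> n \<Longrightarrow> \<exists>col. (\<forall>e<k. col e < A + B) \<and> (\<forall>e<k. \<forall>e'<k. e \<noteq> e' \<and> col e = col e' \<longrightarrow> p e \<noteq> p e' \<and> q e \<noteq> q e')" for k
  proof (induction k)
    case (Suc k)
    then obtain col where col: "\<forall>e<k. col e < A + B"
      "\<forall>e<k. \<forall>e'<k. e \<noteq> e' \<and> col e = col e' \<longrightarrow> p e \<noteq> p e' \<and> q e \<noteq> q e'" by auto
    let ?X = "{e. e < k \<and> p e = p k}" and ?Y = "{e. e < k \<and> q e = q k}"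
    have "card ?X < A"
    proof -
      have "card (insert k ?X) \<le> card {e'. e' < n \<and> p e' = p k}" using Suc.prems by (intro card_mono) auto
      then show ?thesis using A[of k] Suc.prems by simp
    qed
    moreover have "card ?Y < B"
    proof -
      have "card (insert k ?Y) \<le> card {e'. e' < n \<and> q e' = q k}" using Suc.prems by (intro card_mono) auto
      then show ?thesis using B[of k] Suc.prems by simp
    qed
    moreover have "card (col ` (?X \<union> ?Y)) \<le> card ?X + card ?Y"
      by (rule le_trans[OF card_image_le card_Un_le]) auto
    ultimately have "card (col ` (?X \<union> ?Y)) < card {..<A + B}" by simp
    then have "\<not> {..<A + B} \<subseteq> col ` (?X \<union> ?Y)" using card_mono[of "col ` (?X \<union> ?Y)" "{..<A + B}"] by auto
    then obtain c where c: "c < A + B" "c \<notin> col ` (?X \<union> ?Y)" by auto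
    show ?case
    proof (intro exI[of _ "col(k := c)"] conjI allI impI)
      fix e assume "e < Suc k"
      then show "(col(k := c)) e < A + B" using col(1) c(1) by auto
    next
      fix e e' assume *: "e < Suc k" "e' < Suc k" "e \<noteq> e' \<and> (col(k := c)) e = (col(k := c)) e'"
      consider "e < k" "e' < k" | "e = k" "e' < k" | "e < k" "e' = k" using * by linarith
      then have "p e \<noteq> p e' \<and> q e \<noteq> q e'"
      proof cases
        case 1 then show ?thesis using * col(2) by auto
      next
        case 2 then show ?thesis using * c(2) by auto
      next
        case 3 then show ?thesis using * c(2) by auto
      qed
      then show "p e \<noteq> p e'" "q e \<noteq> q e'" by auto
    qed
  qed simp
  then show ?thesis by blast
qed

definition proper :: "nat \<Rightarrow> nat list \<Rightarrow> (nat \<Rightarrow> nat) \<Rightarrow> nat \<Rightarrow> bool" where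
  "proper D bs col n \<longleftrightarrow> (\<forall>e<length bs. col e < n) \<and> (\<forall>e<length bs. \<forall>e'<length bs. e \<noteq> e' \<and> col e = col e' \<longrightarrow>
      bs ! e mod D \<noteq> bs ! e' mod D \<and> e mod D \<noteq> e' mod D)"

text \<open>The number of colours and the colouring are functions of the list alone, so they are
  recomputed from it and never stored.\<close>

definition ncol :: "nat \<Rightarrow> nat list \<Rightarrow> nat" where "ncol D bs = (LEAST n. \<exists>col. proper D bs col n)"
definition col :: "nat \<Rightarrow> nat list \<Rightarrow> nat \<Rightarrow> nat" where "col D bs = (SOME col. proper D bs col (ncol D bs))"

lemma proper_id: "proper D bs (\<lambda>e. e) (length bs)"
  by (auto simp: proper_def)

lemma proper_col: "proper D bs (col D bs) (ncol D bs)"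
proof -
  have "\<exists>col. proper D bs col (ncol D bs)" unfolding ncol_def by (rule LeastI_ex) (use proper_id in blast)
  then show ?thesis unfolding col_def by (rule someI_ex)
qed

lemma card_mod_le:
  assumes "1 \<le> D" shows "card {e::nat. e < n \<and> e mod D = v} \<le> n div D + 1"
proof -
  have "{e. e < n \<and> e mod D = v} \<subseteq> (\<lambda>k. k * D + v) ` {..n div D}"
  proof
    fix e assume "e \<in> {e. e < n \<and> e mod D = v}"
    then have "e = e div D * D + v" "e div D \<le> n div D" by (auto intro: div_le_mono)
    then show "e \<in> (\<lambda>k. k * D + v) ` {..n div D}" by blast
  qed
  then have "card {e. e < n \<and> e mod D = v} \<le> card {..n div D}" by (rule surj_card_le[rotated]) simp
  then show ?thesis by simp
qed

text \<open>Targets are the consecutive positions of the list and therefore balanced; only the load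
  \<open>A\<close> of the source disks remains as a hypothesis.\<close>

lemma ncol_le:
  assumes D: "1 \<le> D" and load: "\<And>v. v < D \<Longrightarrow> card {e. e < length bs \<and> bs ! e mod D = v} \<le> A"
  shows "ncol D bs \<le> A + (length bs div D + 1)"
proof -
  have "\<exists>c. (\<forall>e<length bs. c e < A + (length bs div D + 1)) \<and>
    (\<forall>e<length bs. \<forall>e'<length bs. e \<noteq> e' \<and> c e = c e' \<longrightarrow> bs ! e mod D \<noteq> bs ! e' mod D \<and> e mod D \<noteq> e' mod D)"
    using D by (intro edge_colouring load card_mod_le) simp_all
  then show ?thesis unfolding ncol_def by (intro Least_le) (auto simp: proper_def)
qed

text \<open>By properness at most one edge of a colour meets a given disk, at either end, so the
  choice is determined. \<open>key\<close> selects source or target disks.\<close>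

definition edge_at :: "nat \<Rightarrow> nat list \<Rightarrow> (nat \<Rightarrow> nat) \<Rightarrow> nat \<Rightarrow> nat \<Rightarrow> nat option" where
  "edge_at D bs key c v = (if \<exists>e<length bs. col D bs e = c \<and> key e = v
     then Some (SOME e. e < length bs \<and> col D bs e = c \<and> key e = v) else None)"

lemma edge_at_Some:
  "edge_at D bs key c v = Some e \<Longrightarrow> e < length bs \<and> col D bs e = c \<and> key e = v"
  unfolding edge_at_def by (simp split: if_splits) (metis (mono_tags, lifting) someI_ex)

lemma edge_at_src:
  assumes "e < length bs" "col D bs e = c" "bs ! e mod D = v"
  shows "edge_at D bs (\<lambda>e. bs ! e mod D) c v = Some e"
proof -
  have "\<exists>e<length bs. col D bs e = c \<and> bs ! e mod D = v" using assms by blast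
  then obtain e' where e': "edge_at D bs (\<lambda>e. bs ! e mod D) c v = Some e'" by (simp add: edge_at_def)
  then show ?thesis using edge_at_Some[OF e'] proper_col[of D bs] assms unfolding proper_def by metis
qed

lemma edge_at_dst:
  assumes "e < length bs" "col D bs e = c" "e mod D = v"
  shows "edge_at D bs (\<lambda>e. e mod D) c v = Some e"
proof -
  have "\<exists>e<length bs. col D bs e = c \<and> e mod D = v" using assms by blast
  then obtain e' where e': "edge_at D bs (\<lambda>e. e mod D) c v = Some e'" by (simp add: edge_at_def)
  then show ?thesis using edge_at_Some[OF e'] proper_col[of D bs] assms unfolding proper_def by metis
qed

text \<open>Edges of one colour have different source disks and different target disks, so one read
  and one write move them all. A disk without such an edge reads track \<open>a\<close>, and what it
  returns is ignored.\<close>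

definition move :: "machine \<Rightarrow> nat \<Rightarrow> nat \<Rightarrow> nat list \<Rightarrow> nat \<Rightarrow> unit prog" where
  "move P a b bs c = vrd P (\<lambda>v. case edge_at (vd P) bs (\<lambda>e. bs ! e mod vd P) c v of None \<Rightarrow> a | Some e \<Rightarrow> a + bs ! e div vd P) \<bind>
     (\<lambda>resp. vwr P (\<lambda>v. case edge_at (vd P) bs (\<lambda>e. e mod vd P) c v of None \<Rightarrow> None
        | Some e \<Rightarrow> Some (b + e div vd P, vslice P resp (bs ! e mod vd P))))"

lemma lean_move: "lean (\<lambda>P x. move P (a P x) (b P x) (bs P x) (c P x))"
  unfolding move_def by (intro lean_bind lean_vrd lean_vwr)

lemma wp_move:
  assumes ok: "okm P" "disk_ok P d" and bs: "\<forall>x\<in>set bs. x < K * vd P" and len: "length bs \<le> k * vd P"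
    and tr: "a + K \<le> word_range P ^ 8" "b + k \<le> word_range P ^ 8" "a < word_range P ^ 8"
    and Q: "\<And>d'. disk_ok P d' \<Longrightarrow> same_off {b..<b+k} d d' \<Longrightarrow>
      (\<forall>e<length bs. blk P d' b e = (if col (vd P) bs e = c then blk P d a (bs ! e) else blk P d b e)) \<Longrightarrow> Q () d' 2"
  shows "wp P (move P a b bs c) d Q"
proof -
  let ?D = "vd P"
  let ?s = "edge_at ?D bs (\<lambda>e. bs ! e mod ?D) c" and ?r = "edge_at ?D bs (\<lambda>e. e mod ?D) c"
  have D: "1 \<le> ?D" using virt[OF ok(1)] by simp
  have bsl: "bs ! e div ?D < K" if "e < length bs" for e
    using bs that by (simp add: less_mult_imp_div_less)
  have el: "e div ?D < k" if "e < length bs" for e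
    using len that by (simp add: less_mult_imp_div_less)
  show ?thesis unfolding move_def wp_bind
  proof (rule wp_vrd[OF ok])
    show "(case ?s v of None \<Rightarrow> a | Some e \<Rightarrow> a + bs ! e div ?D) < word_range P ^ 8" for v
    proof (cases "?s v")
      case (Some e)
      then show ?thesis using bsl[of e] edge_at_Some[OF Some] tr(1) by simp
    qed (use tr in simp)
  next
    fix resp assume resp: "\<forall>v<vd P. vslice P resp v = vblk P d v (case ?s v of None \<Rightarrow> a | Some e \<Rightarrow> a + bs ! e div ?D)"
      "set resp \<subseteq> vitems P"
    let ?\<phi> = "\<lambda>v. case ?r v of None \<Rightarrow> None | Some e \<Rightarrow> Some (b + e div ?D, vslice P resp (bs ! e mod ?D))"
    have sl: "vslice P resp (bs ! e mod ?D) = blk P d a (bs ! e)" if "e < length bs" "col ?D bs e = c" for e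
      using resp(1) edge_at_src[OF that refl] D by (simp add: blk_def)
    show "wp P (vwr P ?\<phi>) d (\<lambda>r' d'' t'. Q r' d'' (1 + t'))"
    proof (rule wp_vwr[OF ok])
      fix v t x assume "v < ?D" "?\<phi> v = Some (t, x)"
      then obtain e where e: "?r v = Some e" "t = b + e div ?D" "x = vslice P resp (bs ! e mod ?D)"
        by (auto split: option.splits)
      then have e': "e < length bs" "col ?D bs e = c" using edge_at_Some[OF e(1)] by auto
      show "t < word_range P ^ 8 \<and> length x = vb P \<and> set x \<subseteq> vitems P"
        using el[OF e'(1)] sl[OF e'] e length_blk[OF ok(2)] tr(2) set_vblk[OF ok(2)] by (simp add: blk_def)
    next
      fix d' assume d': "disk_ok P d'"
        "\<forall>v<?D. \<forall>t. vblk P d' v t = (case ?\<phi> v of Some (t', x) \<Rightarrow> if t = t' then x else vblk P d v t | None \<Rightarrow> vblk P d v t)"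
        "same_off {t. \<exists>v<?D. \<exists>x. ?\<phi> v = Some (t, x)} d d'"
      have "same_off {b..<b+k} d d'"
      proof (rule same_off_mono[OF d'(3)], safe)
        fix t v x assume "?\<phi> v = Some (t, x)"
        then obtain e where e: "?r v = Some e" "t = b + e div ?D" by (auto split: option.splits)
        then show "t \<in> {b..<b+k}" using el edge_at_Some[OF e(1)] by auto
      qed
      moreover have "\<forall>e<length bs. blk P d' b e = (if col ?D bs e = c then blk P d a (bs ! e) else blk P d b e)"
      proof (intro allI impI)
        fix e assume e: "e < length bs"
        have v: "e mod ?D < ?D" using D by simp
        show "blk P d' b e = (if col ?D bs e = c then blk P d a (bs ! e) else blk P d b e)"
        proof (cases "col ?D bs e = c")
          case True
          then show ?thesis using d'(2) v edge_at_dst[OF e True refl] sl[OF e True] by (simp add: blk_def)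
        next
          case False
          \<comment> \<open>Another position on the same virtual disk lies on another track, so the
            write leaves this block alone.\<close>
          have "vblk P d' (e mod ?D) (b + e div ?D) = vblk P d (e mod ?D) (b + e div ?D)"
          proof (cases "?r (e mod ?D)")
            case (Some e')
            note e' = edge_at_Some[OF Some]
            have "e' \<noteq> e" using False e' by auto
            then have "e' div ?D \<noteq> e div ?D" using e' by (metis div_mult_mod_eq)
            then show ?thesis using d'(2) v Some by simp
          qed (use d'(2) v in simp)
          then show ?thesis using False by (simp add: blk_def)
        qed
      qed
      ultimately show "Q () d' (1 + 1)" using Q[OF d'(1)] by (simp add: numeral_2_eq_2)
    qed
  qed
qed

definition moves :: "machine \<Rightarrow> nat \<Rightarrow> nat \<Rightarrow> nat list \<Rightarrow> nat prog" where
  "moves P a b bs = while P (nums P) (\<lambda>c. c < ncol (vd P) bs) (\<lambda>c. move P a b bs c \<bind> (\<lambda>_. Ret (c + 1))) 0"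

lemma lean_moves: "lean (\<lambda>P x. moves P (a P x) (b P x) (bs P x))"
  unfolding moves_def by (intro lean_while lean_bind lean_move lean_Ret smallset_intros)

lemma wp_moves:
  assumes ok: "okm P" "disk_ok P d" and bs: "\<forall>x\<in>set bs. x < K * vd P" and len: "length bs \<le> k * vd P"
    and tr: "a + K \<le> word_range P ^ 8" "b + k \<le> word_range P ^ 8" "a < word_range P ^ 8"
    and dis: "{a..<a+K} \<inter> {b..<b+k} = {}" and nc: "2 * ncol (vd P) bs \<in> nums P"
    and Q: "\<And>d' r t. disk_ok P d' \<Longrightarrow> same_off {b..<b+k} d d' \<Longrightarrow>
      (\<forall>e<length bs. blk P d' b e = blk P d a (bs ! e)) \<Longrightarrow> t \<le> 2 * ncol (vd P) bs \<Longrightarrow> Q r d' t"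
  shows "wp P (moves P a b bs) d Q"
proof -
  let ?n = "ncol (vd P) bs"
  have D: "1 \<le> vd P" using virt[OF ok(1)] by simp
  define I where "I c d' \<longleftrightarrow> c \<le> ?n \<and> disk_ok P d' \<and> same_off {b..<b+k} d d' \<and>
    (\<forall>e<length bs. col (vd P) bs e < c \<longrightarrow> blk P d' b e = blk P d a (bs ! e))" for c d'
  define \<Phi> where "\<Phi> c = 2 * (?n - c)" for c
  have "wp P (moves P a b bs) d (\<lambda>c d' t. I c d' \<and> \<not> c < ?n \<and> t + \<Phi> c \<le> \<Phi> 0)"
    unfolding moves_def
  proof (rule wp_while)
    show "I 0 d" using ok by (simp add: I_def)
    show "\<Phi> 0 \<le> word_range P ^ (20 * mem_size P)" using nc by (simp add: \<Phi>_def nums_def)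
  next
    fix c d1 assume I: "I c d1" and c: "c < ?n"
    have d1: "disk_ok P d1" "same_off {b..<b+k} d d1" using I by (auto simp: I_def)
    have src: "blk P d1 a (bs ! e) = blk P d a (bs ! e)" if "e < length bs" for e
    proof -
      have lt: "bs ! e < K * vd P" using bs that by auto
      show ?thesis unfolding blk_in_cont[OF ok(1) d1(1) lt] blk_in_cont[OF ok lt]
        using cont_same_off[OF d1(2)] dis by (metis inf_commute)
    qed
    have "wp P (move P a b bs c \<bind> (\<lambda>_. Ret (c + 1))) d1 (\<lambda>s' d' t. I s' d' \<and> t + \<Phi> s' \<le> \<Phi> c \<and> \<Phi> s' < \<Phi> c)"
      unfolding wp_bind
    proof (rule wp_move[OF ok(1) d1(1) bs len tr])
      fix d2 assume d2: "disk_ok P d2" "same_off {b..<b+k} d1 d2"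
        "\<forall>e<length bs. blk P d2 b e = (if col (vd P) bs e = c then blk P d1 a (bs ! e) else blk P d1 b e)"
      have "same_off {b..<b+k} d d2" by (rule same_off_trans[OF d1(2) d2(2)]) simp
      then have "I (c + 1) d2" using I d2(1,3) src c by (auto simp: I_def less_Suc_eq)
      then show "wp P (Ret (c + 1)) d2 (\<lambda>r' d'' t'. I r' d'' \<and> 2 + t' + \<Phi> r' \<le> \<Phi> c \<and> \<Phi> r' < \<Phi> c)"
        unfolding \<Phi>_def wp_Ret using c by linarith
    qed
    moreover have "c \<in> nums P" using c nc by (auto simp: nums_def)
    ultimately show "c \<in> nums P \<and> wp P (move P a b bs c \<bind> (\<lambda>_. Ret (c + 1))) d1 (\<lambda>s' d' t. I s' d' \<and> t + \<Phi> s' \<le> \<Phi> c \<and> \<Phi> s' < \<Phi> c)"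
      by blast
  qed
  then show ?thesis
  proof (rule wp_mono)
    fix c d' t assume "I c d' \<and> \<not> c < ?n \<and> t + \<Phi> c \<le> \<Phi> 0"
    moreover have "\<forall>e<length bs. col (vd P) bs e < ?n" using proper_col[of "vd P" bs] by (auto simp: proper_def)
    ultimately show "Q c d' t" using Q[of d' t] by (auto simp: I_def \<Phi>_def)
  qed
qed

text \<open>Three digits in base \<open>W\<close> hold a block number below \<open>W^3\<close>
  within the word range. With the most significant digit first, triggers with equal keys are ordered
  by block number.\<close>

definition trig :: "machine \<Rightarrow> item \<Rightarrow> nat \<Rightarrow> item" where
  "trig P x \<beta> = x @ [\<beta> div word_range P ^ 2, \<beta> div word_range P mod word_range P, \<beta> mod word_range P]"

definition trig_block :: "machine \<Rightarrow> item \<Rightarrow> nat" where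
  "trig_block P x = x ! 4 * word_range P ^ 2 + x ! 5 * word_range P + x ! 6"

lemma trig_block_trig [simp]: "length x = 4 \<Longrightarrow> trig_block P (trig P x \<beta>) = \<beta>"
proof -
  assume "length x = 4"
  let ?W = "word_range P"
  have "\<beta> div ?W ^ 2 = \<beta> div ?W div ?W" by (simp add: power2_eq_square div_mult2_eq)
  then have "\<beta> div ?W ^ 2 * ?W ^ 2 + \<beta> div ?W mod ?W * ?W = \<beta> div ?W * ?W"
    by (metis (no_types, lifting) add_mult_distrib div_mult_mod_eq mult.assoc power2_eq_square)
  then show ?thesis using \<open>length x = 4\<close> by (simp add: trig_block_def trig_def nth_append)
qed

text \<open>Argument \<open>(a, h, b, K)\<close>: the blocks of the \<open>K\<close> stripes at \<open>a\<close> are copied to \<open>b\<close> in the order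
  given by the triggers at \<open>h\<close>, one window of \<open>cap\<close> stripes of triggers at a time.\<close>

definition permute :: "machine \<Rightarrow> nat \<times> nat \<times> nat \<times> nat \<Rightarrow> nat prog" where
  "permute P x = (case x of (a, h, b, K) \<Rightarrow>
     while P (nums P) (\<lambda>w. w < cdiv (K * vd P) (zs P))
       (\<lambda>w. load P (h + w, min (cap P) (cdiv (K * vd P) (zs P) - w)) \<bind>
         (\<lambda>gs. moves P a (b + w * vb P) (map (trig_block P) (take (K * vd P - w * zs P) gs)) \<bind> (\<lambda>_. Ret (w + cap P)))) 0)"

lemma lean_permute: "lean (\<lambda>P x. permute P (g P x))"
  unfolding permute_def case_prod_beta
  by (intro lean_bind lean_while lean_load lean_moves lean_Ret smallset_intros)

text \<open>In a window with \<open>l\<close> target stripes a source disk holds at most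
  \<open>l + \<rho>\<close> blocks, so \<open>(l + \<rho>) + (l + 1)\<close> colours suffice, at two
  I/Os each. Summing gives \<open>4 K\<close> and an overhead of \<open>2 * (\<rho> + 1)\<close> per
  window; in the application \<open>\<rho>\<close> is the number of runs.\<close>

lemma wp_permute:
  assumes ok: "okm P" "disk_ok P d" and K: "1 \<le> K" and K1: "K1 = cdiv (K * vd P) (zs P)"
    and bs: "bs = map (trig_block P) (take (K * vd P) (cont (vu P) d h K1))" "\<forall>x\<in>set bs. x < K * vd P"
    and load: "\<And>w v. v < vd P \<Longrightarrow> card {e. e < length (take (cap P * zs P) (drop w bs)) \<and> take (cap P * zs P) (drop w bs) ! e mod vd P = v}
       \<le> length (take (cap P * zs P) (drop w bs)) div vd P + \<rho>"
    and tr: "a + K \<le> word_range P ^ 8" "b + K \<le> word_range P ^ 8" "h + K1 \<le> word_range P ^ 8"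
    and dis: "{a..<a+K} \<inter> {b..<b+K} = {}" "{h..<h+K1} \<inter> {b..<b+K} = {}"
    and big: "K1 + 4 * K + 2 * (\<rho> + 1) * cdiv K1 (cap P) \<in> nums P"
  shows "wp P (permute P (a, h, b, K)) d (\<lambda>r d' t. disk_ok P d' \<and> same_off {b..<b+K} d d' \<and>
     (\<forall>e<K * vd P. blk P d' b e = blk P d a (bs ! e)) \<and> t \<le> K1 + 4 * K + 2 * (\<rho> + 1) * cdiv K1 (cap P))"
proof -
  let ?D = "vd P" and ?Z = "zs P" and ?q = "cap P"
  note v = virt[OF ok(1)]
  have Z: "?Z = vb P * ?D" by (simp add: zs_def mult.commute)
  have lenG: "length (cont (vu P) d h K1) = K1 * ?Z" using length_cont[OF ok(2)] v(7) by simp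
  have TK: "K * ?D \<le> K1 * ?Z" using cdiv_ge[OF v(8)] K1 by simp
  have lbs: "length bs = K * ?D" using bs(1) lenG TK by simp
  \<comment> \<open>A stripe holds \<open>vb P * vd P\<close> triggers and thus describes
    \<open>vb P\<close> target stripes. The last stripe of triggers is not empty, so each one has
    target stripes to fill.\<close>
  have KK1: "w * vb P < K" if "w < K1" for w
  proof -
    have "(K1 - 1) * ?Z < K * ?D" using cdiv_less[OF v(8), of "K * ?D"] K K1 v(1) by (simp add: Suc_le_eq)
    then have "(K1 - 1) * vb P * ?D < K * ?D" by (simp add: Z mult.assoc)
    then have "(K1 - 1) * vb P < K" by simp
    moreover have "w * vb P \<le> (K1 - 1) * vb P" using that by (intro mult_le_mono1) simp
    ultimately show ?thesis by (rule le_less_trans[rotated])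
  qed
  define I where "I w d' \<longleftrightarrow> disk_ok P d' \<and> same_off {b..<b+K} d d' \<and>
    (\<forall>e<K * ?D. e < w * ?Z \<longrightarrow> blk P d' b e = blk P d a (bs ! e))" for w d'
  \<comment> \<open>The three terms pay for reading the triggers, for moving the blocks, and for the
    overhead of each remaining window.\<close>
  define \<Phi> where "\<Phi> w = (K1 - w) + 4 * (K - w * vb P) + 2 * (\<rho> + 1) * cdiv (K1 - w) ?q" for w
  have "wp P (permute P (a, h, b, K)) d (\<lambda>w d' t. I w d' \<and> \<not> w < K1 \<and> t + \<Phi> w \<le> \<Phi> 0)"
    unfolding permute_def prod.case K1[symmetric]
  proof (rule wp_while)
    show "I 0 d" using ok by (simp add: I_def)
    show "\<Phi> 0 \<le> word_range P ^ (20 * mem_size P)" using big by (simp add: \<Phi>_def nums_def)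
  next
    fix w d1 assume I: "I w d1" and w: "w < K1"
    have d1: "disk_ok P d1" "same_off {b..<b+K} d d1" using I by (auto simp: I_def)
    let ?k = "min ?q (K1 - w)"
    let ?gs = "cont (vu P) d1 (h + w) ?k"
    let ?cs = "map (trig_block P) (take (K * ?D - w * ?Z) ?gs)"
    have gs: "?gs = take (?k * ?Z) (drop (w * ?Z) (cont (vu P) d h K1))"
    proof -
      have e1: "cont (vu P) d1 h K1 = cont (vu P) d h K1" using cont_same_off[OF d1(2)] dis(2) by (metis inf_commute)
      have "cont (vu P) d1 h (w + (?k + (K1 - w - ?k))) = cont (vu P) d1 h w @ ?gs @ cont (vu P) d1 (h + w + ?k) (K1 - w - ?k)"
        by (simp only: cont_add)
      moreover have "w + (?k + (K1 - w - ?k)) = K1" using w by simp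
      moreover have "length (cont (vu P) d1 h w) = w * ?Z" "length ?gs = ?k * ?Z"
        using length_cont[OF d1(1)] v(7) by auto
      ultimately show ?thesis unfolding e1[symmetric] by simp
    qed
    have cs: "?cs = take (?q * ?Z) (drop (w * ?Z) bs)"
    proof -
      have "?cs = map (trig_block P) (take (min (K * ?D - w * ?Z) (?k * ?Z)) (drop (w * ?Z) (cont (vu P) d h K1)))"
        unfolding gs by (simp add: min.commute)
      also have "min (K * ?D - w * ?Z) (?k * ?Z) = min (?q * ?Z) (K * ?D - w * ?Z)"
      proof -
        have "K * ?D - w * ?Z \<le> (K1 - w) * ?Z" using TK by (simp add: diff_mult_distrib)
        moreover have "?k * ?Z = min (?q * ?Z) ((K1 - w) * ?Z)" by (simp add: min_def)
        moreover have "min i (min j k) = min j i" if "i \<le> k" for i j k :: nat using that by linarith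
        ultimately show ?thesis by (simp only:)
      qed
      finally show ?thesis unfolding bs(1) by (simp add: drop_map take_map drop_take min.commute)
    qed
    define l where "l = min (?q * vb P) (K - w * vb P)"
    have lcs: "length ?cs = l * ?D"
      unfolding cs using lbs by (simp add: l_def Z nat_mult_min_left diff_mult_distrib mult.assoc min.commute)
    have wK: "w * vb P < K" by (rule KK1[OF w])
    have l1: "l \<le> K - w * vb P" by (simp add: l_def)
    have lb: "b + w * vb P + l \<le> word_range P ^ 8" using tr(2) l1 wK by simp
    have nc: "ncol ?D ?cs \<le> (l + \<rho>) + (l + 1)"
    proof -
      have "length ?cs div ?D = l" using lcs v(1) by simp
      then show ?thesis using ncol_le[OF v(1), of ?cs "l + \<rho>"] load[where w = "w * ?Z"] unfolding cs[symmetric] by simp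
    qed
    have cd: "cdiv (K1 - (w + ?q)) ?q + 1 = cdiv (K1 - w) ?q"
    proof (cases "w + ?q \<le> K1")
      case True
      then have "K1 - w + ?q - 1 = (K1 - (w + ?q) + ?q - 1) + ?q" using v(12) by simp
      then have "cdiv (K1 - w) ?q = ((K1 - (w + ?q) + ?q - 1) + ?q) div ?q" unfolding cdiv_def by (simp only:)
      also have "\<dots> = (K1 - (w + ?q) + ?q - 1) div ?q + 1" using v(12) by (subst div_add_self2) auto
      finally show ?thesis unfolding cdiv_def by (simp only:)
    next
      case False
      then have "cdiv (K1 - w) ?q \<le> 1" using w by (intro cdiv_le) (use v(12) in auto)
      moreover have "cdiv (K1 - w) ?q \<noteq> 0" using cdiv_ge[of ?q "K1 - w"] v(12) w by (metis One_nat_def Suc_leD diff_is_0_eq le_zero_eq mult_0 not_le numeral_2_eq_2)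
      moreover have "cdiv 0 ?q = 0" using v(12) by (simp add: cdiv_def)
      ultimately show ?thesis using False by simp
    qed
    have drop4: "4 * (K - (w + ?q) * vb P) + 4 * l \<le> 4 * (K - w * vb P)"
      unfolding l_def add_mult_distrib by linarith
    have step: "?k + (2 * ((l + \<rho>) + (l + 1))) + \<Phi> (w + ?q) \<le> \<Phi> w"
    proof -
      define A where "A = 2 * (\<rho> + 1) * cdiv (K1 - w) ?q"
      define B where "B = 2 * (\<rho> + 1) * cdiv (K1 - (w + ?q)) ?q"
      have "A = B + 2 * (\<rho> + 1)" unfolding A_def B_def cd[symmetric] by simp
      moreover have "?k + (K1 - (w + ?q)) \<le> K1 - w" by simp
      moreover have "k + 2 * ((l + \<rho>) + (l + 1)) + (m + 4 * X + B) \<le> n + 4 * Y + A"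
        if "A = B + 2 * (\<rho> + 1)" "k + m \<le> n" "4 * X + 4 * l \<le> 4 * Y" for k m n X Y :: nat
        using that by simp
      ultimately show ?thesis unfolding \<Phi>_def A_def[symmetric] B_def[symmetric] using drop4 by blast
    qed
    have "\<Phi> w \<le> \<Phi> 0"
    proof -
      have "cdiv (K1 - w) ?q \<le> cdiv (K1 - 0) ?q" by (intro cdiv_mono) simp
      then show ?thesis unfolding \<Phi>_def by (intro add_mono mult_le_mono2) auto
    qed
    then have \<Phi>n: "\<Phi> w \<in> nums P" using big by (auto simp: \<Phi>_def nums_def)
    have "wp P (load P (h + w, ?k) \<bind> (\<lambda>gs. moves P a (b + w * vb P) (map (trig_block P) (take (K * ?D - w * ?Z) gs)) \<bind> (\<lambda>_. Ret (w + ?q)))) d1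
      (\<lambda>s' d' t. I s' d' \<and> t + \<Phi> s' \<le> \<Phi> w \<and> \<Phi> s' < \<Phi> w)"
      unfolding wp_bind
    proof (rule wp_load[OF ok(1) d1(1)])
      show "?k \<le> ?q" "h + w + ?k \<le> word_range P ^ 8" using tr(3) w by auto
    next
      fix t1 assume t1: "t1 \<le> ?k"
      show "wp P (moves P a (b + w * vb P) ?cs) d1 (\<lambda>r d' t. wp P (Ret (w + ?q)) d' (\<lambda>r' d'' t'. I r' d'' \<and> t1 + (t + t') + \<Phi> r' \<le> \<Phi> w \<and> \<Phi> r' < \<Phi> w))"
      proof (rule wp_moves[OF ok(1) d1(1), where K = K and k = l])
        show "\<forall>x\<in>set ?cs. x < K * ?D" unfolding cs using bs(2) by (auto dest!: in_set_takeD in_set_dropD)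
        show "length ?cs \<le> l * ?D" using lcs by simp
        show "a + K \<le> word_range P ^ 8" "b + w * vb P + l \<le> word_range P ^ 8" "a < word_range P ^ 8"
          using tr lb K by auto
        have "{b + w * vb P..<b + w * vb P + l} \<subseteq> {b..<b+K}" using l1 wK by auto
        then show "{a..<a+K} \<inter> {b + w * vb P..<b + w * vb P + l} = {}" using dis(1) by blast
        show "2 * ncol ?D ?cs \<in> nums P" using nc step \<Phi>n by (auto simp: nums_def)
      next
        fix d2 t assume d2: "disk_ok P d2" "same_off {b + w * vb P..<b + w * vb P + l} d1 d2"
          "\<forall>e<length ?cs. blk P d2 (b + w * vb P) e = blk P d1 a (?cs ! e)" "t \<le> 2 * ncol ?D ?cs"
        have off: "same_off {b..<b+K} d d2" by (rule same_off_trans[OF d1(2) d2(2)]) (use l1 wK in auto)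
        have "blk P d2 b e = blk P d a (bs ! e)" if e: "e < K * ?D" "e < (w + ?q) * ?Z" for e
        proof (cases "e < w * ?Z")
          case True
          have "e div ?D < w * vb P" using True by (simp add: Z less_mult_imp_div_less mult.assoc)
          then have "blk P d2 b e = blk P d1 b e"
            unfolding blk_def vblk_def using d2(2) by (auto simp: same_off_def)
          then show ?thesis using I e True by (simp add: I_def)
        next
          case False
          define e' where "e' = e - w * ?Z"
          have e': "e = w * vb P * ?D + e'" using False by (simp add: e'_def Z mult.assoc)
          have "e' < l * ?D"
          proof -
            have "l * ?D = min (?q * ?Z) (K * ?D - w * ?Z)"
              by (simp add: l_def Z nat_mult_min_left diff_mult_distrib mult.assoc)
            moreover have "e < w * ?Z + ?q * ?Z" using e(2) by (simp add: add_mult_distrib)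
            ultimately show ?thesis unfolding e'_def using e(1) False by linarith
          qed
          then have l': "e' < length ?cs" using lcs by simp
          have "?cs ! e' = bs ! e" unfolding cs
            using l' cs e lbs False nth_drop[of "w * ?Z" bs "e - w * ?Z"] by (simp add: e'_def)
          moreover have "blk P d2 (b + w * vb P) e' = blk P d2 b e" unfolding blk_def e' using v(1) by (simp add: add.assoc)
          moreover have "blk P d1 a (bs ! e) = blk P d a (bs ! e)"
          proof -
            have lt: "bs ! e < K * ?D" using bs(2) e lbs by auto
            show ?thesis unfolding blk_in_cont[OF ok(1) d1(1) lt] blk_in_cont[OF ok lt]
              using cont_same_off[OF d1(2)] dis(1) by (metis inf_commute)
          qed
          ultimately show ?thesis using d2(3) l' by simp
        qed
        then have "I (w + ?q) d2" using off d2(1) by (simp add: I_def)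
        moreover have "\<Phi> (w + ?q) < \<Phi> w" using step by simp
        moreover have "t1 + (t + 0) + \<Phi> (w + ?q) \<le> \<Phi> w"
        proof -
          have "t \<le> 2 * ((l + \<rho>) + (l + 1))" using le_trans[OF d2(4) mult_le_mono2[OF nc]] .
          from add_mono[OF add_mono[OF t1 this] order_refl[of "\<Phi> (w + ?q)"]] show ?thesis
            using step by (simp only: add_0_right)
        qed
        ultimately show "wp P (Ret (w + ?q)) d2 (\<lambda>r' d'' t'. I r' d'' \<and> t1 + (t + t') + \<Phi> r' \<le> \<Phi> w \<and> \<Phi> r' < \<Phi> w)" by simp
      qed
    qed
    moreover have "w \<in> nums P" using nums_le[OF ok(1), of w] w tr(3) by simp
    ultimately show "w \<in> nums P \<and> wp P (load P (h + w, ?k) \<bind> (\<lambda>gs. moves P a (b + w * vb P) (map (trig_block P) (take (K * ?D - w * ?Z) gs)) \<bind> (\<lambda>_. Ret (w + ?q)))) d1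
      (\<lambda>s' d' t. I s' d' \<and> t + \<Phi> s' \<le> \<Phi> w \<and> \<Phi> s' < \<Phi> w)" by blast
  qed
  then show ?thesis
  proof (rule wp_mono)
    fix w d' t assume *: "I w d' \<and> \<not> w < K1 \<and> t + \<Phi> w \<le> \<Phi> 0"
    then have "K1 * ?Z \<le> w * ?Z" by (intro mult_le_mono1) simp
    then have "K * ?D \<le> w * ?Z" by (rule le_trans[OF TK])
    then show "disk_ok P d' \<and> same_off {b..<b+K} d d' \<and>
     (\<forall>e<K * ?D. blk P d' b e = blk P d a (bs ! e)) \<and> t \<le> K1 + 4 * K + 2 * (\<rho> + 1) * cdiv K1 (cap P)"
      using * by (auto simp: I_def \<Phi>_def)
  qed
qed

section \<open>Merging with one I/O per virtual block\<close>

text \<open>A buffered writer: \<open>E\<close> is the whole output so far, a ghost value that is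
  not stored. Its full stripes are on disk from track \<open>b\<close>, the rest is in
  \<open>buf\<close>.\<close>

definition wbuf :: "machine \<Rightarrow> disks \<Rightarrow> nat \<Rightarrow> disks \<Rightarrow> nat \<Rightarrow> item list \<Rightarrow> item list \<Rightarrow> bool" where
  "wbuf P d0 b d c buf E \<longleftrightarrow> disk_ok P d \<and> c = b + length E div zs P \<and>
     cont (vu P) d b (length E div zs P) = take (length E div zs P * zs P) E \<and>
     buf = drop (length E div zs P * zs P) E \<and> same_off {b..<c} d0 d"

lemma wbuf_length: "okm P \<Longrightarrow> wbuf P d0 b d c buf E \<Longrightarrow> length buf < zs P"
  using virt(8)[of P] by (auto simp: wbuf_def minus_div_mult_eq_mod)

lemma wp_wout_wbuf:
  assumes ok: "okm P" and w: "wbuf P d0 b d c buf E" and valid: "set (E @ xs) \<subseteq> vitems P"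
    and len: "length xs \<le> 18 * mem_size P" "b + length (E @ xs) div zs P \<le> word_range P ^ 8"
    and Q: "\<And>r d' t. wbuf P d0 b d' (fst r) (snd r) (E @ xs) \<Longrightarrow> t + c \<le> fst r \<Longrightarrow> Q r d' t"
  shows "wp P (wout P (vu P) (c, buf @ xs)) d Q"
proof -
  let ?Z = "zs P"
  note v = virt[OF ok]
  let ?n = "length E div ?Z" and ?m = "length (buf @ xs) div ?Z"
  have c: "disk_ok P d" "c = b + ?n" "cont (vu P) d b ?n = take (?n * ?Z) E"
     "buf = drop (?n * ?Z) E" "same_off {b..<c} d0 d" using w by (auto simp: wbuf_def)
  have nE: "?n * ?Z \<le> length E" by simp
  have "length (E @ xs) = length (buf @ xs) + ?n * ?Z"
    unfolding c(4) length_append length_drop using nE by linarith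
  then have nm: "length (E @ xs) div ?Z = ?n + ?m" using v(8) by (simp only:) (subst div_mult_self1, auto)
  have sp: "E @ xs = take (?n * ?Z) E @ (buf @ xs)" using c(4) by simp
  show ?thesis
  proof (rule wp_mono[OF wp_wout[OF ok c(1) v(5,6)]], goal_cases)
    case 1 then show ?case using valid c(4) by (auto dest: in_set_dropD)
  next
    case 2 then show ?case using wbuf_length[OF ok w] len(1) v(9) by simp
  next
    case 3 then show ?case using len(2) nm c(2) v(7) by simp
  next
    case (4 r d' t)
    then have r: "fst r = c + ?m" "cont (vu P) d' c ?m = take (?m * ?Z) (buf @ xs)" "snd r = drop (?m * ?Z) (buf @ xs)"
      "disk_ok P d'" "same_off {c..<c + ?m} d d'" "t \<le> ?m" unfolding v(7) by blast+
    have "cont (vu P) d' b ?n = cont (vu P) d b ?n" by (rule cont_same_off[OF r(5)]) (use c in auto)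
    then have "cont (vu P) d' b (?n + ?m) = take (?n * ?Z) E @ take (?m * ?Z) (buf @ xs)"
      unfolding cont_add using c(2,3) r(2) by simp
    moreover have "take ((?n + ?m) * ?Z) (E @ xs) = take (?n * ?Z) E @ take (?m * ?Z) (buf @ xs)"
      unfolding add_mult_distrib sp by (simp add: nE min_absorb2)
    moreover have "drop ((?n + ?m) * ?Z) (E @ xs) = drop (?m * ?Z) (buf @ xs)"
      unfolding add_mult_distrib sp by (simp add: nE min_absorb2)
    moreover have "same_off {b..<b + (?n + ?m)} d0 d'"
      by (rule same_off_trans[OF c(5) r(5)]) (use c(2) in auto)
    ultimately have "wbuf P d0 b d' (fst r) (snd r) (E @ xs)"
      unfolding wbuf_def nm using r c(2) by (simp only: add.assoc)
    then show ?case by (rule Q) (use r in simp)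
  qed
qed

lemma pad_append_full:
  assumes "1 \<le> Z" "length xs = n * Z" shows "pad Z (xs @ ys) = xs @ pad Z ys"
proof -
  have "cdiv (length (xs @ ys)) Z = n + cdiv (length ys) Z"
  proof -
    have "n * Z + length ys + Z - 1 = (length ys + Z - 1) + n * Z" using assms(1) by linarith
    then show ?thesis unfolding cdiv_def using assms
      by (simp only: length_append) (subst div_mult_self1, auto)
  qed
  then show ?thesis by (simp add: pad_def assms(2) add_mult_distrib)
qed

lemma set_pad: "okm P \<Longrightarrow> set xs \<subseteq> vitems P \<Longrightarrow> set (pad Z xs) \<subseteq> vitems P"
  using okmD(4)[of P] by (auto simp: pad_def pad_item_def vitems_def valid_item_def)

lemma wp_wout_flush:
  assumes ok: "okm P" and w: "wbuf P d0 b d c buf E" and valid: "set E \<subseteq> vitems P"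
    and K': "K' = cdiv (length E) (zs P)" "b + K' \<le> word_range P ^ 8"
    and Q: "\<And>r d' t. cont (vu P) d' b K' = pad (zs P) E \<Longrightarrow> disk_ok P d' \<Longrightarrow> same_off {b..<b+K'} d0 d' \<Longrightarrow>
       t + c \<le> b + K' \<Longrightarrow> Q r d' t"
  shows "wp P (wout P (vu P) (c, pad (zs P) buf)) d Q"
proof -
  let ?Z = "zs P"
  note v = virt[OF ok]
  define xs where "xs = replicate (cdiv (length buf) ?Z * ?Z - length buf) pad_item"
  have px: "pad ?Z buf = buf @ xs" by (simp add: pad_def xs_def)
  let ?n = "length E div ?Z"
  have "E = take (?n * ?Z) E @ buf" using w by (simp add: wbuf_def)
  moreover have "length (take (?n * ?Z) E) = ?n * ?Z" by (simp add: min_absorb2)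
  ultimately have pE: "pad ?Z E = E @ xs" using pad_append_full[OF v(8)] px by (metis append.assoc)
  have lE: "length (E @ xs) = K' * ?Z" using length_pad[OF v(8), of E] pE K'(1) by simp
  have dE: "length (E @ xs) div ?Z = K'" unfolding lE using v(8) by simp
  show ?thesis unfolding px
  proof (rule wp_wout_wbuf[OF ok w])
    show "set (E @ xs) \<subseteq> vitems P" using set_pad[OF ok valid, of ?Z] pE by simp
    have "cdiv (length buf) ?Z \<le> 1" by (rule cdiv_le) (use wbuf_length[OF ok w] v(8) in auto)
    then have "cdiv (length buf) ?Z * ?Z \<le> 1 * ?Z" by (rule mult_le_mono1)
    then show "length xs \<le> 18 * mem_size P" unfolding xs_def length_replicate using v(9) by linarith
    show "b + length (E @ xs) div ?Z \<le> word_range P ^ 8" using dE K'(2) by simp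
  next
    fix r d' t assume *: "wbuf P d0 b d' (fst r) (snd r) (E @ xs)" "t + c \<le> fst r"
    show "Q r d' t"
    proof (rule Q)
      show "cont (vu P) d' b K' = pad ?Z E" using * unfolding wbuf_def dE pE lE[symmetric] by simp
    qed (use * dE in \<open>auto simp: wbuf_def\<close>)
  qed
qed

lemma div_add_le: "1 \<le> w \<Longrightarrow> (x + y) div w \<le> x div w + y div w + (1::nat)"
proof -
  assume w: "1 \<le> w"
  have "x + y < (x div w + 1) * w + (y div w + 1) * w"
    using w dividend_less_div_times[of w x] dividend_less_div_times[of w y] by (intro add_strict_mono) auto
  then have "x + y < (x div w + y div w + 2) * w" by (simp add: algebra_simps)
  then have "(x + y) div w < x div w + y div w + 2" by (rule less_mult_imp_div_less)
  then show ?thesis by simp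
qed

section \<open>Merging by forecasting\<close>

definition runhi :: "nat \<Rightarrow> nat \<Rightarrow> nat \<Rightarrow> nat" where
  "runhi T l j = min ((j + 1) * l) T"

text \<open>An exhausted run imposes no bound, so after the last read every item counts as
  final.\<close>

definition emit :: "(nat \<Rightarrow> nat) \<Rightarrow> nat list \<Rightarrow> item list \<Rightarrow> item \<Rightarrow> bool" where
  "emit hi ps ls y \<longleftrightarrow> (\<forall>i<length ps. ps ! i < hi i \<longrightarrow> y \<le> ls ! i)"

text \<open>The forecasting rule of external merging: the run whose last key is smallest is the
  first to need its next block. That this key may itself be emitted expresses its
  minimality.\<close>

definition pick :: "(nat \<Rightarrow> nat) \<Rightarrow> nat list \<Rightarrow> item list \<Rightarrow> nat" where
  "pick hi ps ls = (SOME j. j < length ps \<and> ps ! j < hi j \<and> emit hi ps ls (ls ! j))"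

definition readset :: "item list \<Rightarrow> nat \<Rightarrow> nat list \<Rightarrow> item multiset" where
  "readset X l ps = (\<Sum>j<length ps. mset (map ((!) X) [j * l..<ps ! j]))"

text \<open>The list \<open>ps\<close> holds the read position in each run, \<open>ls\<close> the last key read from it. Every unread item
  is at least the last key of its run, so items below all these keys are final.\<close>

definition minv :: "item list \<Rightarrow> nat \<Rightarrow> nat \<Rightarrow> nat \<Rightarrow> nat list \<Rightarrow> item list \<Rightarrow> item list \<Rightarrow> item list \<Rightarrow> bool" where
  "minv X l T w ps ls pool E \<longleftrightarrow> length ps = cdiv T l \<and> length ls = cdiv T l \<and>
     (\<forall>j<cdiv T l. j * l \<le> ps ! j \<and> ps ! j \<le> runhi T l j \<and> ls ! j = (if ps ! j = j * l then [] else X ! (ps ! j - 1))) \<and>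
     sorted E \<and> (\<forall>y\<in>set E. emit (runhi T l) ps ls y) \<and> (\<forall>y\<in>set pool. \<not> emit (runhi T l) ps ls y) \<and>
     mset E + mset pool = readset X l ps \<and>
     (\<forall>j<cdiv T l. \<forall>i. j * l \<le> i \<and> i < ps ! j - w \<longrightarrow> emit (runhi T l) ps ls (X ! i))"

lemma pick:
  assumes "j < length ps" "ps ! j < hi j"
  shows "pick hi ps ls < length ps \<and> ps ! pick hi ps ls < hi (pick hi ps ls) \<and> emit hi ps ls (ls ! pick hi ps ls)"
proof -
  let ?A = "{j. j < length ps \<and> ps ! j < hi j}"
  have "finite ?A" "?A \<noteq> {}" using assms by auto
  then obtain k where k: "k \<in> ?A" "\<And>i. i \<in> ?A \<Longrightarrow> ls ! k \<le> ls ! i"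
  proof -
    obtain m where m: "m \<in> (!) ls ` ?A" "\<not> (\<exists>b\<in>(!) ls ` ?A. b < m)"
      using ex_min_if_finite[of "(!) ls ` ?A"] \<open>finite ?A\<close> \<open>?A \<noteq> {}\<close> by blast
    then obtain k where k: "k \<in> ?A" "m = ls ! k" by blast
    show ?thesis
    proof (rule that[OF k(1)])
      fix i assume "i \<in> ?A"
      then have "ls ! i \<in> (!) ls ` ?A" by blast
      then show "ls ! k \<le> ls ! i" using m(2) k(2) by (meson not_less)
    qed
  qed
  then have "k < length ps \<and> ps ! k < hi k \<and> emit hi ps ls (ls ! k)" by (auto simp: emit_def)
  then show ?thesis unfolding pick_def by (rule someI[where P = "\<lambda>j. j < length ps \<and> ps ! j < hi j \<and> emit hi ps ls (ls ! j)"])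
qed

lemma sum_list_update_nth:
  fixes f :: "nat \<Rightarrow> nat \<Rightarrow> 'a::comm_monoid_add"
  assumes "j < length ps"
  shows "(\<Sum>i<length ps. f i (ps[j := e] ! i)) + f j (ps ! j) = (\<Sum>i<length ps. f i (ps ! i)) + f j e"
proof -
  have 1: "(\<Sum>i<length ps. f i (ps[j := e] ! i)) = f j e + (\<Sum>i\<in>{..<length ps} - {j}. f i (ps ! i))"
    using assms by (subst sum.remove[of _ j]) (auto intro!: sum.cong)
  have 2: "(\<Sum>i<length ps. f i (ps ! i)) = f j (ps ! j) + (\<Sum>i\<in>{..<length ps} - {j}. f i (ps ! i))"
    using assms by (subst sum.remove[of _ j]) auto
  show ?thesis unfolding 1 2 by (simp add: ac_simps)
qed

lemma readset_update:
  assumes "j < length ps" "j * l \<le> ps ! j" "ps ! j \<le> e"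
  shows "readset X l (ps[j := e]) = readset X l ps + mset (map ((!) X) [ps ! j..<e])"
proof -
  have "[j * l..<e] = [j * l..<ps ! j] @ [ps ! j..<e]"
    using assms(2,3) by (metis le_add_diff_inverse upt_add_eq_append)
  then show ?thesis
    using sum_list_update_nth[OF assms(1), of "\<lambda>j p. mset (map ((!) X) [j * l..<p])" e] by (simp add: readset_def ac_simps)
qed

text \<open>Unread items of the chosen run are at least its last key, which is minimal among the
  unfinished runs. Reading on can only raise this key, so final items remain final and nothing below
  them appears later.\<close>

lemma minv_step:
  assumes I: "minv X l T w ps ls pool E" and l: "1 \<le> l"
    and srt: "\<And>j i i'. j < cdiv T l \<Longrightarrow> j * l \<le> i \<Longrightarrow> i \<le> i' \<Longrightarrow> i' < runhi T l j \<Longrightarrow> X ! i \<le> X ! i'"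
    and j: "j < length ps" "ps ! j < runhi T l j" "emit (runhi T l) ps ls (ls ! j)"
    and e: "ps ! j < e" "e \<le> runhi T l j" "e \<le> ps ! j + w" and new: "new = map ((!) X) [ps ! j..<e]"
    and ps': "ps' = ps[j := e]" and ls': "ls' = ls[j := last new]"
    and R: "R = emit (runhi T l) ps' ls'"
  shows "minv X l T w ps' ls' (filter (\<lambda>y. \<not> R y) (pool @ new)) (E @ sort (filter R (pool @ new)))"
proof -
  let ?hi = "runhi T l" and ?r = "cdiv T l" and ?p = "ps ! j"
  have len: "length ps = ?r" "length ls = ?r" using I by (auto simp: minv_def)
  have jr: "j < ?r" using j len by simp
  have pos: "\<And>i. i < ?r \<Longrightarrow> i * l \<le> ps ! i \<and> ps ! i \<le> ?hi i \<and> ls ! i = (if ps ! i = i * l then [] else X ! (ps ! i - 1))"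
    using I by (auto simp: minv_def)
  have last: "last new = X ! (e - 1)" using e(1) new by (simp add: last_map)
  \<comment> \<open>Before the first read of a run its key is \<open>[]\<close>, the least list,
    which bounds every item.\<close>
  have lsj: "ls ! j \<le> X ! k" if "?p \<le> k" "k < ?hi j" for k
    using pos[OF jr] that srt[OF jr, of "?p - 1" k] by (cases "?p = j * l") auto
  have mono: "R y" if y: "emit ?hi ps ls y" for y
    unfolding R emit_def
  proof (intro allI impI)
    fix i assume i: "i < length ps'" "ps' ! i < ?hi i"
    show "y \<le> ls' ! i"
    proof (cases "i = j")
      case True
      have "y \<le> ls ! j" using y j by (auto simp: emit_def)
      also have "\<dots> \<le> X ! (e - 1)" using e by (intro lsj) auto
      finally show ?thesis using True ls' last jr len by simp
    next
      case False
      then show ?thesis using y i ps' ls' by (auto simp: emit_def)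
    qed
  qed
  have new_ge: "y \<le> z" if y: "emit ?hi ps ls y" and z: "z \<in> set new" for y z
  proof -
    obtain k where k: "?p \<le> k" "k < e" "z = X ! k" using z new by auto
    have "y \<le> ls ! j" using y j by (auto simp: emit_def)
    also have "\<dots> \<le> z" using k e lsj[of k] by simp
    finally show ?thesis .
  qed
  have pool_ge: "y \<le> z" if "emit ?hi ps ls y" "z \<in> set pool" for y z
  proof -
    have "\<not> emit ?hi ps ls z" using I that by (auto simp: minv_def)
    then obtain i where "i < length ps" "ps ! i < ?hi i" "ls ! i < z" by (auto simp: emit_def)
    moreover from this have "y \<le> ls ! i" using that(1) by (auto simp: emit_def)
    ultimately show ?thesis by simp
  qed
  have Eemit: "\<forall>y\<in>set E. emit ?hi ps ls y" "sorted E" using I by (auto simp: minv_def)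
  have s1: "sorted (E @ sort (filter R (pool @ new)))"
    using Eemit new_ge pool_ge by (auto simp: sorted_append)
  have s2: "\<forall>y\<in>set (E @ sort (filter R (pool @ new))). R y" using Eemit mono by auto
  have s3: "mset (E @ sort (filter R (pool @ new))) + mset (filter (\<lambda>y. \<not> R y) (pool @ new)) = readset X l ps'"
  proof -
    have "mset (E @ sort (filter R (pool @ new))) + mset (filter (\<lambda>y. \<not> R y) (pool @ new)) = mset E + (mset pool + mset new)"
      using multiset_partition[of "mset (pool @ new)" R] by (simp add: mset_filter ac_simps)
    also have "\<dots> = readset X l ps + mset new" using I by (simp add: minv_def add.assoc[symmetric])
    also have "\<dots> = readset X l ps'" unfolding ps' new
      using readset_update[OF j(1), of l e X] pos[OF jr] e(1) by simp
    finally show ?thesis .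
  qed
  have s4: "\<forall>i<?r. i * l \<le> ps' ! i \<and> ps' ! i \<le> ?hi i \<and> ls' ! i = (if ps' ! i = i * l then [] else X ! (ps' ! i - 1))"
  proof (intro allI impI)
    fix i assume i: "i < ?r"
    show "i * l \<le> ps' ! i \<and> ps' ! i \<le> ?hi i \<and> ls' ! i = (if ps' ! i = i * l then [] else X ! (ps' ! i - 1))"
      using pos[OF i] e last len i ps' ls' by (cases "i = j") auto
  qed
  \<comment> \<open>Before this read the last key of run \<open>j\<close> was the minimum, so the
    items of this run up to it are final already. Hence only its \<open>w\<close> newest items can
    be pending.\<close>
  have s5: "\<forall>i<?r. \<forall>k. i * l \<le> k \<and> k < ps' ! i - w \<longrightarrow> R (X ! k)"
  proof (intro allI impI)
    fix i k assume i: "i < ?r" and k: "i * l \<le> k \<and> k < ps' ! i - w"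
    have "emit ?hi ps ls (X ! k)"
    proof (cases "i = j")
      case True
      then have "k < e - w" using k ps' len i by simp
      then have kp: "k < ?p" using e(3) by linarith
      then have "ls ! j = X ! (?p - 1)" using pos[OF jr] k True by auto
      moreover have "X ! k \<le> X ! (?p - 1)" using srt[OF jr, of k "?p - 1"] kp k True j(2) by auto
      ultimately show ?thesis using j(3) by (auto simp: emit_def intro: order_trans)
    next
      case False
      then show ?thesis using I i k ps' by (auto simp: minv_def)
    qed
    then show "R (X ! k)" by (rule mono)
  qed
  show ?thesis unfolding minv_def R[symmetric]
    by (intro conjI s1 s2 s3 s4 s5) (use len ps' ls' in auto)
qed

text \<open>Pending items are exactly the read items that are not final, and each run contributes at
  most its \<open>w\<close> newest ones.\<close>

lemma minv_pool_length:
  assumes I: "minv X l T w ps ls pool E" shows "length pool \<le> cdiv T l * w"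
proof -
  let ?Q = "\<lambda>y. \<not> emit (runhi T l) ps ls y"
  have len: "length ps = cdiv T l" using I by (simp add: minv_def)
  have "filter_mset ?Q (mset E + mset pool) = mset pool"
  proof -
    have "filter ?Q E = []" "filter ?Q pool = pool"
      using I by (auto simp: minv_def filter_empty_conv filter_id_conv)
    then show ?thesis by (simp flip: mset_filter)
  qed
  moreover have "mset E + mset pool = readset X l ps" using I by (simp add: minv_def)
  ultimately have "mset pool = filter_mset ?Q (readset X l ps)" by (simp only:)
  moreover have "size (filter_mset ?Q (\<Sum>j<n. mset (map ((!) X) [j * l..<ps ! j]))) \<le> n * w" if "n \<le> cdiv T l" for n
    using that
  proof (induction n)
    case (Suc n)
    let ?m = "max (n * l) (ps ! n - w)"
    have "size (filter_mset ?Q (mset (map ((!) X) [n * l..<ps ! n]))) \<le> w"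
    proof (cases "?m \<le> ps ! n")
      case True
      then have sp: "[n * l..<ps ! n] = [n * l..<?m] @ [?m..<ps ! n]"
        by (metis le_add_diff_inverse max.cobounded1 upt_add_eq_append)
      have "\<forall>i\<in>set [n * l..<?m]. emit (runhi T l) ps ls (X ! i)"
      proof
        fix i assume "i \<in> set [n * l..<?m]"
        then have "n * l \<le> i" "i < ps ! n - w" by auto
        then show "emit (runhi T l) ps ls (X ! i)" using I Suc.prems unfolding minv_def by (metis Suc_le_eq)
      qed
      then have "filter ?Q (map ((!) X) [n * l..<?m]) = []" by (auto simp: filter_empty_conv)
      then have "filter ?Q (map ((!) X) [n * l..<ps ! n]) = filter ?Q (map ((!) X) [?m..<ps ! n])"
        unfolding sp by simp
      then have "length (filter ?Q (map ((!) X) [n * l..<ps ! n])) \<le> length [?m..<ps ! n]"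
        using length_filter_le[of ?Q "map ((!) X) [?m..<ps ! n]"] by simp
      also have "\<dots> \<le> w" by simp
      finally show ?thesis by (metis mset_filter size_mset)
    qed auto
    then show ?case using Suc by simp
  qed simp
  ultimately have "size (mset pool) \<le> cdiv T l * w" using len by (simp add: readset_def)
  then show ?thesis by simp
qed

lemma readset_full:
  assumes l: "1 \<le> l" and ps: "length ps = cdiv T l" "\<And>j. j < cdiv T l \<Longrightarrow> ps ! j = runhi T l j"
  shows "readset X l ps = mset (map ((!) X) [0..<T])"
proof -
  have "(\<Sum>j<n. mset (map ((!) X) [j * l..<runhi T l j])) = mset (map ((!) X) [0..<min (n * l) T])" for n
  proof (induction n)
    case (Suc n)
    show ?case
    proof (cases "n * l \<le> T")
      case True
      then have "[0..<min (Suc n * l) T] = [0..<min (n * l) T] @ [n * l..<runhi T l n]"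
        using upt_add_eq_append[of 0 "n * l" "min (Suc n * l) T - n * l"] by (simp add: runhi_def min_def)
      then show ?thesis using Suc by simp
    next
      case False
      then show ?thesis using Suc by (simp add: runhi_def)
    qed
  qed simp
  from this[of "cdiv T l"] show ?thesis
    using cdiv_ge[OF l, of T] ps by (simp add: readset_def min_absorb2)
qed

text \<open>A read transfers a whole stripe, but only the rest of one virtual block is kept. Wasting
  the bandwidth in this way limits the pool to \<open>vb P\<close> items per run, so that
  \<open>fan P\<close> runs can be merged in internal memory.\<close>

definition nmerge :: "machine \<Rightarrow> nat \<times> nat \<times> nat \<times> nat \<Rightarrow> unit prog" where
  "nmerge P x = (case x of (a, T, l, b) \<Rightarrow>
     while P (nat_lists P \<times> item_lists P \<times> item_lists P \<times> nums P \<times> item_lists P)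
       (\<lambda>(ps, ls, pool, c, buf). \<exists>j<length ps. ps ! j < runhi T l j)
       (\<lambda>(ps, ls, pool, c, buf). let j = pick (runhi T l) ps ls; p = ps ! j; e = min (runhi T l j) ((p div vb P + 1) * vb P) in
          rds P (vu P) (a + p div zs P) \<bind> (\<lambda>xs. let new = take (e - p) (drop (p mod zs P) xs);
            ps' = ps[j := e]; ls' = ls[j := last new]; R = emit (runhi T l) ps' ls' in
            wout P (vu P) (c, buf @ sort (filter R (pool @ new))) \<bind>
              (\<lambda>(c', buf'). Ret (ps', ls', filter (\<lambda>y. \<not> R y) (pool @ new), c', buf'))))
       (map (\<lambda>j. j * l) [0..<cdiv T l], replicate (cdiv T l) [], [], b, [])
     \<bind> (\<lambda>(ps, ls, pool, c, buf). wout P (vu P) (c, pad (zs P) buf) \<bind> (\<lambda>_. Ret ())))"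

lemma lean_nmerge: "lean (\<lambda>P x. nmerge P (g P x))"
  unfolding nmerge_def case_prod_beta Let_def
  by (intro lean_bind lean_while lean_rds lean_wout lean_Ret smallset_intros)

text \<open>Runs may start and end inside a block, so a run can touch up to two blocks more than its
  length divided by \<open>vb P\<close>; this is the term \<open>2 * cdiv T l\<close>. Here
  \<open>T\<close> counts the items to be merged, and the padding behind them is ignored.\<close>

lemma wp_nmerge:
  assumes ok: "okm P" "disk_ok P d" and T: "1 \<le> T" "1 \<le> l" "T \<le> K1 * zs P" "T < word_range P ^ 8"
    and X: "X = cont (vu P) d a K1" and r: "cdiv T l \<le> fan P"
    and srt: "\<And>j i i'. j < cdiv T l \<Longrightarrow> j * l \<le> i \<Longrightarrow> i \<le> i' \<Longrightarrow> i' < runhi T l j \<Longrightarrow> X ! i \<le> X ! i'"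
    and K': "K' = cdiv T (zs P)"
    and tr: "a + K1 \<le> word_range P ^ 8" "b + K' \<le> word_range P ^ 8" "{a..<a+K1} \<inter> {b..<b+K'} = {}"
    and big: "T div vb P + 2 * cdiv T l + K' \<in> nums P"
  shows "wp P (nmerge P (a, T, l, b)) d (\<lambda>r d' t. cont (vu P) d' b K' = pad (zs P) (sort (take T X)) \<and>
     disk_ok P d' \<and> same_off {b..<b+K'} d d' \<and> t \<le> T div vb P + 2 * cdiv T l + K')"
proof -
  let ?Z = "zs P" and ?w = "vb P" and ?r = "cdiv T l" and ?hi = "runhi T l" and ?M = "mem_size P"
  note v = virt[OF ok(1)]
  have lenX: "length X = K1 * ?Z" using X length_cont[OF ok(2)] v(7) by simp
  have setX: "set X \<subseteq> vitems P" using X set_cont_vitems[OF ok(2)] by simp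
  have hiT: "?hi j \<le> T" for j by (simp add: runhi_def)
  have lo: "j * l < ?hi j" if "j < ?r" for j
  proof -
    have "j * l \<le> (?r - 1) * l" using that by (intro mult_le_mono1) simp
    also have "\<dots> < T" using cdiv_less[OF T(2) T(1)] .
    finally show ?thesis using T by (simp add: runhi_def)
  qed
  have rM: "?r \<le> ?M" using r v(4,15) by (metis le_trans mult_le_mono2 nat_mult_1_right)
  have rd: "set_mset (readset X l ps) \<subseteq> vitems P" if "length ps = ?r" "\<forall>j<?r. ps ! j \<le> ?hi j" for ps
  proof -
    have "X ! i \<in> vitems P" if "i < T" for i using that T(3) lenX setX by (metis less_le_trans nth_mem subsetD)
    moreover have "k < T" if "j < ?r" "k < ps ! j" for j k
      using that \<open>\<forall>j<?r. ps ! j \<le> ?hi j\<close> hiT by (meson le_trans less_le_trans)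
    ultimately show ?thesis using \<open>length ps = ?r\<close> by (auto simp: readset_def set_mset_sum)
  qed
  \<comment> \<open>The number of blocks met by the positions from \<open>p\<close> to
    \<open>h - 1\<close>, that is, the reads still due in a run.\<close>
  define rem where "rem p h = (if p < h then (h - 1) div ?w - p div ?w + 1 else 0)" for p h
  define I where "I s d' \<longleftrightarrow> (case s of (ps, ls, pool, c, buf) \<Rightarrow> \<exists>E. minv X l T ?w ps ls pool E \<and> wbuf P d b d' c buf E)" for s d'
  define \<Phi> where "\<Phi> s = (case s of (ps, ls, pool, c, buf) \<Rightarrow> (\<Sum>i<length ps. rem (ps ! i) (?hi i)) + (b + K' - c))"
    for s :: "nat list \<times> item list \<times> item list \<times> nat \<times> item list"
  let ?S = "nat_lists P \<times> item_lists P \<times> item_lists P \<times> nums P \<times> item_lists P"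
  let ?b = "\<lambda>(ps, ls, pool, c, buf). \<exists>j<length ps. ps ! j < ?hi j"
  let ?body = "\<lambda>(ps, ls, pool, c, buf). let j = pick ?hi ps ls; p = ps ! j; e = min (?hi j) ((p div ?w + 1) * ?w) in
          rds P (vu P) (a + p div ?Z) \<bind> (\<lambda>xs. let new = take (e - p) (drop (p mod ?Z) xs);
            ps' = ps[j := e]; ls' = ls[j := last new]; R = emit ?hi ps' ls' in
            wout P (vu P) (c, buf @ sort (filter R (pool @ new))) \<bind>
              (\<lambda>(c', buf'). Ret (ps', ls', filter (\<lambda>y. \<not> R y) (pool @ new), c', buf')))"
  let ?s0 = "(map (\<lambda>j. j * l) [0..<?r], replicate ?r [], [], b, [])"
  have minvD: "set E \<subseteq> vitems P" "set pool \<subseteq> vitems P" "length E \<le> T" "length pool \<le> ?M" "set ls \<subseteq> vitems P" "set ps \<subseteq> {..T}"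
    "length ps = ?r" "length ls = ?r"
    if I: "minv X l T ?w ps ls pool E" for ps ls pool E
  proof -
    show len: "length ps = ?r" "length ls = ?r" using I by (auto simp: minv_def)
    have ph: "\<forall>j<?r. ps ! j \<le> ?hi j" using I by (auto simp: minv_def)
    have "mset E + mset pool = readset X l ps" using I by (auto simp: minv_def)
    then have "set_mset (mset E + mset pool) \<subseteq> vitems P" using rd[OF len(1) ph] by simp
    then show "set E \<subseteq> vitems P" "set pool \<subseteq> vitems P" by auto
    have "length pool \<le> ?r * ?w" by (rule minv_pool_length[OF I])
    also have "\<dots> \<le> fan P * ?w" using r by (rule mult_le_mono1)
    finally show "length pool \<le> ?M" using v(15) by simp
    have "size (\<Sum>j<n. mset (map ((!) X) [j * l..<ps ! j])) \<le> min (n * l) T" if "n \<le> ?r" for n using that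
    proof (induction n)
      case (Suc n)
      have "ps ! n \<le> ?hi n" "n * l < ?hi n" using ph lo Suc.prems by auto
      moreover have "size (\<Sum>j<n. mset (map ((!) X) [j * l..<ps ! j])) \<le> min (n * l) T" using Suc by simp
      ultimately show ?case unfolding sum.lessThan_Suc size_union size_mset length_map length_upt runhi_def
        by simp linarith
    qed simp
    from this[of ?r] have "size (readset X l ps) \<le> T" unfolding readset_def len by simp
    then show "length E \<le> T" using \<open>mset E + _ = _\<close> by (metis size_mset size_union le_add1 le_trans)
    show "set ps \<subseteq> {..T}" using ph hiT len by (fastforce simp: in_set_conv_nth intro: le_trans)
    show "set ls \<subseteq> vitems P"
    proof
      fix y assume "y \<in> set ls"
      then obtain j where j: "j < ?r" "y = ls ! j" using len by (auto simp: in_set_conv_nth)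
      have "y = [] \<or> y = X ! (ps ! j - 1)" using I j by (auto simp: minv_def)
      moreover have "[] \<in> vitems P" by (simp add: vitems_def valid_item_def)
      moreover have "X ! (ps ! j - 1) \<in> vitems P"
      proof -
        have "ps ! j \<le> T" using ph hiT[of j] j le_trans by blast
        then have "ps ! j - 1 < T" using T(1) by linarith
        then show ?thesis using T(3) lenX setX by (metis less_le_trans nth_mem subsetD)
      qed
      ultimately show "y \<in> vitems P" by blast
    qed
  qed
  have \<Phi>0: "\<Phi> ?s0 \<le> T div ?w + 2 * ?r + K'"
  proof -
    have "(\<Sum>j<n. rem (j * l) (?hi j)) \<le> min (n * l) T div ?w + 2 * n" if "n \<le> ?r" for n using that
    proof (induction n)
      case (Suc n)
      have nl: "n * l < ?hi n" using lo Suc.prems by auto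
      have "rem (n * l) (?hi n) \<le> (?hi n - n * l) div ?w + 2"
      proof -
        have "(?hi n - 1) div ?w \<le> ((?hi n - n * l) + n * l) div ?w" using nl by (intro div_le_mono) simp
        also have "\<dots> \<le> (?hi n - n * l) div ?w + n * l div ?w + 1"

          using div_add_le[OF v(4)] by blast
        finally show ?thesis using nl by (simp add: rem_def)
      qed
      moreover have "min (n * l) T div ?w + (?hi n - n * l) div ?w \<le> min (Suc n * l) T div ?w"
      proof -
        have "min (n * l) T div ?w + (?hi n - n * l) div ?w \<le> (min (n * l) T + (?hi n - n * l)) div ?w"
          by (metis div_add1_eq le_add1)
        also have "min (n * l) T + (?hi n - n * l) = min (Suc n * l) T" using nl by (simp add: runhi_def min_def split: if_splits)
        finally show ?thesis .
      qed
      ultimately show ?case using Suc by simp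
    qed simp
    from this[of ?r] cdiv_ge[OF T(2), of T] show ?thesis by (simp add: \<Phi>_def min_absorb2)
  qed
  have loop: "wp P (while P ?S ?b ?body ?s0) d (\<lambda>s d' t. I s d' \<and> \<not> ?b s \<and> t + \<Phi> s \<le> \<Phi> ?s0)"
  proof (rule wp_while)
    have "minv X l T ?w (map (\<lambda>j. j * l) [0..<?r]) (replicate ?r []) [] []"
      using lo by (auto simp: minv_def readset_def less_imp_le)
    moreover have "wbuf P d b d b [] []" using ok by (simp add: wbuf_def)
    ultimately show "I ?s0 d" by (auto simp: I_def)
    show "\<Phi> ?s0 \<le> word_range P ^ (20 * ?M)" using \<Phi>0 big by (simp add: nums_def)
  next
    fix s d1 assume Is: "I s d1" and bs: "?b s"
    obtain ps ls pool c buf where s: "s = (ps, ls, pool, c, buf)" by (cases s)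
    obtain E where E: "minv X l T ?w ps ls pool E" "wbuf P d b d1 c buf E" using Is unfolding I_def s by auto
    note mD = minvD[OF E(1)]
    define j where "j = pick ?hi ps ls"
    define p where "p = ps ! j"
    define e where "e = min (?hi j) ((p div ?w + 1) * ?w)"
    have j: "j < length ps" "p < ?hi j" "emit ?hi ps ls (ls ! j)"
      using bs s pick[of _ ps ?hi ls] by (auto simp: j_def p_def)
    have jr: "j < ?r" using j mD by simp
    have pT: "p < T" using j hiT[of j] by simp
    have pw: "p < (p div ?w + 1) * ?w" using v(4) dividend_less_div_times[of ?w p] by simp
    have e: "p < e" "e \<le> ?hi j" using j pw by (auto simp: e_def)
    have ew: "e \<le> p + ?w" unfolding e_def by (rule le_trans[OF min.cobounded2]) (simp add: add_mult_distrib)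
    have pZ: "p div ?Z < K1" using pT T(3) by (simp add: less_mult_imp_div_less)
    have eZ: "e \<le> (p div ?Z + 1) * ?Z"
    proof -
      have "p div ?Z = p div ?w div vd P" by (simp add: zs_def div_mult2_eq mult.commute)
      moreover have "p div ?w < (p div ?w div vd P + 1) * vd P"
        using v(1) dividend_less_div_times[of "vd P" "p div ?w"] by simp
      ultimately have "p div ?w + 1 \<le> (p div ?Z + 1) * vd P" by simp
      then have "(p div ?w + 1) * ?w \<le> (p div ?Z + 1) * vd P * ?w" by (rule mult_le_mono1)
      also have "\<dots> = (p div ?Z + 1) * ?Z" by (simp only: zs_def mult.assoc)
      finally show ?thesis unfolding e_def by (rule le_trans[OF min.cobounded2])
    qed
    have d1: "disk_ok P d1" "same_off {b..<c} d d1" "c = b + length E div ?Z" using E(2) by (auto simp: wbuf_def)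
    have cK: "c \<le> b + K'"
      using d1(3) mD(3) K' le_trans[OF div_le_cdiv cdiv_mono] by auto
    have st: "stripe (vu P) d1 (a + p div ?Z) = take ?Z (drop (p div ?Z * ?Z) X)"
    proof -
      have "{b..<c} \<subseteq> {b..<b+K'}" using cK by auto
      then have "cont (vu P) d1 a K1 = X" unfolding X using cont_same_off[OF d1(2)] tr(3) by blast
      then show ?thesis using stripe_in_cont[OF d1(1) pZ, of "vu P" a] v(7) by simp
    qed
    define new where "new = map ((!) X) [p..<e]"
    have new: "take (e - p) (drop (p mod ?Z) (take ?Z (drop (p div ?Z * ?Z) X))) = new"
    proof -
      have eX: "e \<le> length X" using e(2) hiT[of j] T(3) lenX by simp
      have "e \<le> p div ?Z * ?Z + ?Z" using eZ by simp
      then have pz: "e - p \<le> ?Z - p mod ?Z" using e(1) div_mult_mod_eq[of p ?Z] by linarith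
      have "drop (p mod ?Z) (take ?Z (drop (p div ?Z * ?Z) X)) = take (?Z - p mod ?Z) (drop p X)"
        using div_mult_mod_eq[of p ?Z] by (simp add: drop_take add.commute)
      moreover have "take (e - p) (drop p X) = new"
        using eX e(1) by (intro nth_equalityI) (auto simp: new_def)
      ultimately show ?thesis using pz by (simp add: min_absorb1)
    qed
    define ps' where "ps' = ps[j := e]"
    define ls' where "ls' = ls[j := last new]"
    define R where "R = emit ?hi ps' ls'"
    let ?pool = "filter (\<lambda>y. \<not> R y) (pool @ new)" and ?o = "sort (filter R (pool @ new))"
    have I': "minv X l T ?w ps' ls' ?pool (E @ ?o)"
    proof (rule minv_step[OF E(1) T(2) _ j(1) _ j(3) _ e(2) _ _ ps'_def ls'_def R_def])
      show "ps ! j < ?hi j" "ps ! j < e" "e \<le> ps ! j + ?w" "new = map ((!) X) [ps ! j..<e]"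
        using j(2) e(1) ew new_def by (simp_all add: p_def)
    qed (rule srt)
    note mD' = minvD[OF I']
    have len_o: "length ?o \<le> 18 * ?M"
    proof -
      have "1 * ?w \<le> fan P * ?w" using v(1,11) by (intro mult_le_mono1) simp
      then have wM: "?w \<le> ?M" using v(15) by linarith
      have "length new \<le> ?w" using ew by (simp add: new_def)
      also note wM
      finally have "length (pool @ new) \<le> 2 * ?M" using mD(4) by simp
      then show ?thesis using length_filter_le[of R "pool @ new"] by simp
    qed
    \<comment> \<open>Either the run ends inside the block just read, or the next position is the
      first one of the following block.\<close>
    have "rem e (?hi j) + 1 = rem p (?hi j)"
    proof (cases "e = ?hi j")
      case True
      have "(?hi j - 1) div ?w = p div ?w"
      proof -
        have "p \<le> ?hi j - 1" "?hi j - 1 < (p div ?w + 1) * ?w" using j True pw by (auto simp: e_def min_def split: if_splits)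
        then have "p div ?w \<le> (?hi j - 1) div ?w" "(?hi j - 1) div ?w < p div ?w + 1"
          by (auto intro: div_le_mono less_mult_imp_div_less)
        then show ?thesis by simp
      qed
      then show ?thesis using True j by (simp add: rem_def)
    next
      case False
      then have ee: "e = (p div ?w + 1) * ?w" "e < ?hi j" by (auto simp: e_def min_def split: if_splits)
      then have "e div ?w = p div ?w + 1" using v(4) by simp
      moreover have "e div ?w \<le> (?hi j - 1) div ?w" using ee by (intro div_le_mono) simp
      ultimately show ?thesis using ee j by (simp add: rem_def)
    qed
    then have remsum: "(\<Sum>i<length ps'. rem (ps' ! i) (?hi i)) + 1 = (\<Sum>i<length ps. rem (ps ! i) (?hi i))"
      using sum_list_update_nth[OF j(1), of "\<lambda>i p. rem p (?hi i)" e] by (simp add: ps'_def p_def)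
    have "s \<in> ?S"
    proof -
      have "c \<in> nums P" using nums_le[OF ok(1), of c] cK tr(2) by simp
      moreover have "set buf \<subseteq> vitems P" using E(2) mD(1) by (auto simp: wbuf_def dest: in_set_dropD)
      moreover have "length buf \<le> ?M" using wbuf_length[OF ok(1) E(2)] v(9) by simp
      moreover have "set ps \<subseteq> {..<word_range P ^ 8}" using mD(6) T(4) by auto
      ultimately show ?thesis unfolding s using mD rM
        by (auto simp: nat_lists_def item_lists_def intro: le_trans)
    qed
    moreover have "wp P (?body s) d1 (\<lambda>s' d' t. I s' d' \<and> t + \<Phi> s' \<le> \<Phi> s \<and> \<Phi> s' < \<Phi> s)"
      unfolding s prod.case Let_def j_def[symmetric] p_def[symmetric] e_def[symmetric] wp_bind
    proof (rule wp_rds[OF d1(1) v(6)])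
      show "a + p div ?Z < word_range P ^ 8" using pZ tr(1) by simp
      show "wp P (wout P (vu P) (c, buf @ sort (filter (emit ?hi (ps[j := e]) (ls[j := last (take (e - p) (drop (p mod ?Z) (stripe (vu P) d1 (a + p div ?Z))))]))
          (pool @ take (e - p) (drop (p mod ?Z) (stripe (vu P) d1 (a + p div ?Z))))))) d1
        (\<lambda>r d' t. wp P (case r of (c', buf') \<Rightarrow> Ret (ps[j := e], ls[j := last (take (e - p) (drop (p mod ?Z) (stripe (vu P) d1 (a + p div ?Z))))],
            filter (\<lambda>y. \<not> emit ?hi (ps[j := e]) (ls[j := last (take (e - p) (drop (p mod ?Z) (stripe (vu P) d1 (a + p div ?Z))))]) y)
             (pool @ take (e - p) (drop (p mod ?Z) (stripe (vu P) d1 (a + p div ?Z)))), c', buf')) d'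
          (\<lambda>r' d'' t'. I r' d'' \<and> 1 + (t + t') + \<Phi> r' \<le> \<Phi> (ps, ls, pool, c, buf) \<and> \<Phi> r' < \<Phi> (ps, ls, pool, c, buf)))"
        unfolding st new ps'_def[symmetric] ls'_def[symmetric] R_def[symmetric]
      proof (rule wp_wout_wbuf[OF ok(1) E(2) mD'(1) len_o])
        have "length (E @ ?o) div ?Z \<le> K'"
          using mD'(3) K' le_trans[OF div_le_cdiv cdiv_mono] by blast
        then show le: "b + length (E @ ?o) div ?Z \<le> word_range P ^ 8" using tr(2) by simp
        fix q d2 t assume q: "wbuf P d b d2 (fst q) (snd q) (E @ ?o)" "t + c \<le> fst q"
        have qK: "fst q \<le> b + K'" using q(1) \<open>length (E @ ?o) div ?Z \<le> K'\<close> by (simp add: wbuf_def)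
        have "I (ps', ls', ?pool, fst q, snd q) d2" using I' q(1) by (auto simp: I_def)
        moreover have "1 + t + \<Phi> (ps', ls', ?pool, fst q, snd q) \<le> \<Phi> (ps, ls, pool, c, buf)"
          unfolding \<Phi>_def prod.case using remsum q(2) qK by linarith
        ultimately show "wp P (case q of (c', buf') \<Rightarrow> Ret (ps', ls', ?pool, c', buf')) d2
          (\<lambda>r' d'' t'. I r' d'' \<and> 1 + (t + t') + \<Phi> r' \<le> \<Phi> (ps, ls, pool, c, buf) \<and> \<Phi> r' < \<Phi> (ps, ls, pool, c, buf))"
          by (simp add: case_prod_beta)
      qed
    qed
    ultimately show "s \<in> ?S \<and> wp P (?body s) d1 (\<lambda>s' d' t. I s' d' \<and> t + \<Phi> s' \<le> \<Phi> s \<and> \<Phi> s' < \<Phi> s)" ..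
  qed
  show ?thesis unfolding nmerge_def prod.case
  proof (rule wp_bindI, rule loop)
    fix s d1 t assume *: "I s d1 \<and> \<not> ?b s \<and> t + \<Phi> s \<le> \<Phi> ?s0"
    obtain ps ls pool c buf where s: "s = (ps, ls, pool, c, buf)" by (cases s)
    obtain E where E: "minv X l T ?w ps ls pool E" "wbuf P d b d1 c buf E" using * unfolding I_def s by auto
    note mD = minvD[OF E(1)]
    have fin: "ps ! j = ?hi j" if "j < ?r" for j
    proof -
      have "ps ! j \<le> ?hi j" using E(1) that by (simp add: minv_def)
      moreover have "\<not> ps ! j < ?hi j" using * that mD(7) unfolding s by simp
      ultimately show ?thesis by simp
    qed
    have "pool = []"
    proof (rule ccontr)
      assume "pool \<noteq> []"
      then have "\<not> emit ?hi ps ls (hd pool)" using E(1) by (auto simp: minv_def)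
      then show False using fin mD(7) by (auto simp: emit_def)
    qed
    then have "mset E = mset (map ((!) X) [0..<T])"
      using E(1) readset_full[OF T(2) mD(7) fin, of X] by (simp add: minv_def)
    moreover have "map ((!) X) [0..<T] = take T X"
      using T(3) lenX by (intro nth_equalityI) auto
    moreover have "sorted E" using E(1) by (simp add: minv_def)
    ultimately have Es: "E = sort (take T X)" by (metis properties_for_sort)
    have lE: "length E = T" using Es T(3) lenX by simp
    show "wp P (case s of (ps, ls, pool, c, buf) \<Rightarrow> wout P (vu P) (c, pad ?Z buf) \<bind> (\<lambda>_. Ret ())) d1
      (\<lambda>r d'' t'. cont (vu P) d'' b K' = pad ?Z (sort (take T X)) \<and>
        disk_ok P d'' \<and> same_off {b..<b+K'} d d'' \<and> t + t' \<le> T div ?w + 2 * ?r + K')"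
      unfolding s prod.case wp_bind
    proof (rule wp_wout_flush[OF ok(1) E(2) mD(1)])
      show "K' = cdiv (length E) ?Z" using K' lE by simp
      fix q d2 t' assume q: "cont (vu P) d2 b K' = pad ?Z E" "disk_ok P d2" "same_off {b..<b+K'} d d2" "t' + c \<le> b + K'"
      have "t + t' \<le> T div ?w + 2 * ?r + K'"
        using * \<Phi>0 q(4) unfolding s \<Phi>_def prod.case by linarith
      then show "wp P (Ret ()) d2 (\<lambda>r d'' t''. cont (vu P) d'' b K' = pad ?Z (sort (take T X)) \<and>
        disk_ok P d'' \<and> same_off {b..<b+K'} d d'' \<and> t + (t' + t'') \<le> T div ?w + 2 * ?r + K')"
        using q Es by simp
    qed (use tr in simp)
  qed
qed

section \<open>Merging sorted runs at full bandwidth\<close>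

definition data_items :: "machine \<Rightarrow> item set" where
  "data_items P = {x. length x = 4 \<and> set x \<subseteq> {..<word_range P}}"

definition sorted_runs :: "nat \<Rightarrow> item list \<Rightarrow> bool" where
  "sorted_runs c xs \<longleftrightarrow> (\<forall>j. sorted (take c (drop (j * c) xs)))"

lemma sorted_runs_nth:
  assumes "sorted_runs c xs" "p \<le> p'" "p' < length xs" "p div c = p' div c" "1 \<le> c"
  shows "xs ! p \<le> xs ! p'"
proof -
  let ?j = "p div c"
  let ?s = "take c (drop (?j * c) xs)"
  have p: "p = ?j * c + p mod c" "p' = ?j * c + p' mod c"
    using assms(4) div_mult_mod_eq[of p c] div_mult_mod_eq[of p' c] by simp_all
  have m: "p mod c < c" "p' mod c < c" using assms(5) by simp_all
  have "p' mod c < length ?s" "p mod c \<le> p' mod c"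
    unfolding length_take length_drop using p m assms(2,3) by linarith+
  moreover have "sorted ?s" using assms(1) by (simp add: sorted_runs_def)
  ultimately have "?s ! (p mod c) \<le> ?s ! (p' mod c)" using sorted_nth_mono by blast
  moreover have "?s ! (p mod c) = xs ! p" "?s ! (p' mod c) = xs ! p'"
    using p m assms(2,3) by (metis le_add1 le_trans less_imp_le nth_drop nth_take)+
  ultimately show ?thesis by simp
qed

lemma append_less_append:
  "length x = length y \<Longrightarrow> (x @ p :: nat list) < y @ q \<longleftrightarrow> x < y \<or> x = y \<and> p < q"
  by (induction x y rule: list_induct2) auto

lemma digits_less:
  assumes "i < i'"
  shows "[i div W ^ 2, i div W mod W, i mod W] < [i' div W ^ 2, i' div W mod W, i' mod W :: nat]"
proof -
  have 2: "i div W ^ 2 = i div W div W" "i' div W ^ 2 = i' div W div W" by (simp_all add: power2_eq_square div_mult2_eq)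
  have a: "i div W ^ 2 \<le> i' div W ^ 2" "i div W \<le> i' div W" using assms by (auto intro: div_le_mono)
  show ?thesis
  proof (cases "i div W ^ 2 = i' div W ^ 2")
    case True
    show ?thesis
    proof (cases "i div W = i' div W")
      case True2: True
      have "i mod W < i' mod W" using assms True2 div_mult_mod_eq[of i W] div_mult_mod_eq[of i' W] by (metis nat_add_left_cancel_less)
      then show ?thesis using True True2 by simp
    next
      case False
      then have "i div W < i' div W" using a by simp
      then have "i div W mod W < i' div W mod W"
        using True div_mult_mod_eq[of "i div W" W] div_mult_mod_eq[of "i' div W" W] unfolding 2
        by (metis nat_add_left_cancel_less)
      then show ?thesis using True by simp
    qed
  qed (use a in simp)
qed

text \<open>Keys of the same length four make the comparison of triggers lexicographic in key and
  block number.\<close>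

lemma trig_less:
  assumes "length x = 4" "length y = 4" "x \<le> y" "i < i'" shows "trig P x i < trig P y i'"
  using assms digits_less[of i i' "word_range P"] unfolding trig_def by (subst append_less_append) auto

lemma trig_less_key:
  assumes "length x = 4" "length y = 4" "trig P x i \<le> trig P y i'" shows "x \<le> y"
proof (rule ccontr)
  assume "\<not> x \<le> y"
  then have "trig P y i' < trig P x i" using assms unfolding trig_def by (subst append_less_append) auto
  then show False using assms by simp
qed

text \<open>Blocks ordered by their first item. Breaking ties by block number keeps the blocks of a
  run in their order even if keys repeat.\<close>

definition guide :: "machine \<Rightarrow> nat \<Rightarrow> nat \<Rightarrow> item list \<Rightarrow> nat list" where
  "guide P w n xs = map (trig_block P) (sort (map (\<lambda>\<beta>. trig P (xs ! (\<beta> * w)) \<beta>) [0..<n]))"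

text \<open>Numbers of equal residue are at least \<open>D\<close> apart, so a segment of
  \<open>D\<close> consecutive numbers contains at most one of them.\<close>

lemma card_interval_mod:
  assumes "1 \<le> D" shows "card {\<beta>. a \<le> \<beta> \<and> \<beta> < b \<and> \<beta> mod D = v} \<le> (b - a) div D + (1::nat)"
proof -
  let ?S = "{\<beta>. a \<le> \<beta> \<and> \<beta> < b \<and> \<beta> mod D = v}"
  have "inj_on (\<lambda>\<beta>. (\<beta> - a) div D) ?S"
  proof (rule linorder_inj_onI', rule notI)
    fix x y assume xy: "x \<in> ?S" "y \<in> ?S" "x < y" and eq: "(x - a) div D = (y - a) div D"
    have "y - x = (y - a) - (x - a)" using xy by simp
    also have "\<dots> = (y - a) mod D - (x - a) mod D"
      using eq div_mult_mod_eq[of "x - a" D] div_mult_mod_eq[of "y - a" D] by (metis diff_cancel2 add.commute)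
    also have "\<dots> < D" using assms by (meson diff_le_self le_less_trans mod_less_divisor less_le_trans zero_less_one)
    finally have "y - x < D" .
    moreover have "D dvd y - x" using xy by (simp add: mod_eq_dvd_iff_nat[symmetric])
    ultimately show False using xy(3) by (metis dvd_imp_le leD zero_less_diff)
  qed
  moreover have "(\<lambda>\<beta>. (\<beta> - a) div D) ` ?S \<subseteq> {..(b - a) div D}" by (auto intro!: div_le_mono)
  ultimately have "card ?S \<le> card {..(b - a) div D}" by (rule card_inj_on_le) simp
  then show ?thesis by simp
qed

text \<open>A finite set without gaps is an interval, and consecutive blocks visit the virtual disks
  in turn.\<close>

lemma card_convex_mod:
  fixes S :: "nat set"
  assumes "finite S" "1 \<le> D" and conv: "\<And>x y z. x \<in> S \<Longrightarrow> z \<in> S \<Longrightarrow> x < y \<Longrightarrow> y < z \<Longrightarrow> y \<in> S"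
  shows "card {\<beta> \<in> S. \<beta> mod D = v} \<le> card S div D + 1"
proof (cases "S = {}")
  case False
  have "S = {Min S..<Max S + 1}"
  proof safe
    fix x assume "x \<in> S"
    then show "x \<in> {Min S..<Max S + 1}" using assms(1) by (auto simp: less_Suc_eq_le)
  next
    fix x assume "x \<in> {Min S..<Max S + 1}"
    then show "x \<in> S" using conv[of "Min S" "Max S" x] Min_in[OF assms(1) False] Max_in[OF assms(1) False]
      by (cases "x = Min S \<or> x = Max S") auto
  qed
  then obtain a b where S: "S = {a..<b}" by blast
  then have "{\<beta> \<in> S. \<beta> mod D = v} = {\<beta>. a \<le> \<beta> \<and> \<beta> < b \<and> \<beta> mod D = v}" by auto
  then show ?thesis using card_interval_mod[OF assms(2), of a b v] S by simp
qed simp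

lemma sum_div_le: "(\<Sum>j<r::nat. f j div D) \<le> (\<Sum>j<r. f j :: nat) div D"
proof (induction r)
  case (Suc r)
  have "(\<Sum>j<r. f j) div D + f r div D \<le> ((\<Sum>j<r. f j) + f r) div D" by (metis div_add1_eq le_add1)
  then show ?case using Suc by simp
qed simp

lemma mset_concat_map: "mset (concat (map g xs)) = sum_mset (image_mset (\<lambda>x. mset (g x)) (mset xs))"
  by (induction xs) auto

text \<open>The list consists of \<open>n\<close> blocks of \<open>w\<close> items, and each sorted
  run of \<open>l\<close> blocks.\<close>

locale merge_blocks =
  fixes P :: machine and xs :: "item list" and w n l :: nat
  assumes w: "1 \<le> w" and l: "1 \<le> l" and len: "length xs = n * w" and items: "\<And>x. x \<in> set xs \<Longrightarrow> length x = 4"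
    and runs: "sorted_runs (l * w) xs"
begin

definition "tr \<beta> = trig P (xs ! (\<beta> * w)) \<beta>"
abbreviation "bs \<equiv> guide P w n xs"

lemma idx: "\<beta> < n \<Longrightarrow> k < w \<Longrightarrow> \<beta> * w + k < length xs"
proof -
  assume "\<beta> < n" "k < w"
  then have "\<beta> * w + k < Suc \<beta> * w" by simp
  also have "\<dots> \<le> n * w" using \<open>\<beta> < n\<close> by (intro mult_le_mono1) simp
  finally show ?thesis using len by simp
qed

lemma len4: "\<beta> < n \<Longrightarrow> length (xs ! (\<beta> * w)) = 4"
  using idx[of \<beta> 0] w items by simp

lemma same_run_le:
  assumes "i < i'" "i' < n" "i div l = i' div l" "k < w" shows "xs ! (i * w + k) \<le> xs ! (i' * w)"
proof (rule sorted_runs_nth[OF runs])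
  have "i * w + k \<le> Suc i * w" using assms by simp
  also have "\<dots> \<le> i' * w" using assms by (intro mult_le_mono1) simp
  finally show "i * w + k \<le> i' * w" .
  show "i' * w < length xs" using idx[of i' 0] assms w by simp
  have "(i * w + k) div (w * l) = i div l" "i' * w div (w * l) = i' div l"
    using assms w by (simp_all add: div_mult2_eq)
  then show "(i * w + k) div (l * w) = i' * w div (l * w)" using assms by (simp add: mult.commute)
  show "1 \<le> l * w" using w l by (simp add: Suc_le_eq)
qed

lemma block_le: assumes "i < n" "k < w" shows "xs ! (i * w) \<le> xs ! (i * w + k)"
proof (rule sorted_runs_nth[OF runs])
  show "i * w + k < length xs" using idx assms by simp
  have "(i * w + k) div (w * l) = i div l" "i * w div (w * l) = i div l"
    using assms w by (simp_all add: div_mult2_eq)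
  then show "i * w div (l * w) = (i * w + k) div (l * w)" by (simp add: mult.commute)
  show "1 \<le> l * w" using w l by (simp add: Suc_le_eq)
qed simp

lemma tr_run_less: "i < i' \<Longrightarrow> i' < n \<Longrightarrow> i div l = i' div l \<Longrightarrow> tr i < tr i'"
  unfolding tr_def using same_run_le[of i i' 0] w by (intro trig_less len4) auto

lemma tr_block [simp]: "\<beta> < n \<Longrightarrow> trig_block P (tr \<beta>) = \<beta>"
  unfolding tr_def using len4 by simp

lemma mset_bs: "mset bs = mset [0..<n]"
proof -
  have "mset bs = image_mset (trig_block P) (mset (map tr [0..<n]))" by (simp add: guide_def tr_def[abs_def])
  also have "\<dots> = mset (map (\<lambda>\<beta>. \<beta>) [0..<n])"
    unfolding mset_map[symmetric] map_map by (intro arg_cong[where f = mset] map_cong) auto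
  finally show ?thesis by simp
qed

lemma length_bs: "length bs = n" using mset_bs by (metis length_upt minus_nat.diff_0 size_mset)
lemma set_bs: "set bs = {..<n}" using mset_bs by (metis atLeast_upt set_mset_mset)
lemma distinct_bs: "distinct bs" using mset_bs by (metis distinct_upt mset_eq_imp_distinct_iff)
lemma bs_less: "e < n \<Longrightarrow> bs ! e < n" using set_bs length_bs nth_mem by (metis lessThan_iff)

lemma tr_bs: "e < n \<Longrightarrow> sort (map tr [0..<n]) ! e = tr (bs ! e)"
proof -
  assume e: "e < n"
  then have "sort (map tr [0..<n]) ! e \<in> set (map tr [0..<n])" by (metis length_map length_sort length_upt minus_nat.diff_0 nth_mem set_sort)
  then obtain \<beta> where "\<beta> < n" "sort (map tr [0..<n]) ! e = tr \<beta>" by auto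
  moreover from this have "bs ! e = \<beta>" using e by (simp add: guide_def tr_def[abs_def, symmetric])
  ultimately show ?thesis by simp
qed

lemma tr_bs_less: assumes "e < e'" "e' < n" shows "tr (bs ! e) < tr (bs ! e')"
proof -
  have "tr (bs ! e) \<le> tr (bs ! e')"
    using assms tr_bs[of e] tr_bs[of e'] sorted_nth_mono[OF sorted_sort, of e e' "map tr [0..<n]"] by simp
  moreover have "bs ! e \<noteq> bs ! e'" using distinct_bs assms length_bs by (simp add: nth_eq_iff_index_eq)
  then have "tr (bs ! e) \<noteq> tr (bs ! e')" using tr_block bs_less assms by (metis less_trans)
  ultimately show ?thesis by simp
qed

lemma tr_bs_lessD: assumes "tr (bs ! e) < tr (bs ! e')" "e < n" shows "e < e'"
proof (rule ccontr)
  assume "\<not> e < e'"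
  then consider "e' = e" | "e' < e" by linarith
  then show False using assms tr_bs_less[of e' e] by cases auto
qed

lemma key_bs_le: assumes "e \<le> e'" "e' < n" shows "xs ! (bs ! e * w) \<le> xs ! (bs ! e' * w)"
proof (cases "e = e'")
  case False
  then have le: "tr (bs ! e) \<le> tr (bs ! e')" using tr_bs_less[of e e'] assms by simp
  have "e < n" using assms by simp
  then show ?thesis
    using trig_less_key[OF len4[OF bs_less] len4[OF bs_less] le[unfolded tr_def]] assms(2) by blast
qed simp

text \<open>Within a window of the guide, the blocks of one run are consecutive and hence spread evenly.\<close>

lemma window_load:
  assumes D: "1 \<le> D"
  shows "card {e. e < length (take k (drop u bs)) \<and> take k (drop u bs) ! e mod D = v} \<le> length (take k (drop u bs)) div D + cdiv n l"
proof -
  let ?ws = "take k (drop u bs)"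
  let ?r = "cdiv n l"
  define S where "S j = {\<beta> \<in> set ?ws. \<beta> div l = j}" for j
  have dis: "distinct ?ws" using distinct_bs by simp
  have sub: "set ?ws \<subseteq> {..<n}" using set_bs by (auto dest!: in_set_takeD in_set_dropD)
  have nl: "\<beta> div l < ?r" if "\<beta> < n" for \<beta>
  proof -
    have "\<beta> < ?r * l" using that cdiv_ge[OF l, of n] by simp
    then show ?thesis by (rule less_mult_imp_div_less)
  qed
  have wsE: "\<exists>e. u \<le> e \<and> e < u + k \<and> e < n \<and> \<beta> = bs ! e" if b: "\<beta> \<in> set ?ws" for \<beta>
  proof -
    obtain i where "i < length ?ws" "\<beta> = ?ws ! i" using b by (metis in_set_conv_nth)
    then show ?thesis using length_bs by (intro exI[of _ "u + i"]) auto
  qed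
  \<comment> \<open>Triggers increase strictly along a run. A block between two blocks of the same
    run therefore lies between them in the guide as well, hence in the same window.\<close>
  have conv: "y \<in> S j" if xz: "x \<in> S j" "z \<in> S j" and xy: "x < y" "y < z" for x y z j
  proof -
    have j: "x div l = j" "z div l = j" using xz by (auto simp: S_def)
    then have "y div l = j" using xy div_le_mono[of x y l] div_le_mono[of y z l] by simp
    have "x \<in> set ?ws" "z \<in> set ?ws" using xz by (auto simp: S_def)
    then obtain e1 e3 where e: "u \<le> e1" "x = bs ! e1" "e1 < n" "e3 < u + k" "z = bs ! e3" "e3 < n"
      using wsE by meson
    have zn: "z < n" using e bs_less by simp
    then have "y < n" using xy by simp
    then obtain e2 where e2: "e2 < n" "y = bs ! e2" using set_bs length_bs by (metis in_set_conv_nth lessThan_iff)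
    have "tr (bs ! e1) < tr (bs ! e2)" "tr (bs ! e2) < tr (bs ! e3)"
      using tr_run_less[of x y] tr_run_less[of y z] xy zn \<open>y < n\<close> j \<open>y div l = j\<close> e e2 by auto
    then have "e1 < e2" "e2 < e3" using tr_bs_lessD e(3) e2(1) by blast+
    then have i: "e2 - u < length ?ws" "u + (e2 - u) = e2" using e e2 length_bs by auto
    then have "?ws ! (e2 - u) = y" using e2 length_bs by simp
    then have "y \<in> set ?ws" using i nth_mem by metis
    then show ?thesis using \<open>y div l = j\<close> by (simp add: S_def)
  qed
  have "card {e. e < length ?ws \<and> ?ws ! e mod D = v} = card {\<beta> \<in> set ?ws. \<beta> mod D = v}"
  proof -
    have inj: "inj_on ((!) ?ws) {e. e < length ?ws \<and> ?ws ! e mod D = v}"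
      using dis by (intro inj_on_nth) auto
    have img: "(!) ?ws ` {e. e < length ?ws \<and> ?ws ! e mod D = v} = {\<beta> \<in> set ?ws. \<beta> mod D = v}"
      unfolding set_conv_nth[of ?ws] by blast
    show ?thesis unfolding img[symmetric] by (rule card_image[OF inj, symmetric])
  qed
  also have "{\<beta> \<in> set ?ws. \<beta> mod D = v} = (\<Union>j<?r. {\<beta> \<in> S j. \<beta> mod D = v})"
    using sub nl by (auto simp: S_def)
  also have "card \<dots> \<le> (\<Sum>j<?r. card {\<beta> \<in> S j. \<beta> mod D = v})" by (rule card_UN_le) simp
  also have "\<dots> \<le> (\<Sum>j<?r. card (S j) div D + 1)"
  proof (rule sum_mono)
    fix j show "card {\<beta> \<in> S j. \<beta> mod D = v} \<le> card (S j) div D + 1"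
      by (rule card_convex_mod[OF _ D conv]) (simp add: S_def)
  qed
  also have "\<dots> = (\<Sum>j<?r. card (S j) div D) + ?r" unfolding sum.distrib by simp
  also have "\<dots> \<le> (\<Sum>j<?r. card (S j)) div D + ?r" using sum_div_le by (rule add_right_mono)
  also have "(\<Sum>j<?r. card (S j)) = card (\<Union>j<?r. S j)"
    by (rule card_UN_disjoint[symmetric]) (unfold S_def, auto simp del: set_take_subset)
  also have "(\<Union>j<?r. S j) = set ?ws"
  proof -
    have "\<beta> \<in> S (\<beta> div l)" "\<beta> div l < ?r" if "\<beta> \<in> set ?ws" for \<beta> using that sub nl by (auto simp: S_def)
    then show ?thesis unfolding S_def by blast
  qed
  also have "card (set ?ws) = length ?ws" using dis by (rule distinct_card)
  finally show ?thesis .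
qed

definition "ys = concat (map (\<lambda>e. take w (drop (bs ! e * w) xs)) [0..<n])"

lemma length_blk_xs: "\<beta> < n \<Longrightarrow> length (take w (drop (\<beta> * w) xs)) = w"
  using len by (intro slice_slice_length) auto

lemma length_ys: "length ys = n * w"
  unfolding ys_def using length_blk_xs bs_less by (subst length_concat_const[where B = w]) auto

lemma ys_nth: "e < n \<Longrightarrow> k < w \<Longrightarrow> ys ! (e * w + k) = xs ! (bs ! e * w + k)"
proof -
  assume e: "e < n" "k < w"
  have "take w (drop (e * w) ys) = take w (drop (bs ! e * w) xs)"
    unfolding ys_def using length_blk_xs bs_less e by (subst concat_slice) auto
  then have "take w (drop (e * w) ys) ! k = take w (drop (bs ! e * w) xs) ! k" by simp
  moreover have "e * w \<le> length ys" "bs ! e * w \<le> length xs" using length_ys len e bs_less by (auto intro: mult_le_mono1 less_imp_le)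
  ultimately show ?thesis using e by simp
qed

lemma mset_ys: "mset ys = mset xs"
proof -
  let ?g = "\<lambda>\<beta>. take w (drop (\<beta> * w) xs)"
  have "map (\<lambda>e. ?g (bs ! e)) [0..<n] = map ?g bs"
    by (rule nth_equalityI) (simp_all add: length_bs)
  then have "mset ys = mset (concat (map ?g bs))" by (simp only: ys_def)
  also have "\<dots> = mset (concat (map ?g [0..<n]))" by (simp only: mset_concat_map mset_bs)
  also have "\<dots> = mset xs" unfolding concat_slices using len by simp
  finally show ?thesis .
qed

text \<open>The rearranged list is not sorted, but its blocks are ordered by first items and sorted
  inside. So the first item of a block bounds everything behind it, which is all that the final
  merging pass requires.\<close>

lemma ys_block_start_le:
  assumes "i \<le> i'" "i' < length ys" "w dvd i" shows "ys ! i \<le> ys ! i'"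
proof -
  let ?e = "i div w" and ?f = "i' div w"
  have i: "i = ?e * w + 0" using assms by simp
  have i': "i' = ?f * w + i' mod w" by (simp add: div_mult_mod_eq)
  have ef: "?e \<le> ?f" using assms by (intro div_le_mono) simp
  have f: "?f < n" using assms(2) length_ys by (simp add: less_mult_imp_div_less)
  have m: "i' mod w < w" using w by simp
  have "ys ! i = xs ! (bs ! ?e * w)" using ys_nth[of ?e 0] i ef f w by simp
  also have "\<dots> \<le> xs ! (bs ! ?f * w)" by (rule key_bs_le[OF ef f])
  also have "\<dots> \<le> xs ! (bs ! ?f * w + i' mod w)" by (rule block_le[OF bs_less[OF f] m])
  also have "\<dots> = ys ! i'" using ys_nth[OF f m] i' by simp
  finally show ?thesis .
qed

text \<open>Of two earlier blocks from the same run, the first one contains nothing above the start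
  of the second, which in turn is at most the start of block \<open>t\<close>. Hence only the latest
  block of each run can have items above that start.\<close>

lemma ys_open_blocks:
  assumes t: "t < n"
  shows "card {s. s < t \<and> (\<exists>k<w. ys ! (t * w) < ys ! (s * w + k))} \<le> cdiv n l"
proof -
  let ?S = "{s. s < t \<and> (\<exists>k<w. ys ! (t * w) < ys ! (s * w + k))}"
  have "inj_on (\<lambda>s. bs ! s div l) ?S"
  proof (rule linorder_inj_onI', rule notI)
    fix s s' assume "s \<in> ?S" "s' \<in> ?S" "s < s'" "bs ! s div l = bs ! s' div l"
    then obtain k where *: "s < s'" "s' < t" "bs ! s div l = bs ! s' div l" "k < w" "ys ! (t * w) < ys ! (s * w + k)" by blast
    have lt: "s < n" "s' < n" using * t by auto
    have "bs ! s < bs ! s'"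
    proof (rule ccontr)
      assume "\<not> bs ! s < bs ! s'"
      moreover have "bs ! s \<noteq> bs ! s'" using distinct_bs * lt length_bs by (simp add: nth_eq_iff_index_eq)
      ultimately have "tr (bs ! s') < tr (bs ! s)" using tr_run_less[of "bs ! s'" "bs ! s"] * bs_less lt by simp
      then show False using tr_bs_less[of s s'] * lt by simp
    qed
    then have "xs ! (bs ! s * w + k) \<le> xs ! (bs ! s' * w)" using same_run_le * bs_less lt by blast
    also have "\<dots> \<le> xs ! (bs ! t * w)" using key_bs_le[of s' t] * t by simp
    finally have "ys ! (s * w + k) \<le> ys ! (t * w)"
      using ys_nth[of s k] ys_nth[of t 0] * lt t w by simp
    then show False using * by simp
  qed
  moreover have "(\<lambda>s. bs ! s div l) ` ?S \<subseteq> {..<cdiv n l}"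
  proof safe
    fix s assume "s < t"
    then have "bs ! s < cdiv n l * l" using bs_less[of s] t cdiv_ge[OF l, of n] by simp
    then show "bs ! s div l < cdiv n l" by (rule less_mult_imp_div_less)
  qed
  ultimately have "card ?S \<le> card {..<cdiv n l}" by (rule card_inj_on_le) simp
  then show ?thesis by simp
qed

end

section \<open>Streaming passes of a merge: extracting triggers, merging rearranged blocks\<close>

definition trig_step :: "machine \<Rightarrow> unit \<Rightarrow> nat \<Rightarrow> item \<Rightarrow> nat \<times> item list" where
  "trig_step P y c x = (c + 1, if c mod vb P = 0 then [trig P x (c div vb P)] else [])"

lemma cdiv_Suc: "1 \<le> w \<Longrightarrow> cdiv (Suc m) w = m div w + 1"
  by (simp add: cdiv_def div_add_self2)

lemma cdiv_eq: "1 \<le> w \<Longrightarrow> cdiv m w = (if m mod w = 0 then m div w else m div w + 1)"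
proof (cases m)
  case (Suc k)
  assume w: "1 \<le> w"
  show ?thesis unfolding Suc cdiv_Suc[OF w] using w by (simp add: div_Suc)
qed (simp add: cdiv_def)

lemma trun_trig:
  assumes "okm P"
  shows "trun (trig_step P y) 0 xs = (length xs, map (\<lambda>\<beta>. trig P (xs ! (\<beta> * vb P)) \<beta>) [0..<cdiv (length xs) (vb P)])"
proof (induction xs rule: rev_induct)
  case Nil
  then show ?case using virt(4)[OF assms] by (simp add: cdiv_def)
next
  case (snoc x xs)
  let ?w = "vb P" and ?m = "length xs"
  have w: "1 \<le> ?w" using virt[OF assms] by simp
  have eq: "map (\<lambda>\<beta>. trig P ((xs @ [x]) ! (\<beta> * ?w)) \<beta>) [0..<cdiv ?m ?w] = map (\<lambda>\<beta>. trig P (xs ! (\<beta> * ?w)) \<beta>) [0..<cdiv ?m ?w]"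
  proof (intro map_cong refl)
    fix \<beta> assume "\<beta> \<in> set [0..<cdiv ?m ?w]"
    then have b: "\<beta> < cdiv ?m ?w" by simp
    then have "1 \<le> ?m" using w by (cases ?m) (auto simp: cdiv_def)
    then have "(cdiv ?m ?w - 1) * ?w < ?m" using cdiv_less[OF w] by blast
    moreover have "\<beta> * ?w \<le> (cdiv ?m ?w - 1) * ?w" using b by (intro mult_le_mono1) simp
    ultimately have "\<beta> * ?w < ?m" by (rule le_less_trans[rotated])
    then show "trig P ((xs @ [x]) ! (\<beta> * ?w)) \<beta> = trig P (xs ! (\<beta> * ?w)) \<beta>" by (simp add: nth_append)
  qed
  show ?case
  proof (cases "?m mod ?w = 0")
    case True
    then have "?m div ?w * ?w = ?m" by (simp add: mod_eq_0_iff_dvd)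
    then show ?thesis using snoc eq True cdiv_eq[OF w, of ?m] cdiv_Suc[OF w, of ?m]
      by (simp add: trun_append trig_step_def nth_append)
  next
    case False
    then show ?thesis using snoc eq cdiv_eq[OF w, of ?m] cdiv_Suc[OF w, of ?m]
      by (simp add: trun_append trig_step_def)
  qed
qed

text \<open>The first item of each block bounds all later items from below, so everything in the pool up to it
  can be written.\<close>

definition merge_step :: "machine \<Rightarrow> unit \<Rightarrow> nat \<times> item list \<Rightarrow> item \<Rightarrow> (nat \<times> item list) \<times> item list" where
  "merge_step P y s x = (if fst s mod vb P = 0
     then ((fst s + 1, filter (\<lambda>y. x < y) (snd s) @ [x]), sort (filter (\<lambda>y. y \<le> x) (snd s)))
     else ((fst s + 1, snd s @ [x]), []))"

lemma merge_step_start: "c mod vb P = 0 \<Longrightarrow>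
    merge_step P y (c, pool) x = ((c + 1, filter (\<lambda>y. x < y) pool @ [x]), sort (filter (\<lambda>y. y \<le> x) pool))"
  and merge_step_mid: "c mod vb P \<noteq> 0 \<Longrightarrow> merge_step P y (c, pool) x = ((c + 1, pool @ [x]), [])"
  by (simp_all add: merge_step_def)

lemma merge_step_burst:
  "length (snd (trun (merge_step P y) s ws)) + length (snd (fst (trun (merge_step P y) s ws))) = length (snd s) + length ws"
proof (induction ws arbitrary: s)
  case (Cons z ws)
  have "length (filter (\<lambda>y. z < y) (snd s)) + length (filter (\<lambda>y. y \<le> z) (snd s)) = length (snd s)"
    using sum_length_filter_compl[of "\<lambda>y. z < y" "snd s"] by (simp add: not_less)
  then show ?case
    using Cons.IH[of "(Suc (fst s), filter (\<lambda>y. z < y) (snd s) @ [z])"] Cons.IH[of "(Suc (fst s), snd s @ [z])"]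
    by (cases s, cases "fst s mod vb P = 0") (simp_all add: merge_step_start merge_step_mid)
qed simp

text \<open>The last conjunct describes the pool exactly. With \<open>t\<close> the block of the
  newest item, the pool holds the items of earlier blocks above the first item of block
  \<open>t\<close>, together with what has been read of block \<open>t\<close>. The bound on the
  size of the pool rests on this.\<close>

lemma merge_step_inv:
  assumes w: "w = vb P" "1 \<le> w" and xs: "\<And>i i'. i \<le> i' \<Longrightarrow> i' < length xs \<Longrightarrow> w dvd i \<Longrightarrow> xs ! i \<le> xs ! i'"
    and n: "n \<le> length xs" and tr: "trun (merge_step P y) (0, []) (take n xs) = ((c, pool), out)"
  shows "c = n \<and> sorted out \<and> mset out + mset pool = mset (take n xs) \<and>
    (\<forall>y\<in>set out. \<forall>i. n \<le> i \<and> i < length xs \<longrightarrow> y \<le> xs ! i) \<and> (\<forall>y\<in>set out. \<forall>z\<in>set pool. y \<le> z) \<and>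
    (1 \<le> n \<longrightarrow> (\<exists>t. t = (n - 1) div w \<and> mset pool = filter_mset (\<lambda>y. xs ! (t * w) < y) (mset (take (t * w) xs)) +
        mset (drop (t * w) (take n xs))))"
  using n tr
proof (induction n arbitrary: c pool out)
  case (Suc n)
  obtain c0 pool0 out0 where s0: "trun (merge_step P y) (0, []) (take n xs) = ((c0, pool0), out0)"
    by (metis prod.collapse)
  have nl: "n < length xs" using Suc.prems by simp
  have tS: "take (Suc n) xs = take n xs @ [xs ! n]" using nl by (rule take_Suc_conv_app_nth)
  note IH = Suc.IH[OF _ s0]
  have IH: "c0 = n" "sorted out0" "mset out0 + mset pool0 = mset (take n xs)"
    "\<forall>y\<in>set out0. \<forall>i. n \<le> i \<and> i < length xs \<longrightarrow> y \<le> xs ! i" "\<forall>y\<in>set out0. \<forall>z\<in>set pool0. y \<le> z"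
    "1 \<le> n \<longrightarrow> (\<exists>t. t = (n - 1) div w \<and> mset pool0 = filter_mset (\<lambda>y. xs ! (t * w) < y) (mset (take (t * w) xs)) +
        mset (drop (t * w) (take n xs)))" using IH nl by auto
  let ?x = "xs ! n"
  have out0x: "\<forall>y\<in>set out0. y \<le> ?x" using IH(4) nl by simp
  show ?case
  proof (cases "n mod w = 0")
    case True
    have res: "c = Suc n" "pool = filter (\<lambda>y. ?x < y) pool0 @ [?x]" "out = out0 @ sort (filter (\<lambda>y. y \<le> ?x) pool0)"
      using Suc.prems(2) s0 True IH(1) w unfolding tS by (simp_all add: trun_append merge_step_start)
    have "sorted out" using res IH(2,5) by (auto simp: sorted_append)
    moreover have "mset out + mset pool = mset (take (Suc n) xs)"
    proof -
      have "mset out + mset pool = mset out0 + (filter_mset (\<lambda>y. y \<le> ?x) (mset pool0) + filter_mset (\<lambda>y. \<not> y \<le> ?x) (mset pool0)) + {#?x#}"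
        unfolding res by (simp add: mset_filter not_le ac_simps)
      then show ?thesis unfolding tS multiset_partition[symmetric] using IH(3) by simp
    qed
    moreover have "\<forall>y\<in>set out. \<forall>i. Suc n \<le> i \<and> i < length xs \<longrightarrow> y \<le> xs ! i"
    proof (intro ballI allI impI)
      fix z i assume z: "z \<in> set out" and i: "Suc n \<le> i \<and> i < length xs"
      show "z \<le> xs ! i"
      proof (cases "z \<in> set out0")
        case False
        then have "z \<le> ?x" using z res by auto
        also have "?x \<le> xs ! i" using xs[of n i] i True by (simp add: mod_eq_0_iff_dvd)
        finally show ?thesis .
      qed (use IH(4) i in auto)
    qed
    moreover have "\<forall>y\<in>set out. \<forall>z\<in>set pool. y \<le> z"
      using res IH(5) out0x by (auto intro: order_trans less_imp_le)
    moreover have "\<exists>t. t = (Suc n - 1) div w \<and> mset pool = filter_mset (\<lambda>y. xs ! (t * w) < y) (mset (take (t * w) xs)) +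
        mset (drop (t * w) (take (Suc n) xs))"
    proof (intro exI conjI)
      have nw: "n div w * w = n" using True by (simp add: mod_eq_0_iff_dvd)
      \<comment> \<open>Items already written are at most the new block start, so filtering the pool
        gives the same as filtering everything read before.\<close>
      have "filter_mset (\<lambda>y. ?x < y) (mset out0) = {#}"
      proof -
        have "filter (\<lambda>y. ?x < y) out0 = []" using out0x by (auto simp: filter_empty_conv not_less)
        then show ?thesis by (simp flip: mset_filter)
      qed
      then have "filter_mset (\<lambda>y. ?x < y) (mset (take n xs)) = filter_mset (\<lambda>y. ?x < y) (mset pool0)"
        unfolding IH(3)[symmetric] by simp
      then show "mset pool = filter_mset (\<lambda>y. xs ! ((Suc n - 1) div w * w) < y) (mset (take ((Suc n - 1) div w * w) xs)) +
        mset (drop ((Suc n - 1) div w * w) (take (Suc n) xs))"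
        using nw nl by (simp add: res tS mset_filter)
    qed simp
    ultimately show ?thesis using res by blast
  next
    case False
    have res: "c = Suc n" "pool = pool0 @ [?x]" "out = out0"
      using Suc.prems(2) s0 False IH(1) w unfolding tS by (simp_all add: trun_append merge_step_mid)
    have n1: "1 \<le> n" using False by (cases n) auto
    have "mset out + mset pool = mset (take (Suc n) xs)" unfolding res tS using IH(3) by (simp add: add.assoc[symmetric])
    moreover have "\<forall>y\<in>set out. \<forall>z\<in>set pool. y \<le> z" using res IH(5) out0x by auto
    moreover have "\<exists>t. t = (Suc n - 1) div w \<and> mset pool = filter_mset (\<lambda>y. xs ! (t * w) < y) (mset (take (t * w) xs)) +
        mset (drop (t * w) (take (Suc n) xs))"
    proof -
      obtain t where t: "t = (n - 1) div w" "mset pool0 = filter_mset (\<lambda>y. xs ! (t * w) < y) (mset (take (t * w) xs)) +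
        mset (drop (t * w) (take n xs))" using IH(6) n1 by auto
      have "t = n div w" using t(1) False n1 div_Suc[of "n - 1" w] by simp
      moreover have "t * w \<le> n" using t(1) by (metis diff_le_self div_times_less_eq_dividend le_trans)
      ultimately show ?thesis using t(2) nl unfolding res tS by (auto simp: min_absorb2)
    qed
    moreover have "\<forall>y\<in>set out. \<forall>i. Suc n \<le> i \<and> i < length xs \<longrightarrow> y \<le> xs ! i" using IH(4) res by auto
    ultimately show ?thesis using res IH(2) by blast
  qed
qed simp

lemma filter_blocks:
  assumes "t * w \<le> length xs"
  shows "length (filter Q (take (t * w) xs)) \<le> card {s. s < t \<and> (\<exists>k<w. Q (xs ! (s * w + k)))} * w"
  using assms
proof (induction t)
  case (Suc t)
  let ?A = "{s. s < t \<and> (\<exists>k<w. Q (xs ! (s * w + k)))}" and ?B = "{s. s < Suc t \<and> (\<exists>k<w. Q (xs ! (s * w + k)))}"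
  let ?s = "take w (drop (t * w) xs)"
  have sp: "take (Suc t * w) xs = take (t * w) xs @ ?s" by (simp add: take_add[symmetric] add.commute)
  have IH: "length (filter Q (take (t * w) xs)) \<le> card ?A * w" using Suc by simp
  show ?case
  proof (cases "\<exists>k<w. Q (xs ! (t * w + k))")
    case True
    then have "?B = insert t ?A" by (auto simp: less_Suc_eq)
    then have "card ?B = Suc (card ?A)" by simp
    moreover have "length (filter Q ?s) \<le> w" by (rule le_trans[OF length_filter_le]) simp
    ultimately show ?thesis unfolding sp using IH by simp
  next
    case False
    then have "?B = ?A" by (auto simp: less_Suc_eq)
    moreover have "filter Q ?s = []"
    proof -
      have "\<forall>x\<in>set ?s. \<not> Q x"
      proof
        fix x assume "x \<in> set ?s"
        then obtain k where "k < length ?s" "x = ?s ! k" by (metis in_set_conv_nth)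
        then show "\<not> Q x" using False Suc.prems by auto
      qed
      then show ?thesis by (simp add: filter_empty_conv)
    qed
    ultimately show ?thesis unfolding sp using IH by simp
  qed
qed simp

text \<open>In the application \<open>r\<close> is the number of runs, each with at most one earlier
  block that still has pending items; the summand 1 is the block being read.\<close>

lemma merge_pool_length:
  assumes w: "w = vb P" "1 \<le> w" and xs: "\<And>i i'. i \<le> i' \<Longrightarrow> i' < length xs \<Longrightarrow> w dvd i \<Longrightarrow> xs ! i \<le> xs ! i'"
    and op: "\<And>t. t * w < length xs \<Longrightarrow> card {s. s < t \<and> (\<exists>k<w. xs ! (t * w) < xs ! (s * w + k))} \<le> r"
    and n: "n \<le> length xs"
  shows "length (snd (fst (trun (merge_step P y) (0, []) (take n xs)))) \<le> (r + 1) * w"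
proof (cases "n = 0")
  case False
  obtain c pool out where tr: "trun (merge_step P y) (0, []) (take n xs) = ((c, pool), out)" by (metis prod.collapse)
  define t where "t = (n - 1) div w"
  have mp: "mset pool = filter_mset (\<lambda>y. xs ! (t * w) < y) (mset (take (t * w) xs)) + mset (drop (t * w) (take n xs))"
    using merge_step_inv[OF w xs n tr] False by (auto simp: t_def)
  have tn: "t * w \<le> n - 1" by (simp add: t_def)
  have tl: "t * w < length xs" using tn False n by linarith
  have "n - 1 < (t + 1) * w" using w(2) dividend_less_div_times[of w "n - 1"] by (simp add: t_def)
  then have l2: "n - t * w \<le> w" by simp
  have "length pool = size (mset pool)" by simp
  also have "\<dots> = length (filter (\<lambda>y. xs ! (t * w) < y) (take (t * w) xs)) + (n - t * w)"
    unfolding mp using n by (simp add: mset_filter[symmetric] del: mset_filter)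
  also have "\<dots> \<le> card {s. s < t \<and> (\<exists>k<w. xs ! (t * w) < xs ! (s * w + k))} * w + w"
    using filter_blocks[of t w xs "\<lambda>y. xs ! (t * w) < y"] tl l2 by simp
  also have "\<dots> \<le> r * w + w" using op[OF tl] by simp
  finally show ?thesis using tr by simp
qed simp

lemma merge_result:
  assumes w: "w = vb P" "1 \<le> w" and xs: "\<And>i i'. i \<le> i' \<Longrightarrow> i' < length xs \<Longrightarrow> w dvd i \<Longrightarrow> xs ! i \<le> xs ! i'"
  shows "snd (trun (merge_step P y) (0, []) xs) @ sort (snd (fst (trun (merge_step P y) (0, []) xs))) = sort xs"
proof -
  obtain c pool out where tr: "trun (merge_step P y) (0, []) (take (length xs) xs) = ((c, pool), out)" by (metis prod.collapse)
  have i: "sorted out" "mset out + mset pool = mset xs" "\<forall>y\<in>set out. \<forall>z\<in>set pool. y \<le> z"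
    using merge_step_inv[OF w xs order_refl tr] by auto
  have "sorted (out @ sort pool)" using i by (auto simp: sorted_append)
  moreover have "mset (out @ sort pool) = mset xs" using i by simp
  ultimately have "out @ sort pool = sort xs" by (metis properties_for_sort)
  then show ?thesis using tr by simp
qed

section \<open>Merging one group of runs\<close>

lemma nums_power: "okm P \<Longrightarrow> x \<le> word_range P ^ 30 \<Longrightarrow> x \<in> nums P"
proof -
  assume a: "okm P" "x \<le> word_range P ^ 30"
  \<comment> \<open>The exponent \<open>20 * M\<close> is at least 40, because \<open>M\<close> is
    at least 2.\<close>
  have "word_range P ^ 30 < word_range P ^ (20 * mem_size P)"
    using okmD[OF a(1)] by (intro power_strict_increasing) auto
  then show ?thesis using a by (simp add: nums_def)
qed

lemma trig_valid:
  assumes "okm P" "x \<in> data_items P" "\<beta> < word_range P ^ 3" shows "trig P x \<beta> \<in> vitems P"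
proof -
  let ?W = "word_range P"
  have "\<beta> < ?W * ?W ^ 2" using assms(3) by (simp add: power3_eq_cube power2_eq_square)
  then have "\<beta> div ?W ^ 2 < ?W" by (rule less_mult_imp_div_less)
  moreover have "\<beta> div ?W mod ?W < ?W" "\<beta> mod ?W < ?W" using okmD(4)[OF assms(1)] by simp_all
  ultimately show ?thesis using assms(2) by (auto simp: trig_def vitems_def valid_item_def data_items_def)
qed

lemma data_items_vitems: "data_items P \<subseteq> vitems P"
  by (auto simp: data_items_def vitems_def valid_item_def)

lemma trig_step_burst: "length (snd (trun (trig_step P y) s ws)) \<le> length ws"
proof (induction ws arbitrary: s)
  case (Cons x ws)
  show ?case using Cons[of "Suc s"] by (simp add: trig_step_def)
qed simp

text \<open>Argument \<open>(a, K, L, tmp)\<close>: the \<open>K\<close> stripes at \<open>a\<close> consist of sorted runs of \<open>L\<close> stripes each.\<close>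

definition mgroup :: "machine \<Rightarrow> nat \<times> nat \<times> nat \<times> nat \<Rightarrow> unit prog" where
  "mgroup P x = (case x of (a, K, L, tmp) \<Rightarrow>
     scan nums trig_step (\<lambda>P y s. []) vu vu P ((), a, K, tmp, 0) \<bind> (\<lambda>_.
     nmerge P (tmp, K * vd P, L * vd P, tmp + K) \<bind> (\<lambda>_.
     permute P (a, tmp + K, tmp + 2 * K, K) \<bind> (\<lambda>_.
     scan (\<lambda>P. nums P \<times> item_lists P) merge_step (\<lambda>P y s. sort (snd s)) vu vu P ((), tmp + 2 * K, K, a, (0, [])) \<bind> (\<lambda>_.
     Ret ())))))"

lemma lean_mgroup: "lean (\<lambda>P x. mgroup P (g P x))"
  unfolding mgroup_def case_prod_beta
  by (intro lean_bind lean_scan_comp lean_nmerge lean_permute lean_Ret smallset_intros)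

text \<open>The excess load of \<open>r\<close> per window must be paid for by the length of a
  window. Since \<open>fan P * vb P\<close> is at most \<open>M\<close> and \<open>M\<close> at most
  \<open>2 * cap P * zs P\<close>, \<open>r\<close> is at most \<open>2 * cap P * vd P\<close>, so
  all full windows together cost at most \<open>2 * vd P * K1\<close>. One stripe of triggers serves
  \<open>vb P >= vd P\<close> target stripes, whence \<open>vd P * K1\<close> is of order
  \<open>K\<close>. The hypothesis \<open>r <= K\<close> covers the incomplete window.\<close>

lemma permute_cost:
  assumes ok: "okm P" and K: "1 \<le> K" and r: "r \<le> fan P" "r \<le> K" and K1: "K1 = cdiv (K * vd P) (zs P)"
  shows "K1 \<le> K" "(r + 1) * cdiv K1 (cap P) \<le> 7 * K"
proof -
  note v = virt[OF ok]
  have zv: "zs P = vb P * vd P" by (simp add: zs_def mult.commute)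
  have "K * vd P \<le> K * zs P" using v(4) by (simp add: zv)
  then show K1K: "K1 \<le> K" unfolding K1 by (rule cdiv_le) (use v in simp)
  let ?m = "K1 div cap P"
  have c: "cdiv K1 (cap P) \<le> ?m + 1" using cdiv_eq[of "cap P" K1] v(12) by simp
  have rm: "r * ?m \<le> 4 * K"
  proof (cases "?m = 0")
    case False
    then have K2: "2 \<le> K1" using v(12) by (meson div_less le_trans not_le)
    have "(K1 - 1) * zs P < K * vd P" using cdiv_less[OF v(8), of "K * vd P"] K K1 v(1) by (simp add: Suc_le_eq)
    then have "(K1 - 1) * vb P * vd P < K * vd P" by (simp only: zv mult.assoc)
    then have a1: "(K1 - 1) * vb P < K" by simp
    have "vd P * (K1 - 1) \<le> vb P * (K1 - 1)" using v(3) by (rule mult_le_mono1)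
    moreover have "vb P * (K1 - 1) < K" using a1 by (simp only: mult.commute)
    ultimately have a2: "vd P * (K1 - 1) \<le> K" by linarith
    have "vd P * K1 \<le> vd P * (2 * (K1 - 1))" using K2 by (intro mult_le_mono2) linarith
    also have "\<dots> = 2 * (vd P * (K1 - 1))" by simp
    finally have a3: "vd P * K1 \<le> 2 * K" using a2 by linarith
    have "fan P * vb P \<le> 2 * (cap P * zs P)" using v(14,15) by simp
    also have "\<dots> = 2 * cap P * vd P * vb P" by (simp add: zv)
    finally have f: "fan P \<le> 2 * cap P * vd P" using v(4) by simp
    have "r * ?m \<le> 2 * cap P * vd P * ?m" using r(1) f by (intro mult_le_mono1) simp
    also have "\<dots> = 2 * vd P * (cap P * ?m)" by simp
    also have "\<dots> \<le> 2 * vd P * K1" by (intro mult_le_mono2) simp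
    also have "\<dots> = 2 * (vd P * K1)" by (simp only: mult.assoc)
    also have "\<dots> \<le> 4 * K" using a3 by linarith
    finally show ?thesis .
  qed simp
  have "(r + 1) * cdiv K1 (cap P) \<le> (r + 1) * (?m + 1)" using c by (rule mult_le_mono2)
  also have "\<dots> = r * ?m + ?m + r + 1" by simp
  also have "\<dots> \<le> 4 * K + K + K + K"
    using rm r(2) K K1K le_trans[OF div_le_dividend K1K, of "cap P"] by (intro add_mono) auto
  finally show "(r + 1) * cdiv K1 (cap P) \<le> 7 * K" by simp
qed

text \<open>The constant 27 collects \<open>2 K\<close> for extracting the triggers,
  \<open>4 K\<close> for merging them, \<open>19 K\<close> for rearranging the blocks and
  \<open>2 K\<close> for the last pass. The scratch area has one part each for triggers, sorted
  triggers and rearranged blocks; the result overwrites the runs, whose items have all been copied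
  by then.\<close>

lemma wp_mgroup:
  assumes ok: "okm P" "disk_ok P d" and K: "1 \<le> K" "1 \<le> L" "K \<le> fan P * L" "K * zs P \<le> word_range P ^ 3"
    and xs: "xs = cont (vu P) d a K" "set xs \<subseteq> data_items P" "sorted_runs (L * zs P) xs"
    and tr: "a + K \<le> word_range P ^ 8" "tmp + 3 * K \<le> word_range P ^ 8" "{a..<a+K} \<inter> {tmp..<tmp+3*K} = {}"
  shows "wp P (mgroup P (a, K, L, tmp)) d (\<lambda>r d' t. cont (vu P) d' a K = sort xs \<and> disk_ok P d' \<and>
     same_off ({a..<a+K} \<union> {tmp..<tmp+3*K}) d d' \<and> t \<le> 27 * K)"
proof -
  let ?W = "word_range P" and ?w = "vb P" and ?Z = "zs P" and ?M = "mem_size P"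
  define n where "n = K * vd P"
  define l where "l = L * vd P"
  define K1 where "K1 = cdiv n ?Z"
  define r where "r = cdiv n l"
  note v = virt[OF ok(1)]
  have Zw: "?Z = vd P * ?w" by (simp add: zs_def)
  have lenxs: "length xs = n * ?w" using length_cont[OF ok(2)] xs(1) v(7) by (simp add: n_def Zw mult.assoc)
  have l1: "1 \<le> l" using K(2) v(1) by (simp add: l_def Suc_le_eq)
  have n1: "1 \<le> n" using K(1) v(1) by (simp add: n_def Suc_le_eq)
  have lw: "l * ?w = L * ?Z" by (simp add: l_def Zw mult.assoc)
  have K3: "K * ?Z \<le> ?W ^ 30"
    by (rule le_trans[OF K(4) power_increasing]) (use okmD(4)[OF ok(1)] in auto)
  have nW: "n \<le> K * ?Z" unfolding n_def using v(4) by (simp add: Zw)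
  interpret mb: merge_blocks P xs ?w n l
  proof
    show "length x = 4" if "x \<in> set xs" for x using that xs(2) by (auto simp: data_items_def)
    show "sorted_runs (l * ?w) xs" using xs(3) lw by simp
  qed (use v l1 lenxs in auto)
  have "K * vd P \<le> fan P * (L * vd P)" using mult_le_mono1[OF K(3), of "vd P"] by (simp add: mult.assoc)
  then have rf: "r \<le> fan P" unfolding r_def n_def l_def[symmetric] by (rule cdiv_le[OF _ l1])
  have "n \<le> K * l" unfolding n_def l_def using K(2) by simp
  then have rK: "r \<le> K" unfolding r_def by (rule cdiv_le[OF _ l1])
  note pc = permute_cost[OF ok(1) K(1) rf rK K1_def[unfolded n_def]]
  define trs where "trs = map (\<lambda>\<beta>. trig P (xs ! (\<beta> * ?w)) \<beta>) [0..<n]"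
  have trs_valid: "set trs \<subseteq> vitems P"
  proof
    fix x assume "x \<in> set trs"
    then obtain \<beta> where b: "\<beta> < n" "x = trig P (xs ! (\<beta> * ?w)) \<beta>" by (auto simp: trs_def)
    have "xs ! (\<beta> * ?w) \<in> data_items P" using mb.idx[of \<beta> 0] b v(4) xs(2) nth_mem by fastforce
    then show "x \<in> vitems P" using trig_valid[OF ok(1)] b nW K(4) by simp
  qed
  have S1: "wp P (scan nums trig_step (\<lambda>P y s. []) vu vu P ((), a, K, tmp, 0)) d
    (\<lambda>r d' t. cont (vu P) d' tmp K1 = pad ?Z trs \<and> disk_ok P d' \<and> same_off {tmp..<tmp+K1} d d' \<and> t \<le> K + K1)"
  proof (rule wp_mono[OF wp_scan[OF ok, where u = vu and v = vu and xs = xs and out = trs and K' = K1 and f' = "trig_step P ()"]], goal_cases)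
    case 7 then show ?case using trun_trig[OF ok(1), of "()" xs] lenxs v(4) by (simp add: trs_def)
  next
    case 8 then show ?case by (simp add: K1_def trs_def v(7))
  next
    case (9 ys ws)
    have "length ys \<le> K * ?Z" using arg_cong[OF 9, of length] lenxs by (simp add: n_def Zw mult.assoc)
    then show ?case using trun_trig[OF ok(1), of "()" ys] nums_power[OF ok(1), of "length ys"] K3 by simp
  next
    case (10 ys ws us)
    have "length (snd (trun (trig_step P ()) (fst (trun (trig_step P ()) 0 ys)) ws)) \<le> length ws" by (rule trig_step_burst)
    then show ?case using 10(2) v(7,9) by simp
  next
    case 15 then show ?case using tr(3) pc(1) by auto
  next
    case (16 r d' t) then show ?case unfolding v(7) by blast
  qed (use v xs tr trs_valid pc in auto)
  have S2: "wp P (nmerge P (tmp, n, l, tmp + K)) d1 (\<lambda>r d' t. cont (vu P) d' (tmp + K) K1 = pad ?Z (sort trs) \<and>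
     disk_ok P d' \<and> same_off {tmp + K..<tmp + K + K1} d1 d' \<and> t \<le> 4 * K)"
    if d1: "cont (vu P) d1 tmp K1 = pad ?Z trs" "disk_ok P d1" for d1
  proof -
    define X where "X = cont (vu P) d1 tmp K1"
    have tX: "take n X = trs" unfolding X_def d1(1) by (simp add: pad_def trs_def)
    have Xn: "X ! i = mb.tr i" if "i < n" for i
      using that tX nth_take[of i n X] by (simp add: trs_def mb.tr_def)
    \<comment> \<open>This is where a virtual block must have at least \<open>vd P\<close> items:
      \<open>K * vd P\<close> triggers are merged at one I/O per \<open>vb P\<close> of
      them.\<close>
    have ndv: "n div ?w \<le> K"
    proof -
      have "n \<le> K * ?w" unfolding n_def using v(3) by simp
      then have "n div ?w \<le> K * ?w div ?w" by (rule div_le_mono)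
      then show ?thesis using v(4) by simp
    qed
    have cost: "n div ?w + 2 * r + K1 \<le> 4 * K" using ndv rK pc(1) by linarith
    have nW3: "n \<le> ?W ^ 3" using nW K(4) by simp
    have W38: "?W ^ 3 < ?W ^ 8" using okmD(4)[OF ok(1)] by (intro power_strict_increasing) auto
    have KZ: "K \<le> K * ?Z" using v(8) by simp
    show ?thesis
    proof (rule wp_mono[OF wp_nmerge[OF ok(1) d1(2) n1 l1 _ _ X_def, where K' = K1]], goal_cases)
      case 1 then show ?case using cdiv_ge[OF v(8), of n] by (simp add: K1_def)
    next
      case 2 then show ?case using nW3 W38 by simp
    next
      case 3 then show ?case using rf by (simp add: r_def)
    next
      case (4 j i i')
      have i'n: "i' < n" using 4(4) by (simp add: runhi_def)
      have "i div l = j" "i' div l = j" using 4 by (auto simp: runhi_def intro!: div_nat_eqI simp: mult.commute)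
      then show ?case using mb.tr_run_less[of i i'] Xn i'n 4(3) by (cases "i = i'") auto
    next
      case 5 then show ?case by (rule K1_def)
    next
      case 9
      have "n div ?w + 2 * cdiv n l + K1 \<le> 4 * (K * ?Z)" unfolding r_def[symmetric] using cost KZ by linarith
      also have "\<dots> \<le> 2 ^ 2 * ?W ^ 3" using K(4) by simp
      also have "\<dots> \<le> ?W ^ 2 * ?W ^ 3" using okmD(4)[OF ok(1)] by (intro mult_le_mono1 power_mono) auto
      also have "\<dots> = ?W ^ 5" by (simp flip: power_add)
      also have "\<dots> \<le> ?W ^ 30" using okmD(4)[OF ok(1)] by (intro power_increasing) auto
      finally show ?case by (rule nums_power[OF ok(1)])
    next
      case (10 r' d' t) then show ?case using cost tX by (auto simp: r_def)
    qed (use tr pc in auto)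
  qed
  have S3: "wp P (permute P (a, tmp + K, tmp + 2 * K, K)) d2 (\<lambda>r d' t. cont (vu P) d' (tmp + 2 * K) K = mb.ys \<and>
     disk_ok P d' \<and> same_off {tmp + 2 * K..<tmp + 2 * K + K} d2 d' \<and> t \<le> 19 * K)"
    if d2: "cont (vu P) d2 (tmp + K) K1 = pad ?Z (sort trs)" "disk_ok P d2" "cont (vu P) d2 a K = xs" for d2
  proof -
    have bs: "map (trig_block P) (take n (cont (vu P) d2 (tmp + K) K1)) = guide P ?w n xs"
    proof -
      have "length trs = n" by (simp add: trs_def)
      then show ?thesis unfolding d2(1) guide_def trs_def[symmetric] by (simp add: pad_def)
    qed
    have c19: "K1 + 4 * K + 2 * (r + 1) * cdiv K1 (cap P) \<le> 19 * K"
    proof -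
      have "2 * (r + 1) * cdiv K1 (cap P) = 2 * ((r + 1) * cdiv K1 (cap P))" by (simp only: mult.assoc)
      then show ?thesis using pc by linarith
    qed
    show ?thesis
    proof (rule wp_mono[OF wp_permute[OF ok(1) d2(2) K(1) K1_def[unfolded n_def] bs[symmetric, unfolded n_def], where \<rho> = r]], goal_cases)
      case 1 then show ?case using mb.set_bs by (auto simp: n_def)
    next
      case (2 w' u') then show ?case using mb.window_load[OF v(1)] unfolding r_def n_def by blast
    next
      case 8
      have "K \<le> K * ?Z" using v(8) by simp
      then have "K \<le> ?W ^ 3" using K(4) by (rule le_trans)
      then have "19 * K \<le> 2 ^ 5 * ?W ^ 3" by simp
      also have "\<dots> \<le> ?W ^ 5 * ?W ^ 3" using okmD(4)[OF ok(1)] by (intro mult_le_mono1 power_mono) auto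
      also have "\<dots> = ?W ^ 8" by (simp flip: power_add)
      finally show ?case using c19 nums_le[OF ok(1)] le_trans by blast
    next
      case (9 r' d' t)
      have "cont (vu P) d' (tmp + 2 * K) K = concat (map (blk P d' (tmp + 2 * K)) [0..<n])"
        unfolding n_def by (rule cont_blk[OF v(1)])
      also have "map (blk P d' (tmp + 2 * K)) [0..<n] = map (\<lambda>e. take ?w (drop (guide P ?w n xs ! e * ?w) xs)) [0..<n]"
      proof (rule map_cong[OF refl])
        fix e assume "e \<in> set [0..<n]"
        then have e: "e < n" by simp
        have "blk P d' (tmp + 2 * K) e = blk P d2 a (guide P ?w n xs ! e)" using 9 e by (simp add: n_def)
        also have "\<dots> = take ?w (drop (guide P ?w n xs ! e * ?w) xs)"
          using blk_in_cont[OF ok(1) d2(2), of "guide P ?w n xs ! e" K a] mb.bs_less[OF e] d2(3) by (simp add: n_def)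
        finally show "blk P d' (tmp + 2 * K) e = take ?w (drop (guide P ?w n xs ! e * ?w) xs)" .
      qed
      finally show ?case using 9 c19 by (auto simp: mb.ys_def)
    qed (use tr pc in auto)
  qed
  have S4: "wp P (scan (\<lambda>P. nums P \<times> item_lists P) merge_step (\<lambda>P y s. sort (snd s)) vu vu P ((), tmp + 2 * K, K, a, (0, []))) d3
     (\<lambda>r d' t. cont (vu P) d' a K = sort xs \<and> disk_ok P d' \<and> same_off {a..<a+K} d3 d' \<and> t \<le> 2 * K)"
    if d3: "cont (vu P) d3 (tmp + 2 * K) K = mb.ys" "disk_ok P d3" for d3
  proof -
    have lys: "length mb.ys = K * ?Z" using mb.length_ys by (simp add: n_def Zw mult.assoc)
    have sy: "sort mb.ys = sort xs" using mb.mset_ys by (metis properties_for_sort sorted_sort mset_sort)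
    have yv: "set mb.ys \<subseteq> vitems P" using mb.mset_ys xs(2) data_items_vitems by (metis set_mset_mset subset_trans)
    have pool: "length (snd (fst (trun (merge_step P ()) (0, []) ys))) \<le> 2 * ?M \<and>
        set (snd (fst (trun (merge_step P ()) (0, []) ys))) \<subseteq> vitems P \<and> fst (fst (trun (merge_step P ()) (0, []) ys)) = length ys"
      if ys: "mb.ys = ys @ ws" for ys ws
    proof -
      have tk: "ys = take (length ys) mb.ys" and le: "length ys \<le> length mb.ys" using ys by auto
      have "length (snd (fst (trun (merge_step P ()) (0, []) (take (length ys) mb.ys)))) \<le> (r + 1) * ?w"
      proof (rule merge_pool_length[OF refl v(4) mb.ys_block_start_le _ le])
        fix t assume "t * ?w < length mb.ys"
        then have "t < n" using mb.length_ys by simp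
        then show "card {s. s < t \<and> (\<exists>k<?w. mb.ys ! (t * ?w) < mb.ys ! (s * ?w + k))} \<le> r"
          using mb.ys_open_blocks by (simp add: r_def)
      qed
      also have "\<dots> \<le> (fan P + fan P) * ?w" using rf v(1,11) by (intro mult_le_mono1) simp
      also have "\<dots> \<le> 2 * ?M" using v(15) by (simp add: add_mult_distrib)
      finally have 1: "length (snd (fst (trun (merge_step P ()) (0, []) ys))) \<le> 2 * ?M" using tk by simp
      obtain c pool out where tp: "trun (merge_step P ()) (0, []) (take (length ys) mb.ys) = ((c, pool), out)" by (metis prod.collapse)
      have m: "c = length ys" "mset out + mset pool = mset ys"
        using merge_step_inv[OF refl v(4) mb.ys_block_start_le le tp] tk by auto
      have "set pool \<subseteq> set ys" using m(2) by (metis set_mset_mset set_mset_union Un_upper2)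
      then show ?thesis using 1 m(1) tp tk yv ys by auto
    qed
    show ?thesis
    proof (rule wp_mono[OF wp_scan[OF ok(1) d3(2), where u = vu and v = vu and xs = mb.ys and out = "sort xs" and K' = K and f' = "merge_step P ()"]], goal_cases)
      case 7 then show ?case using merge_result[OF refl v(4) mb.ys_block_start_le, where y = "()"] sy by simp
    next
      case 8 then show ?case using lenxs v(7,8) by (simp add: n_def Zw mult.assoc)
    next
      case (9 ys ws)
      have "length ys \<le> K * ?Z" using arg_cong[OF 9, of length] lys by simp
      then show ?case using pool[OF 9] nums_power[OF ok(1), of "length ys"] K3 by (auto simp: item_lists_def mem_Times_iff)
    next
      case (10 ys ws us)
      have "length (snd (trun (merge_step P ()) (fst (trun (merge_step P ()) (0, []) ys)) ws)) \<le>
         length (snd (fst (trun (merge_step P ()) (0, []) ys))) + length ws"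
        using merge_step_burst[of P "()" "fst (trun (merge_step P ()) (0, []) ys)" ws] by linarith
      then show ?case using pool[OF 10(1)] 10(2) v(7,9) by simp
    next
      case 11 then show ?case using pool[of mb.ys "[]"] by simp
    next
      case 12 then show ?case using xs(2) data_items_vitems by auto
    next
      case 15 then show ?case using tr(3) by auto
    next
      case (16 r d' t)
      have "length (sort xs) = K * ?Z" using lenxs by (simp add: n_def Zw mult.assoc)
      then show ?case using 16 pad_full[OF v(8), of "sort xs" K] v(7) by auto
    qed (use v d3 tr in auto)
  qed
  show ?thesis unfolding mgroup_def prod.case n_def[symmetric] l_def[symmetric]
  proof (rule wp_bindI[OF S1], rule wp_bindI[OF S2])
    fix r1 d1 t1 assume 1: "cont (vu P) d1 tmp K1 = pad ?Z trs \<and> disk_ok P d1 \<and> same_off {tmp..<tmp+K1} d d1 \<and> t1 \<le> K + K1"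
    show "cont (vu P) d1 tmp K1 = pad ?Z trs" "disk_ok P d1" using 1 by auto
    fix r2 d2 t2 assume 2: "cont (vu P) d2 (tmp + K) K1 = pad ?Z (sort trs) \<and> disk_ok P d2 \<and> same_off {tmp + K..<tmp + K + K1} d1 d2 \<and> t2 \<le> 4 * K"
    have off12: "same_off {tmp..<tmp+3*K} d d2"
      by (rule same_off_trans[of "{tmp..<tmp+K1}" _ d1 "{tmp + K..<tmp + K + K1}"]) (use 1 2 pc(1) in auto)
    have ca: "cont (vu P) d2 a K = xs" unfolding xs(1) by (rule cont_same_off[OF off12]) (use tr(3) in auto)
    show "wp P (permute P (a, tmp + K, tmp + 2 * K, K) \<bind> (\<lambda>_. scan (\<lambda>P. nums P \<times> item_lists P) merge_step (\<lambda>P y s. sort (snd s)) vu vu P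
        ((), tmp + 2 * K, K, a, 0, []) \<bind> (\<lambda>_. Ret ()))) d2 (\<lambda>r' d'' t'. cont (vu P) d'' a K = sort xs \<and> disk_ok P d'' \<and>
          same_off ({a..<a + K} \<union> {tmp..<tmp + 3 * K}) d d'' \<and> t1 + (t2 + t') \<le> 27 * K)"
    proof (rule wp_bindI[OF S3[OF conjunct1[OF 2] conjunct1[OF conjunct2[OF 2]] ca]], rule wp_bindI[OF S4])
      fix r3 d3 t3 assume 3: "cont (vu P) d3 (tmp + 2 * K) K = mb.ys \<and> disk_ok P d3 \<and> same_off {tmp + 2 * K..<tmp + 2 * K + K} d2 d3 \<and> t3 \<le> 19 * K"
      show "cont (vu P) d3 (tmp + 2 * K) K = mb.ys" "disk_ok P d3" using 3 by auto
      fix r4 d4 t4 assume 4: "cont (vu P) d4 a K = sort xs \<and> disk_ok P d4 \<and> same_off {a..<a+K} d3 d4 \<and> t4 \<le> 2 * K"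
      have "same_off {tmp..<tmp+3*K} d d3" by (rule same_off_trans[OF off12, of "{tmp + 2 * K..<tmp + 2 * K + K}"]) (use 3 in auto)
      then have "same_off ({a..<a + K} \<union> {tmp..<tmp + 3 * K}) d d4" by (rule same_off_trans[of _ _ _ "{a..<a+K}"]) (use 4 in auto)
      then show "wp P (Ret ()) d4 (\<lambda>r' d'' t'. cont (vu P) d'' a K = sort xs \<and> disk_ok P d'' \<and>
          same_off ({a..<a + K} \<union> {tmp..<tmp + 3 * K}) d d'' \<and> t1 + (t2 + (t3 + (t4 + t'))) \<le> 27 * K)"
        using 1 2 3 4 pc(1) by simp
    qed
  qed
qed

section \<open>Sorting\<close>

text \<open>Run formation needs disjoint source and target, so the array is first copied away; this
  lets sorting end in the area where it started.\<close>

definition copy_step :: "machine \<Rightarrow> unit \<Rightarrow> unit \<Rightarrow> item \<Rightarrow> unit \<times> item list" where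
  "copy_step P y s x = ((), [x])"

lemma trun_copy: "snd (trun (copy_step P y) s xs) = xs"
  by (induction xs arbitrary: s) (auto simp: copy_step_def)

definition chunk_step :: "machine \<Rightarrow> unit \<Rightarrow> item list \<Rightarrow> item \<Rightarrow> item list \<times> item list" where
  "chunk_step P y s x = (if length s + 1 = cap P * zs P then ([], sort (s @ [x])) else (s @ [x], []))"

function csort :: "nat \<Rightarrow> item list \<Rightarrow> item list" where
  "csort C xs = (if C = 0 \<or> length xs < C then sort xs else sort (take C xs) @ csort C (drop C xs))"
  by auto
termination by (relation "measure (\<lambda>(C, xs). length xs)") auto

declare csort.simps [simp del]

lemma trun_chunk:
  assumes "length s < cap P * zs P"
  shows "snd (trun (chunk_step P y) s xs) @ sort (fst (trun (chunk_step P y) s xs)) = csort (cap P * zs P) (s @ xs)"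
  using assms
proof (induction xs arbitrary: s)
  case Nil
  then show ?case by (simp add: csort.simps)
next
  case (Cons x xs)
  let ?C = "cap P * zs P"
  have "0 < ?C" using Cons.prems by linarith
  then have C0: "length ([] :: item list) < ?C" by (simp only: list.size)
  show ?case
  proof (cases "length s + 1 = ?C")
    case True
    have "csort ?C (s @ x # xs) = sort (s @ [x]) @ csort ?C xs"
      using True by (subst csort.simps) (simp flip: True)
    then show ?thesis using True Cons.IH[OF C0] by (simp add: chunk_step_def)
  next
    case False
    then show ?thesis using Cons.IH[of "s @ [x]"] Cons.prems by (simp add: chunk_step_def)
  qed
qed

lemma chunk_state:
  assumes "length s < cap P * zs P"
  shows "length (fst (trun (chunk_step P y) s xs)) < cap P * zs P \<and> set (fst (trun (chunk_step P y) s xs)) \<subseteq> set s \<union> set xs \<and>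
    length (snd (trun (chunk_step P y) s xs)) \<le> length s + length xs"
  using assms
proof (induction xs arbitrary: s)
  case (Cons x xs)
  have "0 < cap P * zs P" using Cons.prems by linarith
  then have C0: "length ([] :: item list) < cap P * zs P" by (simp only: list.size)
  show ?case
  proof (cases "length s + 1 = cap P * zs P")
    case True
    then show ?thesis using Cons.IH[OF C0] by (auto simp: chunk_step_def)
  next
    case False
    then show ?thesis using Cons.IH[of "s @ [x]"] Cons.prems by (auto simp: chunk_step_def)
  qed
qed simp

lemma csort_props: "1 \<le> C \<Longrightarrow> mset (csort C xs) = mset xs \<and> length (csort C xs) = length xs \<and> sorted_runs C (csort C xs)"
proof (induction C xs rule: csort.induct)
  case (1 C xs)
  show ?case
  proof (cases "length xs < C")
    case True
    have "sorted (take C (drop (j * C) (sort xs)))" for j by (simp add: sorted_wrt_take sorted_wrt_drop)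
    then show ?thesis using True by (simp add: csort.simps sorted_runs_def)
  next
    case False
    have IH: "mset (csort C (drop C xs)) = mset (drop C xs)" "length (csort C (drop C xs)) = length (drop C xs)"
      "sorted_runs C (csort C (drop C xs))" using 1 False by auto
    have eq: "csort C xs = sort (take C xs) @ csort C (drop C xs)" using False 1(2) by (subst csort.simps) simp
    have "sorted (take C (drop (j * C) (csort C xs)))" for j
    proof (cases j)
      case 0
      then show ?thesis using False by (simp add: eq)
    next
      case (Suc i)
      then show ?thesis using IH(3) False by (simp add: eq sorted_runs_def)
    qed
    moreover have "mset (csort C xs) = mset xs" using IH(1) by (simp add: eq) (metis append_take_drop_id mset_append)
    ultimately show ?thesis using IH(2) False by (simp add: eq sorted_runs_def)
  qed
qed

lemma sorted_runs_sub: "sorted_runs c xs \<Longrightarrow> sorted_runs c (take m (drop (i * c) xs))"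
proof -
  assume a: "sorted_runs c xs"
  have "take c (drop (j * c) (take m (drop (i * c) xs))) = take (m - j * c) (take c (drop ((i + j) * c) xs))" for j
    by (simp add: drop_take min.commute add_mult_distrib add.commute)
  moreover have "sorted (take c (drop ((i + j) * c) xs))" for j using a by (simp add: sorted_runs_def)
  ultimately show ?thesis unfolding sorted_runs_def by (simp only: sorted_wrt_take simp_thms)
qed

lemma sorted_runs_append:
  assumes "sorted_runs c xs" "length xs = j * c" "sorted ys" "length ys \<le> c"
  shows "sorted_runs c (xs @ ys)"
  unfolding sorted_runs_def
proof
  fix i
  consider "i < j" | "i = j" | "j < i" by linarith
  then show "sorted (take c (drop (i * c) (xs @ ys)))"
  proof cases
    case 1
    then have "Suc i * c \<le> j * c" by (intro mult_le_mono1) simp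
    then show ?thesis using assms(1,2) by (simp add: sorted_runs_def)
  next
    case 2
    then show ?thesis using assms by (simp add: sorted_wrt_take)
  next
    case 3
    then have "Suc j * c \<le> i * c" by (intro mult_le_mono1) simp
    then have "length xs \<le> i * c" "length ys \<le> i * c - length xs"
      using assms(2,4) unfolding mult_Suc by linarith+
    then show ?thesis by simp
  qed
qed

definition level :: "machine \<Rightarrow> nat \<times> nat \<times> nat \<times> nat \<Rightarrow> nat prog" where
  "level P x = (case x of (a, K, L, tmp) \<Rightarrow>
     while P (nums P) (\<lambda>o'. o' < K) (\<lambda>o'. mgroup P (a + o', min (fan P * L) (K - o'), L, tmp) \<bind> (\<lambda>_. Ret (o' + fan P * L))) 0)"

lemma lean_level: "lean (\<lambda>P x. level P (g P x))"
  unfolding level_def case_prod_beta by (intro lean_while lean_bind lean_mgroup lean_Ret smallset_intros)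

lemma wp_level:
  assumes ok: "okm P" "disk_ok P d" and L: "1 \<le> L" "K * zs P \<le> word_range P ^ 3"
    and xs: "xs = cont (vu P) d a K" "set xs \<subseteq> data_items P" "sorted_runs (L * zs P) xs"
    and tr: "a + K \<le> word_range P ^ 8" "tmp + 3 * K \<le> word_range P ^ 8" "{a..<a+K} \<inter> {tmp..<tmp+3*K} = {}"
  shows "wp P (level P (a, K, L, tmp)) d (\<lambda>r d' t. mset (cont (vu P) d' a K) = mset xs \<and>
     sorted_runs (fan P * L * zs P) (cont (vu P) d' a K) \<and> disk_ok P d' \<and>
     same_off ({a..<a+K} \<union> {tmp..<tmp+3*K}) d d' \<and> t \<le> 27 * K)"
proof -
  let ?Z = "zs P" and ?W = "word_range P"
  define G where "G = fan P * L"
  note v = virt[OF ok(1)]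
  have G1: "1 \<le> G" using v(1,11) L(1) by (simp add: G_def Suc_le_eq)
  have len: "length (cont (vu P) d' a' K') = K' * ?Z" if "disk_ok P d'" for d' a' K'
    using length_cont[OF that] v(7) by simp
  have lxs: "length xs = K * ?Z" using len[OF ok(2)] xs(1) by simp
  let ?F = "{a..<a+K} \<union> {tmp..<tmp+3*K}"
  \<comment> \<open>The counter advances by \<open>G\<close> and may pass \<open>K\<close> in the
    last iteration, hence \<open>min q K\<close>.\<close>
  define I where "I q d' \<longleftrightarrow> disk_ok P d' \<and> same_off ?F d d' \<and> (\<exists>j. q = j * G) \<and>
     cont (vu P) d' (a + min q K) (K - q) = drop (q * ?Z) xs \<and> mset (cont (vu P) d' a (min q K)) = mset (take (q * ?Z) xs) \<and>
     sorted_runs (G * ?Z) (cont (vu P) d' a (min q K))" for q d'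
  define \<Phi> where "\<Phi> q = 27 * (K - q)" for q
  have W3: "K \<le> ?W ^ 3"
  proof -
    have "K \<le> K * ?Z" using v(8) by simp
    then show ?thesis using L(2) by (rule le_trans)
  qed
  have W8: "27 * K \<le> ?W ^ 8"
  proof -
    have "27 * K \<le> 2 ^ 5 * ?W ^ 3" using W3 by simp
    also have "\<dots> \<le> ?W ^ 5 * ?W ^ 3" using okmD(4)[OF ok(1)] by (intro mult_le_mono1 power_mono) auto
    also have "\<dots> = ?W ^ 8" by (simp flip: power_add)
    finally show ?thesis .
  qed
  have "wp P (level P (a, K, L, tmp)) d (\<lambda>q d' t. I q d' \<and> \<not> q < K \<and> t + \<Phi> q \<le> \<Phi> 0)"
    unfolding level_def prod.case G_def[symmetric]
  proof (rule wp_while)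
    show "I 0 d" using ok xs by (auto simp: I_def sorted_runs_def)
    show "\<Phi> 0 \<le> ?W ^ (20 * mem_size P)" using nums_le[OF ok(1) W8] by (simp add: \<Phi>_def nums_def)
  next
    fix q d1 assume I: "I q d1" and q: "q < K"
    obtain j where j: "q = j * G" using I by (auto simp: I_def)
    have d1: "disk_ok P d1" "same_off ?F d d1" "cont (vu P) d1 (a + q) (K - q) = drop (q * ?Z) xs"
      "mset (cont (vu P) d1 a q) = mset (take (q * ?Z) xs)" "sorted_runs (G * ?Z) (cont (vu P) d1 a q)"
      using I q by (auto simp: I_def)
    define k where "k = min G (K - q)"
    have k: "1 \<le> k" "k \<le> G" "q + k \<le> K" using q G1 by (auto simp: k_def)
    have gs: "cont (vu P) d1 (a + q) k = take (k * ?Z) (drop (q * ?Z) xs)"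
      "cont (vu P) d1 (a + q + k) (K - q - k) = drop (k * ?Z) (drop (q * ?Z) xs)"
    proof -
      have "cont (vu P) d1 (a + q) (k + (K - q - k)) = cont (vu P) d1 (a + q) k @ cont (vu P) d1 (a + q + k) (K - q - k)"
        by (rule cont_add)
      moreover have "k + (K - q - k) = K - q" using k by simp
      ultimately have "drop (q * ?Z) xs = cont (vu P) d1 (a + q) k @ cont (vu P) d1 (a + q + k) (K - q - k)" using d1(3) by simp
      moreover have "length (cont (vu P) d1 (a + q) k) = k * ?Z" by (rule len[OF d1(1)])
      ultimately show "cont (vu P) d1 (a + q) k = take (k * ?Z) (drop (q * ?Z) xs)"
        "cont (vu P) d1 (a + q + k) (K - q - k) = drop (k * ?Z) (drop (q * ?Z) xs)" by simp_all
    qed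
    let ?g = "take (k * ?Z) (drop (q * ?Z) xs)"
    have sg: "sorted_runs (L * ?Z) ?g"
    proof -
      \<comment> \<open>Groups start at multiples of \<open>fan P * L\<close> stripes, hence at
        boundaries of runs.\<close>
      have "q * ?Z = (j * fan P) * (L * ?Z)" by (simp add: j G_def)
      then show ?thesis by (simp only: sorted_runs_sub[OF xs(3)])
    qed
    have kZ: "k * ?Z \<le> ?W ^ 3" using k(3) by (intro le_trans[OF mult_le_mono1 L(2)]) simp
    have "wp P (mgroup P (a + q, k, L, tmp) \<bind> (\<lambda>_. Ret (q + G))) d1 (\<lambda>s' d' t. I s' d' \<and> t + \<Phi> s' \<le> \<Phi> q \<and> \<Phi> s' < \<Phi> q)"
    proof (rule wp_bindI[OF wp_mgroup[OF ok(1) d1(1) k(1) L(1) _ kZ gs(1)[symmetric] _ sg]])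
      show "k \<le> fan P * L" using k by (simp add: G_def)
      show "set ?g \<subseteq> data_items P" using xs(2) by (auto dest!: in_set_takeD in_set_dropD)
      show "a + q + k \<le> ?W ^ 8" "tmp + 3 * k \<le> ?W ^ 8" using tr k by auto
      show "{a + q..<a + q + k} \<inter> {tmp..<tmp + 3 * k} = {}" using tr(3) k by fastforce
    next
      fix r d2 t assume 2: "cont (vu P) d2 (a + q) k = sort ?g \<and> disk_ok P d2 \<and>
        same_off ({a + q..<a + q + k} \<union> {tmp..<tmp + 3 * k}) d1 d2 \<and> t \<le> 27 * k"
      have off: "same_off ?F d d2" by (rule same_off_trans[OF d1(2), of "{a + q..<a + q + k} \<union> {tmp..<tmp + 3 * k}"]) (use 2 k in auto)
      have dj: "({a + q..<a + q + k} \<union> {tmp..<tmp + 3 * k}) \<inter> {a..<a+q} = {}"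
        "({a + q..<a + q + k} \<union> {tmp..<tmp + 3 * k}) \<inter> {a+q+k..<a+q+k+(K-q-k)} = {}" using tr(3) k by fastforce+
      have c1: "cont (vu P) d2 a q = cont (vu P) d1 a q" using 2 dj(1) by (intro cont_same_off) auto
      have c2: "cont (vu P) d2 (a + q + k) (K - q - k) = drop (k * ?Z) (drop (q * ?Z) xs)"
        unfolding gs(2)[symmetric] using 2 dj(2) by (intro cont_same_off) auto
      have mq: "min (q + G) K = q + k" "K - (q + G) = K - q - k" using q by (auto simp: k_def)
      have c12: "cont (vu P) d2 a (q + k) = cont (vu P) d1 a q @ sort ?g" unfolding cont_add c1 using 2 by simp
      have t1: "take ((q + G) * ?Z) xs = take (q * ?Z) xs @ ?g"
      proof -
        have "take ((q + G) * ?Z) xs = take ((q + k) * ?Z) xs"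
        proof (cases "k = G")
          case False
          then have "q + k = K" using q by (auto simp: k_def)
          moreover have "K * ?Z \<le> (q + G) * ?Z" using k_def \<open>q + k = K\<close> by (intro mult_le_mono1) simp
          ultimately show ?thesis using lxs by simp
        qed simp
        then show ?thesis by (simp add: add_mult_distrib take_add)
      qed
      have t2: "drop ((q + G) * ?Z) xs = drop (k * ?Z) (drop (q * ?Z) xs)"
      proof (cases "k = G")
        case False
        then have qk: "q + k = K" using q by (auto simp: k_def)
        then have "K * ?Z \<le> (q + G) * ?Z" using k_def by (intro mult_le_mono1) simp
        moreover have "k * ?Z + q * ?Z = K * ?Z" using qk by (metis add.commute add_mult_distrib)
        ultimately show ?thesis using lxs by (simp add: add.commute)
      qed (simp add: add_mult_distrib add.commute)
      have "sorted_runs (G * ?Z) (cont (vu P) d1 a q @ sort ?g)"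
      proof (rule sorted_runs_append[OF d1(5)])
        show "length (cont (vu P) d1 a q) = j * (G * ?Z)" using len[OF d1(1)] by (simp add: j)
        have "length (sort ?g) \<le> k * ?Z" by simp
        also have "\<dots> \<le> G * ?Z" using k(2) by (rule mult_le_mono1)
        finally show "length (sort ?g) \<le> G * ?Z" .
      qed simp
      moreover have "mset (cont (vu P) d1 a q @ sort ?g) = mset (take (q * ?Z) xs @ ?g)" using d1(4) by simp
      moreover have "\<exists>j'. q + G = j' * G" using j by (intro exI[of _ "Suc j"]) simp
      ultimately have "I (q + G) d2" unfolding I_def mq c12 t1 t2 using off 2 c2 by (auto simp: add.assoc)
      moreover have "t + \<Phi> (q + G) \<le> \<Phi> q" "\<Phi> (q + G) < \<Phi> q" unfolding \<Phi>_def mq(2) using 2 k by auto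
      ultimately show "wp P (Ret (q + G)) d2 (\<lambda>r' d'' t'. I r' d'' \<and> t + t' + \<Phi> r' \<le> \<Phi> q \<and> \<Phi> r' < \<Phi> q)" by simp
    qed
    moreover have "q \<in> nums P" using nums_le[OF ok(1), of q] q W8 by simp
    ultimately show "q \<in> nums P \<and> wp P (mgroup P (a + q, min G (K - q), L, tmp) \<bind> (\<lambda>_. Ret (q + G))) d1
      (\<lambda>s' d' t. I s' d' \<and> t + \<Phi> s' \<le> \<Phi> q \<and> \<Phi> s' < \<Phi> q)" unfolding k_def by blast
  qed
  then show ?thesis
  proof (rule wp_mono)
    fix q d' t assume *: "I q d' \<and> \<not> q < K \<and> t + \<Phi> q \<le> \<Phi> 0"
    then have "K * ?Z \<le> q * ?Z" by (intro mult_le_mono1) simp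
    then have tk: "take (q * ?Z) xs = xs" using lxs by simp
    have mK: "min q K = K" using * by simp
    show "mset (cont (vu P) d' a K) = mset xs \<and> sorted_runs (fan P * L * ?Z) (cont (vu P) d' a K) \<and> disk_ok P d' \<and>
     same_off ?F d d' \<and> t \<le> 27 * K" using * unfolding I_def tk mK \<Phi>_def G_def by auto
  qed
qed

section \<open>Levels of merging and the whole sort\<close>

definition nlev :: "machine \<Rightarrow> nat \<Rightarrow> nat \<Rightarrow> nat" where
  "nlev P K L = (LEAST i. K \<le> L * fan P ^ i)"

lemma nlev_ex: "okm P \<Longrightarrow> 1 \<le> L \<Longrightarrow> K \<le> L * fan P ^ K"
proof -
  assume a: "okm P" "1 \<le> L"
  have "2 \<le> fan P" using virt(1,11)[OF a(1)] by simp
  have "K \<le> 2 ^ K" using less_exp[of K] by simp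
  also have "\<dots> \<le> fan P ^ K" using \<open>2 \<le> fan P\<close> by (rule power_mono) simp
  also have "\<dots> \<le> L * fan P ^ K" using a(2) by simp
  finally show ?thesis .
qed

lemma nlev_Suc: "okm P \<Longrightarrow> 1 \<le> L \<Longrightarrow> L < K \<Longrightarrow> nlev P K L = Suc (nlev P K (L * fan P))"
  unfolding nlev_def
  using Least_Suc[of "\<lambda>i. K \<le> L * fan P ^ i" K] nlev_ex[of P L K] by (simp add: mult.assoc)

lemma nlev_le: "okm P \<Longrightarrow> 1 \<le> L \<Longrightarrow> nlev P K L \<le> K"
  unfolding nlev_def by (rule Least_le) (rule nlev_ex)

lemma nlev_0: "K \<le> L \<Longrightarrow> nlev P K L = 0"
  by (simp add: nlev_def)

definition sort_arr :: "machine \<Rightarrow> nat \<times> nat \<times> nat \<Rightarrow> unit prog" where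
  "sort_arr P x = (case x of (a, K, tmp) \<Rightarrow>
     scan (\<lambda>P. {()}) copy_step (\<lambda>P y s. []) vu vu P ((), a, K, tmp, ()) \<bind> (\<lambda>_.
     scan item_lists chunk_step (\<lambda>P y s. sort s) vu vu P ((), tmp, K, a, []) \<bind> (\<lambda>_.
     while P (nums P) (\<lambda>L. L < K) (\<lambda>L. level P (a, K, L, tmp) \<bind> (\<lambda>_. Ret (L * fan P))) (cap P) \<bind> (\<lambda>_. Ret ()))))"

lemma lean_sort_arr: "lean (\<lambda>P x. sort_arr P (g P x))"
  unfolding sort_arr_def case_prod_beta
  by (intro lean_bind lean_while lean_scan_comp lean_level lean_Ret smallset_intros smallset_finite_const) simp

text \<open>Merging requires block numbers of three words, hence at most \<open>W^3\<close> items.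
  If internal memory is large compared with the word range, a single stripe may exceed this; but
  then at most \<open>cap P\<close> stripes are sorted by run formation alone, without
  triggers.\<close>

lemma wp_sort_arr:
  assumes ok: "okm P" "disk_ok P d" and K: "K \<le> cap P \<or> K * zs P \<le> word_range P ^ 3"
    and xs: "xs = cont (vu P) d a K" "set xs \<subseteq> data_items P"
    and tr: "a + K \<le> word_range P ^ 8" "tmp + 3 * K \<le> word_range P ^ 8" "{a..<a+K} \<inter> {tmp..<tmp+3*K} = {}"
  shows "wp P (sort_arr P (a, K, tmp)) d (\<lambda>r d' t. cont (vu P) d' a K = sort xs \<and> disk_ok P d' \<and>
     same_off ({a..<a+K} \<union> {tmp..<tmp+3*K}) d d' \<and> t \<le> 4 * K + 27 * K * nlev P K (cap P))"
proof -
  let ?Z = "zs P" and ?W = "word_range P" and ?M = "mem_size P"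
  let ?F = "{a..<a+K} \<union> {tmp..<tmp+3*K}" and ?C = "cap P * zs P"
  note v = virt[OF ok(1)]
  have lxs: "length xs = K * ?Z" using length_cont[OF ok(2)] v(7) xs(1) by simp
  have cdK: "K = cdiv (length xs) (vu P * block_size P)" unfolding v(7) lxs using v(8) by simp
  have vx: "set xs \<subseteq> vitems P" using xs(2) data_items_vitems by blast
  have C1: "1 \<le> ?C" using v(8,12) by (simp add: Suc_le_eq)
  have S1: "wp P (scan (\<lambda>P. {()}) copy_step (\<lambda>P y s. []) vu vu P ((), a, K, tmp, ())) d
    (\<lambda>r d' t. cont (vu P) d' tmp K = xs \<and> disk_ok P d' \<and> same_off {tmp..<tmp+K} d d' \<and> t \<le> 2 * K)"
  proof (rule wp_mono[OF wp_scan[OF ok, where u = vu and v = vu and xs = xs and out = xs and K' = K and f' = "copy_step P ()"]], goal_cases)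
    case 7 then show ?case by (simp add: trun_copy)
  next
    case (10 ys ws us) then show ?case using v(7,9) by (simp add: trun_copy)
  next
    case 15 then show ?case using tr(3) by fastforce
  next
    case (16 r d' t) then show ?case using pad_full[OF v(8) lxs] v(7) by auto
  next
    case 5 show ?case by (rule xs(1))
  next
    case 8 show ?case by (rule cdK)
  qed (use v tr vx in auto)
  have cs: "mset (csort ?C xs) = mset xs" "length (csort ?C xs) = K * ?Z" "sorted_runs ?C (csort ?C xs)"
    using csort_props[OF C1, of xs] lxs by auto
  have cv: "set (csort ?C xs) = set xs" using cs(1) by (metis set_mset_mset)
  have S2: "wp P (scan item_lists chunk_step (\<lambda>P y s. sort s) vu vu P ((), tmp, K, a, [])) d1
    (\<lambda>r d' t. cont (vu P) d' a K = csort ?C xs \<and> disk_ok P d' \<and> same_off {a..<a+K} d1 d' \<and> t \<le> 2 * K)"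
    if d1: "cont (vu P) d1 tmp K = xs" "disk_ok P d1" for d1
  proof -
    have st: "length (fst (trun (chunk_step P ()) [] ys)) < ?C \<and> set (fst (trun (chunk_step P ()) [] ys)) \<subseteq> set ys" for ys
      using chunk_state[of "[]" P "()" ys] C1 by auto
    show ?thesis
    proof (rule wp_mono[OF wp_scan[OF ok(1) d1(2), where u = vu and v = vu and xs = xs and out = "csort ?C xs" and K' = K and f' = "chunk_step P ()"]], goal_cases)
      case 7 then show ?case using trun_chunk[of "[]" P "()" xs] C1 by simp
    next
      case 8 show ?case unfolding v(7) cs(2) using v(8) by simp
    next
      case (9 ys ws) then show ?case using st[of ys] v(13) vx by (auto simp: item_lists_def)
    next
      case (10 ys ws us)
      have "length (snd (trun (chunk_step P ()) (fst (trun (chunk_step P ()) [] ys)) ws)) \<le> length (fst (trun (chunk_step P ()) [] ys)) + length ws"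
        using chunk_state st by blast
      then show ?case using st[of ys] 10(2) v(7,9,13) by simp
    next
      case 11 then show ?case using st[of xs] v(13) by simp
    next
      case 12 then show ?case using cv vx by simp
    next
      case 15 then show ?case using tr(3) by fastforce
    next
      case (16 r d' t) then show ?case using pad_full[OF v(8) cs(2)] v(7) by auto
    qed (use v d1 tr in auto)
  qed
  define I where "I L d' \<longleftrightarrow> disk_ok P d' \<and> same_off ?F d d' \<and> cap P \<le> L \<and> mset (cont (vu P) d' a K) = mset xs \<and>
     sorted_runs (L * ?Z) (cont (vu P) d' a K)" for L d'
  define \<Phi> where "\<Phi> L = 27 * K * nlev P K L" for L
  have S3: "wp P (while P (nums P) (\<lambda>L. L < K) (\<lambda>L. level P (a, K, L, tmp) \<bind> (\<lambda>_. Ret (L * fan P))) (cap P)) d2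
     (\<lambda>L d' t. I L d' \<and> \<not> L < K \<and> t + \<Phi> L \<le> \<Phi> (cap P))" if I2: "I (cap P) d2" for d2
  proof (cases "K \<le> cap P")
    case True
    show ?thesis
    proof (rule wp_while[where I = I, OF I2])
      show "\<Phi> (cap P) \<le> ?W ^ (20 * ?M)" using nlev_0[OF True] by (simp add: \<Phi>_def)
    qed (use True in \<open>auto simp: I_def\<close>)
  next
    case False
    then have K3: "K * ?Z \<le> ?W ^ 3" using K by simp
    have "K \<le> K * ?Z" using v(8) by simp
    then have W3: "K \<le> ?W ^ 3" using K3 by (rule le_trans)
    show ?thesis
    proof (rule wp_while[where I = I, OF I2])
      have "\<Phi> (cap P) \<le> 27 * K * K" unfolding \<Phi>_def using nlev_le[OF ok(1), of "cap P" K] v(12) by (intro mult_le_mono2) simp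
      also have "\<dots> \<le> 2 ^ 5 * ?W ^ 3 * ?W ^ 3" using W3 by (intro mult_le_mono) auto
      also have "\<dots> \<le> ?W ^ 5 * ?W ^ 3 * ?W ^ 3" using okmD(4)[OF ok(1)] by (intro mult_le_mono1 power_mono) auto
      also have "\<dots> = ?W ^ 11" by (simp flip: power_add)
      also have "\<dots> \<le> ?W ^ 30" using okmD(4)[OF ok(1)] by (intro power_increasing) auto
      finally have "\<Phi> (cap P) \<in> nums P" by (rule nums_power[OF ok(1)])
      then show "\<Phi> (cap P) \<le> ?W ^ (20 * ?M)" by (simp add: nums_def)
    next
      fix L d3 assume I3: "I L d3" and LK: "L < K"
      have d3: "disk_ok P d3" "same_off ?F d d3" "cap P \<le> L" "mset (cont (vu P) d3 a K) = mset xs"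
         "sorted_runs (L * ?Z) (cont (vu P) d3 a K)" using I3 by (auto simp: I_def)
      have L1: "1 \<le> L" using d3(3) v(12) by simp
      have nl: "nlev P K L = Suc (nlev P K (L * fan P))" by (rule nlev_Suc[OF ok(1) L1 LK])
      have "set (cont (vu P) d3 a K) \<subseteq> data_items P" using d3(4) xs(2) by (metis set_mset_mset)
      then have "wp P (level P (a, K, L, tmp) \<bind> (\<lambda>_. Ret (L * fan P))) d3 (\<lambda>s' d' t. I s' d' \<and> t + \<Phi> s' \<le> \<Phi> L \<and> \<Phi> s' < \<Phi> L)"
      proof (rule wp_bindI[OF wp_level[OF ok(1) d3(1) L1 K3 refl _ d3(5) tr]])
        fix r d4 t assume 4: "mset (cont (vu P) d4 a K) = mset (cont (vu P) d3 a K) \<and> sorted_runs (fan P * L * ?Z) (cont (vu P) d4 a K) \<and>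
           disk_ok P d4 \<and> same_off ?F d3 d4 \<and> t \<le> 27 * K"
        have "same_off ?F d d4" by (rule same_off_trans[OF d3(2), of ?F]) (use 4 in auto)
        moreover have "cap P * 1 \<le> L * fan P" using d3(3) v(1,11) by (intro mult_le_mono) auto
        ultimately have "I (L * fan P) d4" using 4 d3(4) by (simp add: I_def mult.commute)
        moreover have "t + \<Phi> (L * fan P) \<le> \<Phi> L" "\<Phi> (L * fan P) < \<Phi> L" using 4 LK by (simp_all add: \<Phi>_def nl)
        ultimately show "wp P (Ret (L * fan P)) d4 (\<lambda>r' d'' t'. I r' d'' \<and> t + t' + \<Phi> r' \<le> \<Phi> L \<and> \<Phi> r' < \<Phi> L)" by simp
      qed
      moreover have "L \<in> nums P"
      proof (rule nums_le[OF ok(1)])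
        have "?W ^ 3 \<le> ?W ^ 8" using okmD(4)[OF ok(1)] by (intro power_increasing) auto
        then show "L \<le> ?W ^ 8" using LK W3 by linarith
      qed
      ultimately show "L \<in> nums P \<and> wp P (level P (a, K, L, tmp) \<bind> (\<lambda>_. Ret (L * fan P))) d3 (\<lambda>s' d' t. I s' d' \<and> t + \<Phi> s' \<le> \<Phi> L \<and> \<Phi> s' < \<Phi> L)" by blast
    qed
  qed
  show ?thesis unfolding sort_arr_def prod.case
  proof (rule wp_bindI[OF S1], rule wp_bindI[OF S2])
    fix r1 d1 t1 assume 1: "cont (vu P) d1 tmp K = xs \<and> disk_ok P d1 \<and> same_off {tmp..<tmp+K} d d1 \<and> t1 \<le> 2 * K"
    show "cont (vu P) d1 tmp K = xs" "disk_ok P d1" using 1 by auto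
    fix r2 d2 t2 assume 2: "cont (vu P) d2 a K = csort ?C xs \<and> disk_ok P d2 \<and> same_off {a..<a+K} d1 d2 \<and> t2 \<le> 2 * K"
    have "same_off ?F d d2" by (rule same_off_trans[of "{tmp..<tmp+K}" _ d1 "{a..<a+K}"]) (use 1 2 in auto)
    then have I2: "I (cap P) d2" using 2 cs v(12) by (simp add: I_def)
    show "wp P (while P (nums P) (\<lambda>L. L < K) (\<lambda>L. level P (a, K, L, tmp) \<bind> (\<lambda>_. Ret (L * fan P))) (cap P) \<bind> (\<lambda>_. Ret ())) d2
      (\<lambda>r' d'' t'. cont (vu P) d'' a K = sort xs \<and> disk_ok P d'' \<and> same_off ?F d d'' \<and> t1 + (t2 + t') \<le> 4 * K + 27 * K * nlev P K (cap P))"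
    proof (rule wp_bindI[OF S3[OF I2]])
      fix L d3 t3 assume 3: "I L d3 \<and> \<not> L < K \<and> t3 + \<Phi> L \<le> \<Phi> (cap P)"
      have d3: "disk_ok P d3" "same_off ?F d d3" "mset (cont (vu P) d3 a K) = mset xs"
         "sorted_runs (L * ?Z) (cont (vu P) d3 a K)" using 3 by (auto simp: I_def)
      have "length (cont (vu P) d3 a K) \<le> L * ?Z" using length_cont[OF d3(1)] v(7) 3 by simp
      then have "sorted (cont (vu P) d3 a K)" using d3(4) unfolding sorted_runs_def by (metis drop0 mult_0 take_all)
      then have "cont (vu P) d3 a K = sort xs" using d3(3) by (metis properties_for_sort)
      then show "wp P (Ret ()) d3 (\<lambda>r' d'' t'. cont (vu P) d'' a K = sort xs \<and> disk_ok P d'' \<and> same_off ?F d d'' \<and>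
          t1 + (t2 + (t3 + t')) \<le> 4 * K + 27 * K * nlev P K (cap P))"
        using 1 2 3 d3 by (simp add: \<Phi>_def)
    qed
  qed
qed

section \<open>One round of peeling: the item lists\<close>

text \<open>Turns a stateful pass over a sorted list into an itemwise map: the invariant
  \<open>I\<close> ties the state to the prefix read so far, and in sorted order this prefix
  determines what the state contributes at each item.\<close>

lemma trun_context:
  assumes "I [] s" and "\<And>ps x qs s. xs = ps @ x # qs \<Longrightarrow> I ps s \<Longrightarrow> I (ps @ [x]) (fst (f s x)) \<and> snd (f s x) = g x"
  shows "snd (trun f s xs) = concat (map g xs) \<and> I xs (fst (trun f s xs))"
proof -
  have "snd (trun f s ps) = concat (map g ps) \<and> I ps (fst (trun f s ps))" if "xs = ps @ qs" for ps qs
    using that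
  proof (induction ps arbitrary: qs rule: rev_induct)
    case Nil then show ?case using assms(1) by simp
  next
    case (snoc x ps)
    have IH: "snd (trun f s ps) = concat (map g ps)" "I ps (fst (trun f s ps))"
      using snoc.IH[of "x # qs"] snoc.prems by auto
    show ?case using IH assms(2)[of ps x qs "fst (trun f s ps)"] snoc.prems by (simp add: trun_append)
  qed
  from this[of xs "[]"] show ?thesis by simp
qed

lemma distinct_concat_map:
  assumes "distinct xs" "\<And>x. x \<in> set xs \<Longrightarrow> distinct (g x)"
    "\<And>x y z. x \<in> set xs \<Longrightarrow> y \<in> set xs \<Longrightarrow> z \<in> set (g x) \<Longrightarrow> z \<in> set (g y) \<Longrightarrow> x = y"
  shows "distinct (concat (map g xs))"
  using assms
proof (induction xs)
  case (Cons x xs)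
  have "distinct (concat (map g xs))" using Cons by (intro Cons.IH) auto
  moreover have "set (g x) \<inter> set (concat (map g xs)) = {}" using Cons.prems by fastforce
  ultimately show ?case using Cons.prems by simp
qed simp

lemma sorted_split:
  assumes "sorted (xs :: item list)" "distinct xs" "xs = ps @ x # qs"
  shows "\<And>p. p \<in> set ps \<Longrightarrow> p < x" "\<And>p. p \<in> set xs \<Longrightarrow> p < x \<Longrightarrow> p \<in> set ps" "\<And>p. p \<in> set ps \<Longrightarrow> p \<le> last ps"
proof -
  show 1: "p < x" if "p \<in> set ps" for p using assms that by (auto simp: sorted_append less_le)
  show "p \<in> set ps" if "p \<in> set xs" "p < x" for p using assms that by (auto simp: sorted_append)
  show "p \<le> last ps" if p: "p \<in> set ps" for p
  proof -
    have "ps \<noteq> []" using p by auto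
    then have "ps = butlast ps @ [last ps]" by simp
    moreover have "sorted ps" using assms by (simp add: sorted_append)
    ultimately have "sorted (butlast ps @ [last ps])" by simp
    then show ?thesis using p \<open>ps = butlast ps @ [last ps]\<close> unfolding sorted_append
      by (metis Un_iff append_butlast_last_id list.set_intros(1) order_refl set_ConsD set_append empty_iff list.set(1) insert_iff list.simps(15))
  qed
qed

text \<open>Vertices and edges have one format and are told apart by whether the two inner words
  coincide. The leading 0 keeps them below the padding.\<close>

definition gset :: "nat set \<Rightarrow> nat set set \<Rightarrow> item set" where
  "gset V E = (\<lambda>v. [0, v, v, 0]) ` V \<union> {[0, u, v, 0] |u v. u < v \<and> {u, v} \<in> E}"

text \<open>An edge becomes one arc per endpoint. Sorting puts the arcs \<open>[0, u, 0, v]\<close>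
  of a vertex directly before its marker \<open>[0, u, 1, 0]\<close>, so that the degree is known
  when the marker arrives.\<close>

definition split_step :: "machine \<Rightarrow> unit \<Rightarrow> unit \<Rightarrow> item \<Rightarrow> unit \<times> item list" where
  "split_step P y s x = ((), if x = pad_item then [] else if x ! 1 = x ! 2 then [[0, x ! 1, 1, 0]]
     else [[0, x ! 1, 0, x ! 2], [0, x ! 2, 0, x ! 1]])"

text \<open>Arcs and markers exchange the codes 0 and 1 in the third word. After sorting, the flag
  of a vertex therefore precedes its arcs. Through \<open>y\<close> the flag function sees the sizes
  of the current graph.\<close>

definition count_step :: "(nat \<Rightarrow> nat \<Rightarrow> nat \<Rightarrow> nat) \<Rightarrow> machine \<Rightarrow> nat \<times> nat \<Rightarrow> nat \<times> nat \<Rightarrow> item \<Rightarrow> (nat \<times> nat) \<times> item list" where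
  "count_step F P y s x = (if x = pad_item then (s, []) else
     let c = (if x ! 1 = fst s then snd s else 0) in
     if x ! 2 = 0 then ((x ! 1, c + 1), [[0, x ! 1, 1, x ! 3]]) else ((x ! 1, c), [[0, x ! 1, 0, F (fst y) (snd y) c]]))"

text \<open>Each arc leaving a surviving vertex becomes a vote for its edge. The last word tells
  whether the smaller or the larger endpoint votes.\<close>

definition flag_step :: "machine \<Rightarrow> unit \<Rightarrow> nat \<Rightarrow> item \<Rightarrow> nat \<times> item list" where
  "flag_step P y s x = (if x = pad_item then (s, []) else
     if x ! 2 = 0 then (x ! 3, [[0, x ! 1, x ! 1, x ! 3]])
     else (s, if s = 0 then [[0, min (x ! 1) (x ! 3), max (x ! 1) (x ! 3), if x ! 1 < x ! 3 then 0 else 1]] else []))"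

definition low_step :: "machine \<Rightarrow> unit \<Rightarrow> unit \<Rightarrow> item \<Rightarrow> unit \<times> item list" where
  "low_step P y s x = ((), if x \<noteq> pad_item \<and> x ! 1 = x ! 2 \<and> x ! 3 = 1 then [[0, x ! 1, x ! 1, 0]] else [])"

text \<open>An edge survives if both votes are present. These are adjacent after sorting, so it
  suffices to remember the previous item. The counters give the size of the next graph.\<close>

definition high_step :: "machine \<Rightarrow> unit \<Rightarrow> item \<times> nat \<times> nat \<Rightarrow> item \<Rightarrow> (item \<times> nat \<times> nat) \<times> item list" where
  "high_step P y s x = (if x = pad_item then (s, []) else
     if x ! 1 = x ! 2 then (if x ! 3 = 0 then ((x, fst (snd s) + 1, snd (snd s)), [x]) else ((x, snd s), []))
     else if x ! 3 = 1 \<and> fst s = [0, x ! 1, x ! 2, 0] then ((x, fst (snd s), snd (snd s) + 1), [fst s])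
     else ((x, snd s), []))"

text \<open>\<open>F\<close> maps a degree to a flag, with 1 for removal. \<open>H1\<close>,
  \<open>H2\<close> and \<open>H3\<close> are the item sets produced by the first three
  passes.\<close>

locale round_graph =
  fixes V :: "nat set" and E :: "nat set set" and F :: "nat \<Rightarrow> nat"
  assumes graph: "simple_graph V E" and F: "\<And>c. F c \<le> 1"
begin

definition "deg u = card {v. {u, v} \<in> E}"
definition "fl u = F (deg u)"
definition "V' = {v \<in> V. fl v = 0}"
definition "E' = {e \<in> E. e \<subseteq> V'}"
definition "H1 = (\<lambda>v. [0, v, 1, 0]) ` V \<union> {[0, u, 0, v] |u v. {u, v} \<in> E}"
definition "H2 = (\<lambda>v. [0, v, 0, fl v]) ` V \<union> {[0, u, 1, v] |u v. {u, v} \<in> E}"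
definition "H3 = (\<lambda>v. [0, v, v, fl v]) ` V \<union> {[0, min u v, max u v, if u < v then 0 else 1] |u v. {u, v} \<in> E \<and> fl u = 0}"

lemma edge: "{u, v} \<in> E \<Longrightarrow> u \<noteq> v \<and> u \<in> V \<and> v \<in> V \<and> {v, u} \<in> E"
proof -
  assume e: "{u, v} \<in> E"
  then have "card {u, v} = 2" "{u, v} \<subseteq> V" using graph by (auto simp: simple_graph_def)
  then show ?thesis using e by (auto simp: insert_commute card_insert_if split: if_splits)
qed

lemma fl_le: "fl u = 0 \<or> fl u = 1"
  using F[of "deg u"] by (auto simp: fl_def)

lemma finV: "finite V" using graph by (simp add: simple_graph_def)

lemma finE: "finite E"
proof -
  have "E \<subseteq> Pow V" using graph by (auto simp: simple_graph_def)
  then show ?thesis using finV by (simp add: finite_subset)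
qed

lemma deg_degree: "deg u = vertex_degree E u"
proof -
  have "{e \<in> E. u \<in> e} = (\<lambda>v. {u, v}) ` {v. {u, v} \<in> E}"
  proof (safe)
    fix e assume e: "e \<in> E" "u \<in> e"
    then have "card e = 2" using graph by (auto simp: simple_graph_def)
    then obtain a b where "e = {a, b}" by (auto simp: card_2_iff)
    then have "\<exists>v. e = {u, v}" using e by auto
    then show "e \<in> (\<lambda>v. {u, v}) ` {v. {u, v} \<in> E}" using e by auto
  qed
  moreover have "inj_on (\<lambda>v. {u, v}) {v. {u, v} \<in> E}" by (auto simp: inj_on_def doubleton_eq_iff)
  ultimately show ?thesis unfolding deg_def vertex_degree_def by (simp add: card_image)
qed

lemma split_pass:
  assumes "distinct ys" "set ys = gset V E"
  shows "distinct (snd (trun (split_step P y) () ys)) \<and> set (snd (trun (split_step P y) () ys)) = H1"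
proof -
  define g where "g x = (if x ! 1 = x ! 2 then [[0, x ! 1, 1, 0]] else [[0, x ! 1, 0, x ! 2], [0, x ! 2, 0, x ! 1]])" for x :: item
  have np: "x \<noteq> pad_item" if "x \<in> set ys" for x using that assms(2) by (auto simp: gset_def pad_item_def)
  have "snd (trun (split_step P y) () ys) = concat (map g ys) \<and> True"
    by (rule trun_context) (use np in \<open>auto simp: split_step_def g_def\<close>)
  then have out: "snd (trun (split_step P y) () ys) = concat (map g ys)" by simp
  have "distinct (concat (map g ys))"
  proof (rule distinct_concat_map[OF assms(1)])
    show "distinct (g x)" if "x \<in> set ys" for x using that assms(2) by (auto simp: gset_def g_def)
    show "x = y" if "x \<in> set ys" "y \<in> set ys" "z \<in> set (g x)" "z \<in> set (g y)" for x y z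
      using that assms(2) by (auto simp: gset_def g_def)
  qed
  moreover have "set (concat (map g ys)) = H1"
  proof
    show "set (concat (map g ys)) \<subseteq> H1"
      using assms(2) edge by (auto simp: gset_def g_def H1_def)
    show "H1 \<subseteq> set (concat (map g ys))"
    proof
      fix z assume "z \<in> H1"
      then consider v where "v \<in> V" "z = [0, v, 1, 0]" | u v where "{u, v} \<in> E" "z = [0, u, 0, v]" by (auto simp: H1_def)
      then show "z \<in> set (concat (map g ys))"
      proof cases
        case 1
        then have "[0, v, v, 0] \<in> set ys" "z \<in> set (g [0, v, v, 0])" using assms(2) by (auto simp: gset_def g_def)
        then show ?thesis by auto
      next
        case 2
        have uv: "u \<noteq> v" "{v, u} \<in> E" using edge[OF 2(1)] by auto
        let ?x = "[0, min u v, max u v, 0]"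
        have "?x \<in> set ys" using assms(2) 2(1) uv by (cases "u < v") (auto simp: gset_def min_def max_def)
        moreover have "z \<in> set (g ?x)" using 2 uv by (auto simp: g_def min_def max_def)
        ultimately show ?thesis by auto
      qed
    qed
  qed
  ultimately show ?thesis using out by simp
qed

lemma count_pass:
  assumes xs: "sorted xs" "distinct xs" "set xs = H1" and G: "\<And>c. G (fst y) (snd y) c = F c"
  shows "distinct (snd (trun (count_step G P y) (0, 0) xs)) \<and> set (snd (trun (count_step G P y) (0, 0) xs)) = H2 \<and>
    length (snd (trun (count_step G P y) (0, 0) xs)) = length xs"
proof -
  define cnt where "cnt ps u = length (filter (\<lambda>x. x ! 1 = u \<and> x ! 2 = 0) ps)" for ps :: "item list" and u
  define g where "g x = (if x ! 2 = 0 then [[0, x ! 1, 1, x ! 3]] else [[0, x ! 1, 0, fl (x ! 1)]])" for x :: item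
  define I where "I ps s \<longleftrightarrow> (if ps = [] then s = (0, 0) else s = (last ps ! 1, cnt ps (last ps ! 1)))" for ps s
  have form: "\<exists>u b v. x = [0, u, b, v]" if "x \<in> H1" for x using that by (auto simp: H1_def)
  have np: "x \<noteq> pad_item" if "x \<in> H1" for x using that by (auto simp: H1_def pad_item_def)
  have "snd (trun (count_step G P y) (0, 0) xs) = concat (map g xs) \<and> I xs (fst (trun (count_step G P y) (0, 0) xs))"
  proof (rule trun_context)
    show "I [] (0, 0)" by (simp add: I_def)
    fix ps x qs s assume sp: "xs = ps @ x # qs" and Is: "I ps s"
    note ss = sorted_split[OF xs(1,2) sp]
    have xH: "x \<in> H1" using sp xs(3) by auto
    obtain u b v where x: "x = [0, u, b, v]" using form[OF xH] by blast
    have c: "(if x ! 1 = fst s then snd s else 0) = cnt ps u"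
    proof (cases "ps = []")
      case True
      then show ?thesis using Is by (simp add: I_def cnt_def)
    next
      case False
      then have lp: "last ps \<in> set ps" by simp
      have "last ps \<in> H1" using lp sp xs(3) by auto
      then obtain u' b' v' where l: "last ps = [0, u', b', v']" using form by blast
      have s: "s = (u', cnt ps u')" using Is False l by (simp add: I_def)
      show ?thesis
      proof (cases "u = u'")
        case False2: False
        have "u' < u" using ss(1)[OF lp] False2 unfolding x l by auto
        \<comment> \<open>The last item of the prefix is its largest and belongs to a smaller
          vertex, so no arc of \<open>u\<close> has been read and its counter starts at 0.\<close>
        have "\<not> (p ! 1 = u \<and> p ! 2 = 0)" if p: "p \<in> set ps" for p
        proof -
          have "p \<in> H1" using p sp xs(3) by auto
          then obtain u'' b'' v'' where pp: "p = [0, u'', b'', v'']" using form by blast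
          show ?thesis using ss(3)[OF p] \<open>u' < u\<close> unfolding pp l by auto
        qed
        then have "cnt ps u = 0" by (simp add: cnt_def filter_empty_conv)
        then show ?thesis using s x False2 by simp
      qed (use s x in simp)
    qed
    have new: "cnt (ps @ [x]) u = cnt ps u + (if b = 0 then 1 else 0)" by (simp add: cnt_def x)
    \<comment> \<open>The marker follows all arcs of its vertex in sorted order, so on its arrival
      they have all been counted.\<close>
    have full: "cnt ps u = deg u" if "b \<noteq> 0"
    proof -
      have x1: "x = [0, u, 1, 0]" using xH that unfolding x H1_def by auto
      have fs: "set (filter (\<lambda>x. x ! 1 = u \<and> x ! 2 = 0) ps) = (\<lambda>v. [0, u, 0, v]) ` {v. {u, v} \<in> E}"
      proof
        show "set (filter (\<lambda>x. x ! 1 = u \<and> x ! 2 = 0) ps) \<subseteq> (\<lambda>v. [0, u, 0, v]) ` {v. {u, v} \<in> E}"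
        proof
          fix p assume "p \<in> set (filter (\<lambda>x. x ! 1 = u \<and> x ! 2 = 0) ps)"
          then have "p \<in> H1" "p ! 1 = u" "p ! 2 = 0" using sp xs(3) by auto
          then show "p \<in> (\<lambda>v. [0, u, 0, v]) ` {v. {u, v} \<in> E}" by (auto simp: H1_def)
        qed
        show "(\<lambda>v. [0, u, 0, v]) ` {v. {u, v} \<in> E} \<subseteq> set (filter (\<lambda>x. x ! 1 = u \<and> x ! 2 = 0) ps)"
        proof
          fix p assume "p \<in> (\<lambda>v. [0, u, 0, v]) ` {v. {u, v} \<in> E}"
          then obtain v where v: "p = [0, u, 0, v]" "{u, v} \<in> E" by auto
          then have "p \<in> set xs" unfolding xs(3) H1_def by blast
          moreover have "p < x" unfolding v x1 by simp
          ultimately have "p \<in> set ps" by (rule ss(2))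
          then show "p \<in> set (filter (\<lambda>x. x ! 1 = u \<and> x ! 2 = 0) ps)" using v by simp
        qed
      qed
      have dd: "distinct (filter (\<lambda>x. x ! 1 = u \<and> x ! 2 = 0) ps)" using xs(2) sp by simp
      have "cnt ps u = card ((\<lambda>v. [0, u, 0, v]) ` {v. {u, v} \<in> E})"
        unfolding cnt_def fs[symmetric] by (rule distinct_card[OF dd, symmetric])
      also have "\<dots> = deg u" unfolding deg_def by (rule card_image) (auto simp: inj_on_def)
      finally show ?thesis .
    qed
    show "I (ps @ [x]) (fst (count_step G P y s x)) \<and> snd (count_step G P y s x) = g x"
    proof (cases "b = 0")
      case True
      then show ?thesis unfolding count_step_def c using np[OF xH] new by (simp add: I_def g_def x Let_def)
    next
      case False
      then show ?thesis unfolding count_step_def c using np[OF xH] new full[OF False] G by (simp add: I_def g_def x Let_def fl_def)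
    qed
  qed
  then have out: "snd (trun (count_step G P y) (0, 0) xs) = concat (map g xs)" by simp
  have "distinct (concat (map g xs))"
  proof (rule distinct_concat_map[OF xs(2)])
    show "distinct (g x)" for x by (simp add: g_def)
    show "x = y" if "x \<in> set xs" "y \<in> set xs" "z \<in> set (g x)" "z \<in> set (g y)" for x y z
      using that xs(3) by (auto simp: H1_def g_def)
  qed
  moreover have "set (concat (map g xs)) = H2"
  proof -
    have "set (concat (map g xs)) = (\<Union>x\<in>H1. set (g x))" using xs(3) by auto
    also have "\<dots> = H2"
    proof (rule set_eqI)
      fix z
      have gv: "g [0, v, 1, 0] = [[0, v, 0, fl v]]" and ge: "g [0, u, 0, v] = [[0, u, 1, v]]" for u v
        by (simp_all add: g_def)
      have "z \<in> (\<Union>x\<in>H1. set (g x)) \<longleftrightarrow> (\<exists>v\<in>V. z \<in> set (g [0, v, 1, 0])) \<or> (\<exists>u v. {u, v} \<in> E \<and> z \<in> set (g [0, u, 0, v]))"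
        unfolding H1_def by blast
      also have "\<dots> \<longleftrightarrow> z \<in> H2" unfolding gv ge H2_def by auto
      finally show "z \<in> (\<Union>x\<in>H1. set (g x)) \<longleftrightarrow> z \<in> H2" .
    qed
    finally show ?thesis .
  qed
  moreover have "length (concat (map g xs)) = length xs" by (induction xs) (auto simp: g_def)
  ultimately show ?thesis using out by simp
qed

lemma flag_pass:
  assumes xs: "sorted xs" "distinct xs" "set xs = H2"
  shows "distinct (snd (trun (flag_step P y) 0 xs)) \<and> set (snd (trun (flag_step P y) 0 xs)) = H3 \<and>
    length (snd (trun (flag_step P y) 0 xs)) \<le> length xs"
proof -
  define g where "g x = (if x ! 2 = 0 then [[0, x ! 1, x ! 1, x ! 3]]
     else if fl (x ! 1) = 0 then [[0, min (x ! 1) (x ! 3), max (x ! 1) (x ! 3), if x ! 1 < x ! 3 then 0 else 1]] else [])" for x :: item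
  define I where "I ps s \<longleftrightarrow> (ps \<noteq> [] \<longrightarrow> s = fl (last ps ! 1))" for ps :: "item list" and s
  have form: "\<exists>u b v. x = [0, u, b, v]" if "x \<in> H2" for x using that by (auto simp: H2_def)
  have np: "x \<noteq> pad_item" if "x \<in> H2" for x using that by (auto simp: H2_def pad_item_def)
  have "snd (trun (flag_step P y) 0 xs) = concat (map g xs) \<and> I xs (fst (trun (flag_step P y) 0 xs))"
  proof (rule trun_context)
    show "I [] 0" by (simp add: I_def)
    fix ps x qs s assume sp: "xs = ps @ x # qs" and Is: "I ps s"
    note ss = sorted_split[OF xs(1,2) sp]
    have xH: "x \<in> H2" using sp xs(3) by auto
    then consider v where "v \<in> V" "x = [0, v, 0, fl v]" | u v where "{u, v} \<in> E" "x = [0, u, 1, v]" by (auto simp: H2_def)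
    then show "I (ps @ [x]) (fst (flag_step P y s x)) \<and> snd (flag_step P y s x) = g x"
    proof cases
      case 1
      then show ?thesis using np[OF xH] by (simp add: flag_step_def I_def g_def)
    next
      case 2
      have "[0, u, 0, fl u] \<in> set xs" using edge[OF 2(1)] xs(3) by (simp add: H2_def)
      moreover have "[0, u, 0, fl u] < x" by (simp add: 2)
      ultimately have mem: "[0, u, 0, fl u] \<in> set ps" by (rule ss(2))
      then have ne: "ps \<noteq> []" by auto
      then have lp: "last ps \<in> set ps" by simp
      then have "last ps \<in> H2" using sp xs(3) by auto
      then obtain u' b' v' where l: "last ps = [0, u', b', v']" using form by blast
      \<comment> \<open>The last item read lies between the flag of \<open>u\<close> and the arc
        \<open>x\<close> of \<open>u\<close>, hence belongs to \<open>u\<close>, and the state still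
        is the flag of \<open>u\<close>.\<close>
      have "u' = u" using ss(3)[OF mem] ss(1)[OF lp] unfolding l 2 by auto
      then have "s = fl u" using Is ne l by (simp add: I_def)
      then show ?thesis using np[OF xH] 2 by (simp add: flag_step_def I_def g_def)
    qed
  qed
  then have out: "snd (trun (flag_step P y) 0 xs) = concat (map g xs)" by simp
  have "distinct (concat (map g xs))"
  proof (rule distinct_concat_map[OF xs(2)])
    show "distinct (g x)" for x by (simp add: g_def)
    show "x = y" if xy: "x \<in> set xs" "y \<in> set xs" and z: "z \<in> set (g x)" "z \<in> set (g y)" for x y z
    proof -
      have E: "(\<exists>v\<in>V. x = [0, v, 0, fl v]) \<or> (\<exists>u v. u \<noteq> v \<and> x = [0, u, 1, v])" if "x \<in> set xs" for x
        using that xs(3) edge by (auto simp: H2_def)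
      show ?thesis using E[OF xy(1)] E[OF xy(2)] z
        by (elim disjE bexE exE conjE) (auto simp: g_def min_def max_def split: if_splits)
    qed
  qed
  moreover have "set (concat (map g xs)) = H3"
  proof -
    have "set (concat (map g xs)) = (\<Union>x\<in>H2. set (g x))" using xs(3) by auto
    also have "\<dots> = H3"
    proof
      show "(\<Union>x\<in>H2. set (g x)) \<subseteq> H3"
      proof
        fix z assume "z \<in> (\<Union>x\<in>H2. set (g x))"
        then consider v where "v \<in> V" "z \<in> set (g [0, v, 0, fl v])" | u v where "{u, v} \<in> E" "z \<in> set (g [0, u, 1, v])"
          unfolding H2_def by blast
        then show "z \<in> H3"
        proof cases
          case 1 then show ?thesis by (simp add: g_def H3_def)
        next
          case 2
          then have "fl u = 0" "z = [0, min u v, max u v, if u < v then 0 else 1]" by (simp_all add: g_def split: if_splits)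
          then show ?thesis unfolding H3_def using 2(1) by blast
        qed
      qed
      show "H3 \<subseteq> (\<Union>x\<in>H2. set (g x))"
      proof
        fix z assume "z \<in> H3"
        then consider v where "v \<in> V" "z = [0, v, v, fl v]" |
          u v where "{u, v} \<in> E" "fl u = 0" "z = [0, min u v, max u v, if u < v then 0 else 1]" unfolding H3_def by blast
        then show "z \<in> (\<Union>x\<in>H2. set (g x))"
        proof cases
          case 1
          then have "[0, v, 0, fl v] \<in> H2" "z \<in> set (g [0, v, 0, fl v])" by (auto simp: H2_def g_def)
          then show ?thesis by blast
        next
          case 2
          then have "[0, u, 1, v] \<in> H2" "z \<in> set (g [0, u, 1, v])" by (auto simp: H2_def g_def)
          then show ?thesis by blast
        qed
      qed
    qed
    finally show ?thesis .
  qed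
  moreover have "length (concat (map g xs)) \<le> length xs" by (induction xs) (auto simp: g_def)
  ultimately show ?thesis using out by simp
qed

lemma low_pass:
  assumes xs: "distinct xs" "set xs = H3"
  shows "\<exists>lows. snd (trun (low_step P y) () xs) = map (\<lambda>v. [0, v, v, 0]) lows \<and> distinct lows \<and> set lows = V - V'"
proof -
  define g where "g x = (if x ! 1 = x ! 2 \<and> x ! 3 = 1 then [[0, x ! 1, x ! 1, 0]] else [])" for x :: item
  define lows where "lows = map (\<lambda>x. x ! 1) (filter (\<lambda>x. x ! 1 = x ! 2 \<and> x ! 3 = 1) xs)"
  have np: "x \<noteq> pad_item" if "x \<in> set xs" for x using that xs(2) by (auto simp: H3_def pad_item_def)
  have "snd (trun (low_step P y) () xs) = concat (map g xs) \<and> True"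
    by (rule trun_context) (use np in \<open>auto simp: low_step_def g_def\<close>)
  moreover have "concat (map g xs) = map (\<lambda>v. [0, v, v, 0]) lows"
    unfolding lows_def by (induction xs) (auto simp: g_def)
  moreover have sl: "{x \<in> set xs. x ! 1 = x ! 2 \<and> x ! 3 = 1} = (\<lambda>v. [0, v, v, 1]) ` (V - V')"
  proof
    show "{x \<in> set xs. x ! 1 = x ! 2 \<and> x ! 3 = 1} \<subseteq> (\<lambda>v. [0, v, v, 1]) ` (V - V')"
      using xs(2) edge by (fastforce simp: H3_def V'_def min_def max_def split: if_splits)
    show "(\<lambda>v. [0, v, v, 1]) ` (V - V') \<subseteq> {x \<in> set xs. x ! 1 = x ! 2 \<and> x ! 3 = 1}"
    proof safe
      fix v assume v: "v \<in> V" "v \<notin> V'"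
      then have "fl v = 1" using fl_le[of v] by (auto simp: V'_def)
      then show "[0, v, v, 1] \<in> set xs" using v xs(2) by (auto simp: H3_def)
    qed auto
  qed
  moreover have "distinct lows"
    unfolding lows_def distinct_map using xs(1) sl by (auto simp: inj_on_def set_filter)
  moreover have "set lows = V - V'" unfolding lows_def set_map set_filter sl by (auto simp: image_image)
  ultimately show ?thesis by auto
qed

lemma high_pass:
  assumes xs: "sorted xs" "distinct xs" "set xs = H3"
  shows "distinct (snd (trun (high_step P y) ([], 0, 0) xs)) \<and> set (snd (trun (high_step P y) ([], 0, 0) xs)) = gset V' E' \<and>
    snd (fst (trun (high_step P y) ([], 0, 0) xs)) = (card V', card E')"
proof -
  define g where "g x = (if x ! 1 = x ! 2 then (if x ! 3 = 0 then [x] else [])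
    else if x ! 3 = 1 \<and> [0, x ! 1, x ! 2, 0] \<in> H3 then [[0, x ! 1, x ! 2, 0]] else [])" for x :: item
  define vv where "vv ps = length (filter (\<lambda>x. x ! 1 = x ! 2) (concat (map g ps)))" for ps
  define ee where "ee ps = length (filter (\<lambda>x. x ! 1 \<noteq> x ! 2) (concat (map g ps)))" for ps
  define I where "I ps s \<longleftrightarrow> fst s = (if ps = [] then [] else last ps) \<and> snd s = (vv ps, ee ps)" for ps s
  have form: "\<exists>u b v. x = [0, u, b, v]" if "x \<in> H3" for x using that by (auto simp: H3_def)
  have np: "x \<noteq> pad_item" if "x \<in> H3" for x using that by (auto simp: H3_def pad_item_def)
  have ctx: "snd (trun (high_step P y) ([], 0, 0) xs) = concat (map g xs) \<and> I xs (fst (trun (high_step P y) ([], 0, 0) xs))"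
  proof (rule trun_context)
    show "I [] ([], 0, 0)" by (simp add: I_def vv_def ee_def)
    fix ps x qs s assume sp: "xs = ps @ x # qs" and Is: "I ps s"
    note ss = sorted_split[OF xs(1,2) sp]
    have xH: "x \<in> H3" using sp xs(3) by auto
    obtain u b v where x: "x = [0, u, b, v]" using form[OF xH] by blast
    \<comment> \<open>No item of the list can lie strictly between \<open>[0, u, b, 0]\<close> and
      \<open>[0, u, b, 1]\<close>, so presence of the first vote means that it is the previous
      item.\<close>
    have adj: "fst s = [0, u, b, 0] \<longleftrightarrow> [0, u, b, 0] \<in> H3" if "v = 1"
    proof
      assume "fst s = [0, u, b, 0]"
      then have "ps \<noteq> []" "last ps = [0, u, b, 0]" using Is by (auto simp: I_def split: if_splits)
      then show "[0, u, b, 0] \<in> H3" using sp xs(3) last_in_set[of ps] by auto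
    next
      assume m: "[0, u, b, 0] \<in> H3"
      have "[0, u, b, 0] \<in> set ps" by (rule ss(2)) (use m xs(3) x that in auto)
      moreover from this have ne: "ps \<noteq> []" by auto
      then have lp: "last ps \<in> set ps" by simp
      then have "last ps \<in> H3" using sp xs(3) by auto
      then obtain u' b' v' where l: "last ps = [0, u', b', v']" using form by blast
      ultimately have "last ps = [0, u, b, 0]" using ss(3)[of "[0, u, b, 0]"] ss(1)[OF lp] that unfolding l x by auto
      then show "fst s = [0, u, b, 0]" using Is ne by (simp add: I_def)
    qed
    show "I (ps @ [x]) (fst (high_step P y s x)) \<and> snd (high_step P y s x) = g x"
    proof -
      have s2: "snd s = (vv ps, ee ps)" using Is by (simp add: I_def)
      have vS: "vv (ps @ [x]) = vv ps + length (filter (\<lambda>x. x ! 1 = x ! 2) (g x))"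
        "ee (ps @ [x]) = ee ps + length (filter (\<lambda>x. x ! 1 \<noteq> x ! 2) (g x))" by (simp_all add: vv_def ee_def)
      show ?thesis unfolding high_step_def I_def vS s2 using np[OF xH] adj by (auto simp: g_def x s2)
    qed
  qed
  then have out: "snd (trun (high_step P y) ([], 0, 0) xs) = concat (map g xs)"
    and fin: "snd (fst (trun (high_step P y) ([], 0, 0) xs)) = (vv xs, ee xs)" by (auto simp: I_def)
  \<comment> \<open>The two votes for an edge testify separately that its smaller and its larger
    endpoint survive.\<close>
  have both: "[0, u, v, 0] \<in> H3 \<and> [0, u, v, 1] \<in> H3 \<longleftrightarrow> {u, v} \<in> E \<and> fl u = 0 \<and> fl v = 0" if uv: "u < v" for u v
  proof -
    have a: "[0, u, v, 0] \<in> H3 \<longleftrightarrow> {u, v} \<in> E \<and> fl u = 0"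
    proof
      assume "[0, u, v, 0] \<in> H3"
      then obtain u' v' where "{u', v'} \<in> E" "fl u' = 0" "u = min u' v'" "v = max u' v'" "u' < v'"
        using uv by (auto simp: H3_def split: if_splits)
      then show "{u, v} \<in> E \<and> fl u = 0" by (auto simp: min_def max_def)
    next
      assume "{u, v} \<in> E \<and> fl u = 0"
      then have "[0, min u v, max u v, if u < v then 0 else 1] \<in> H3" unfolding H3_def by blast
      then show "[0, u, v, 0] \<in> H3" using uv by (simp add: min_def max_def)
    qed
    have b: "[0, u, v, 1] \<in> H3 \<longleftrightarrow> {u, v} \<in> E \<and> fl v = 0"
    proof
      assume "[0, u, v, 1] \<in> H3"
      then obtain u' v' where *: "{u', v'} \<in> E" "fl u' = 0" "u = min u' v'" "v = max u' v'" "\<not> u' < v'"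
        using uv by (auto simp: H3_def split: if_splits)
      then have eq: "u' = v" "v' = u" using uv by (auto simp: min_def max_def)
      show "{u, v} \<in> E \<and> fl v = 0" using *(1,2)[unfolded eq] by (metis insert_commute)
    next
      assume *: "{u, v} \<in> E \<and> fl v = 0"
      then have "{v, u} \<in> E \<and> fl v = 0" by (metis insert_commute)
      then have "[0, min v u, max v u, if v < u then 0 else 1] \<in> H3" unfolding H3_def by blast
      then show "[0, u, v, 1] \<in> H3" using uv by (simp add: min_def max_def)
    qed
    show ?thesis using a b by blast
  qed
  have H3E: "(\<exists>v\<in>V. x = [0, v, v, fl v]) \<or> (\<exists>u v f. u < v \<and> f \<le> 1 \<and> x = [0, u, v, f])" if "x \<in> H3" for x
  proof -
    from that consider v where "v \<in> V" "x = [0, v, v, fl v]" |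
      u v where "{u, v} \<in> E" "x = [0, min u v, max u v, if u < v then 0 else 1]" unfolding H3_def by blast
    then show ?thesis
    proof cases
      case 2
      then have "u \<noteq> v" using edge by blast
      then have "min u v < max u v" by (simp add: min_def max_def)
      then show ?thesis using 2(2) by (intro disjI2 exI[of _ "min u v"] exI[of _ "max u v"] exI[of _ "if u < v then 0 else 1"]) simp
    qed blast
  qed
  \<comment> \<open>An output item determines the input item that caused it, which gives
    distinctness of the output.\<close>
  have gE: "(z ! 1 = z ! 2 \<and> x = z) \<or> (z ! 1 \<noteq> z ! 2 \<and> x = [0, z ! 1, z ! 2, 1])" if x: "x \<in> H3" and z: "z \<in> set (g x)" for x z
    using H3E[OF x]
  proof (elim disjE bexE exE conjE)
    fix v assume "x = [0, v, v, fl v]"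
    then show ?thesis using z by (auto simp: g_def split: if_splits)
  next
    fix u v f :: nat assume *: "u < v" "x = [0, u, v, f]"
    then have "z = [0, u, v, 0]" "f = 1" using z by (auto simp: g_def split: if_splits)
    then show ?thesis using * by simp
  qed
  have dis: "distinct (concat (map g xs))"
  proof (rule distinct_concat_map[OF xs(2)])
    show "distinct (g x)" for x by (simp add: g_def)
    show "x = y" if xy: "x \<in> set xs" "y \<in> set xs" and z: "z \<in> set (g x)" "z \<in> set (g y)" for x y z
      using gE[OF xy(1)[unfolded xs(3)] z(1)] gE[OF xy(2)[unfolded xs(3)] z(2)] by metis
  qed
  have eset: "{[0, u, v, 0] |u v. u < v \<and> {u, v} \<in> E'} = {[0, u, v, 0] |u v. u < v \<and> [0, u, v, 0] \<in> H3 \<and> [0, u, v, 1] \<in> H3}"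
  proof -
    have "{u, v} \<in> E' \<longleftrightarrow> [0, u, v, 0] \<in> H3 \<and> [0, u, v, 1] \<in> H3" if "u < v" for u v
      unfolding both[OF that] E'_def V'_def using edge[of u v] by auto
    then show ?thesis by blast
  qed
  have st: "set (concat (map g xs)) = gset V' E'"
  proof
    show "set (concat (map g xs)) \<subseteq> gset V' E'"
    proof
      fix z assume "z \<in> set (concat (map g xs))"
      then obtain x where x: "x \<in> H3" "z \<in> set (g x)" using xs(3) by auto
      from H3E[OF x(1)] show "z \<in> gset V' E'"
      proof (elim disjE bexE exE conjE)
        fix v assume "v \<in> V" "x = [0, v, v, fl v]"
        then show ?thesis using x(2) by (auto simp: g_def gset_def V'_def split: if_splits)
      next
        fix u v f :: nat assume *: "u < v" "x = [0, u, v, f]"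
        then have "z = [0, u, v, 0]" "[0, u, v, 0] \<in> H3" "[0, u, v, 1] \<in> H3" using x by (auto simp: g_def split: if_splits)
        then show ?thesis unfolding gset_def eset using *(1) by blast
      qed
    qed
    show "gset V' E' \<subseteq> set (concat (map g xs))"
    proof
      fix z assume "z \<in> gset V' E'"
      then consider v where "v \<in> V'" "z = [0, v, v, 0]" | u v where "u < v" "[0, u, v, 0] \<in> H3" "[0, u, v, 1] \<in> H3" "z = [0, u, v, 0]"
        unfolding gset_def eset by blast
      then have "\<exists>x\<in>H3. z \<in> set (g x)"
      proof cases
        case 1
        then have "[0, v, v, 0] \<in> H3" unfolding H3_def V'_def by force
        moreover have "z \<in> set (g [0, v, v, 0])" using 1 by (simp add: g_def)
        ultimately show ?thesis by blast
      next
        case 2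
        then have "z \<in> set (g [0, u, v, 1])" by (simp add: g_def)
        then show ?thesis using 2(3) by blast
      qed
      then show "z \<in> set (concat (map g xs))" using xs(3) by auto
    qed
  qed
  have "vv xs = card {x \<in> gset V' E'. x ! 1 = x ! 2}"
    unfolding vv_def st[symmetric] using distinct_card[OF distinct_filter[OF dis, of "\<lambda>x. x ! 1 = x ! 2"]] by (simp only: set_filter)
  also have "{x \<in> gset V' E'. x ! 1 = x ! 2} = (\<lambda>v. [0, v, v, 0]) ` V'" by (auto simp: gset_def)
  also have "card \<dots> = card V'" by (rule card_image) (auto simp: inj_on_def)
  finally have vV: "vv xs = card V'" .
  have "ee xs = card {x \<in> gset V' E'. x ! 1 \<noteq> x ! 2}"
    unfolding ee_def st[symmetric] using distinct_card[OF distinct_filter[OF dis, of "\<lambda>x. x ! 1 \<noteq> x ! 2"]] by (simp only: set_filter)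
  also have "{x \<in> gset V' E'. x ! 1 \<noteq> x ! 2} = (\<lambda>e. [0, Min e, Max e, 0]) ` E'"
  proof
    show "{x \<in> gset V' E'. x ! 1 \<noteq> x ! 2} \<subseteq> (\<lambda>e. [0, Min e, Max e, 0]) ` E'"
    proof
      fix x assume "x \<in> {x \<in> gset V' E'. x ! 1 \<noteq> x ! 2}"
      then obtain u v where "u < v" "{u, v} \<in> E'" "x = [0, u, v, 0]" by (auto simp: gset_def)
      then show "x \<in> (\<lambda>e. [0, Min e, Max e, 0]) ` E'" by (intro image_eqI[of _ _ "{u, v}"]) auto
    qed
    show "(\<lambda>e. [0, Min e, Max e, 0]) ` E' \<subseteq> {x \<in> gset V' E'. x ! 1 \<noteq> x ! 2}"
    proof safe
      fix e assume e: "e \<in> E'"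
      then have "card e = 2" using graph by (auto simp: E'_def simple_graph_def)
      then obtain a b where ab: "e = {a, b}" "a \<noteq> b" by (auto simp: card_2_iff)
      then have "{Min e, Max e} = e" "Min e < Max e" by (auto simp: min_def max_def)
      then show "[0, Min e, Max e, 0] \<in> gset V' E'" using e unfolding gset_def by auto
      assume "[0, Min e, Max e, 0] ! 1 = [0, Min e, Max e, 0] ! 2"
      then show False using \<open>Min e < Max e\<close> by simp
    qed
  qed
  also have "card \<dots> = card E'"
  proof (rule card_image, rule inj_onI)
    fix e f assume e: "e \<in> E'" "f \<in> E'" "[0, Min e, Max e, 0] = [0, Min f, Max f, 0]"
    have "{Min e, Max e} = e" if "e \<in> E'" for e
    proof -
      have "card e = 2" using that graph by (auto simp: E'_def simple_graph_def)
      then obtain a b where ab: "e = {a, b}" "a \<noteq> b" by (auto simp: card_2_iff)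
      then show ?thesis by (auto simp: min_def max_def)
    qed
    then show "e = f" using e by (metis list.inject)
  qed
  finally have "ee xs = card E'" .
  then show ?thesis using out fin dis st vV by simp
qed

lemma card_H1: "card H1 \<le> card V + 2 * card E"
proof -
  have "{[0, u, 0, v] |u v. {u, v} \<in> E} = (\<Union>e\<in>E. {[0, u, 0, v] |u v. e = {u, v}})" by auto
  also have "card \<dots> \<le> (\<Sum>e\<in>E. card {[0, u, 0, v] |u v. e = {u, v}})" by (rule card_UN_le[OF finE])
  also have "\<dots> \<le> (\<Sum>e\<in>E. 2)"
  proof (rule sum_mono)
    fix e assume "e \<in> E"
    then have "card e = 2" using graph by (auto simp: simple_graph_def)
    then obtain a b where ab: "e = {a, b}" by (auto simp: card_2_iff)
    have "{[0, u, 0, v] |u v. e = {u, v}} \<subseteq> {[0, a, 0, b], [0, b, 0, a]}" unfolding ab by (auto simp: doubleton_eq_iff)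
    then have "card {[0, u, 0, v] |u v. e = {u, v}} \<le> card {[0, a, 0, b], [0, b, 0, a]}" by (rule card_mono[rotated]) simp
    also have "\<dots> \<le> 2" by (intro card_insert_le_m1) simp_all
    finally show "card {[0, u, 0, v] |u v. e = {u, v}} \<le> 2" .
  qed
  finally have "card {[0, u, 0, v] |u v. {u, v} \<in> E} \<le> 2 * card E" by simp
  moreover have "card ((\<lambda>v. [0, v, 1, 0]) ` V) \<le> card V" by (rule card_image_le[OF finV])
  ultimately show ?thesis unfolding H1_def using card_Un_le[of "(\<lambda>v. [0, v, 1, 0]) ` V" "{[0, u, 0, v] |u v. {u, v} \<in> E}"] by linarith
qed

end

section \<open>One round of peeling: the program\<close>

definition zitems :: "machine \<Rightarrow> item set" where
  "zitems P = {x \<in> data_items P. hd x = 0}"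

lemma zitem_less_pad: "x \<in> zitems P \<Longrightarrow> x < pad_item"
  by (cases x) (auto simp: zitems_def data_items_def pad_item_def)

lemma zitem_iff: "[0, a, b, c] \<in> zitems P \<longleftrightarrow> 0 < word_range P \<and> a < word_range P \<and> b < word_range P \<and> c < word_range P"
  by (auto simp: zitems_def data_items_def)

definition arr :: "machine \<Rightarrow> disks \<Rightarrow> nat \<Rightarrow> item list \<Rightarrow> bool" where
  "arr P d a ys \<longleftrightarrow> cont (vu P) d a (cdiv (length ys) (zs P)) = pad (zs P) ys"

lemma sort_pad:
  assumes "set ys \<subseteq> zitems P" shows "sort (pad Z ys) = pad Z (sort ys)"
proof (rule properties_for_sort)
  show "mset (pad Z (sort ys)) = mset (pad Z ys)" by (simp add: pad_def)
  have "y \<le> pad_item" if "y \<in> set ys" for y using zitem_less_pad[of y P] that assms by auto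
  then show "sorted (pad Z (sort ys))" by (auto simp: pad_def sorted_append)
qed

lemma trun_pad:
  assumes "\<And>s. f s pad_item = (s, [])" shows "trun f s (xs @ replicate n pad_item) = trun f s xs"
proof -
  have "trun f s (replicate n pad_item) = (s, [])" for s using assms by (induction n) auto
  then show ?thesis by (simp add: trun_append)
qed

lemma trun_burst2:
  assumes "\<And>s x. length (snd (f s x)) \<le> 2" shows "length (snd (trun f s ws)) \<le> 2 * length ws"
proof (induction ws arbitrary: s)
  case (Cons x ws)
  show ?case using Cons[of "fst (f s x)"] assms[of s x] by simp
qed simp

text \<open>Transducers that skip padding compute the same on the padded array as on its items, so
  the passes can be specified without padding.\<close>

lemma wp_pass:
  fixes f :: "machine \<Rightarrow> 'y \<Rightarrow> 's \<Rightarrow> item \<Rightarrow> 's \<times> item list"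
  assumes ok: "okm P" "disk_ok P d" and arr: "arr P d a ys" and K: "K = cdiv (length ys) (zs P)" and f': "f' = f P y"
    and skip: "\<And>s. f' s pad_item = (s, [])" and burst: "\<And>s x. length (snd (f' s x)) \<le> 2"
    and st: "\<And>k. fst (trun f' s0 (take k ys)) \<in> S P" and out: "out = snd (trun f' s0 ys)" "set out \<subseteq> vitems P"
    and K': "K' = cdiv (length out) (zs P)"
    and tr: "a + K \<le> word_range P ^ 8" "b + K' \<le> word_range P ^ 8" "{a..<a+K} \<inter> {b..<b+K'} = {}"
  shows "wp P (scan S f (\<lambda>P y s. []) vu vu P (y, a, K, b, s0)) d (\<lambda>r d' t. fst r = fst (trun f' s0 ys) \<and> snd r = b + K' \<and>
     arr P d' b out \<and> disk_ok P d' \<and> same_off {b..<b+K'} d d' \<and> t \<le> K + K')"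
proof -
  note v = virt[OF ok(1)]
  let ?Z = "zs P"
  have tp: "trun f' s0 (pad ?Z ys) = trun f' s0 ys" unfolding pad_def using skip by (rule trun_pad)
  have xs: "cont (vu P) d a K = pad ?Z ys" using arr K by (simp add: arr_def)
  show ?thesis
  proof (rule wp_mono[OF wp_scan[OF ok, where u = vu and v = vu and xs = "pad ?Z ys" and out = out and K' = K' and f' = f']], goal_cases)
    case (9 us ws)
    have "us = take (length us) (pad ?Z ys)" using 9 by simp
    also have "\<dots> = take (length us) ys @ replicate (min (length us - length ys) (cdiv (length ys) ?Z * ?Z - length ys)) pad_item"
      by (simp add: pad_def)
    finally obtain n where us: "us = take (length us) ys @ replicate n pad_item" by blast
    have "trun f' s0 us = trun f' s0 (take (length us) ys)" by (subst us) (rule trun_pad, rule skip)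
    then show ?case using st[of "length us"] by simp
  next
    case (10 us ws qs)
    have "length (snd (trun f' (fst (trun f' s0 us)) ws)) \<le> 2 * length ws" by (rule trun_burst2, rule burst)
    then show ?case using 10(2) v(7,9) by simp
  next
    case (16 r d' t) then show ?case unfolding tp v(7) arr_def K'[symmetric] by blast
  qed (use v xs f' out K' tr tp in auto)
qed

definition psort :: "(machine \<Rightarrow> 's set) \<Rightarrow> (machine \<Rightarrow> 'y \<Rightarrow> 's \<Rightarrow> item \<Rightarrow> 's \<times> item list) \<Rightarrow> machine \<Rightarrow>
    'y \<times> nat \<times> nat \<times> nat \<times> 's \<times> nat \<Rightarrow> nat prog" where
  "psort S f P x = (case x of (y, a, K, b, s0, tmp) \<Rightarrow> scan S f (\<lambda>P y s. []) vu vu P (y, a, K, b, s0) \<bind>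
     (\<lambda>r. sort_arr P (b, snd r - b, tmp) \<bind> (\<lambda>_. Ret (snd r - b))))"

lemma lean_psort: "smallset S \<Longrightarrow> lean (\<lambda>P x. psort S f P (g P x))"
  unfolding psort_def case_prod_beta by (intro lean_bind lean_scan_comp lean_sort_arr lean_Ret)

lemma interval_disjoint: "(b::nat) \<le> c \<Longrightarrow> {a..<b} \<inter> {c..<d} = {}" "b \<le> c \<Longrightarrow> {c..<d} \<inter> {a..<b} = {}"
  by auto

lemma nlev_mono: "okm P \<Longrightarrow> 1 \<le> L \<Longrightarrow> K \<le> K' \<Longrightarrow> nlev P K L \<le> nlev P K' L"
  unfolding nlev_def by (rule Least_le) (rule le_trans[OF _ LeastI[of "\<lambda>i. K' \<le> L * fan P ^ i" K']], simp_all add: nlev_ex)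

text \<open>All arrays of a round are charged to one bound \<open>H\<close>: \<open>2 H\<close> for
  the pass, \<open>4 H\<close> for copying and run formation, and \<open>27 H\<close> for each level
  of merging.\<close>

lemma wp_psort:
  fixes f :: "machine \<Rightarrow> 'y \<Rightarrow> 's \<Rightarrow> item \<Rightarrow> 's \<times> item list"
  assumes ok: "okm P" "disk_ok P d" and arr: "arr P d a ys" and K: "K = cdiv (length ys) (zs P)" and f': "f' = f P y"
    and skip: "\<And>s. f' s pad_item = (s, [])" and burst: "\<And>s x. length (snd (f' s x)) \<le> 2"
    and st: "\<And>k. fst (trun f' s0 (take k ys)) \<in> S P" and out: "out = snd (trun f' s0 ys)" "set out \<subseteq> zitems P"
    and H: "K \<le> H" "cdiv (length out) (zs P) \<le> H" "H \<le> cap P \<or> H * zs P \<le> word_range P ^ 3"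
    and tr: "a + H \<le> word_range P ^ 8" "b + H \<le> word_range P ^ 8" "tmp + 3 * H \<le> word_range P ^ 8"
      "{a..<a+H} \<inter> {b..<b+H} = {}" "b + H \<le> tmp"
  shows "wp P (psort S f P (y, a, K, b, s0, tmp)) d (\<lambda>r d' t. r = cdiv (length out) (zs P) \<and> arr P d' b (sort out) \<and> disk_ok P d' \<and>
     same_off ({b..<b+H} \<union> {tmp..<tmp+3*H}) d d' \<and> t \<le> 6 * H + 27 * (H * nlev P H (cap P)))"
proof -
  note v = virt[OF ok(1)]
  let ?Z = "zs P"
  define K' where "K' = cdiv (length out) ?Z"
  have K'H: "K' \<le> H" using H by (simp add: K'_def)
  have zv: "zitems P \<subseteq> data_items P" "zitems P \<subseteq> vitems P" using data_items_vitems by (auto simp: zitems_def)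
  have pd: "pad_item \<in> data_items P" using okmD(4)[OF ok(1)] by (simp add: pad_item_def data_items_def)
  have P1: "wp P (scan S f (\<lambda>P y s. []) vu vu P (y, a, K, b, s0)) d (\<lambda>r d' t. fst r = fst (trun f' s0 ys) \<and> snd r = b + K' \<and>
     arr P d' b out \<and> disk_ok P d' \<and> same_off {b..<b+K'} d d' \<and> t \<le> K + K')"
  proof (rule wp_pass[where f = f, OF ok arr K f' _ _ _ out(1) _ K'_def])
    show "f' s pad_item = (s, [])" for s by (rule skip)
    show "length (snd (f' s x)) \<le> 2" for s x by (rule burst)
    show "fst (trun f' s0 (take k ys)) \<in> S P" for k by (rule st)
    show "set out \<subseteq> vitems P" using out(2) zv by blast
    show "a + K \<le> word_range P ^ 8" "b + K' \<le> word_range P ^ 8" using tr H(1) K'H by auto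
    have "{a..<a+K} \<subseteq> {a..<a+H}" "{b..<b+K'} \<subseteq> {b..<b+H}" using H(1) K'H by auto
    then show "{a..<a+K} \<inter> {b..<b+K'} = {}" using tr(4) by blast
  qed
  show ?thesis unfolding psort_def prod.case
  proof (rule wp_bindI[OF P1])
    fix r d1 t1 assume 1: "fst r = fst (trun f' s0 ys) \<and> snd r = b + K' \<and>
     arr P d1 b out \<and> disk_ok P d1 \<and> same_off {b..<b+K'} d d1 \<and> t1 \<le> K + K'"
    then have r: "snd r - b = K'" by simp
    have c1: "pad ?Z out = cont (vu P) d1 b K'" using 1 by (simp add: arr_def K'_def)
    show "wp P (sort_arr P (b, snd r - b, tmp) \<bind> (\<lambda>_. Ret (snd r - b))) d1 (\<lambda>r d' t'. r = cdiv (length out) ?Z \<and> arr P d' b (sort out) \<and> disk_ok P d' \<and>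
     same_off ({b..<b+H} \<union> {tmp..<tmp+3*H}) d d' \<and> t1 + t' \<le> 6 * H + 27 * (H * nlev P H (cap P)))"
      unfolding r
    proof (rule wp_bindI[OF wp_sort_arr[OF ok(1) _ _ c1]])
      show "disk_ok P d1" using 1 by simp
      show "K' \<le> cap P \<or> K' * ?Z \<le> word_range P ^ 3" using H(3) K'H by (meson le_trans mult_le_mono1)
      show "set (pad ?Z out) \<subseteq> data_items P" using out(2) zv pd by (auto simp: pad_def)
      show "b + K' \<le> word_range P ^ 8" "tmp + 3 * K' \<le> word_range P ^ 8" using tr K'H by auto
      show "{b..<b+K'} \<inter> {tmp..<tmp+3*K'} = {}" using tr(5) K'H by (intro interval_disjoint) simp
    next
      fix q d2 t2 assume 2: "cont (vu P) d2 b K' = sort (pad ?Z out) \<and> disk_ok P d2 \<and>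
        same_off ({b..<b+K'} \<union> {tmp..<tmp+3*K'}) d1 d2 \<and> t2 \<le> 4 * K' + 27 * K' * nlev P K' (cap P)"
      have "arr P d2 b (sort out)" using 2 sort_pad[OF out(2), of ?Z] by (simp add: arr_def K'_def)
      moreover have "same_off ({b..<b+H} \<union> {tmp..<tmp+3*H}) d d2"
        by (rule same_off_trans[of "{b..<b+K'}" _ d1 "{b..<b+K'} \<union> {tmp..<tmp+3*K'}"]) (use 1 2 K'H in auto)
      moreover have "t1 + t2 \<le> 6 * H + 27 * (H * nlev P H (cap P))"
      proof -
        have "K' * nlev P K' (cap P) \<le> H * nlev P H (cap P)"
          using K'H nlev_mono[OF ok(1) _ K'H, of "cap P"] v(12) by (intro mult_le_mono) auto
        then show ?thesis using 1 2 H(1) K'H by (simp add: mult.assoc)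
      qed
      ultimately show "wp P (Ret K') d2 (\<lambda>r d' t'. r = cdiv (length out) ?Z \<and> arr P d' b (sort out) \<and> disk_ok P d' \<and>
         same_off ({b..<b+H} \<union> {tmp..<tmp+3*H}) d d' \<and> t1 + (t2 + t') \<le> 6 * H + 27 * (H * nlev P H (cap P)))"
        using 2 by (simp add: K'_def)
    qed
  qed
qed

lemma smallset_vitems: "smallset vitems"
proof -
  have "small P 16 (vitems P)" if ok: "okm P" for P
  proof -
    have "card (vitems P) \<le> word_range P ^ 16" by (rule vitems_finite_card[OF ok])
    also have "\<dots> \<le> word_range P ^ (16 * mem_size P)" using okmD[OF ok] by (intro power_increasing) auto
    finally show ?thesis using vitems_finite_card[OF ok] by (simp add: small_def)
  qed
  then show ?thesis unfolding smallset_def by blast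
qed

text \<open>The areas \<open>rA\<close> and \<open>rB\<close> alternate as source and target.
  Removed vertices and surviving graph are extracted from the same sorted array. The surviving graph
  needs no order, because the next round starts by splitting and sorting it.\<close>

definition round_step :: "(nat \<Rightarrow> nat \<Rightarrow> nat \<Rightarrow> nat) \<Rightarrow> machine \<Rightarrow> (nat \<times> nat \<times> nat) \<times> nat \<times> nat \<times> nat \<times> nat \<Rightarrow> (nat \<times> nat \<times> nat \<times> nat) prog" where
  "round_step F P x = (case x of ((rA, rB, tmp), n, m, K, lg) \<Rightarrow>
     psort (\<lambda>P. {()}) split_step P ((), rA, K, rB, (), tmp) \<bind> (\<lambda>K1.
     psort (\<lambda>P. nums P \<times> nums P) (count_step F) P ((n, m), rB, K1, rA, (0, 0), tmp) \<bind> (\<lambda>K2.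
     psort nums flag_step P ((), rA, K2, rB, 0, tmp) \<bind> (\<lambda>K3.
     scan (\<lambda>P. {()}) low_step (\<lambda>P y s. []) vu vu P ((), rB, K3, lg, ()) \<bind> (\<lambda>r.
     scan (\<lambda>P. vitems P \<times> nums P \<times> nums P) high_step (\<lambda>P y s. []) vu vu P ((), rB, K3, rA, ([], 0, 0)) \<bind> (\<lambda>q.
     Ret (fst (snd (fst q)), snd (snd (fst q)), snd q - rA, snd r)))))))"

lemma lean_round_step: "lean (\<lambda>P x. round_step F P (g P x))"
  unfolding round_step_def case_prod_beta
  by (intro lean_bind lean_psort lean_scan_comp lean_Ret smallset_intros smallset_vitems smallset_finite_const) simp_all

lemma count_state:
  assumes "\<And>x. x \<in> set xs \<Longrightarrow> x ! 1 < N"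
  shows "fst (fst (trun (count_step F P y) s xs)) < max N (fst s + 1) \<and> snd (fst (trun (count_step F P y) s xs)) \<le> snd s + length xs"
  using assms
proof (induction xs arbitrary: s)
  case (Cons x xs)
  let ?s = "fst (count_step F P y s x)"
  have x: "x ! 1 < N" using Cons.prems by simp
  have 1: "fst ?s < max N (fst s + 1)" "snd ?s \<le> snd s + 1" using x by (auto simp: count_step_def Let_def)
  have "fst (fst (trun (count_step F P y) ?s xs)) < max N (fst ?s + 1)" "snd (fst (trun (count_step F P y) ?s xs)) \<le> snd ?s + length xs"
    using Cons.IH[of ?s] Cons.prems by auto
  then show ?case using 1 by auto
qed simp

lemma flag_state:
  assumes "\<And>x. x \<in> set xs \<Longrightarrow> x ! 3 < N" "s < N"
  shows "fst (trun (flag_step P y) s xs) < N"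
  using assms
proof (induction xs arbitrary: s)
  case (Cons x xs)
  have "fst (flag_step P y s x) < N" using Cons.prems by (auto simp: flag_step_def)
  then show ?case using Cons by simp
qed simp

lemma high_state:
  assumes "\<And>x. x \<in> set xs \<Longrightarrow> x \<in> X" "fst s \<in> X"
  shows "fst (fst (trun (high_step P y) s xs)) \<in> X \<and> fst (snd (fst (trun (high_step P y) s xs))) \<le> fst (snd s) + length xs \<and>
     snd (snd (fst (trun (high_step P y) s xs))) \<le> snd (snd s) + length xs"
  using assms
proof (induction xs arbitrary: s)
  case (Cons x xs)
  let ?s = "fst (high_step P y s x)"
  have 1: "fst ?s \<in> X" "fst (snd ?s) \<le> fst (snd s) + 1" "snd (snd ?s) \<le> snd (snd s) + 1"
    using Cons.prems by (auto simp: high_step_def)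
  have "fst (fst (trun (high_step P y) ?s xs)) \<in> X \<and> fst (snd (fst (trun (high_step P y) ?s xs))) \<le> fst (snd ?s) + length xs \<and>
     snd (snd (fst (trun (high_step P y) ?s xs))) \<le> snd (snd ?s) + length xs"
    using Cons.IH[of ?s] Cons.prems 1 by auto
  then show ?case using 1 by auto
qed simp

lemma card_gset:
  assumes "simple_graph V E" shows "card (gset V E) = card V + card E"
proof -
  \<comment> \<open>The constant flag function only gives access to the general facts on simple
    graphs.\<close>
  interpret round_graph V E "\<lambda>_. 0" by unfold_locales (use assms in auto)
  have pr: "{Min e, Max e} = e \<and> Min e < Max e" if "e \<in> E" for e
  proof -
    have "card e = 2" using that graph by (auto simp: simple_graph_def)
    then obtain a b where ab: "e = {a, b}" "a \<noteq> b" by (auto simp: card_2_iff)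
    then show ?thesis by (auto simp: min_def max_def)
  qed
  have im: "{[0, u, v, 0] |u v. u < v \<and> {u, v} \<in> E} = (\<lambda>e. [0, Min e, Max e, 0]) ` E"
  proof
    show "{[0, u, v, 0] |u v. u < v \<and> {u, v} \<in> E} \<subseteq> (\<lambda>e. [0, Min e, Max e, 0]) ` E"
    proof clarify
      fix u v :: nat assume "u < v" "{u, v} \<in> E"
      then show "[0, u, v, 0] \<in> (\<lambda>e. [0, Min e, Max e, 0]) ` E" by (intro image_eqI[of _ _ "{u, v}"]) auto
    qed
    show "(\<lambda>e. [0, Min e, Max e, 0]) ` E \<subseteq> {[0, u, v, 0] |u v. u < v \<and> {u, v} \<in> E}" using pr by fastforce
  qed
  have "card ((\<lambda>e. [0, Min e, Max e, 0]) ` E) = card E"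
  proof (rule card_image, rule inj_onI)
    fix e f assume e: "e \<in> E" "f \<in> E" "[0, Min e, Max e, 0] = [0, Min f, Max f, 0]"
    then have "{Min e, Max e} = {Min f, Max f}" by simp
    then show "e = f" using pr[OF e(1)] pr[OF e(2)] by argo
  qed
  moreover have "card ((\<lambda>v. [0, v, v, 0 :: nat]) ` V) = card V" by (rule card_image) (auto simp: inj_on_def)
  moreover have "(\<lambda>v. [0, v, v, 0]) ` V \<inter> {[0, u, v, 0] |u v. u < v \<and> {u, v} \<in> E} = {}" by auto
  moreover have "finite ((\<lambda>v. [0, v, v, 0 :: nat]) ` V)" "finite ((\<lambda>e. [0, Min e, Max e, 0]) ` E)" using finV finE by auto
  ultimately show ?thesis unfolding gset_def im by (subst card_Un_disjoint) (auto simp: im)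
qed

text \<open>Three sorted passes cost \<open>6 H\<close> and \<open>27 H\<close> per merge level
  each, the two closing passes \<open>2 H\<close> each; together these are \<open>22 H\<close>, and
  \<open>81 H\<close> per level.\<close>

lemma wp_round_step:
  assumes ok: "okm P" "disk_ok P d" and W: "3 \<le> word_range P" and g: "simple_graph V E" "V \<subseteq> {..<word_range P}"
    and nm: "n = card V" "m = card E" "n < word_range P" "m < word_range P"
    and ys: "arr P d rA ys" "distinct ys" "set ys = gset V E" and K: "K = cdiv (n + m) (zs P)"
    and F: "\<And>c. F n m c \<le> 1" and H: "H = cdiv (n + 2 * m) (zs P)"
    and V': "V' = {v \<in> V. F n m (vertex_degree E v) = 0}" "E' = {e \<in> E. e \<subseteq> V'}"
    and tr: "rA + H \<le> rB" "rB + H \<le> tmp" "tmp + 3 * H \<le> lg" "lg + H \<le> word_range P ^ 8"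
  shows "wp P (round_step F P ((rA, rB, tmp), n, m, K, lg)) d (\<lambda>r d' t. \<exists>ys' lows.
     r = (card V', card E', cdiv (card V' + card E') (zs P), lg + cdiv (length lows) (zs P)) \<and>
     arr P d' rA ys' \<and> distinct ys' \<and> set ys' = gset V' E' \<and>
     arr P d' lg (map (\<lambda>v. [0, v, v, 0]) lows) \<and> distinct lows \<and> set lows = V - V' \<and> disk_ok P d' \<and>
     same_off ({rA..<tmp+3*H} \<union> {lg..<lg + cdiv (length lows) (zs P)}) d d' \<and> cdiv (length lows) (zs P) \<le> H \<and>
     t \<le> 22 * H + 81 * (H * nlev P H (cap P)))"
proof -
  let ?Z = "zs P" and ?W = "word_range P"
  note v = virt[OF ok(1)]
  interpret G: round_graph V E "F n m" by unfold_locales (use g F in auto)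
  have V'G: "V' = G.V'" "E' = G.E'" unfolding V' G.V'_def G.E'_def G.fl_def G.deg_degree by auto
  have Vw: "v < ?W" if "v \<in> V" for v using that g(2) by auto
  have lys: "length ys = n + m" using distinct_card[OF ys(2)] ys(3) card_gset[OF g(1)] nm by simp
  have Klys: "K = cdiv (length ys) ?Z" using K lys by simp
  have KH: "K \<le> H" unfolding K H by (rule cdiv_mono) simp
  \<comment> \<open>A single stripe may exceed \<open>W^3\<close> items, but it needs no merging.
    From two stripes on, rounding up at most doubles the number of items, and
    \<open>2 * (n + 2 * m) <= 6 * W <= W^3\<close>, since \<open>W\<close> is at least 3.\<close>
  have H3: "H \<le> cap P \<or> H * ?Z \<le> ?W ^ 3"
  proof (cases "H \<le> 1")
    case True then show ?thesis using v(12) by simp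
  next
    case False
    then have "1 \<le> n + 2 * m" unfolding H using v(8) by (cases "n + 2 * m") (auto simp: cdiv_def)
    then have a: "(H - 1) * ?Z \<le> n + 2 * m" using cdiv_less[OF v(8)] H less_imp_le by blast
    have "H * ?Z \<le> (2 * (H - 1)) * ?Z" using False by (intro mult_le_mono1) simp
    then have "H * ?Z \<le> 2 * ((H - 1) * ?Z)" by (simp only: mult.assoc)
    then have "H * ?Z \<le> 2 * (n + 2 * m)" using mult_le_mono2[OF a] by (rule le_trans)
    also have "\<dots> \<le> 6 * ?W" using nm(3,4) by simp
    also have "\<dots> \<le> ?W * ?W * ?W"
    proof -
      have "6 \<le> ?W * ?W" using mult_le_mono[OF W W] by simp
      then show ?thesis by (rule mult_le_mono1)
    qed
    finally show ?thesis by (simp add: power3_eq_cube)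
  qed
  have W8: "x \<le> ?W ^ 8" if "x \<le> lg + H" for x using that tr(4) by simp
  have nmW: "n + 2 * m \<le> ?W ^ 8"
  proof -
    have "n + 2 * m \<le> 3 * ?W" using nm(3,4) by simp
    also have "\<dots> \<le> ?W * ?W" using W by (rule mult_le_mono1)
    also have "\<dots> = ?W ^ 2" by (simp add: power2_eq_square)
    also have "\<dots> \<le> ?W ^ 8" using W by (intro power_increasing) auto
    finally show ?thesis .
  qed
  have numsN: "x \<in> nums P" if "x \<le> n + 2 * m" for x using nums_le[OF ok(1)] that nmW le_trans by blast
  have numsW: "x \<in> nums P" if "x < ?W" for x
  proof (rule nums_le[OF ok(1)])
    have "?W ^ 1 \<le> ?W ^ 8" using W by (intro power_increasing) auto
    then show "x \<le> ?W ^ 8" using that by simp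
  qed
  define o1 where "o1 = snd (trun (split_step P ()) () ys)"
  have o1: "distinct o1" "set o1 = G.H1" using G.split_pass[OF ys(2,3), of P "()"] by (auto simp: o1_def)
  have l1: "length o1 \<le> n + 2 * m" using distinct_card[OF o1(1)] o1(2) G.card_H1 nm by simp
  have z1: "set o1 \<subseteq> zitems P" unfolding o1(2) G.H1_def using Vw G.edge W by (auto simp: zitem_iff)
  define s1 where "s1 = sort o1"
  have s1: "sorted s1" "distinct s1" "set s1 = G.H1" "length s1 = length o1" using o1 by (auto simp: s1_def)
  define o2 where "o2 = snd (trun (count_step F P (n, m)) (0, 0) s1)"
  have o2: "distinct o2" "set o2 = G.H2" "length o2 = length s1"
    using G.count_pass[OF s1(1-3), of F "(n, m)" P] by (auto simp: o2_def)
  have flW: "G.fl u < ?W" for u using G.fl_le[of u] W by auto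
  have z2: "set o2 \<subseteq> zitems P" unfolding o2(2) G.H2_def using Vw G.edge W flW by (auto simp: zitem_iff)
  define s2 where "s2 = sort o2"
  have s2: "sorted s2" "distinct s2" "set s2 = G.H2" "length s2 = length o2" using o2 by (auto simp: s2_def)
  define o3 where "o3 = snd (trun (flag_step P ()) 0 s2)"
  have o3: "distinct o3" "set o3 = G.H3" "length o3 \<le> length s2"
    using G.flag_pass[OF s2(1-3), of P "()"] by (auto simp: o3_def)
  have z3: "set o3 \<subseteq> zitems P" unfolding o3(2)
  proof
    fix z assume "z \<in> G.H3"
    then consider v where "v \<in> V" "z = [0, v, v, G.fl v]" |
      u v where "{u, v} \<in> E" "z = [0, min u v, max u v, if u < v then 0 else 1]" unfolding G.H3_def by blast
    then show "z \<in> zitems P"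
    proof cases
      case 1 then show ?thesis using Vw flW W by (simp add: zitem_iff)
    next
      case 2
      then have "u < ?W" "v < ?W" using G.edge Vw by blast+
      then show ?thesis using 2(2) W by (simp add: zitem_iff min_def max_def)
    qed
  qed
  define s3 where "s3 = sort o3"
  have s3: "sorted s3" "distinct s3" "set s3 = G.H3" "length s3 = length o3" using o3 by (auto simp: s3_def)
  obtain lows where lows: "snd (trun (low_step P ()) () s3) = map (\<lambda>v. [0, v, v, 0]) lows" "distinct lows" "set lows = V - V'"
    using G.low_pass[OF s3(2,3), of P "()"] V'G by auto
  define o5 where "o5 = snd (trun (high_step P ()) ([], 0, 0) s3)"
  have o5: "distinct o5" "set o5 = gset V' E'" "snd (fst (trun (high_step P ()) ([], 0, 0) s3)) = (card V', card E')"
    using G.high_pass[OF s3(1-3), of P "()"] V'G by (auto simp: o5_def)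
  have g': "simple_graph V' E'" using g(1) unfolding V' simple_graph_def by auto
  have l5: "length o5 = card V' + card E'" using distinct_card[OF o5(1)] o5(2) card_gset[OF g'] by simp
  have cV: "card V' \<le> n" "card E' \<le> m" unfolding nm V' using G.finV G.finE by (auto intro: card_mono)
  have ll: "length lows \<le> n" using distinct_card[OF lows(2)] lows(3) card_mono[OF G.finV, of "V - V'"] nm by auto
  have cH: "cdiv x ?Z \<le> H" if "x \<le> n + 2 * m" for x unfolding H by (rule cdiv_mono[OF that])
  have ls: "length s1 \<le> n + 2 * m" "length s2 \<le> n + 2 * m" "length s3 \<le> n + 2 * m" using l1 s1 s2 s3 o2 o3 by auto
  have P1: "wp P (psort (\<lambda>P. {()}) split_step P ((), rA, K, rB, (), tmp)) d (\<lambda>r d' t. r = cdiv (length o1) ?Z \<and> arr P d' rB (sort o1) \<and> disk_ok P d' \<and>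
     same_off ({rB..<rB+H} \<union> {tmp..<tmp+3*H}) d d' \<and> t \<le> 6 * H + 27 * (H * nlev P H (cap P)))"
    by (rule wp_psort[where f = split_step and y = "()", OF ok ys(1) Klys refl _ _ _ o1_def z1 KH cH[OF l1] H3])
      (use W8 tr in \<open>auto simp: split_step_def intro: interval_disjoint\<close>)
  have P2: "wp P (psort (\<lambda>P. nums P \<times> nums P) (count_step F) P ((n, m), rB, cdiv (length s1) ?Z, rA, (0, 0), tmp)) d1
     (\<lambda>r d' t. r = cdiv (length o2) ?Z \<and> arr P d' rA (sort o2) \<and> disk_ok P d' \<and>
     same_off ({rA..<rA+H} \<union> {tmp..<tmp+3*H}) d1 d' \<and> t \<le> 6 * H + 27 * (H * nlev P H (cap P)))"
    if d1: "disk_ok P d1" "arr P d1 rB s1" for d1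
  proof (rule wp_psort[where f = "count_step F" and y = "(n, m)", OF ok(1) d1 refl refl _ _ _ o2_def z2 cH[OF ls(1)] _ H3])
    fix k
    have "x ! 1 < ?W" if "x \<in> set (take k s1)" for x
      using in_set_takeD[OF that] s1(3) Vw G.edge by (auto simp: G.H1_def)
    from count_state[of "take k s1" ?W F P "(n, m)" "(0, 0)", OF this]
    have "fst (fst (trun (count_step F P (n, m)) (0, 0) (take k s1))) < ?W" "snd (fst (trun (count_step F P (n, m)) (0, 0) (take k s1))) \<le> n + 2 * m"
      using W ls(1) by auto
    then show "fst (trun (count_step F P (n, m)) (0, 0) (take k s1)) \<in> nums P \<times> nums P"
      using numsN numsW by (simp add: mem_Times_iff)
  qed (use W8 tr cH ls o2(3) in \<open>auto simp: count_step_def Let_def intro: interval_disjoint\<close>)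
  have P3: "wp P (psort nums flag_step P ((), rA, cdiv (length s2) ?Z, rB, 0, tmp)) d2
     (\<lambda>r d' t. r = cdiv (length o3) ?Z \<and> arr P d' rB (sort o3) \<and> disk_ok P d' \<and>
     same_off ({rB..<rB+H} \<union> {tmp..<tmp+3*H}) d2 d' \<and> t \<le> 6 * H + 27 * (H * nlev P H (cap P)))"
    if d2: "disk_ok P d2" "arr P d2 rA s2" for d2
  proof (rule wp_psort[where f = flag_step and y = "()", OF ok(1) d2 refl refl _ _ _ o3_def z3 cH[OF ls(2)] _ H3])
    fix k
    have "x ! 3 < ?W" if "x \<in> set (take k s2)" for x
      using in_set_takeD[OF that] s2(3) Vw G.edge flW by (auto simp: G.H2_def)
    then have "fst (trun (flag_step P ()) 0 (take k s2)) < ?W" using W by (intro flag_state) auto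
    then show "fst (trun (flag_step P ()) 0 (take k s2)) \<in> nums P" by (rule numsW)
  qed (use W8 tr cH ls(3) s3(4) in \<open>auto simp: flag_step_def intro: interval_disjoint\<close>)
  have P4: "wp P (scan (\<lambda>P. {()}) low_step (\<lambda>P y s. []) vu vu P ((), rB, cdiv (length s3) ?Z, lg, ())) d3
     (\<lambda>r d' t. fst r = fst (trun (low_step P ()) () s3) \<and> snd r = lg + cdiv (length lows) ?Z \<and> arr P d' lg (map (\<lambda>v. [0, v, v, 0]) lows) \<and> disk_ok P d' \<and>
     same_off {lg..<lg + cdiv (length lows) ?Z} d3 d' \<and> t \<le> cdiv (length s3) ?Z + cdiv (length lows) ?Z)"
    if d3: "disk_ok P d3" "arr P d3 rB s3" for d3
  proof (rule wp_pass[where f = low_step and y = "()", OF ok(1) d3 refl refl _ _ _ lows(1)[symmetric]])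
    show "set (map (\<lambda>v. [0, v, v, 0]) lows) \<subseteq> vitems P"
      using lows(3) Vw W by (auto simp: vitems_def valid_item_def)
    show "rB + cdiv (length s3) ?Z \<le> ?W ^ 8" using cH[OF ls(3)] tr by simp
    show "{rB..<rB + cdiv (length s3) ?Z} \<inter> {lg..<lg + cdiv (length lows) ?Z} = {}" using cH[OF ls(3)] tr by (intro interval_disjoint) simp
    show "lg + cdiv (length lows) ?Z \<le> ?W ^ 8" using cH[of "length lows"] ll tr by simp
  qed (auto simp: low_step_def)
  have P5: "wp P (scan (\<lambda>P. vitems P \<times> nums P \<times> nums P) high_step (\<lambda>P y s. []) vu vu P ((), rB, cdiv (length s3) ?Z, rA, ([], 0, 0))) d4
     (\<lambda>r d' t. fst r = fst (trun (high_step P ()) ([], 0, 0) s3) \<and> snd r = rA + cdiv (length o5) ?Z \<and> arr P d' rA o5 \<and> disk_ok P d' \<and>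
     same_off {rA..<rA + cdiv (length o5) ?Z} d4 d' \<and> t \<le> cdiv (length s3) ?Z + cdiv (length o5) ?Z)"
    if d4: "disk_ok P d4" "arr P d4 rB s3" for d4
  proof (rule wp_pass[where f = high_step and y = "()", OF ok(1) d4 refl refl _ _ _ o5_def])
    have l5n: "cdiv (length o5) ?Z \<le> H" using cH[of "length o5"] l5 cV by simp
    show "rB + cdiv (length s3) ?Z \<le> ?W ^ 8" "rA + cdiv (length o5) ?Z \<le> ?W ^ 8" using cH[OF ls(3)] l5n tr by auto
    show "{rB..<rB + cdiv (length s3) ?Z} \<inter> {rA..<rA + cdiv (length o5) ?Z} = {}" using l5n tr by (intro interval_disjoint) simp
    show "set o5 \<subseteq> vitems P" unfolding o5(2) gset_def V' using Vw W G.edge by (auto simp: vitems_def valid_item_def)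
    fix k
    have zv: "zitems P \<subseteq> vitems P" using data_items_vitems by (auto simp: zitems_def)
    have "x \<in> vitems P" if "x \<in> set (take k s3)" for x using in_set_takeD[OF that] s3(3) z3 o3(2) zv by auto
    moreover have "[] \<in> vitems P" by (simp add: vitems_def valid_item_def)
    ultimately have "fst (fst (trun (high_step P ()) ([], 0, 0) (take k s3))) \<in> vitems P \<and>
       fst (snd (fst (trun (high_step P ()) ([], 0, 0) (take k s3)))) \<le> n + 2 * m \<and> snd (snd (fst (trun (high_step P ()) ([], 0, 0) (take k s3)))) \<le> n + 2 * m"
      using high_state[of "take k s3" "vitems P" "([], 0, 0)" P "()"] ls(3) by auto
    then show "fst (trun (high_step P ()) ([], 0, 0) (take k s3)) \<in> vitems P \<times> nums P \<times> nums P" using numsN by (simp add: mem_Times_iff)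
  qed (auto simp: high_step_def)
  let ?F1 = "{rB..<rB+H} \<union> {tmp..<tmp+3*H}" and ?F2 = "{rA..<rA+H} \<union> {tmp..<tmp+3*H}"
  let ?A = "{rA..<tmp+3*H}" and ?L = "{lg..<lg + cdiv (length lows) ?Z}"
  have FA: "?F1 \<subseteq> ?A" "?F2 \<subseteq> ?A" using tr by auto
  show ?thesis unfolding round_step_def prod.case
  proof (rule wp_bindI[OF P1])
    fix K1 d1 t1 assume 1: "K1 = cdiv (length o1) ?Z \<and> arr P d1 rB (sort o1) \<and> disk_ok P d1 \<and> same_off ?F1 d d1 \<and> t1 \<le> 6 * H + 27 * (H * nlev P H (cap P))"
    have d1: "disk_ok P d1" "arr P d1 rB s1" and K1: "K1 = cdiv (length s1) ?Z" using 1 by (auto simp: s1_def)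
    have so1: "same_off ?A d d1" using 1 same_off_mono FA by blast
    show "wp P (psort (\<lambda>P. nums P \<times> nums P) (count_step F) P ((n, m), rB, K1, rA, (0, 0), tmp) \<bind> (\<lambda>K2.
     psort nums flag_step P ((), rA, K2, rB, 0, tmp) \<bind> (\<lambda>K3.
     scan (\<lambda>P. {()}) low_step (\<lambda>P y s. []) vu vu P ((), rB, K3, lg, ()) \<bind> (\<lambda>r.
     scan (\<lambda>P. vitems P \<times> nums P \<times> nums P) high_step (\<lambda>P y s. []) vu vu P ((), rB, K3, rA, ([], 0, 0)) \<bind> (\<lambda>q.
     Ret (fst (snd (fst q)), snd (snd (fst q)), snd q - rA, snd r)))))) d1 (\<lambda>r d' t. \<exists>ys' lows.
     r = (card V', card E', cdiv (card V' + card E') (zs P), lg + cdiv (length lows) (zs P)) \<and>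
     arr P d' rA ys' \<and> distinct ys' \<and> set ys' = gset V' E' \<and>
     arr P d' lg (map (\<lambda>v. [0, v, v, 0]) lows) \<and> distinct lows \<and> set lows = V - V' \<and> disk_ok P d' \<and>
     same_off (?A \<union> {lg..<lg + cdiv (length lows) (zs P)}) d d' \<and> cdiv (length lows) (zs P) \<le> H \<and>
     t1 + t \<le> 22 * H + 81 * (H * nlev P H (cap P)))"
      unfolding K1
    proof (rule wp_bindI[OF P2[OF d1]])
      fix K2 d2 t2 assume 2: "K2 = cdiv (length o2) ?Z \<and> arr P d2 rA (sort o2) \<and> disk_ok P d2 \<and> same_off ?F2 d1 d2 \<and> t2 \<le> 6 * H + 27 * (H * nlev P H (cap P))"
      have d2: "disk_ok P d2" "arr P d2 rA s2" and K2: "K2 = cdiv (length s2) ?Z" using 2 by (auto simp: s2_def)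
      have so2: "same_off ?A d d2" by (rule same_off_trans[OF so1, of ?F2]) (use 2 FA in auto)
      show "wp P (psort nums flag_step P ((), rA, K2, rB, 0, tmp) \<bind> (\<lambda>K3.
     scan (\<lambda>P. {()}) low_step (\<lambda>P y s. []) vu vu P ((), rB, K3, lg, ()) \<bind> (\<lambda>r.
     scan (\<lambda>P. vitems P \<times> nums P \<times> nums P) high_step (\<lambda>P y s. []) vu vu P ((), rB, K3, rA, ([], 0, 0)) \<bind> (\<lambda>q.
     Ret (fst (snd (fst q)), snd (snd (fst q)), snd q - rA, snd r))))) d2 (\<lambda>r d' t. \<exists>ys' lows.
     r = (card V', card E', cdiv (card V' + card E') (zs P), lg + cdiv (length lows) (zs P)) \<and>
     arr P d' rA ys' \<and> distinct ys' \<and> set ys' = gset V' E' \<and>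
     arr P d' lg (map (\<lambda>v. [0, v, v, 0]) lows) \<and> distinct lows \<and> set lows = V - V' \<and> disk_ok P d' \<and>
     same_off (?A \<union> {lg..<lg + cdiv (length lows) (zs P)}) d d' \<and> cdiv (length lows) (zs P) \<le> H \<and>
     t1 + (t2 + t) \<le> 22 * H + 81 * (H * nlev P H (cap P)))"
        unfolding K2
      proof (rule wp_bindI[OF P3[OF d2]])
        fix K3 d3 t3 assume 3: "K3 = cdiv (length o3) ?Z \<and> arr P d3 rB (sort o3) \<and> disk_ok P d3 \<and> same_off ?F1 d2 d3 \<and> t3 \<le> 6 * H + 27 * (H * nlev P H (cap P))"
        have d3: "disk_ok P d3" "arr P d3 rB s3" and K3: "K3 = cdiv (length s3) ?Z" using 3 by (auto simp: s3_def)
        have so3: "same_off ?A d d3" by (rule same_off_trans[OF so2, of ?F1]) (use 3 FA in auto)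
        show "wp P (scan (\<lambda>P. {()}) low_step (\<lambda>P y s. []) vu vu P ((), rB, K3, lg, ()) \<bind> (\<lambda>r.
     scan (\<lambda>P. vitems P \<times> nums P \<times> nums P) high_step (\<lambda>P y s. []) vu vu P ((), rB, K3, rA, ([], 0, 0)) \<bind> (\<lambda>q.
     Ret (fst (snd (fst q)), snd (snd (fst q)), snd q - rA, snd r)))) d3 (\<lambda>r d' t. \<exists>ys' lows.
     r = (card V', card E', cdiv (card V' + card E') (zs P), lg + cdiv (length lows) (zs P)) \<and>
     arr P d' rA ys' \<and> distinct ys' \<and> set ys' = gset V' E' \<and>
     arr P d' lg (map (\<lambda>v. [0, v, v, 0]) lows) \<and> distinct lows \<and> set lows = V - V' \<and> disk_ok P d' \<and>
     same_off (?A \<union> {lg..<lg + cdiv (length lows) (zs P)}) d d' \<and> cdiv (length lows) (zs P) \<le> H \<and>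
     t1 + (t2 + (t3 + t)) \<le> 22 * H + 81 * (H * nlev P H (cap P)))"
          unfolding K3
        proof (rule wp_bindI[OF P4[OF d3]])
          fix r d4 t4 assume 4: "fst r = fst (trun (low_step P ()) () s3) \<and> snd r = lg + cdiv (length lows) ?Z \<and> arr P d4 lg (map (\<lambda>v. [0, v, v, 0]) lows) \<and>
            disk_ok P d4 \<and> same_off ?L d3 d4 \<and> t4 \<le> cdiv (length s3) ?Z + cdiv (length lows) ?Z"
          have llH: "cdiv (length lows) ?Z \<le> H" using cH[of "length lows"] ll by simp
          have so4: "same_off (?A \<union> ?L) d d4" by (rule same_off_trans[OF so3, of ?L]) (use 4 in auto)
          have "cont (vu P) d4 rB (cdiv (length s3) ?Z) = cont (vu P) d3 rB (cdiv (length s3) ?Z)"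
            using 4 by (intro cont_same_off[of ?L]) (use cH[OF ls(3)] tr in \<open>auto intro: interval_disjoint\<close>)
          then have d4: "disk_ok P d4" "arr P d4 rB s3" using 4 d3(2) by (auto simp: arr_def)
          show "wp P (scan (\<lambda>P. vitems P \<times> nums P \<times> nums P) high_step (\<lambda>P y s. []) vu vu P ((), rB, cdiv (length s3) ?Z, rA, ([], 0, 0)) \<bind> (\<lambda>q.
     Ret (fst (snd (fst q)), snd (snd (fst q)), snd q - rA, snd r))) d4 (\<lambda>r d' t. \<exists>ys' lows.
     r = (card V', card E', cdiv (card V' + card E') (zs P), lg + cdiv (length lows) (zs P)) \<and>
     arr P d' rA ys' \<and> distinct ys' \<and> set ys' = gset V' E' \<and>
     arr P d' lg (map (\<lambda>v. [0, v, v, 0]) lows) \<and> distinct lows \<and> set lows = V - V' \<and> disk_ok P d' \<and>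
     same_off (?A \<union> {lg..<lg + cdiv (length lows) (zs P)}) d d' \<and> cdiv (length lows) (zs P) \<le> H \<and>
     t1 + (t2 + (t3 + (t4 + t))) \<le> 22 * H + 81 * (H * nlev P H (cap P)))"
          proof (rule wp_bindI[OF P5[OF d4]])
            fix q d5 t5 assume 5: "fst q = fst (trun (high_step P ()) ([], 0, 0) s3) \<and> snd q = rA + cdiv (length o5) ?Z \<and> arr P d5 rA o5 \<and> disk_ok P d5 \<and>
              same_off {rA..<rA + cdiv (length o5) ?Z} d4 d5 \<and> t5 \<le> cdiv (length s3) ?Z + cdiv (length o5) ?Z"
            have l5n: "cdiv (length o5) ?Z \<le> H" using cH[of "length o5"] l5 cV by simp
            have oA: "{rA..<rA + cdiv (length o5) ?Z} \<subseteq> ?A" using l5n tr by auto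
            have so5: "same_off (?A \<union> ?L) d d5" by (rule same_off_trans[OF so4, of "{rA..<rA + cdiv (length o5) ?Z}"]) (use 5 oA in auto)
            have "cont (vu P) d5 lg (cdiv (length lows) ?Z) = cont (vu P) d4 lg (cdiv (length lows) ?Z)"
              using 5 l5n tr by (intro cont_same_off[of "{rA..<rA + cdiv (length o5) ?Z}"]) (auto intro: interval_disjoint)
            then have a5: "arr P d5 lg (map (\<lambda>v. [0, v, v, 0]) lows)" using 4 by (simp add: arr_def)
            have q: "snd (fst q) = (card V', card E')" using 5 o5(3) by simp
            have cost: "t1 + (t2 + (t3 + (t4 + (t5 + 0)))) \<le> 22 * H + 81 * (H * nlev P H (cap P))"
            proof -
              define N where "N = H * nlev P H (cap P)"
              have "t1 \<le> 6 * H + 27 * N" "t2 \<le> 6 * H + 27 * N" "t3 \<le> 6 * H + 27 * N" using 1 2 3 by (auto simp: N_def)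
              moreover have "t4 \<le> 2 * H" "t5 \<le> 2 * H" using 4 5 cH[OF ls(3)] llH l5n by auto
              ultimately show ?thesis unfolding N_def[symmetric] by linarith
            qed
            show "wp P (Ret (fst (snd (fst q)), snd (snd (fst q)), snd q - rA, snd r)) d5 (\<lambda>r d' t. \<exists>ys' lows.
     r = (card V', card E', cdiv (card V' + card E') (zs P), lg + cdiv (length lows) (zs P)) \<and>
     arr P d' rA ys' \<and> distinct ys' \<and> set ys' = gset V' E' \<and>
     arr P d' lg (map (\<lambda>v. [0, v, v, 0]) lows) \<and> distinct lows \<and> set lows = V - V' \<and> disk_ok P d' \<and>
     same_off (?A \<union> {lg..<lg + cdiv (length lows) (zs P)}) d d' \<and> cdiv (length lows) (zs P) \<le> H \<and>
     t1 + (t2 + (t3 + (t4 + (t5 + t)))) \<le> 22 * H + 81 * (H * nlev P H (cap P)))"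
              unfolding wp_Ret
              by (rule exI[of _ o5], rule exI[of _ lows])
                (use 4 5 q l5 o5(1,2) a5 lows(2,3) so5 llH cost in simp)
          qed
        qed
      qed
    qed
  qed
qed

section \<open>Degeneracy orderings\<close>

lemma later_neighbours_le_degree:
  assumes "finite E" "distinct xs" "i < length xs"
  shows "card {j. i < j \<and> j < length xs \<and> {xs ! i, xs ! j} \<in> E} \<le> vertex_degree E (xs ! i)"
proof -
  let ?S = "{j. i < j \<and> j < length xs \<and> {xs ! i, xs ! j} \<in> E}"
  have "inj_on (\<lambda>j. {xs ! i, xs ! j}) ?S"
    using assms by (auto simp: inj_on_def doubleton_eq_iff nth_eq_iff_index_eq)
  moreover have "(\<lambda>j. {xs ! i, xs ! j}) ` ?S \<subseteq> {e \<in> E. xs ! i \<in> e}" by auto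
  ultimately show ?thesis unfolding vertex_degree_def by (rule card_inj_on_le) (use assms in simp)
qed

lemma simple_graph_finite: "simple_graph V E \<Longrightarrow> finite V \<and> finite E"
proof -
  assume "simple_graph V E"
  then have "finite V" "E \<subseteq> Pow V" by (auto simp: simple_graph_def)
  then show ?thesis by (simp add: finite_subset)
qed

text \<open>After a removed vertex come at most all its neighbours in the current graph; after a
  survivor come only survivors. So any ordering of the survivors within the bound can be
  appended.\<close>

lemma peel_ordering:
  assumes g: "simple_graph V E" and V': "V' \<subseteq> V" "E' = {e \<in> E. e \<subseteq> V'}"
    and lows: "distinct lows" "set lows = V - V'" "\<And>v. v \<in> set lows \<Longrightarrow> real (vertex_degree E v) \<le> \<delta>"
    and ys: "degeneracy_ordering V' E' \<delta> ys"
  shows "degeneracy_ordering V E \<delta> (lows @ ys)"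
  unfolding degeneracy_ordering_def
proof (intro conjI allI impI)
  let ?xs = "lows @ ys" and ?k = "length lows"
  have y: "distinct ys" "set ys = V'" "\<And>i. i < length ys \<Longrightarrow> real (card {j. i < j \<and> j < length ys \<and> {ys ! i, ys ! j} \<in> E'}) \<le> \<delta>"
    using ys by (auto simp: degeneracy_ordering_def)
  show dx: "distinct ?xs" using lows(1,2) y by auto
  show "set ?xs = V" using lows(2) y V' by auto
  fix i assume i: "i < length ?xs"
  show "real (card {j. i < j \<and> j < length ?xs \<and> {?xs ! i, ?xs ! j} \<in> E}) \<le> \<delta>"
  proof (cases "i < ?k")
    case True
    have "real (card {j. i < j \<and> j < length ?xs \<and> {?xs ! i, ?xs ! j} \<in> E}) \<le> real (vertex_degree E (?xs ! i))"
      using later_neighbours_le_degree[OF _ dx i] simple_graph_finite[OF g] by simp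
    also have "\<dots> \<le> \<delta>" using True lows(3)[of "lows ! i"] by (simp add: nth_append)
    finally show ?thesis .
  next
    case False
    define i' where "i' = i - ?k"
    have i': "i = ?k + i'" "i' < length ys" using False i by (auto simp: i'_def)
    have "{j. i < j \<and> j < length ?xs \<and> {?xs ! i, ?xs ! j} \<in> E} \<subseteq> (\<lambda>j. ?k + j) ` {j. i' < j \<and> j < length ys \<and> {ys ! i', ys ! j} \<in> E'}"
    proof
      fix j assume j: "j \<in> {j. i < j \<and> j < length ?xs \<and> {?xs ! i, ?xs ! j} \<in> E}"
      define j' where "j' = j - ?k"
      have j': "j = ?k + j'" "i' < j'" "j' < length ys" using j i' by (auto simp: j'_def)
      have "{ys ! i', ys ! j'} \<in> E" using j i' j' by (simp add: nth_append)
      moreover have "ys ! i' \<in> V'" "ys ! j' \<in> V'" using y(2) i' j' nth_mem by auto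
      ultimately have "{ys ! i', ys ! j'} \<in> E'" using V' by simp
      then show "j \<in> (\<lambda>j. ?k + j) ` {j. i' < j \<and> j < length ys \<and> {ys ! i', ys ! j} \<in> E'}" using j' by auto
    qed
    then have "card {j. i < j \<and> j < length ?xs \<and> {?xs ! i, ?xs ! j} \<in> E} \<le> card {j. i' < j \<and> j < length ys \<and> {ys ! i', ys ! j} \<in> E'}"
      by (rule surj_card_le[rotated]) simp
    then show ?thesis using y(3)[OF i'(2)] by simp
  qed
qed

lemma degenerate_low_vertex:
  assumes "degenerate V E d" "V' \<noteq> {}" "V' \<subseteq> V" "E' \<subseteq> E" "simple_graph V' E'"
  shows "\<exists>v\<in>V'. vertex_degree E' v \<le> d"
proof (rule ccontr)
  assume "\<not> ?thesis"
  then have "\<forall>v\<in>V'. Suc d \<le> vertex_degree E' v" by (auto simp: not_le Suc_le_eq)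
  then have "has_core V E (Suc d)" using assms unfolding has_core_def by blast
  then show False using assms(1) unfolding degenerate_def by fastforce
qed

text \<open>Deleting a vertex of degree at most \<open>d\<close> accounts for at most
  \<open>d\<close> edges and puts the vertex first. One induction thus yields the edge bound, on
  which the threshold rests, and an ordering for the final graph in internal memory.\<close>

lemma degenerate_edges_ordering:
  assumes deg: "degenerate V E d"
  shows "simple_graph V' E' \<Longrightarrow> V' \<subseteq> V \<Longrightarrow> E' \<subseteq> E \<Longrightarrow> card E' \<le> d * card V' \<and> (\<exists>xs. degeneracy_ordering V' E' (real d) xs)"
proof (induction "card V'" arbitrary: V' E')
  case 0
  then have "V' = {}" using simple_graph_finite by (metis card_0_eq)
  moreover from this have "E' = {}" using 0 by (auto simp: simple_graph_def)
  ultimately show ?case by (auto simp: degeneracy_ordering_def intro!: exI[of _ "[]"])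
next
  case (Suc k)
  have fin: "finite V'" "finite E'" using simple_graph_finite Suc.prems by auto
  have ne: "V' \<noteq> {}" using Suc.hyps(2) by auto
  obtain v where v: "v \<in> V'" "vertex_degree E' v \<le> d" using degenerate_low_vertex[OF deg ne Suc.prems(2,3,1)] by blast
  let ?V = "V' - {v}" and ?E = "{e \<in> E'. e \<subseteq> V' - {v}}"
  have g: "simple_graph ?V ?E" using Suc.prems(1) by (auto simp: simple_graph_def)
  have "card ?V = k" using Suc.hyps(2) v fin by simp
  then have IH: "card ?E \<le> d * card ?V" "\<exists>xs. degeneracy_ordering ?V ?E (real d) xs"
    using Suc.hyps(1)[of ?V ?E] g Suc.prems by auto
  have "E' = ?E \<union> {e \<in> E'. v \<in> e}" using Suc.prems(1) by (auto simp: simple_graph_def)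
  then have "card E' \<le> card ?E + card {e \<in> E'. v \<in> e}" by (metis card_Un_le)
  also have "\<dots> \<le> d * card ?V + d" using IH v by (intro add_mono) (auto simp: vertex_degree_def)
  also have "\<dots> = d * card V'" using \<open>card ?V = k\<close> Suc.hyps(2)[symmetric] by simp
  finally have 1: "card E' \<le> d * card V'" .
  obtain xs where xs: "degeneracy_ordering ?V ?E (real d) xs" using IH by blast
  have "degeneracy_ordering V' E' (real d) ([v] @ xs)"
    by (rule peel_ordering[OF Suc.prems(1) _ refl _ _ _ xs]) (use v in auto)
  then show ?case using 1 by blast
qed

text \<open>The handshake lemma, by double counting of incident pairs.\<close>

lemma sum_degrees:
  assumes "simple_graph V E" shows "(\<Sum>v\<in>V. vertex_degree E v) = 2 * card E"
proof -
  have fin: "finite V" "finite E" using simple_graph_finite[OF assms] by auto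
  have "(\<Sum>v\<in>V. vertex_degree E v) = (\<Sum>v\<in>V. \<Sum>e\<in>E. if v \<in> e then 1 else 0)"
    unfolding vertex_degree_def using fin by (intro sum.cong refl) (simp add: sum.If_cases Int_def)
  also have "\<dots> = (\<Sum>e\<in>E. \<Sum>v\<in>V. if v \<in> e then 1 else 0)" by (rule sum.swap)
  also have "\<dots> = (\<Sum>e\<in>E. 2)"
  proof (rule sum.cong[OF refl])
    fix e assume "e \<in> E"
    then have e: "e \<subseteq> V" "card e = 2" using assms by (auto simp: simple_graph_def)
    then have "{v \<in> V. v \<in> e} = e" by auto
    then show "(\<Sum>v\<in>V. if v \<in> e then 1 else 0) = (2::nat)" using e fin by (simp add: sum.If_cases Int_def)
  qed
  finally show ?thesis by simp
qed

text \<open>Markov's inequality for the average degree \<open>2m/n\<close>. The condition is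
  multiplied out, so that it makes sense without division by the number of vertices.\<close>

lemma high_degree_few:
  fixes \<epsilon> :: real
  assumes g: "simple_graph V E" and \<epsilon>: "\<epsilon> > 0"
    and V': "V' = {v \<in> V. \<not> real (vertex_degree E v) * real (card V) \<le> (2 + \<epsilon>) * real (card E)}"
  shows "real (card V') * (2 + \<epsilon>) \<le> 2 * real (card V)"
proof (cases "V' = {}")
  case False
  let ?n = "real (card V)" and ?m = "real (card E)"
  have fin: "finite V" "finite E" using simple_graph_finite[OF g] by auto
  then have finV': "finite V'" by (simp add: V')
  \<comment> \<open>Without edges all degrees are 0, and no vertex would be left over.\<close>
  have m0: "?m > 0"
  proof (rule ccontr)
    assume "\<not> ?m > 0"
    then have "E = {}" using fin by simp
    then show False using False by (auto simp: V' vertex_degree_def)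
  qed
  have "real (card V') * ((2 + \<epsilon>) * ?m) = (\<Sum>v\<in>V'. (2 + \<epsilon>) * ?m)" by simp
  also have "\<dots> \<le> (\<Sum>v\<in>V'. real (vertex_degree E v) * ?n)" by (intro sum_mono) (auto simp: V')
  also have "\<dots> \<le> (\<Sum>v\<in>V. real (vertex_degree E v) * ?n)" using fin by (intro sum_mono2) (auto simp: V')
  also have "\<dots> = real (\<Sum>v\<in>V. vertex_degree E v) * ?n" by (simp add: sum_distrib_right)
  also have "\<dots> = (2 * ?n) * ?m" by (simp add: sum_degrees[OF g])
  finally have "(real (card V') * (2 + \<epsilon>)) * ?m \<le> (2 * ?n) * ?m" by (simp add: mult.assoc)
  then show ?thesis using m0 by (simp add: mult_le_cancel_right)
qed simp

lemma degeneracy_ordering_mono: "degeneracy_ordering V E \<delta> xs \<Longrightarrow> \<delta> \<le> \<delta>' \<Longrightarrow> degeneracy_ordering V E \<delta>' xs"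
  unfolding degeneracy_ordering_def by (meson order_trans)

text \<open>The algorithm does not know \<open>d\<close>, so the ordering is defined by the graph
  alone, through the least bound that any ordering attains.\<close>

definition best_order :: "nat set \<Rightarrow> nat set set \<Rightarrow> nat list" where
  "best_order V E = (SOME xs. degeneracy_ordering V E (real (LEAST d. \<exists>xs. degeneracy_ordering V E (real d) xs)) xs)"

lemma best_order:
  assumes "degeneracy_ordering V E (real d) xs" shows "degeneracy_ordering V E (real d) (best_order V E)"
proof -
  let ?P = "\<lambda>d::nat. \<exists>xs. degeneracy_ordering V E (real d) xs"
  have "?P (Least ?P)" by (rule LeastI[of ?P d]) (use assms in blast)
  then have 1: "degeneracy_ordering V E (real (Least ?P)) (best_order V E)" unfolding best_order_def by (rule someI_ex)
  have "Least ?P \<le> d" by (rule Least_le) (use assms in blast)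
  then have le: "real (Least ?P) \<le> real d" by simp
  show ?thesis using degeneracy_ordering_mono[OF 1 le] .
qed

definition items_vertices :: "item set \<Rightarrow> nat set" where "items_vertices S = {v. [0, v, v, 0] \<in> S}"
definition items_edges :: "item set \<Rightarrow> nat set set" where "items_edges S = {{u, v} |u v. u < v \<and> [0, u, v, 0] \<in> S}"

lemma items_graph:
  assumes "simple_graph V E" shows "items_vertices (gset V E) = V" "items_edges (gset V E) = E"
proof -
  show "items_vertices (gset V E) = V" by (auto simp: items_vertices_def gset_def)
  have "e \<in> items_edges (gset V E)" if e: "e \<in> E" for e
  proof -
    have "card e = 2" using assms e by (auto simp: simple_graph_def)
    then obtain a b where ab: "e = {a, b}" "a \<noteq> b" by (auto simp: card_2_iff)
    define u w where "u = min a b" and "w = max a b"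
    have "e = {u, w}" "u < w" using ab by (auto simp: u_def w_def min_def max_def)
    then show ?thesis using e unfolding items_edges_def gset_def by blast
  qed
  moreover have "items_edges (gset V E) \<subseteq> E" by (auto simp: items_edges_def gset_def)
  ultimately show "items_edges (gset V E) = E" by blast
qed

section \<open>Counting I/Os\<close>

lemma cdiv_real_le: "1 \<le> Z \<Longrightarrow> real (cdiv n Z) \<le> real n / real Z + 1"
proof -
  assume Z: "1 \<le> Z"
  have "cdiv n Z * Z \<le> n + Z" by (simp add: cdiv_def le_trans[OF div_times_less_eq_dividend])
  then have "real (cdiv n Z) * real Z \<le> real n + real Z" by (metis of_nat_add of_nat_le_iff of_nat_mult)
  then show ?thesis using Z by (simp add: field_simps)
qed

lemma cdiv_real_le_double:
  assumes "1 \<le> Z" "Z \<le> n" shows "real (cdiv n Z) \<le> 2 * real n / real Z"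
proof -
  have "1 \<le> real n / real Z" using assms by (simp add: field_simps)
  then show ?thesis using cdiv_real_le[OF assms(1), of n] by simp
qed

lemma num_stripes_cdiv: "okm P \<Longrightarrow> num_stripes P n = cdiv n (num_disks P * block_size P)"
proof -
  assume ok: "okm P"
  let ?Z = "num_disks P * block_size P"
  have Z: "1 \<le> ?Z" using okmD[OF ok] by (simp add: Suc_le_eq)
  have "\<lceil>real n / real ?Z\<rceil> = int (cdiv n ?Z)"
  proof (cases "n = 0")
    case True then show ?thesis using Z by (simp add: cdiv_def)
  next
    case False
    then have a: "(cdiv n ?Z - 1) * ?Z < n" using cdiv_less[OF Z] by simp
    have b: "n \<le> cdiv n ?Z * ?Z" by (rule cdiv_ge[OF Z])
    then have c1: "1 \<le> cdiv n ?Z" using False by (cases "cdiv n ?Z") auto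
    have "real ((cdiv n ?Z - 1) * ?Z) < real n" using a by (simp only: of_nat_less_iff)
    then have "(real (cdiv n ?Z) - 1) * real ?Z < real n" using c1 by (simp only: of_nat_mult of_nat_diff of_nat_1)
    moreover have "real n \<le> real (cdiv n ?Z) * real ?Z" using b by (metis of_nat_le_iff of_nat_mult)
    moreover have "0 < real ?Z" using Z by simp
    ultimately show ?thesis by (intro ceiling_unique) (simp_all only: pos_less_divide_eq pos_divide_le_eq of_int_of_nat_eq)
  qed
  then show ?thesis by (simp add: num_stripes_def)
qed

text \<open>If \<open>i\<close> levels do not suffice, \<open>cap P * fan P ^ i\<close> is below the
  number of stripes. As \<open>cap P * zs P\<close> is at least \<open>M/2\<close>, this makes
  \<open>fan P ^ i\<close> of order \<open>N/M\<close>, hence of order at most \<open>N/B\<close>.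
  Taking logarithms with \<open>M/B <= fan P ^ 4\<close> gives \<open>i <= 12 + 4 * lam\<close>; one
  more level and \<open>lam >= 1\<close> lead to 17.\<close>

lemma nlev_bound:
  assumes ok: "okm P" and N: "1 \<le> N" and x: "x \<le> 3 * N" and H: "H = cdiv x (zs P)"
    and lam: "lam = max 1 (log (real (mem_size P) / real (block_size P)) (real N / real (block_size P)))"
  shows "real (nlev P H (cap P)) \<le> 17 * lam"
proof (cases "nlev P H (cap P)")
  case 0 then show ?thesis using lam by simp
next
  case (Suc i)
  let ?M = "real (mem_size P)" and ?B = "real (block_size P)"
  note v = virt[OF ok] and m = okmD[OF ok]
  have f2: "2 \<le> fan P" using v(1,11) by simp
  have "i < (LEAST i. H \<le> cap P * fan P ^ i)" using Suc by (simp add: nlev_def)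
  then have "\<not> H \<le> cap P * fan P ^ i" by (rule not_less_Least)
  then have h: "cap P * fan P ^ i < H" by simp
  have "1 \<le> fan P ^ i" using f2 by simp
  then have "cap P * 1 \<le> cap P * fan P ^ i" by (rule mult_le_mono2)
  then have "2 \<le> H" using h v(12) by linarith
  have zx: "zs P \<le> x"
  proof (rule ccontr)
    assume "\<not> zs P \<le> x"
    then have "x \<le> 1 * zs P" by simp
    then have "cdiv x (zs P) \<le> 1" by (rule cdiv_le[OF _ v(8)])
    then show False using \<open>2 \<le> H\<close> H by simp
  qed
  have "real (cap P) * real (fan P) ^ i < real H" using h by (metis of_nat_less_iff of_nat_mult of_nat_power)
  also have "\<dots> \<le> 2 * real x / real (zs P)" unfolding H by (rule cdiv_real_le_double[OF v(8) zx])
  finally have "real (cap P) * real (fan P) ^ i * real (zs P) < 2 * real x" using v(8) by (simp add: field_simps)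
  moreover have xN: "real x \<le> 3 * real N" using x by (metis of_nat_le_iff of_nat_mult of_nat_numeral)
  ultimately have a1: "real (cap P * zs P) * real (fan P) ^ i < 6 * real N" by (simp add: mult_ac)
  have M2: "?M \<le> 2 * real (cap P * zs P)" using v(14) by (metis of_nat_le_iff of_nat_mult of_nat_numeral)
  have "?M * real (fan P) ^ i \<le> 2 * (real (cap P * zs P) * real (fan P) ^ i)"
    using mult_right_mono[OF M2, of "real (fan P) ^ i"] by simp
  then have a2: "?M * real (fan P) ^ i < 12 * real N" using a1 by linarith
  have B0: "0 < ?B" using m by simp
  have "2 * 1 * block_size P \<le> 2 * num_disks P * block_size P" using m(2) by (intro mult_le_mono) auto
  then have MB: "2 * ?B \<le> ?M" using m(3) by (metis (no_types, lifting) le_trans mult.right_neutral of_nat_le_iff of_nat_mult of_nat_numeral)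
  have "2 * ?B * real (fan P) ^ i \<le> ?M * real (fan P) ^ i" by (rule mult_right_mono[OF MB]) simp
  then have "2 * ?B * real (fan P) ^ i < 12 * real N" using a2 by linarith
  \<comment> \<open>The factor 6 is raised to 8, whose logarithm \<open>3 * ln 2\<close> is at most
    three times that of \<open>M/B\<close>.\<close>
  then have a3: "real (fan P) ^ i \<le> 8 * (real N / ?B)" using B0 by (simp add: field_simps)
  define \<beta> where "\<beta> = ln (?M / ?B)"
  have MBq: "2 \<le> ?M / ?B" using MB B0 by (simp add: field_simps)
  have \<beta>2: "ln 2 \<le> \<beta>" unfolding \<beta>_def using MBq by simp
  have \<beta>0: "0 < \<beta>" using \<beta>2 by (meson ln_gt_zero less_le_trans one_less_numeral_iff semiring_norm(76))
  have fan4: "?M / ?B \<le> real (fan P) ^ 4"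
  proof -
    have "?M \<le> real (fan P) ^ 4 * ?B" using v(16) by (metis of_nat_le_iff of_nat_mult of_nat_power)
    then show ?thesis using B0 by (simp add: field_simps)
  qed
  have f0: "0 < real (fan P)" using f2 by simp
  have "\<beta> \<le> ln (real (fan P) ^ 4)" unfolding \<beta>_def using fan4 MBq f0 by (subst ln_le_cancel_iff) auto
  then have b4: "\<beta> \<le> 4 * ln (real (fan P))" using f0 by (simp add: ln_realpow)
  have N0: "0 < real N / ?B" using N B0 by simp
  have "ln (real (fan P) ^ i) \<le> ln (8 * (real N / ?B))" using a3 f0 N0 by (subst ln_le_cancel_iff) auto
  then have "real i * ln (real (fan P)) \<le> ln 8 + ln (real N / ?B)"
    using ln_mult_pos[OF _ N0, of 8] f0 by (simp add: ln_realpow)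
  moreover have "ln (8::real) = 3 * ln 2" using ln_realpow[of "2::real" 3] by simp
  ultimately have c1: "real i * ln (real (fan P)) \<le> 3 * ln 2 + ln (real N / ?B)" by simp
  have lg: "ln (real N / ?B) = \<beta> * log (?M / ?B) (real N / ?B)"
    using \<beta>0 unfolding \<beta>_def log_def by simp
  have lam1: "1 \<le> lam" "log (?M / ?B) (real N / ?B) \<le> lam" unfolding lam by auto
  have "real i * \<beta> \<le> real i * (4 * ln (real (fan P)))" using b4 by (intro mult_left_mono) auto
  also have "\<dots> = 4 * (real i * ln (real (fan P)))" by simp
  also have "\<dots> \<le> 4 * (3 * ln 2 + \<beta> * log (?M / ?B) (real N / ?B))" using c1 lg by simp
  also have "\<dots> \<le> 4 * (3 * \<beta> + \<beta> * lam)" using \<beta>2 \<beta>0 lam1 by (intro mult_left_mono add_mono) auto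
  also have "\<dots> = (12 + 4 * lam) * \<beta>" by (simp add: algebra_simps)
  finally have "real i \<le> 12 + 4 * lam" using \<beta>0 by simp
  then show ?thesis using Suc lam1 by simp
qed

section \<open>Input and output format\<close>

lemma concat_upt_blocks: "concat (map (\<lambda>b. map h [b * B..<(b + 1) * B]) [0..<n]) = map h [0..<n * B]"
proof (induction n)
  case (Suc n)
  have "[0..<Suc n * B] = [0..<n * B] @ [n * B..<Suc n * B]" using upt_add_eq_append[of 0 "n * B" B] by (simp add: add.commute)
  then show ?case using Suc by simp
qed simp

lemma cont_striped:
  "cont (num_disks P) (striped P xs) 0 K = map (\<lambda>j. if j < length xs then xs ! j else []) [0..<K * (num_disks P * block_size P)]"
proof -
  let ?h = "\<lambda>j. if j < length xs then xs ! j else []" and ?D = "num_disks P" and ?B = "block_size P"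
  have "cont ?D (striped P xs) 0 K = concat (map (\<lambda>t. concat (map (\<lambda>i. map ?h [(?D * t + i) * ?B..<(?D * t + i + 1) * ?B]) [0..<?D])) [0..<K])"
    by (simp add: cont_def stripe_def[abs_def] striped_def mult.commute)
  also have "\<dots> = concat (map (\<lambda>b. map ?h [b * ?B..<(b + 1) * ?B]) [0..<K * ?D])"
    using concat_map_blocks[of "\<lambda>b. map ?h [b * ?B..<(b + 1) * ?B]" K ?D] by simp
  finally show ?thesis by (simp only: concat_upt_blocks mult.assoc)
qed

lemma map_pad_nth: "length xs \<le> N \<Longrightarrow> map (\<lambda>j. if j < length xs then xs ! j else c) [0..<N] = xs @ replicate (N - length xs) c"
  by (intro nth_equalityI) (auto simp: nth_append)

text \<open>Both input lists are padded to whole stripes, with the edges right behind the vertices,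
  so one pass can read them as a single array. Item lengths tell vertices, edges and padding
  apart.\<close>

lemma cont_input:
  assumes ok: "okm P"
  shows "\<exists>k k'. cont (num_disks P) (input_disks P vs es) 0 (num_stripes P (length vs) + num_stripes P (length es)) =
    (map (\<lambda>v. [v]) vs @ replicate k []) @ (map (\<lambda>(u, v). [u, v]) es @ replicate k' [])"
proof -
  let ?d = "input_disks P vs es" and ?s = "num_stripes P (length vs)" and ?s' = "num_stripes P (length es)"
  let ?D = "num_disks P"
  let ?Z = "?D * block_size P"
  have Z: "1 \<le> ?Z" using okmD[OF ok] by (simp add: Suc_le_eq)
  have "cont ?D ?d 0 ?s = cont ?D (striped P (map (\<lambda>v. [v]) vs)) 0 ?s"
    unfolding cont_def stripe_def[abs_def] input_disks_def Let_def by (intro arg_cong[where f = concat] map_cong) auto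
  also have "\<dots> = map (\<lambda>v. [v]) vs @ replicate (?s * ?Z - length (map (\<lambda>v. [v]) vs)) []"
    unfolding cont_striped using cdiv_ge[OF Z] by (intro map_pad_nth) (simp add: num_stripes_cdiv[OF ok])
  finally have 1: "cont ?D ?d 0 ?s = map (\<lambda>v. [v]) vs @ replicate (?s * ?Z - length (map (\<lambda>v. [v]) vs)) []" .
  have "cont ?D ?d (0 + ?s) ?s' = cont ?D (striped P (map (\<lambda>(u, v). [u, v]) es)) 0 ?s'"
  proof -
    have "[0 + ?s..<0 + ?s + ?s'] = map (\<lambda>t. t + ?s) [0..<?s']" by (simp add: map_add_upt add.commute)
    then show ?thesis unfolding cont_def by (simp add: stripe_def[abs_def] input_disks_def Let_def comp_def)
  qed
  also have "\<dots> = map (\<lambda>(u, v). [u, v]) es @ replicate (?s' * ?Z - length (map (\<lambda>(u, v). [u, v]) es)) []"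
    unfolding cont_striped using cdiv_ge[OF Z] by (intro map_pad_nth) (simp add: num_stripes_cdiv[OF ok])
  finally have 2: "cont ?D ?d (0 + ?s) ?s' = map (\<lambda>(u, v). [u, v]) es @ replicate (?s' * ?Z - length (map (\<lambda>(u, v). [u, v]) es)) []" .
  show ?thesis unfolding cont_add 1 2 by blast
qed

lemma disk_ok_input:
  assumes "\<forall>v\<in>set vs. v < word_range P" "\<forall>(u, v)\<in>set es. u < word_range P \<and> v < word_range P"
  shows "disk_ok P (input_disks P vs es)"
proof -
  have "length (striped P xs i tr) = block_size P" for xs i tr by (simp add: striped_def)
  moreover have "set (striped P xs i tr) \<subseteq> vitems P" if "set xs \<subseteq> vitems P" for xs i tr
  proof -
    have "[] \<in> vitems P" by (simp add: vitems_def valid_item_def)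
    then show ?thesis using that nth_mem by (fastforce simp: striped_def)
  qed
  moreover have "set (map (\<lambda>v. [v]) vs) \<subseteq> vitems P" "set (map (\<lambda>(u, v). [u, v]) es) \<subseteq> vitems P"
    using assms by (auto simp: vitems_def valid_item_def)
  ultimately show ?thesis unfolding disk_ok_def input_disks_def Let_def by auto
qed

lemma output_list_cont:
  assumes ok: "okm P" "disk_ok P d" and N: "N \<le> K * (num_disks P * block_size P)"
  shows "output_list P d a N = take N (cont (num_disks P) d a K)"
proof (rule nth_equalityI)
  let ?D = "num_disks P" and ?B = "block_size P"
  have len: "length (cont ?D d a K) = K * (?D * ?B)" by (rule length_cont[OF ok(2)])
  show "length (output_list P d a N) = length (take N (cont ?D d a K))" using N len by (simp add: output_list_def)
  fix j assume "j < length (output_list P d a N)"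
  then have j: "j < N" by (simp add: output_list_def)
  let ?b = "j div ?B"
  have m: "1 \<le> ?B" "1 \<le> ?D" using okmD[OF ok(1)] by auto
  have bl: "?b < K * ?D" using j N by (simp add: less_mult_imp_div_less mult.assoc)
  have c: "cont ?D d a K = concat (map (\<lambda>b. d (b mod ?D) (a + b div ?D)) [0..<K * ?D])"
  proof -
    have "concat (map (\<lambda>v. d ((?D * t + v) mod ?D) (a + (?D * t + v) div ?D)) [0..<?D]) = stripe ?D d (a + t)" for t
      unfolding stripe_def using m by (intro arg_cong[where f = concat] map_cong) auto
    moreover have "[a..<a + K] = map (\<lambda>t. a + t) [0..<K]" using map_add_upt[of a K] by (simp add: add.commute)
    ultimately show ?thesis unfolding cont_def by (subst concat_map_blocks) (simp add: comp_def)
  qed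
  have "take ?B (drop (?b * ?B) (cont ?D d a K)) = d (?b mod ?D) (a + ?b div ?D)"
    unfolding c using bl ok(2) by (subst concat_slice) (auto simp: disk_ok_def)
  moreover have "take ?B (drop (?b * ?B) (cont ?D d a K)) ! (j mod ?B) = cont ?D d a K ! (?b * ?B + j mod ?B)"
  proof -
    have "?b * ?B \<le> length (cont ?D d a K)" using j N len div_times_less_eq_dividend[of j ?B] by linarith
    then show ?thesis using m by simp
  qed
  ultimately show "output_list P d a N ! j = take N (cont ?D d a K) ! j"
    using j by (simp add: output_list_def Let_def)
qed

section \<open>The algorithm\<close>

text \<open>Flag 1 stands for removal. \<open>n\<close> and \<open>m\<close> are the sizes of the
  current graph, so the threshold is recomputed in every round and never refers to
  \<open>d\<close>.\<close>

definition low_flag :: "real \<Rightarrow> nat \<Rightarrow> nat \<Rightarrow> nat \<Rightarrow> nat" where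
  "low_flag \<epsilon> n m c = (if real c * real n \<le> (2 + \<epsilon>) * real m then 1 else 0)"

definition load_step :: "machine \<Rightarrow> unit \<Rightarrow> unit \<Rightarrow> item \<Rightarrow> unit \<times> item list" where
  "load_step P y s x = (s, if length x = 1 then [[0, x ! 0, x ! 0, 0]]
     else if length x = 2 then [[0, min (x ! 0) (x ! 1), max (x ! 0) (x ! 1), 0]] else [])"

definition fin_step :: "machine \<Rightarrow> unit \<Rightarrow> item list \<Rightarrow> item \<Rightarrow> item list \<times> item list" where
  "fin_step P y s x = (if x = pad_item then s else s @ [x], [])"

definition fin_end :: "machine \<Rightarrow> unit \<Rightarrow> item list \<Rightarrow> item list" where
  "fin_end P y s = map (\<lambda>v. [0, v, v, 0]) (best_order (items_vertices (set s)) (items_edges (set s)))"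

definition out_step :: "machine \<Rightarrow> unit \<Rightarrow> unit \<Rightarrow> item \<Rightarrow> unit \<times> item list" where
  "out_step P y s x = (s, if x = pad_item then [] else [[x ! 1]])"

text \<open>First tracks of the work areas, behind the input, which has at most \<open>n + m\<close> stripes: the current graph at 0,
  scratch space at 1 and 2 to 4, the removed vertices at 5, and the output at 6.\<close>

definition area :: "nat \<times> nat \<Rightarrow> nat \<Rightarrow> nat" where
  "area x i = fst x + snd x + i * (fst x + 2 * snd x + 1)"

text \<open>Without edges \<open>d = 0\<close>, and the bound allows no I/O at all; the vertex list
  at the start of the input is then announced as output. The loop ends when the graph has at most
  \<open>cap P\<close> stripes and so fits into internal memory.\<close>

definition main :: "real \<Rightarrow> machine \<Rightarrow> nat \<times> nat \<Rightarrow> nat prog" where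
  "main \<epsilon> P x = (if snd x = 0 then Ret 0 else
     scan (\<lambda>P. {()}) load_step (\<lambda>P y s. []) num_disks vu P
       ((), 0, num_stripes P (fst x) + num_stripes P (snd x), area x 0, ()) \<bind> (\<lambda>r.
     while P (nums P \<times> nums P \<times> nums P \<times> nums P) (\<lambda>s. cap P < fst (snd (snd s)))
       (\<lambda>s. round_step (low_flag \<epsilon>) P ((area x 0, area x 1, area x 2), s)) (fst x, snd x, snd r - area x 0, area x 5) \<bind> (\<lambda>s.
     scan item_lists fin_step fin_end vu vu P ((), area x 0, fst (snd (snd s)), snd (snd (snd s)), []) \<bind> (\<lambda>q.
     scan (\<lambda>P. {()}) out_step (\<lambda>P y s. []) vu num_disks P ((), area x 5, snd q - area x 5, area x 6, ()) \<bind> (\<lambda>_.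
     Ret (area x 6))))))"

lemma lean_main: "lean (main \<epsilon>)"
  unfolding main_def
  by (intro lean_if lean_bind lean_while lean_scan_comp lean_round_step lean_Ret smallset_intros smallset_finite_const) simp_all

lemma trun_stateless:
  assumes "\<And>x. f s x = (s, g x)" shows "trun f s xs = (s, concat (map g xs))"
  using assms by (induction xs) auto

lemma filter_pad: "pad_item \<notin> set ys \<Longrightarrow> filter (\<lambda>x. x \<noteq> pad_item) (pad Z ys) = ys"
  by (auto simp: pad_def filter_id_conv)

lemma wp_load_graph:
  assumes ok: "okm P" and g: "simple_graph V E" and l: "lists_graph vs es V E" and VW: "V \<subseteq> {..<word_range P}"
    and s: "s = num_stripes P (length vs) + num_stripes P (length es)"
    and tr: "s \<le> a" "a + cdiv (length vs + length es) (zs P) \<le> word_range P ^ 8"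
  shows "wp P (scan (\<lambda>P. {()}) load_step (\<lambda>P y s. []) num_disks vu P ((), 0, s, a, ())) (input_disks P vs es)
    (\<lambda>r d' t. snd r = a + cdiv (length vs + length es) (zs P) \<and> (\<exists>ys. arr P d' a ys \<and> distinct ys \<and> set ys = gset V E) \<and>
      disk_ok P d' \<and> t \<le> s + cdiv (length vs + length es) (zs P))"
proof -
  note v = virt[OF ok] and m = okmD[OF ok]
  let ?D = "num_disks P" and ?d = "input_disks P vs es" and ?W = "word_range P"
  define g1 where "g1 = (\<lambda>x :: item. if length x = 1 then [[0, x ! 0, x ! 0, 0]]
     else if length x = 2 then [[0, min (x ! 0) (x ! 1), max (x ! 0) (x ! 1), 0]] else [])"
  have tg: "trun (load_step P ()) () xs = ((), concat (map g1 xs))" for xs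
    by (rule trun_stateless) (simp add: load_step_def g1_def)
  define ys where "ys = map (\<lambda>v. [0, v, v, 0]) vs @ map (\<lambda>(u, v). [0, min u v, max u v, 0 :: nat]) es"
  obtain k k' where c: "cont ?D ?d 0 s = (map (\<lambda>v. [v]) vs @ replicate k []) @ (map (\<lambda>(u, v). [u, v]) es @ replicate k' [])"
    using cont_input[OF ok, of vs es] s by blast
  have ys1: "concat (map g1 (cont ?D ?d 0 s)) = ys"
  proof -
    have "concat (map g1 (map (\<lambda>v. [v]) vs)) = map (\<lambda>v. [0, v, v, 0]) vs" by (induction vs) (auto simp: g1_def)
    moreover have "g1 [] = []" by (simp add: g1_def)
    moreover have "concat (map g1 (map (\<lambda>(u, v). [u, v]) es)) = map (\<lambda>(u, v). [0, min u v, max u v, 0]) es"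
      by (induction es) (auto simp: g1_def)
    ultimately show ?thesis unfolding c ys_def by simp
  qed
  have vs: "distinct vs" "set vs = V" and es: "distinct (map (\<lambda>(u, v). {u, v}) es)" "(\<lambda>(u, v). {u, v}) ` set es = E"
    using l by (auto simp: lists_graph_def)
  have ed: "u \<in> V \<and> v \<in> V \<and> u \<noteq> v" if "(u, v) \<in> set es" for u v
  proof -
    have "{u, v} \<in> E" using that es(2) by force
    then have "{u, v} \<subseteq> V" "card {u, v} = 2" using g by (auto simp: simple_graph_def)
    then show ?thesis by (cases "u = v") auto
  qed
  have mm: "{min u v, max u v} = {u, v}" for u v :: nat by (auto simp: min_def max_def)
  have dy: "distinct ys"
  proof -
    have "distinct (map (\<lambda>(u, v). [0, min u v, max u v, 0 :: nat]) es)"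
    proof -
      have "map (\<lambda>(u, v). {u, v}) es = map (\<lambda>x. {x ! 1, x ! 2}) (map (\<lambda>(u, v). [0, min u v, max u v, 0 :: nat]) es)"
        by (auto simp: mm)
      then show ?thesis using es(1) by (simp only: distinct_map[of "\<lambda>x. {x ! 1, x ! 2}"])
    qed
    moreover have "distinct (map (\<lambda>v. [0, v, v, 0 :: nat]) vs)" using vs(1) by (simp add: distinct_map inj_on_def)
    moreover have "x \<notin> set (map (\<lambda>(u, v). [0, min u v, max u v, 0 :: nat]) es)" if "x \<in> set (map (\<lambda>v. [0, v, v, 0]) vs)" for x
    proof
      assume "x \<in> set (map (\<lambda>(u, v). [0, min u v, max u v, 0 :: nat]) es)"
      then obtain u w where uw: "(u, w) \<in> set es" "x = [0, min u w, max u w, 0]" by auto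
      then have "min u w = max u w" using that by auto
      then show False using ed[OF uw(1)] by (auto simp: min_def max_def split: if_splits)
    qed
    ultimately show ?thesis unfolding ys_def distinct_append by blast
  qed
  have sy: "set ys = gset V E"
  proof -
    have "[0, min u w, max u w, 0] \<in> {[0, u, v, 0] |u v. u < v \<and> {u, v} \<in> E}" if "(u, w) \<in> set es" for u w
    proof -
      have "min u w < max u w" using ed[OF that] by (auto simp: min_def max_def)
      moreover have "{min u w, max u w} \<in> E" using that es(2) mm by force
      ultimately show ?thesis by blast
    qed
    moreover have "[0, u, w, 0] \<in> (\<lambda>(u, v). [0, min u v, max u v, 0]) ` set es" if uw: "u < w" "{u, w} \<in> E" for u w
    proof -
      obtain p q where pq: "(p, q) \<in> set es" "{p, q} = {u, w}" using uw(2) es(2) by auto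
      then have "min p q = u" "max p q = w" using uw(1) by (auto simp: doubleton_eq_iff)
      then show ?thesis using pq(1) by (intro image_eqI[of _ _ "(p, q)"]) auto
    qed
    ultimately show ?thesis unfolding ys_def gset_def vs(2)[symmetric] by auto
  qed
  have ly: "length ys = length vs + length es" by (simp add: ys_def)
  have vy: "set ys \<subseteq> vitems P"
  proof -
    have "u < ?W \<and> w < ?W" if "{u, w} \<in> E" for u w
    proof -
      have "{u, w} \<subseteq> V" using that g unfolding simple_graph_def by blast
      then show ?thesis using VW by auto
    qed
    moreover have "v < ?W" if "v \<in> V" for v using that VW by auto
    ultimately show ?thesis unfolding sy gset_def using m(4) by (auto simp: vitems_def valid_item_def)
  qed
  have dok: "disk_ok P ?d"
    by (rule disk_ok_input) (use vs(2) VW ed in auto)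
  show ?thesis
  proof (rule wp_mono[OF wp_scan[OF ok dok, where u = num_disks and v = vu and xs = "cont ?D ?d 0 s" and out = ys
      and K' = "cdiv (length vs + length es) (zs P)" and f' = "load_step P ()"]], goal_cases)
    case (10 us ws qs)
    have "length (snd (trun (load_step P ()) (fst (trun (load_step P ()) () us)) ws)) \<le> 2 * length ws"
      by (rule trun_burst2) (simp add: load_step_def)
    then show ?case using 10(2) m(3) by simp
  next
    case (16 r d' t)
    then have "arr P d' a ys" unfolding arr_def v(7) ly by blast
    then show ?case using 16 dy sy by blast
  qed (use v m tg ys1 ly vy tr in \<open>auto intro: interval_disjoint\<close>)
qed

lemma trun_fin: "trun (fin_step P y) s xs = (s @ filter (\<lambda>x. x \<noteq> pad_item) xs, [])"
  by (induction xs arbitrary: s) (auto simp: fin_step_def)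

lemma wp_fin:
  assumes ok: "okm P" "disk_ok P d" and g: "simple_graph V E" "V \<subseteq> {..<word_range P}"
    and ys: "arr P d a ys" "distinct ys" "set ys = gset V E" and K: "K = cdiv (card V + card E) (zs P)" "K \<le> cap P"
    and o: "distinct (best_order V E)" "set (best_order V E) = V"
    and tr: "a + K \<le> lg" "lg + cdiv (card V) (zs P) \<le> word_range P ^ 8"
  shows "wp P (scan item_lists fin_step fin_end vu vu P ((), a, K, lg, [])) d
    (\<lambda>r d' t. snd r = lg + cdiv (card V) (zs P) \<and> arr P d' lg (map (\<lambda>v. [0, v, v, 0]) (best_order V E)) \<and>
      disk_ok P d' \<and> same_off {lg..<lg + cdiv (card V) (zs P)} d d' \<and> t \<le> K + cdiv (card V) (zs P))"
proof -
  note v = virt[OF ok(1)] and m = okmD[OF ok(1)]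
  have ly: "length ys = card V + card E" using distinct_card[OF ys(2)] ys(3) card_gset[OF g(1)] by simp
  have xs: "cont (vu P) d a K = pad (zs P) ys" using ys(1) by (simp add: arr_def ly K(1))
  have "pad_item \<notin> set ys" unfolding ys(3) by (auto simp: pad_item_def gset_def)
  then have fl: "filter (\<lambda>x. x \<noteq> pad_item) (pad (zs P) ys) = ys" by (rule filter_pad)
  have fe: "fin_end P () ys = map (\<lambda>v. [0, v, v, 0]) (best_order V E)"
    by (simp add: fin_end_def ys(3) items_graph[OF g(1)])
  have lb: "length (best_order V E) = card V" using distinct_card[OF o(1)] o(2) by simp
  \<comment> \<open>At most \<open>cap P\<close> stripes are at most \<open>M\<close> items, so the
    state of the pass may hold the whole graph.\<close>
  have lp: "length (pad (zs P) ys) \<le> mem_size P"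
    unfolding length_pad[OF v(8)] ly K(1)[symmetric] using mult_le_mono1[OF K(2)] v(13) by (rule le_trans)
  have vM: "card V \<le> mem_size P" using lp ly by (simp add: pad_def)
  show ?thesis
  proof (rule wp_mono[OF wp_scan[OF ok, where u = vu and v = vu and xs = "pad (zs P) ys"
      and out = "map (\<lambda>v. [0, v, v, 0]) (best_order V E)" and K' = "cdiv (card V) (zs P)" and f' = "fin_step P ()"]], goal_cases)
    case (9 us ws)
    have "set (pad (zs P) ys) \<subseteq> vitems P" using set_cont_vitems[OF ok(2), of "vu P" a K] xs by simp
    moreover have "length us \<le> mem_size P" using 9 lp by simp
    moreover have "length (filter (\<lambda>x. x \<noteq> pad_item) us) \<le> length us" by simp
    ultimately have "length (filter (\<lambda>x. x \<noteq> pad_item) us) \<le> 20 * mem_size P" by linarith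
    then show ?case using 9 \<open>set (pad (zs P) ys) \<subseteq> vitems P\<close> unfolding item_lists_def trun_fin by auto
  next
    case (14)
    then show ?case using tr by simp
  next
    case (16 r d' t) then show ?case unfolding arr_def v(7) by (simp add: lb)
  qed (use v m xs fl fe lb vM tr g(2) o(2) in \<open>auto simp: trun_fin vitems_def valid_item_def intro: interval_disjoint\<close>)
qed

text \<open>Each round starts a new stripe of removed vertices, so their list contains padding. This
  pass drops it and stripes the vertices over all disks, the format that \<open>output_list\<close>
  expects.\<close>

lemma wp_out:
  assumes ok: "okm P" "disk_ok P d" and xs: "filter (\<lambda>x. x \<noteq> pad_item) (cont (vu P) d a K) = map (\<lambda>v. [0, v, v, 0]) xs"
    and W: "set xs \<subseteq> {..<word_range P}"
    and tr: "a + K \<le> b" "b + cdiv (length xs) (num_disks P * block_size P) \<le> word_range P ^ 8"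
  shows "wp P (scan (\<lambda>P. {()}) out_step (\<lambda>P y s. []) vu num_disks P ((), a, K, b, ())) d
    (\<lambda>r d' t. output_list P d' b (length xs) = map (\<lambda>v. [v]) xs \<and> t \<le> K + cdiv (length xs) (num_disks P * block_size P))"
proof -
  note v = virt[OF ok(1)] and m = okmD[OF ok(1)]
  let ?Z = "num_disks P * block_size P"
  define g1 where "g1 = (\<lambda>x :: item. if x = pad_item then [] else [[x ! 1]])"
  have tg: "trun (out_step P ()) () xs = ((), concat (map g1 xs))" for xs
    by (rule trun_stateless) (simp add: out_step_def g1_def)
  have cg: "concat (map g1 us) = map (\<lambda>x. [x ! 1]) (filter (\<lambda>x. x \<noteq> pad_item) us)" for us
    by (induction us) (auto simp: g1_def)
  have o: "concat (map g1 (cont (vu P) d a K)) = map (\<lambda>v. [v]) xs" unfolding cg xs by simp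
  have Z: "1 \<le> ?Z" using m by (simp add: Suc_le_eq)
  show ?thesis
  proof (rule wp_mono[OF wp_scan[OF ok, where u = vu and v = num_disks and xs = "cont (vu P) d a K"
      and out = "map (\<lambda>v. [v]) xs" and K' = "cdiv (length xs) ?Z" and f' = "out_step P ()"]], goal_cases)
    case (10 us ws qs)
    have "length (snd (trun (out_step P ()) (fst (trun (out_step P ()) () us)) ws)) \<le> 2 * length ws"
      by (rule trun_burst2) (simp add: out_step_def)
    then show ?case using 10(2) v(7,9) by simp
  next
    case (16 r d' t)
    have "output_list P d' b (length xs) = take (length xs) (cont (num_disks P) d' b (cdiv (length xs) ?Z))"
      by (rule output_list_cont[OF ok(1)]) (use 16 cdiv_ge[OF Z] in auto)
    also have "\<dots> = map (\<lambda>v. [v]) xs" using 16 by (simp add: pad_def)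
    finally show ?case using 16 by simp
  qed (use v m tg o tr W in \<open>auto simp: vitems_def valid_item_def intro: interval_disjoint\<close>)
qed


section \<open>The peeling loop and its potential, for graphs with at least one edge\<close>

locale peeling =
  fixes P :: machine and V :: "nat set" and E :: "nat set set" and d n m :: nat and \<epsilon> :: real
  assumes ok: "okm P" and graph: "simple_graph V E" and deg: "degenerate V E d" and VW: "V \<subseteq> {..<word_range P}"
    and n: "n = card V" "n < word_range P" and m: "m = card E" "m < word_range P" "1 \<le> m" and eps: "\<epsilon> > 0"
begin

definition \<delta> :: real where "\<delta> = (2 + \<epsilon>) * real d"

text \<open>A cost per vertex. A round on \<open>n'\<close> vertices costs at most
  \<open>104 * (1 + nlev) * H\<close> with \<open>H <= 6 * d * n' / zs P\<close>, and
  \<open>624 = 104 * 6\<close>. The factor \<open>(2 + \<epsilon>) / \<epsilon>\<close> is the sum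
  of the geometric series with ratio \<open>2 / (2 + \<epsilon>)\<close>. The number of levels for
  the initial graph bounds that of all rounds.\<close>

definition rounds_cost :: real where
  "rounds_cost = 624 * (1 + real (nlev P (cdiv (n + 2 * m) (zs P)) (cap P))) * real d / real (zs P) * ((2 + \<epsilon>) / \<epsilon>)"

abbreviation tr where "tr \<equiv> area (n, m)"

lemma m_le: "m \<le> d * n"
  using degenerate_edges_ordering[OF deg graph] n m by simp

lemma d1: "1 \<le> d"
  using m_le m(3) by (cases d) auto

lemma n_pos: "1 \<le> n"
  using m_le m(3) by (cases n) auto

text \<open>An edge has two ends, and the number of vertices is below the word range.\<close>

lemma W3: "3 \<le> word_range P"
proof -
  have "E \<noteq> {}" using m by auto
  then obtain e where e: "e \<in> E" by blast
  then have "e \<subseteq> V" "card e = 2" "finite V" using graph by (auto simp: simple_graph_def)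
  then have "2 \<le> card V" by (metis card_mono)
  then show ?thesis using n by simp
qed

lemma areas:
  assumes "x \<le> n + 2 * m"
  shows "tr 0 = n + m" "tr 0 + x \<le> tr 1" "tr 1 + x \<le> tr 2" "tr 2 + 3 * x \<le> tr 5" "tr 5 + x \<le> tr 6" "tr 0 + x \<le> tr 5"
    "tr 5 + n + x \<le> word_range P ^ 8" "tr 6 + n < word_range P ^ 8" "tr 5 + x \<le> word_range P ^ 8" "n + 2 * m \<le> word_range P ^ 8"
proof -
  define Y where "Y = n + 2 * m + 1"
  have t: "tr 0 = n + m" "tr 1 = n + m + Y" "tr 2 = n + m + 2 * Y" "tr 5 = n + m + 5 * Y" "tr 6 = n + m + 6 * Y"
    by (simp_all add: area_def Y_def)
  have x: "x < Y" using assms by (simp add: Y_def)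
  show "tr 0 = n + m" "tr 0 + x \<le> tr 1" "tr 1 + x \<le> tr 2" "tr 2 + 3 * x \<le> tr 5" "tr 5 + x \<le> tr 6" "tr 0 + x \<le> tr 5"
    using x unfolding t by linarith+
  let ?W = "word_range P"
  have "n + 1 \<le> ?W" "m + 1 \<le> ?W" using n m by auto
  then have "Y \<le> 3 * ?W" by (simp add: Y_def)
  then have a: "n + m + 6 * Y + n < 27 * ?W" using n(2) m(2) by simp
  \<comment> \<open>The bound was rounded up to \<open>27 = 3^3\<close>, so that three powers of the
    word range absorb it.\<close>
  have "27 * ?W \<le> ?W ^ 3 * ?W" using power_mono[OF W3, of 3] by (intro mult_le_mono1) simp
  also have "\<dots> = ?W ^ 4" by (simp add: eval_nat_numeral)
  also have "\<dots> \<le> ?W ^ 8" using W3 by (intro power_increasing) auto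
  finally have b: "n + m + 6 * Y + n < ?W ^ 8" using a by simp
  show "tr 5 + n + x \<le> ?W ^ 8" "tr 6 + n < ?W ^ 8" "tr 5 + x \<le> ?W ^ 8" "n + 2 * m \<le> ?W ^ 8"
    using b x unfolding t by (simp_all add: Y_def)
qed

lemma cdiv_zs_le: "x \<le> y \<Longrightarrow> cdiv x (zs P) \<le> y"
proof -
  assume x: "x \<le> y"
  have "y * 1 \<le> y * zs P" using virt(8)[OF ok] by (rule mult_le_mono2)
  then have "x \<le> y * zs P" using x by linarith
  then show ?thesis using virt(8)[OF ok] by (rule cdiv_le)
qed

text \<open>Quantifying over all completions \<open>qs\<close> lets rounds compose before the final
  ordering is known. The last clause bounds the stripes of removed vertices by the cost already
  paid: dividing the number of vertices by the stripe size is not enough, since every round may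
  leave an incomplete stripe.\<close>

definition inv :: "nat \<times> nat \<times> nat \<times> nat \<Rightarrow> disks \<Rightarrow> bool" where
  "inv s dk \<longleftrightarrow> (case s of (n', m', K, lg) \<Rightarrow> \<exists>V' E' ys lgs. simple_graph V' E' \<and> V' \<subseteq> V \<and> E' \<subseteq> E \<and> n' = card V' \<and> m' = card E' \<and>
     K = cdiv (n' + m') (zs P) \<and> arr P dk (tr 0) ys \<and> distinct ys \<and> set ys = gset V' E' \<and> disk_ok P dk \<and>
     tr 5 \<le> lg \<and> lg + n' \<le> tr 5 + n \<and>
     filter (\<lambda>x. x \<noteq> pad_item) (cont (vu P) dk (tr 5) (lg - tr 5)) = map (\<lambda>v. [0, v, v, 0]) lgs \<and>
     (\<forall>qs. degeneracy_ordering V' E' \<delta> qs \<longrightarrow> degeneracy_ordering V E \<delta> (lgs @ qs)) \<and>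
     real (lg - tr 5) + rounds_cost * real n' \<le> rounds_cost * real n)"

lemma inv_start:
  assumes "disk_ok P dk" "arr P dk (tr 0) ys" "distinct ys" "set ys = gset V E"
  shows "inv (n, m, cdiv (n + m) (zs P), tr 5) dk"
  unfolding inv_def prod.case
  by (rule exI[of _ V], rule exI[of _ E], rule exI[of _ ys], rule exI[of _ "[]"]) (use assms n m graph in simp)

lemma rounds_cost_nonneg: "0 \<le> rounds_cost"
  using eps by (simp add: rounds_cost_def)

text \<open>The geometric decrease as a potential argument: since \<open>n''\<close> is at most
  \<open>2 * n' / (2 + \<epsilon>)\<close>, the drop of \<open>rounds_cost * n'\<close> covers the
  cost of the round. The \<open>c\<close> new stripes of removed vertices are charged as well,
  because the last pass reads them again.\<close>

lemma round_bound:
  assumes K: "cap P < cdiv (n' + m') (zs P)" and le: "n' \<le> n" "m' \<le> m" "m' \<le> d * n'" and H: "H = cdiv (n' + 2 * m') (zs P)"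
    and t: "t \<le> 22 * H + 81 * (H * nlev P H (cap P))" and c: "c \<le> H" and n'': "real n'' * (2 + \<epsilon>) \<le> 2 * real n'"
  shows "real t + real c + rounds_cost * real n'' \<le> rounds_cost * real n'"
proof -
  note v = virt[OF ok]
  define L where "L = nlev P (cdiv (n + 2 * m) (zs P)) (cap P)"
  define c0 where "c0 = 624 * (1 + real L) * real d / real (zs P)"
  have z0: "0 < real (zs P)" using v(8) by simp
  have "nlev P H (cap P) \<le> L" unfolding L_def H
    by (rule nlev_mono[OF ok]) (use v(12) le in \<open>auto intro!: cdiv_mono\<close>)
  then have "H * nlev P H (cap P) \<le> H * L" by (rule mult_le_mono2)
  then have "t + c \<le> 23 * H + 81 * (H * L)" using t c by linarith
  also have "\<dots> \<le> 104 * (H * (1 + L))" by (simp add: algebra_simps)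
  finally have "real (t + c) \<le> real (104 * (H * (1 + L)))" by (simp only: of_nat_le_iff)
  then have tc: "real t + real c \<le> 104 * (1 + real L) * real H" by (simp add: algebra_simps)
  \<comment> \<open>More than \<open>cap P >= 2\<close> stripes mean at least one full stripe of
    items, so rounding up to stripes at most doubles the cost.\<close>
  have "zs P \<le> n' + 2 * m'"
  proof (rule ccontr)
    assume "\<not> ?thesis"
    then have "cdiv (n' + m') (zs P) \<le> 1" using v(8) by (intro cdiv_le) auto
    then show False using K v(12) by simp
  qed
  then have "real H \<le> 2 * real (n' + 2 * m') / real (zs P)" unfolding H by (intro cdiv_real_le_double v(8))
  also have "\<dots> \<le> 2 * (3 * (real d * real n')) / real (zs P)"
  proof -
    have "n' + 2 * m' \<le> d * n' + 2 * (d * n')" using le(3) mult_le_mono1[OF d1, of n'] by (intro add_mono) auto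
    then have "real (n' + 2 * m') \<le> real (3 * (d * n'))" unfolding of_nat_le_iff by simp
    then show ?thesis using z0 by (intro divide_right_mono) auto
  qed
  finally have "104 * (1 + real L) * real H \<le> 104 * (1 + real L) * (2 * (3 * (real d * real n')) / real (zs P))"
    by (intro mult_left_mono) auto
  also have "\<dots> = c0 * real n'" by (simp add: c0_def)
  finally have 1: "real t + real c \<le> c0 * real n'" using tc by simp
  have rc: "rounds_cost = c0 * ((2 + \<epsilon>) / \<epsilon>)" by (simp add: rounds_cost_def c0_def L_def)
  have "real n' * \<epsilon> \<le> (2 + \<epsilon>) * (real n' - real n'')" using n'' by (simp add: algebra_simps)
  then have "real n' \<le> (2 + \<epsilon>) * (real n' - real n'') / \<epsilon>" using eps by (simp add: pos_le_divide_eq)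
  then have "c0 * real n' \<le> c0 * ((2 + \<epsilon>) * (real n' - real n'') / \<epsilon>)" by (intro mult_left_mono) (auto simp: c0_def)
  also have "\<dots> = rounds_cost * real n' - rounds_cost * real n''" unfolding rc by (simp add: algebra_simps diff_divide_distrib add_divide_distrib)
  finally show ?thesis using 1 by simp
qed

lemma inv_step:
  assumes I: "inv s dk" and b: "cap P < fst (snd (snd s))"
  shows "s \<in> nums P \<times> nums P \<times> nums P \<times> nums P \<and>
    wp P (round_step (low_flag \<epsilon>) P ((tr 0, tr 1, tr 2), s)) dk (\<lambda>s' dk' t. inv s' dk' \<and>
      t + nat \<lfloor>rounds_cost * real (fst s')\<rfloor> \<le> nat \<lfloor>rounds_cost * real (fst s)\<rfloor> \<and> fst s' < fst s)"
proof -
  obtain n' m' K lg where s: "s = (n', m', K, lg)" by (cases s)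
  obtain V' E' ys lgs where I1: "simple_graph V' E'" "V' \<subseteq> V" "E' \<subseteq> E" "n' = card V'" "m' = card E'"
     "K = cdiv (n' + m') (zs P)" "arr P dk (tr 0) ys" "distinct ys" "set ys = gset V' E'" "disk_ok P dk"
     "tr 5 \<le> lg" "lg + n' \<le> tr 5 + n"
     and lgs: "filter (\<lambda>x. x \<noteq> pad_item) (cont (vu P) dk (tr 5) (lg - tr 5)) = map (\<lambda>v. [0, v, v, 0]) lgs"
     and ord: "\<And>qs. degeneracy_ordering V' E' \<delta> qs \<Longrightarrow> degeneracy_ordering V E \<delta> (lgs @ qs)"
     and cost: "real (lg - tr 5) + rounds_cost * real n' \<le> rounds_cost * real n"
    using I unfolding inv_def s by auto
  have fin: "finite V" "finite E" using simple_graph_finite[OF graph] by auto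
  have le: "n' \<le> n" "m' \<le> m" unfolding I1(4,5) n(1) m(1) using card_mono[OF fin(1) I1(2)] card_mono[OF fin(2) I1(3)] .
  have md: "m' \<le> d * n'" using degenerate_edges_ordering[OF deg I1(1-3)] I1(4,5) by simp
  define H where "H = cdiv (n' + 2 * m') (zs P)"
  have Hx: "H \<le> n + 2 * m" unfolding H_def using le by (intro cdiv_zs_le) simp
  define V'' where "V'' = {v \<in> V'. low_flag \<epsilon> n' m' (vertex_degree E' v) = 0}"
  define E'' where "E'' = {e \<in> E'. e \<subseteq> V''}"
  have V''a: "V'' = {v \<in> V'. \<not> real (vertex_degree E' v) * real (card V') \<le> (2 + \<epsilon>) * real (card E')}"
    unfolding V''_def low_flag_def I1(4,5) by auto
  have few: "real (card V'') * (2 + \<epsilon>) \<le> 2 * real n'" using high_degree_few[OF I1(1) eps V''a] I1(4) by simp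
  have Kc: "cap P < cdiv (n' + m') (zs P)" using b s I1(6) by simp
  have n'0: "0 < n'"
  proof (rule ccontr)
    assume "\<not> 0 < n'"
    then have "n' + m' = 0" using md by simp
    then show False using Kc virt(8)[OF ok] by (simp add: cdiv_def)
  qed
  have dec: "card V'' < n'"
  proof (rule ccontr)
    assume "\<not> ?thesis"
    then have "real n' * (2 + \<epsilon>) \<le> real (card V'') * (2 + \<epsilon>)" using eps by (intro mult_right_mono) auto
    then have "real n' * (2 + \<epsilon>) \<le> 2 * real n'" using few by linarith
    then have "real n' * \<epsilon> \<le> 0" by (simp add: algebra_simps)
    then show False using n'0 eps by (simp add: mult_le_0_iff)
  qed
  have V'W: "V' \<subseteq> {..<word_range P}" using I1(2) VW by auto
  have g'': "simple_graph V'' E''" using I1(1) unfolding E''_def V''_def simple_graph_def by auto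
  have lgW: "lg + H \<le> word_range P ^ 8" using areas(7)[OF Hx] I1(12) by simp
  have "n' \<le> word_range P ^ 8" "m' \<le> word_range P ^ 8" using areas(10)[OF Hx] le by auto
  moreover have "K \<le> word_range P ^ 8" using cdiv_zs_le[of "n' + m'" "n + 2 * m"] areas(10)[OF Hx] le I1(6) by simp
  ultimately have 1: "s \<in> nums P \<times> nums P \<times> nums P \<times> nums P" using s nums_le[OF ok] lgW by simp
  have tr4: "tr 2 + 3 * H \<le> lg" using areas(4)[OF Hx] I1(11) by simp
  note R = wp_round_step[where F = "low_flag \<epsilon>", OF ok I1(10) W3 I1(1) V'W I1(4,5) _ _ I1(7,8,9,6) _ H_def V''_def E''_def
      areas(2,3)[OF Hx] tr4 lgW]
  have "wp P (round_step (low_flag \<epsilon>) P ((tr 0, tr 1, tr 2), s)) dk (\<lambda>s' dk' t. inv s' dk' \<and>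
      t + nat \<lfloor>rounds_cost * real (fst s')\<rfloor> \<le> nat \<lfloor>rounds_cost * real (fst s)\<rfloor> \<and> fst s' < fst s)"
    unfolding s
  proof (rule wp_mono[OF R], goal_cases)
    case 1 then show ?case using le n by simp
  next
    case 2 then show ?case using le m by simp
  next
    case (3 c) then show ?case by (simp add: low_flag_def)
  next
    case (4 s' dk' t)
    then obtain ys' lows where r: "s' = (card V'', card E'', cdiv (card V'' + card E'') (zs P), lg + cdiv (length lows) (zs P))"
      and a: "arr P dk' (tr 0) ys'" "distinct ys'" "set ys' = gset V'' E''"
        "arr P dk' lg (map (\<lambda>v. [0, v, v, 0]) lows)" and lows: "distinct lows" "set lows = V' - V''" and dok: "disk_ok P dk'"
      and so: "same_off ({tr 0..<tr 2 + 3 * H} \<union> {lg..<lg + cdiv (length lows) (zs P)}) dk dk'"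
      and cH: "cdiv (length lows) (zs P) \<le> H" and t: "t \<le> 22 * H + 81 * (H * nlev P H (cap P))" by blast
    define c where "c = cdiv (length lows) (zs P)"
    have rb: "real t + real c + rounds_cost * real (card V'') \<le> rounds_cost * real n'"
      by (rule round_bound[OF Kc le md H_def t cH[folded c_def] few])
    have fV': "finite V'" using simple_graph_finite[OF I1(1)] by simp
    have sub: "V'' \<subseteq> V'" by (auto simp: V''_def)
    have "length lows = n' - card V''"
      using distinct_card[OF lows(1)] lows(2) card_Diff_subset[OF finite_subset[OF sub fV'] sub] I1(4) by simp
    \<comment> \<open>A round adds at most one stripe per removed vertex, so the list of removed
      vertices stays within its area.\<close>
    then have cl: "c + card V'' \<le> n'" using cdiv_zs_le[of "length lows" "length lows"] dec by (simp add: c_def)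
    have "cont (vu P) dk' (tr 5) (lg - tr 5) = cont (vu P) dk (tr 5) (lg - tr 5)"
      by (rule cont_same_off[OF so]) (use areas(4)[OF Hx] I1(11) in auto)
    moreover have "cont (vu P) dk' (tr 5) (lg + c - tr 5) = cont (vu P) dk' (tr 5) (lg - tr 5) @ cont (vu P) dk' lg c"
      using cont_add[of "vu P" dk' "tr 5" "lg - tr 5" c] I1(11) by simp
    moreover have "filter (\<lambda>x. x \<noteq> pad_item) (cont (vu P) dk' lg c) = map (\<lambda>v. [0, v, v, 0]) lows"
    proof -
      have "cont (vu P) dk' lg c = pad (zs P) (map (\<lambda>v. [0, v, v, 0]) lows)" using a(4) by (simp add: arr_def c_def)
      moreover have "pad_item \<notin> set (map (\<lambda>v. [0, v, v, 0]) lows)" by (auto simp: pad_item_def)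
      ultimately show ?thesis using filter_pad by metis
    qed
    ultimately have lg': "filter (\<lambda>x. x \<noteq> pad_item) (cont (vu P) dk' (tr 5) (lg + c - tr 5)) = map (\<lambda>v. [0, v, v, 0]) (lgs @ lows)"
      using lgs by simp
    have ord': "degeneracy_ordering V E \<delta> ((lgs @ lows) @ qs)" if qs: "degeneracy_ordering V'' E'' \<delta> qs" for qs
    proof -
      have "degeneracy_ordering V' E' \<delta> (lows @ qs)"
      proof (rule peel_ordering[OF I1(1) sub E''_def lows _ qs])
        fix v assume "v \<in> set lows"
        then have "real (vertex_degree E' v) * real n' \<le> (2 + \<epsilon>) * real m'"
          unfolding lows(2) V''a I1(4,5) by auto
        \<comment> \<open>Every subgraph has at most \<open>d\<close> edges per vertex, so a
          threshold computed from the current sizes never exceeds \<open>\<delta>\<close>.\<close>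
        also have "\<dots> \<le> (2 + \<epsilon>) * real (d * n')" using md eps by (intro mult_left_mono of_nat_mono) auto
        also have "\<dots> = \<delta> * real n'" by (simp add: \<delta>_def)
        finally show "real (vertex_degree E' v) \<le> \<delta>" using n'0 by simp
      qed
      then show ?thesis using ord by simp
    qed
    have cost': "real (lg + c - tr 5) + rounds_cost * real (card V'') \<le> rounds_cost * real n"
      using cost rb I1(11) by (simp add: of_nat_diff)
    have "inv s' dk'" unfolding r inv_def prod.case c_def[symmetric]
      by (rule exI[of _ V''], rule exI[of _ E''], rule exI[of _ ys'], rule exI[of _ "lgs @ lows"])
        (use g'' sub I1(2,3,11,12) a(1-3) dok cl lg' ord' cost' in \<open>auto simp: E''_def\<close>)
    moreover have "t + nat \<lfloor>rounds_cost * real (card V'')\<rfloor> \<le> nat \<lfloor>rounds_cost * real n'\<rfloor>"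
    proof (rule le_nat_floor)
      have "real (nat \<lfloor>rounds_cost * real (card V'')\<rfloor>) \<le> rounds_cost * real (card V'')"
        using rounds_cost_nonneg by (intro of_nat_floor) simp
      then show "real (t + nat \<lfloor>rounds_cost * real (card V'')\<rfloor>) \<le> rounds_cost * real n'" using rb by simp
    qed
    ultimately show ?case using dec by (simp add: r)
  qed
  then show ?thesis using 1 by simp
qed

lemma wp_rounds:
  assumes "inv (n, m, K, lg) dk"
  shows "wp P (while P (nums P \<times> nums P \<times> nums P \<times> nums P) (\<lambda>s. cap P < fst (snd (snd s)))
       (\<lambda>s. round_step (low_flag \<epsilon>) P ((tr 0, tr 1, tr 2), s)) (n, m, K, lg)) dk
     (\<lambda>s dk' t. inv s dk' \<and> fst (snd (snd s)) \<le> cap P \<and> real t \<le> rounds_cost * real n)"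
proof -
  have "n \<le> word_range P ^ 8" using areas(10)[of 0] by simp
  then have "n \<in> nums P" by (rule nums_le[OF ok])
  then have nW: "n \<le> word_range P ^ (20 * mem_size P)" by (simp add: nums_def)
  have w: "wp P (while P (nums P \<times> nums P \<times> nums P \<times> nums P) (\<lambda>s. cap P < fst (snd (snd s)))
       (\<lambda>s. round_step (low_flag \<epsilon>) P ((tr 0, tr 1, tr 2), s)) (n, m, K, lg)) dk
     (\<lambda>s dk' t. inv s dk' \<and> \<not> cap P < fst (snd (snd s)) \<and>
       t + nat \<lfloor>rounds_cost * real (fst s)\<rfloor> \<le> nat \<lfloor>rounds_cost * real (fst (n, m, K, lg))\<rfloor>)"
    by (rule wp_while_measure[where \<mu> = fst and \<Phi> = "\<lambda>s. nat \<lfloor>rounds_cost * real (fst s)\<rfloor>"])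
      (use assms nW inv_step in auto)
  have fl: "real (nat \<lfloor>rounds_cost * real n\<rfloor>) \<le> rounds_cost * real n" using rounds_cost_nonneg by (intro of_nat_floor) simp
  show ?thesis
  proof (rule wp_mono[OF w])
    fix s dk' t assume "inv s dk' \<and> \<not> cap P < fst (snd (snd s)) \<and>
       t + nat \<lfloor>rounds_cost * real (fst s)\<rfloor> \<le> nat \<lfloor>rounds_cost * real (fst (n, m, K, lg))\<rfloor>"
    then have "inv s dk'" "fst (snd (snd s)) \<le> cap P" "real t \<le> real (nat \<lfloor>rounds_cost * real n\<rfloor>)" by auto
    then show "inv s dk' \<and> fst (snd (snd s)) \<le> cap P \<and> real t \<le> rounds_cost * real n" using fl by linarith
  qed
qed

lemma stripes_le: "num_stripes P x \<le> x"
proof -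
  have Z: "1 \<le> num_disks P * block_size P" using okmD[OF ok] by (simp add: Suc_le_eq)
  have "x * 1 \<le> x * (num_disks P * block_size P)" using Z by (rule mult_le_mono2)
  then show ?thesis unfolding num_stripes_cdiv[OF ok] by (intro cdiv_le Z) simp
qed

text \<open>The stripes of the initial graph enter four times: for writing it, for reading the last
  graph, for writing the ordering of that graph, and for reading this ordering again. The rounds
  enter twice, for their I/Os and for rereading the removed vertices. The other terms are input and
  output.\<close>

definition total_cost :: real where
  "total_cost = real (num_stripes P n + num_stripes P m) + 4 * real (cdiv (n + m) (zs P)) +
     2 * (rounds_cost * real n) + real (num_stripes P n)"

lemma wp_main:
  assumes l: "lists_graph vs es V E" and len: "length vs = n" "length es = m"
  shows "wp P (main \<epsilon> P (n, m)) (input_disks P vs es) (\<lambda>r d' t. r < word_range P ^ 8 \<and>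
    (\<exists>xs. output_list P d' r n = map (\<lambda>v. [v]) xs \<and> degeneracy_ordering V E \<delta> xs) \<and> real t \<le> total_cost)"
proof -
  let ?s = "num_stripes P n + num_stripes P m" and ?K0 = "cdiv (n + m) (zs P)" and ?W = "word_range P"
  have K0: "?K0 \<le> n + 2 * m" by (rule cdiv_zs_le) simp
  have s_le: "?s \<le> tr 0" using stripes_le[of n] stripes_le[of m] areas(1)[OF K0] by simp
  have K0W: "tr 0 + ?K0 \<le> ?W ^ 8" using areas(6,9)[OF K0] by simp
  have L: "wp P (scan (\<lambda>P. {()}) load_step (\<lambda>P y s. []) num_disks vu P ((), 0, ?s, tr 0, ())) (input_disks P vs es)
    (\<lambda>r d' t. snd r = tr 0 + ?K0 \<and> (\<exists>ys. arr P d' (tr 0) ys \<and> distinct ys \<and> set ys = gset V E) \<and>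
      disk_ok P d' \<and> t \<le> ?s + ?K0)"
    using wp_load_graph[OF ok graph l VW refl, of "tr 0"] s_le K0W unfolding len by blast
  have m0: "snd (n, m) \<noteq> 0" using m(3) by simp
  show ?thesis unfolding main_def if_not_P[OF m0] unfolding fst_conv snd_conv
  proof (rule wp_bindI[OF L])
    fix r d1 t1 assume 1: "snd r = tr 0 + ?K0 \<and> (\<exists>ys. arr P d1 (tr 0) ys \<and> distinct ys \<and> set ys = gset V E) \<and>
      disk_ok P d1 \<and> t1 \<le> ?s + ?K0"
    then have r: "snd r - tr 0 = ?K0" by simp
    have I: "inv (n, m, ?K0, tr 5) d1" using 1 inv_start by blast
    show "wp P (while P (nums P \<times> nums P \<times> nums P \<times> nums P) (\<lambda>s. cap P < fst (snd (snd s)))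
       (\<lambda>s. round_step (low_flag \<epsilon>) P ((tr 0, tr 1, tr 2), s)) (n, m, snd r - tr 0, tr 5) \<bind> (\<lambda>s.
     scan item_lists fin_step fin_end vu vu P ((), tr 0, fst (snd (snd s)), snd (snd (snd s)), []) \<bind> (\<lambda>q.
     scan (\<lambda>P. {()}) out_step (\<lambda>P y s. []) vu num_disks P ((), tr 5, snd q - tr 5, tr 6, ()) \<bind> (\<lambda>_.
     Ret (tr 6))))) d1 (\<lambda>r d' t. r < word_range P ^ 8 \<and>
    (\<exists>xs. output_list P d' r n = map (\<lambda>v. [v]) xs \<and> degeneracy_ordering V E \<delta> xs) \<and> real (t1 + t) \<le> total_cost)"
      unfolding r
    proof (rule wp_bindI[OF wp_rounds[OF I]])
      fix s d2 t2 assume 2: "inv s d2 \<and> fst (snd (snd s)) \<le> cap P \<and> real t2 \<le> rounds_cost * real n"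
      obtain n' m' K lg where s: "s = (n', m', K, lg)" by (cases s)
      obtain V' E' ys lgs where I1: "simple_graph V' E'" "V' \<subseteq> V" "E' \<subseteq> E" "n' = card V'" "m' = card E'"
         "K = cdiv (n' + m') (zs P)" "arr P d2 (tr 0) ys" "distinct ys" "set ys = gset V' E'" "disk_ok P d2"
         "tr 5 \<le> lg" "lg + n' \<le> tr 5 + n"
         and lgs: "filter (\<lambda>x. x \<noteq> pad_item) (cont (vu P) d2 (tr 5) (lg - tr 5)) = map (\<lambda>v. [0, v, v, 0]) lgs"
         and ord: "\<And>qs. degeneracy_ordering V' E' \<delta> qs \<Longrightarrow> degeneracy_ordering V E \<delta> (lgs @ qs)"
         and cost: "real (lg - tr 5) + rounds_cost * real n' \<le> rounds_cost * real n"
        using 2 unfolding inv_def s by auto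
      have Kc: "K \<le> cap P" using 2 s by simp
      have fin: "finite V" "finite E" using simple_graph_finite[OF graph] by auto
      have le: "n' \<le> n" "m' \<le> m" unfolding I1(4,5) n(1) m(1) using card_mono[OF fin(1) I1(2)] card_mono[OF fin(2) I1(3)] .
      obtain qs where "degeneracy_ordering V' E' (real d) qs" using degenerate_edges_ordering[OF deg I1(1-3)] by blast
      then have bo: "degeneracy_ordering V' E' (real d) (best_order V' E')" by (rule best_order)
      then have dbo: "distinct (best_order V' E')" "set (best_order V' E') = V'" by (auto simp: degeneracy_ordering_def)
      have "1 * real d \<le> \<delta>" unfolding \<delta>_def using eps by (intro mult_right_mono) auto
      then have "degeneracy_ordering V' E' \<delta> (best_order V' E')" using degeneracy_ordering_mono[OF bo] by simp
      then have final: "degeneracy_ordering V E \<delta> (lgs @ best_order V' E')" by (rule ord)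
      let ?xs = "lgs @ best_order V' E'"
      have sx: "set ?xs = V" "length ?xs = n" using final distinct_card[of ?xs] n(1) by (auto simp: degeneracy_ordering_def)
      let ?c = "cdiv n' (zs P)"
      have KK: "K \<le> ?K0" "?c \<le> ?K0" unfolding I1(6) using le by (auto intro!: cdiv_mono)
      have lgc: "lg + ?c \<le> tr 5 + n" using cdiv_zs_le[of n' n'] I1(12) by simp
      have Kn: "K \<le> n + 2 * m" using KK(1) K0 by simp
      have trF: "tr 0 + K \<le> lg" "lg + ?c \<le> ?W ^ 8" using areas(6)[OF Kn] areas(7)[of 0] I1(11) lgc by auto
      have V'W: "V' \<subseteq> {..<?W}" using I1(2) VW by auto
      have F: "wp P (scan item_lists fin_step fin_end vu vu P ((), tr 0, K, lg, [])) d2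
        (\<lambda>r d' t. snd r = lg + ?c \<and> arr P d' lg (map (\<lambda>v. [0, v, v, 0]) (best_order V' E')) \<and>
          disk_ok P d' \<and> same_off {lg..<lg + ?c} d2 d' \<and> t \<le> K + ?c)"
        using wp_fin[OF ok I1(10,1) V'W I1(7-9) _ Kc dbo trF(1)] trF(2) I1(4-6) by simp
      show "wp P (scan item_lists fin_step fin_end vu vu P ((), tr 0, fst (snd (snd s)), snd (snd (snd s)), []) \<bind> (\<lambda>q.
     scan (\<lambda>P. {()}) out_step (\<lambda>P y s. []) vu num_disks P ((), tr 5, snd q - tr 5, tr 6, ()) \<bind> (\<lambda>_.
     Ret (tr 6)))) d2 (\<lambda>r d' t. r < word_range P ^ 8 \<and>
    (\<exists>xs. output_list P d' r n = map (\<lambda>v. [v]) xs \<and> degeneracy_ordering V E \<delta> xs) \<and> real (t1 + (t2 + t)) \<le> total_cost)"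
        unfolding s fst_conv snd_conv
      proof (rule wp_bindI[OF F])
        fix q d3 t3 assume 3: "snd q = lg + ?c \<and> arr P d3 lg (map (\<lambda>v. [0, v, v, 0]) (best_order V' E')) \<and>
          disk_ok P d3 \<and> same_off {lg..<lg + ?c} d2 d3 \<and> t3 \<le> K + ?c"
        have lb: "length (best_order V' E') = n'" using distinct_card[OF dbo(1)] dbo(2) I1(4) by simp
        have "cont (vu P) d3 (tr 5) (lg - tr 5) = cont (vu P) d2 (tr 5) (lg - tr 5)"
          by (rule cont_same_off[of "{lg..<lg + ?c}"]) (use 3 I1(11) in auto)
        moreover have "cont (vu P) d3 (tr 5) (lg + ?c - tr 5) = cont (vu P) d3 (tr 5) (lg - tr 5) @ cont (vu P) d3 lg ?c"
          using cont_add[of "vu P" d3 "tr 5" "lg - tr 5" ?c] I1(11) by simp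
        moreover have "filter (\<lambda>x. x \<noteq> pad_item) (cont (vu P) d3 lg ?c) = map (\<lambda>v. [0, v, v, 0]) (best_order V' E')"
        proof -
          have "cont (vu P) d3 lg ?c = pad (zs P) (map (\<lambda>v. [0, v, v, 0]) (best_order V' E'))" using 3 lb by (simp add: arr_def)
          moreover have "pad_item \<notin> set (map (\<lambda>v. [0, v, v, 0]) (best_order V' E'))" by (auto simp: pad_item_def)
          ultimately show ?thesis using filter_pad by metis
        qed
        ultimately have all: "filter (\<lambda>x. x \<noteq> pad_item) (cont (vu P) d3 (tr 5) (lg + ?c - tr 5)) = map (\<lambda>v. [0, v, v, 0]) ?xs"
          using lgs by simp
        have q: "snd q - tr 5 = lg + ?c - tr 5" using 3 by simp
        have sn: "num_stripes P n = cdiv (length ?xs) (num_disks P * block_size P)" using num_stripes_cdiv[OF ok] sx(2) by simp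
        have O: "wp P (scan (\<lambda>P. {()}) out_step (\<lambda>P y s. []) vu num_disks P ((), tr 5, lg + ?c - tr 5, tr 6, ())) d3
          (\<lambda>r d' t. output_list P d' (tr 6) (length ?xs) = map (\<lambda>v. [v]) ?xs \<and> t \<le> (lg + ?c - tr 5) + num_stripes P n)"
          unfolding sn
        proof (rule wp_out[OF ok _ all])
          show "disk_ok P d3" using 3 by simp
          show "set ?xs \<subseteq> {..<?W}" using sx(1) VW by simp
          show "tr 5 + (lg + ?c - tr 5) \<le> tr 6" using lgc areas(5)[of n] I1(11) by simp
          show "tr 6 + cdiv (length ?xs) (num_disks P * block_size P) \<le> ?W ^ 8"
            using stripes_le[of n] areas(8)[of 0] sn by simp
        qed
        show "wp P (scan (\<lambda>P. {()}) out_step (\<lambda>P y s. []) vu num_disks P ((), tr 5, snd q - tr 5, tr 6, ()) \<bind> (\<lambda>_.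
     Ret (tr 6))) d3 (\<lambda>r d' t. r < word_range P ^ 8 \<and>
    (\<exists>xs. output_list P d' r n = map (\<lambda>v. [v]) xs \<and> degeneracy_ordering V E \<delta> xs) \<and> real (t1 + (t2 + (t3 + t))) \<le> total_cost)"
          unfolding q
        proof (rule wp_bindI[OF O])
          fix q' d4 t4 assume 4: "output_list P d4 (tr 6) (length ?xs) = map (\<lambda>v. [v]) ?xs \<and> t4 \<le> (lg + ?c - tr 5) + num_stripes P n"
          have "t1 \<le> ?s + ?K0" "t3 \<le> ?K0 + ?K0" "t4 \<le> (lg - tr 5) + ?K0 + num_stripes P n" using 1 3 4 KK I1(11) by auto
          then have "real t1 \<le> real (?s + ?K0)" "real t3 \<le> real (?K0 + ?K0)" "real t4 \<le> real ((lg - tr 5) + ?K0 + num_stripes P n)"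
            by (simp_all only: of_nat_le_iff)
          moreover have "real t2 \<le> rounds_cost * real n" using 2 by simp
          moreover have "0 \<le> rounds_cost * real n'" using rounds_cost_nonneg by simp
          ultimately have "real (t1 + (t2 + (t3 + (t4 + 0)))) \<le> total_cost" using cost unfolding total_cost_def by simp
          then show "wp P (Ret (tr 6)) d4 (\<lambda>r d' t. r < word_range P ^ 8 \<and>
    (\<exists>xs. output_list P d' r n = map (\<lambda>v. [v]) xs \<and> degeneracy_ordering V E \<delta> xs) \<and> real (t1 + (t2 + (t3 + (t4 + t)))) \<le> total_cost)"
            unfolding wp_Ret using 4 final areas(8)[of 0] unfolding sx(2) by (intro conjI exI[of _ ?xs]) auto
        qed
      qed
    qed
  qed
qed

text \<open>The constant 23 is \<open>3 + 4 * 5\<close>: three terms for input and output of at most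
  \<open>X\<close> each, and \<open>5 * X\<close> for the stripes of the initial graph. The other is
  \<open>44928 = 2 * 624 * 18 * 2\<close>, where 18 comes from \<open>1 + L <= 18 * lam\<close> and
  the last 2 is the bandwidth lost by grouping disks.\<close>

lemma total_cost_le: "total_cost \<le> (23 + 44928 * ((2 + \<epsilon>) / \<epsilon>)) * sort_ios P (d * n)"
proof -
  note v = virt[OF ok] and k = okmD[OF ok]
  let ?Z = "real (zs P)" and ?Q = "real (num_disks P * block_size P)"
  define N where "N = d * n"
  define X where "X = real_of_int \<lceil>real N / ?Q\<rceil>"
  define lam where "lam = max 1 (log (real (mem_size P) / real (block_size P)) (real N / real (block_size P)))"
  have N1: "1 \<le> N" using mult_le_mono[OF d1 n_pos] by (simp add: N_def)
  have nN: "n \<le> N" "m \<le> N" using mult_le_mono1[OF d1, of n] m_le by (simp_all add: N_def)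
  have Q0: "0 < ?Q" using k by simp
  have Z0: "0 < ?Z" using v(8) by simp
  have QX: "real N / ?Q \<le> X" unfolding X_def by simp
  have X1: "1 \<le> X"
  proof -
    have "0 < real N / ?Q" using N1 Q0 by simp
    then show ?thesis unfolding X_def by simp
  qed
  have lam1: "1 \<le> lam" by (simp add: lam_def)
  have st: "real (num_stripes P x) \<le> X" if "x \<le> N" for x
  proof -
    have "real x / ?Q \<le> real N / ?Q" using that Q0 by (intro divide_right_mono) auto
    then have "\<lceil>real x / ?Q\<rceil> \<le> \<lceil>real N / ?Q\<rceil>" by (rule ceiling_mono)
    moreover have "0 \<le> \<lceil>real x / ?Q\<rceil>" using Q0 by (simp add: zero_le_ceiling less_le_trans[of _ 0])
    ultimately show ?thesis unfolding num_stripes_def X_def by simp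
  qed
  have NZ: "real N / ?Z \<le> 2 * X"
  proof -
    have "?Q \<le> 2 * ?Z" using v(10) by (metis of_nat_le_iff of_nat_mult of_nat_numeral)
    then have "real N / (2 * ?Z) \<le> real N / ?Q" using Q0 Z0 by (intro divide_left_mono) auto
    then show ?thesis using QX by simp
  qed
  have K0: "real (cdiv (n + m) (zs P)) \<le> 5 * X"
  proof -
    have "real (cdiv (n + m) (zs P)) \<le> real (n + m) / ?Z + 1" by (rule cdiv_real_le[OF v(8)])
    also have "\<dots> \<le> (2 * real N) / ?Z + 1" using nN Z0 by (intro add_mono divide_right_mono) auto
    also have "\<dots> \<le> 5 * X" using NZ X1 by simp
    finally show ?thesis .
  qed
  define L where "L = real (nlev P (cdiv (n + 2 * m) (zs P)) (cap P))"
  have "L \<le> 17 * lam" unfolding L_def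
    by (rule nlev_bound[OF ok N1 _ refl lam_def]) (use nN in simp)
  then have L: "1 + L \<le> 18 * lam" using lam1 by simp
  have e0: "0 \<le> (2 + \<epsilon>) / \<epsilon>" using eps by simp
  have "rounds_cost * real n = 624 * (1 + L) * (real N / ?Z) * ((2 + \<epsilon>) / \<epsilon>)"
    by (simp add: rounds_cost_def L_def N_def)
  also have "\<dots> \<le> 624 * (18 * lam) * (2 * X) * ((2 + \<epsilon>) / \<epsilon>)"
    using L NZ e0 lam1 Z0 by (intro mult_right_mono mult_mono mult_left_mono) auto
  finally have rc: "rounds_cost * real n \<le> 22464 * ((2 + \<epsilon>) / \<epsilon>) * (X * lam)" by (simp add: mult_ac)
  have "X * 1 \<le> X * lam" using lam1 X1 by (intro mult_left_mono) auto
  then have XL: "23 * X \<le> 23 * (X * lam)" by simp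
  have "total_cost \<le> 23 * X + 2 * (rounds_cost * real n)"
    unfolding total_cost_def of_nat_add using st[OF nN(1)] st[OF nN(2)] K0 by linarith
  also have "\<dots> \<le> 23 * (X * lam) + 2 * (22464 * ((2 + \<epsilon>) / \<epsilon>) * (X * lam))" using XL rc by linarith
  also have "\<dots> = (23 + 44928 * ((2 + \<epsilon>) / \<epsilon>)) * (X * lam)" by (simp add: distrib_right)
  finally show ?thesis unfolding X_def lam_def N_def sort_ios_def .
qed

end

theorem theorem1:
  fixes \<epsilon> :: real
  assumes "\<epsilon> > 0"
  shows "\<exists>(A :: em_algorithm) (k :: nat) (C :: real).
    \<forall>(P :: machine) (V :: nat set) (E :: nat set set) (d :: nat) vs es.
      valid_machine P \<longrightarrow> simple_graph V E \<longrightarrow> degenerate V E d \<longrightarrow>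
      lists_graph vs es V E \<longrightarrow> fits_words P vs es \<longrightarrow>
      (\<exists>t xs. computes_ordering P k A vs es t xs \<and>
         degeneracy_ordering V E ((2 + \<epsilon>) * real d) xs \<and>
         real t \<le> C * sort_ios P (d * card V))"
proof -
  obtain A :: em_algorithm and k where A: "\<And>P n m d a d' t. okm P \<Longrightarrow> n < word_range P \<Longrightarrow> m < word_range P \<Longrightarrow> disk_ok P d \<Longrightarrow>
       exec P (main \<epsilon> P (n, m)) d = (a, d', t) \<Longrightarrow> a < word_range P ^ 8 \<Longrightarrow> em_run P k (A P) [[n, m]] d t a d'"
    by (rule lean_simulation[OF lean_main[of \<epsilon>]]) blast
  have "\<exists>t xs. computes_ordering P k A vs es t xs \<and> degeneracy_ordering V E ((2 + \<epsilon>) * real d) xs \<and>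
         real t \<le> (23 + 44928 * ((2 + \<epsilon>) / \<epsilon>)) * sort_ios P (d * card V)"
    if P: "valid_machine P" and g: "simple_graph V E" and deg: "degenerate V E d" and l: "lists_graph vs es V E"
      and w: "fits_words P vs es" for P V E d vs es
  proof -
    let ?n = "length vs" and ?m = "length es" and ?d = "input_disks P vs es"
    have fin: "finite V" "finite E" using simple_graph_finite[OF g] by auto
    have vs: "distinct vs" "set vs = V" and es: "distinct (map (\<lambda>(u, v). {u, v}) es)" "set (map (\<lambda>(u, v). {u, v}) es) = E"
      using l by (auto simp: lists_graph_def)
    have n: "?n = card V" using distinct_card[OF vs(1)] vs(2) by simp
    have m: "?m = card E" using distinct_card[OF es(1)] es(2) by simp
    \<comment> \<open>A core is nonempty by definition, also for \<open>d = 0\<close>. One vertex is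
      what makes the word range at least 2.\<close>
    have "V \<noteq> {}" using deg unfolding degenerate_def has_core_def by blast
    then have "1 \<le> ?n" using n fin by (simp add: Suc_le_eq card_gt_0_iff)
    then have ok: "okm P" using P w by (auto simp: okm_def fits_words_def)
    have VW: "V \<subseteq> {..<word_range P}" using w vs(2) by (auto simp: fits_words_def)
    have "u \<in> V \<and> v \<in> V" if "(u, v) \<in> set es" for u v
    proof -
      have "{u, v} \<in> E" using that es(2) by force
      then show ?thesis using g by (auto simp: simple_graph_def)
    qed
    then have dok: "disk_ok P ?d" by (intro disk_ok_input) (use vs(2) VW in auto)
    have nm: "?n < word_range P" "?m < word_range P" using w by (auto simp: fits_words_def)
    show ?thesis
    proof (cases "?m = 0")
      \<comment> \<open>Here \<open>d = 0\<close> and the bound is exactly 0, so the program halts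
        at once with the vertex list of the input as its output.\<close>
      case True
      then have E: "E = {}" using m fin by simp
      have "d = 0" using deg unfolding degenerate_def has_core_def E by (auto simp: vertex_degree_def)
      have "exec P (main \<epsilon> P (?n, ?m)) ?d = (0, ?d, 0)" using True by (simp add: main_def)
      then have "em_run P k (A P) [[?n, ?m]] ?d 0 0 ?d" by (rule A[OF ok nm dok]) (use okmD(4)[OF ok] in simp)
      moreover have "output_list P ?d 0 ?n = map (\<lambda>v. [v]) vs"
      proof -
        have "1 \<le> num_disks P * block_size P" using okmD[OF ok] by (simp add: Suc_le_eq)
        then have "?n \<le> num_stripes P ?n * (num_disks P * block_size P)" unfolding num_stripes_cdiv[OF ok] by (rule cdiv_ge)
        then have "?n \<le> (num_stripes P ?n + num_stripes P ?m) * (num_disks P * block_size P)" by (simp add: distrib_right)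
        from output_list_cont[OF ok dok this, of 0] show ?thesis using cont_input[OF ok, of vs es] by auto
      qed
      moreover have "degeneracy_ordering V E ((2 + \<epsilon>) * real d) vs"
        using vs E \<open>d = 0\<close> by (simp add: degeneracy_ordering_def)
      moreover have "sort_ios P (d * card V) = 0" using \<open>d = 0\<close> by (simp add: sort_ios_def)
      ultimately show ?thesis unfolding computes_ordering_def by fastforce
    next
      case False
      interpret peeling P V E d ?n ?m \<epsilon>
        by unfold_locales (use ok g deg VW n m nm False assms in auto)
      obtain a d' t where ex: "exec P (main \<epsilon> P (?n, ?m)) ?d = (a, d', t)" by (cases "exec P (main \<epsilon> P (?n, ?m)) ?d")
      then have post: "a < word_range P ^ 8 \<and> (\<exists>xs. output_list P d' a ?n = map (\<lambda>v. [v]) xs \<and> degeneracy_ordering V E \<delta> xs) \<and>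
          real t \<le> total_cost"
        using wp_main[OF l refl refl] by (simp add: wp_def)
      then have "em_run P k (A P) [[?n, ?m]] ?d t a d'" using A[OF ok nm dok ex] by simp
      moreover have "real t \<le> (23 + 44928 * ((2 + \<epsilon>) / \<epsilon>)) * sort_ios P (d * card V)"
        using post total_cost_le n by simp
      ultimately show ?thesis using post unfolding computes_ordering_def \<delta>_def by blast
    qed
  qed
  then show ?thesis by blast
qed

end
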